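(* Let $h:\mathbb R_+\to\mathbb R_+$ be such that $h(\delta)\to\infty$ for $\delta\to0$. Assume in addition that $w\ge\underline w>0$ on $\Omega$ for some constant $\underline w$, and let $\epsilon_n,\delta_n>0$ be vanishing sequences such that $\epsilon_n\cdot h(\delta_n)^\alpha\to0$. Let $q_n\in L^\alpha(\Omega_{\epsilon_n};\mathbb R^d)$ be corresponding solutions of the doubly regularized problem, i.e. minimizers of $\int_{\Omega_{\epsilon_n}}\mathcal G^*_{\epsilon_n,\delta_n}(x,q(x))\,dx$ over all $q\in L^\alpha(\Omega_{\epsilon_n};\mathbb R^d)$ with $\operatorname{div}q=\tilde\mu$ in $W^{-1,\alpha}_\perp(\Omega_{\epsilon_n})$. Then $(q_n)$ (extended by zero to $\tilde\Omega$ and regarded as measures) admits a subsequence that converges, with respect to weak-$*$ convergence in $\mathcal M(\tilde\Omega;\mathbb R^d)$, to a solution of the Beckmann problem $$\inf\Big\{\int_\Omega w\,d|q| : q\in\mathcal M(\Omega;\mathbb R^d),\ \operatorname{div}_{\mathcal M}q=\mu\Big\}.$$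
   Context: Setting: $d\in\mathbb N$; $\Omega\subset\mathbb R^d$ is compact and its interior $\Omega^\circ$ is a bounded Lipschitz domain; $\Omega$ is strictly star shaped with respect to $0$: $\lambda x\in\Omega^\circ$ for all $x\in\Omega$, $0\le\lambda<1$; $w:\Omega\to[0,\infty)$ is continuous; $1<\alpha<\frac{d}{d-1}$, $\alpha'=\frac{\alpha}{\alpha-1}$; $\mu^+,\mu^-$ are Borel probability measures on $\Omega$, $\mu:=\mu^+-\mu^-$. $|\cdot|$ is the Euclidean norm, $|q|$ the total variation measure of a vector measure $q$, $dx$ Lebesgue measure, $\mathcal M(K;\mathbb R^d)$ the $\mathbb R^d$-valued Radon measures on a compact set $K$ (weak-$*$ topology as dual of $C(K;\mathbb R^d)$). Spaces, for a compact set $K$ (here $K=\Omega$ or $K=\Omega_\tau$ below; Sobolev spaces on the interior): $W^{1,p}_\emptyset(K)=\{v\in W^{1,p}(K):\int_K v\,dx=0\}$; $W^{-1,p}_\perp(K)=\{v\in(W^{1,p'}(K))^*:\langle v,1\rangle=0\}$ with $p'$ conjugate to $p$; $\operatorname{div}:L^p(K;\mathbb R^d)\to W^{-1,p}_\perp(K)$, $\langle\operatorname{div}q,\phi\rangle=-\int_K q\cdot\nabla\phi\,dx$ for $\phi\in W^{1,p'}_\emptyset(K)$. Measures with total mass zero are regarded as elements of $W^{-1,\alpha}_\perp(K)$ (since $W^{1,\alpha'}(K)\hookrightarrow C(K)$). $C^1_\emptyset(K)=\{v\in C^1(K):\int_Kv\,dx=0\}$; for $q\in\mathcal M(\Omega;\mathbb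 R^d)$, $\operatorname{div}_{\mathcal M}q=\mu$ means $-\int_\Omega\nabla\phi\cdot dq=\int_\Omega\phi\,d\mu$ for all $\phi\in C^1_\emptyset(\Omega)$. Assumption on $\Omega$: for every $\nu\in W^{-1,\alpha'}_\perp(\Omega)$ there is a unique $y\in W^{1,\alpha'}_\emptyset(\Omega)$ with $-\int_\Omega\nabla y\cdot\nabla\phi\,dx=\langle\nu,\phi\rangle$ for all $\phi\in W^{1,\alpha}_\emptyset(\Omega)$. Enlarged domains: fix a sequence of parameters $\tau>0$, $\tau\to0$, and nonnegative mollifiers $\phi_\tau\in C_c^\infty(\mathbb R^d)$ ($\int\phi_\tau=1$, supports shrinking to $\{0\}$). For each $\tau$ choose $s_\tau>0$, $s_\tau\to0$, such that $\Omega_\tau:=(1+s_\tau)\Omega\supset\Omega+\operatorname{supp}\phi_\tau$ and $\Omega_\tau\supset\Omega_\vartheta$ for $\tau>\vartheta$. Put $\tilde\Omega=\bigcup_\tau\Omega_\tau$. $\tilde f$ denotes extension of a function or measure $f$ by zero to $\tilde\Omega$; $\hat w$ is a continuous extension of $w$ to $\tilde\Omega$ with $\min_{\tilde\Omega}\hat w=\min_\Omega w$. The parameters $\epsilon_n$ are taken from this family of parameters, and $\Omega_{\epsilon_n}$ is the domain for $\tau=\epsilon_n$. Integrand: for $\epsilon,\delta>0$, $\mathcal G^*_{\epsilon,\delta}(x,q)=|q|^2\frac{\hat w(x)}{2\delta}-\delta\hat w(x)$ if $|q|\le\delta$, and $\mathcal G^*_{\epsilon,\delta}(x,q)=\frac\epsilon\alpha(|q|-\delta)^\alpha-\frac32\delta\hat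 w(x)+|q|\hat w(x)$ otherwise. *)

theory Defs
  imports "HOL-Probability.Probability_Measure"
begin

text \<open>
  Euclidean space of dimension \<open>d\<close> is a type of class \<^class>\<open>euclidean_space\<close> with \<open>d = DIM('a)\<close>.
  Functions on a set are total functions of which only the values on that set matter, and
  elements of Lebesgue and Sobolev spaces are represented by functions rather than by
  classes modulo null sets. Sobolev spaces live on an open set \<open>U\<close>; for a compact set \<open>K\<close> one takes
  \<open>U = interior K\<close>, the frontier being a null set for the domains considered here.
\<close>


section \<open>Domains\<close>

text \<open>Locally, and up to a rotation, \<open>U\<close> is the strict epigraph of a Lipschitz function \<open>\<gamma>\<close> over
  the hyperplane orthogonal to a unit vector \<open>e\<close>.\<close>

definition lipschitz_domain :: "'a::euclidean_space set \<Rightarrow> bool" where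
  "lipschitz_domain U \<longleftrightarrow>
     open U \<and> connected U \<and> U \<noteq> {} \<and>
     (\<forall>x\<in>frontier U. \<exists>e r L \<gamma>. norm e = 1 \<and> 0 < r \<and> L-lipschitz_on {z. z \<bullet> e = 0} \<gamma> \<and>
        (\<forall>y\<in>ball x r. y \<in> U \<longleftrightarrow> \<gamma> (y - (y \<bullet> e) *\<^sub>R e) < y \<bullet> e))"

definition strictly_star_shaped :: "'a::euclidean_space set \<Rightarrow> bool" where
  "strictly_star_shaped K \<longleftrightarrow> (\<forall>x\<in>K. \<forall>l. 0 \<le> l \<and> l < 1 \<longrightarrow> l *\<^sub>R x \<in> interior K)"

definition enlarged :: "'a::euclidean_space set \<Rightarrow> (real \<Rightarrow> real) \<Rightarrow> real \<Rightarrow> 'a set" where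
  "enlarged K s \<tau> = (\<lambda>x. (1 + s \<tau>) *\<^sub>R x) ` K"


section \<open>Smooth functions with compact support\<close>

primrec Ck :: "nat \<Rightarrow> ('a::euclidean_space \<Rightarrow> real) \<Rightarrow> bool" where
  "Ck 0 f \<longleftrightarrow> continuous_on UNIV f"
| "Ck (Suc k) f \<longleftrightarrow> (\<exists>D. (\<forall>x. GDERIV f x :> D x) \<and> (\<forall>i\<in>Basis. Ck k (\<lambda>x. D x \<bullet> i)))"

definition supp :: "('a::euclidean_space \<Rightarrow> real) \<Rightarrow> 'a set" where
  "supp f = closure {x. f x \<noteq> 0}"

definition Cc_infinity :: "'a::euclidean_space set \<Rightarrow> ('a \<Rightarrow> real) set" where
  "Cc_infinity U = {f. (\<forall>k. Ck k f) \<and> compact (supp f) \<and> supp f \<subseteq> U}"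


section \<open>Lebesgue and Sobolev spaces\<close>

definition conj_exp :: "real \<Rightarrow> real" where
  "conj_exp p = p / (p - 1)"

definition Lp :: "'a::euclidean_space set \<Rightarrow> real \<Rightarrow> ('a \<Rightarrow> 'b::euclidean_space) set" where
  "Lp S p = {f. f \<in> borel_measurable (lebesgue_on S) \<and>
                integrable (lebesgue_on S) (\<lambda>x. norm (f x) powr p)}"

definition locally_integrable ::
    "'a::euclidean_space set \<Rightarrow> ('a \<Rightarrow> 'b::euclidean_space) \<Rightarrow> bool" where
  "locally_integrable U f \<longleftrightarrow> (\<forall>C. compact C \<and> C \<subseteq> U \<longrightarrow> set_integrable lebesgue C f)"

definition has_weak_gradient ::
    "'a::euclidean_space set \<Rightarrow> ('a \<Rightarrow> real) \<Rightarrow> ('a \<Rightarrow> 'a) \<Rightarrow> bool" where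
  "has_weak_gradient U v g \<longleftrightarrow>
     locally_integrable U v \<and> locally_integrable U g \<and>
     (\<forall>\<psi>\<in>Cc_infinity U. \<forall>D. (\<forall>x. GDERIV \<psi> x :> D x) \<longrightarrow>
        (LINT x:U|lebesgue. v x *\<^sub>R D x) = - (LINT x:U|lebesgue. \<psi> x *\<^sub>R g x))"

definition W1 :: "'a::euclidean_space set \<Rightarrow> real \<Rightarrow> ('a \<Rightarrow> real) set" where
  "W1 U p = {v \<in> Lp U p. \<exists>g\<in>Lp U p. has_weak_gradient U v g}"

definition W1_mean0 :: "'a::euclidean_space set \<Rightarrow> real \<Rightarrow> ('a \<Rightarrow> real) set" where
  "W1_mean0 U p = {v \<in> W1 U p. (LINT x:U|lebesgue. v x) = 0}"

text \<open>The Sobolev norm of \<open>v\<close>, where \<open>g\<close> is the weak gradient of \<open>v\<close>.\<close>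

definition W1_norm ::
    "'a::euclidean_space set \<Rightarrow> real \<Rightarrow> ('a \<Rightarrow> real) \<Rightarrow> ('a \<Rightarrow> 'a) \<Rightarrow> real" where
  "W1_norm U p v g =
     ((LINT x:U|lebesgue. \<bar>v x\<bar> powr p) + (LINT x:U|lebesgue. norm (g x) powr p)) powr (1 / p)"

text \<open>Continuous linear functionals on \<open>W1 U (conj_exp p)\<close> that annihilate the constants.
  Boundedness forces such a functional to respect equality almost everywhere.\<close>

definition Wneg_perp :: "'a::euclidean_space set \<Rightarrow> real \<Rightarrow> (('a \<Rightarrow> real) \<Rightarrow> real) set" where
  "Wneg_perp U p = {\<nu>.
     (\<forall>u\<in>W1 U (conj_exp p). \<forall>v\<in>W1 U (conj_exp p). \<nu> (\<lambda>x. u x + v x) = \<nu> u + \<nu> v) \<and>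
     (\<forall>c. \<forall>v\<in>W1 U (conj_exp p). \<nu> (\<lambda>x. c * v x) = c * \<nu> v) \<and>
     (\<exists>C. \<forall>v\<in>W1 U (conj_exp p). \<forall>g. has_weak_gradient U v g \<longrightarrow>
        \<bar>\<nu> v\<bar> \<le> C * W1_norm U (conj_exp p) v g) \<and>
     \<nu> (\<lambda>x. 1) = 0}"

text \<open>\<open>div q = \<nu>\<close> in \<open>Wneg_perp U p\<close>, for \<open>q \<in> Lp U p\<close>.\<close>

definition div_eq ::
    "'a::euclidean_space set \<Rightarrow> real \<Rightarrow> ('a \<Rightarrow> 'a) \<Rightarrow> (('a \<Rightarrow> real) \<Rightarrow> real) \<Rightarrow> bool" where
  "div_eq U p q \<nu> \<longleftrightarrow>
     (\<forall>\<phi>\<in>W1_mean0 U (conj_exp p). \<forall>g. has_weak_gradient U \<phi> g \<longrightarrow>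
        - (LINT x:U|lebesgue. q x \<bullet> g x) = \<nu> \<phi>)"

text \<open>Unique solvability, up to null sets, of the Neumann problem for the Laplacian: the weak
  formulation for \<open>y\<close> says that the divergence of the gradient of \<open>y\<close> is \<open>\<nu>\<close>.\<close>

definition neumann_solution ::
    "'a::euclidean_space set \<Rightarrow> real \<Rightarrow> (('a \<Rightarrow> real) \<Rightarrow> real) \<Rightarrow> ('a \<Rightarrow> real) \<Rightarrow> bool" where
  "neumann_solution U p \<nu> y \<longleftrightarrow>
     y \<in> W1_mean0 U p \<and> (\<exists>g. has_weak_gradient U y g \<and> div_eq U p g \<nu>)"

definition neumann_well_posed :: "'a::euclidean_space set \<Rightarrow> real \<Rightarrow> bool" where
  "neumann_well_posed U p \<longleftrightarrow>
     (\<forall>\<nu>\<in>Wneg_perp U p. \<exists>y. neumann_solution U p \<nu> y \<and>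
        (\<forall>z. neumann_solution U p \<nu> z \<longrightarrow> (AE x in lebesgue_on U. z x = y x)))"

text \<open>The measure \<open>\<mu>p - \<mu>m\<close> on \<open>K\<close> acts on a Sobolev function through its representative that is
  continuous on \<open>K\<close>, which exists by the Sobolev embedding when the exponent exceeds the dimension
  and is unique on \<open>K\<close> when \<open>K\<close> is the closure of its interior.\<close>

definition cont_rep :: "'a::euclidean_space set \<Rightarrow> ('a \<Rightarrow> real) \<Rightarrow> 'a \<Rightarrow> real" where
  "cont_rep K \<phi> =
     (SOME c. continuous_on K c \<and> (AE x in lebesgue_on (interior K). c x = \<phi> x))"

definition measure_functional ::
    "'a::euclidean_space set \<Rightarrow> 'a measure \<Rightarrow> 'a measure \<Rightarrow> ('a \<Rightarrow> real) \<Rightarrow> real" where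
  "measure_functional K \<mu>p \<mu>m \<phi> =
     (LINT x:K|\<mu>p. cont_rep K \<phi> x) - (LINT x:K|\<mu>m. cont_rep K \<phi> x)"


section \<open>Vector measures\<close>

text \<open>Set functions are only relevant on Borel sets. Finite Borel vector measures on Euclidean
  space are automatically Radon. The measures on \<open>K\<close> are those concentrated on \<open>K\<close>, so
  extension by zero to a larger set is the identity.\<close>

definition vector_measure :: "('a::euclidean_space set \<Rightarrow> 'b::real_normed_vector) \<Rightarrow> bool" where
  "vector_measure q \<longleftrightarrow>
     (\<forall>A::nat \<Rightarrow> 'a set. range A \<subseteq> sets borel \<and> disjoint_family A \<longrightarrow>
        (\<lambda>i. q (A i)) sums q (\<Union>i. A i))"

definition vector_measures_on :: "'a::euclidean_space set \<Rightarrow> ('a set \<Rightarrow> 'a) set" where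
  "vector_measures_on K = {q. vector_measure q \<and> (\<forall>A\<in>sets borel. q A = q (A \<inter> K))}"

definition total_variation ::
    "('a::euclidean_space set \<Rightarrow> 'b::real_normed_vector) \<Rightarrow> 'a measure" where
  "total_variation q = measure_of UNIV (sets borel)
     (\<lambda>A. SUP P\<in>{P :: nat \<Rightarrow> 'a set. range P \<subseteq> sets borel \<and> disjoint_family P \<and> (\<Union>i. P i) = A}.
            \<Sum>i. ennreal (norm (q (P i))))"

text \<open>Jordan decomposition \<open>(|s| + s) / 2\<close> and \<open>(|s| - s) / 2\<close> of a signed measure \<open>s\<close>.\<close>

definition positive_part :: "('a::euclidean_space set \<Rightarrow> real) \<Rightarrow> 'a measure" where
  "positive_part s = measure_of UNIV (sets borel)
     (\<lambda>A. ennreal ((measure (total_variation s) A + s A) / 2))"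

definition signed_integral ::
    "'a::euclidean_space set \<Rightarrow> ('a set \<Rightarrow> real) \<Rightarrow> ('a \<Rightarrow> real) \<Rightarrow> real" where
  "signed_integral K s f =
     (LINT x:K|positive_part s. f x) - (LINT x:K|positive_part (\<lambda>A. - s A). f x)"

definition vector_integral ::
    "'a::euclidean_space set \<Rightarrow> ('a set \<Rightarrow> 'a) \<Rightarrow> ('a \<Rightarrow> 'a) \<Rightarrow> real" where
  "vector_integral K q f = (\<Sum>i\<in>Basis. signed_integral K (\<lambda>A. q A \<bullet> i) (\<lambda>x. f x \<bullet> i))"

text \<open>The vector measure with Lebesgue density \<open>f\<close> on \<open>K\<close> and zero elsewhere.\<close>

definition density_on :: "'a::euclidean_space set \<Rightarrow> ('a \<Rightarrow> 'a) \<Rightarrow> 'a set \<Rightarrow> 'a" where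
  "density_on K f A = (LINT x:A|lebesgue. (if x \<in> K then f x else 0))"

definition weak_star_converges ::
    "'a::euclidean_space set \<Rightarrow> (nat \<Rightarrow> 'a set \<Rightarrow> 'a) \<Rightarrow> ('a set \<Rightarrow> 'a) \<Rightarrow> bool" where
  "weak_star_converges K Q q \<longleftrightarrow>
     (\<forall>n. Q n \<in> vector_measures_on K) \<and> q \<in> vector_measures_on K \<and>
     (\<forall>f. continuous_on K f \<longrightarrow>
        (\<lambda>n. vector_integral K (Q n) f) \<longlonglongrightarrow> vector_integral K q f)"


section \<open>The Beckmann problem\<close>

text \<open>\<open>f\<close> is \<open>C\<^sup>1\<close> on \<open>K\<close> with gradient \<open>D\<close>: it is so in the interior, and both \<open>f\<close> and \<open>D\<close> are
  continuous up to the boundary.\<close>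

definition C1_on :: "'a::euclidean_space set \<Rightarrow> ('a \<Rightarrow> real) \<Rightarrow> ('a \<Rightarrow> 'a) \<Rightarrow> bool" where
  "C1_on K f D \<longleftrightarrow>
     continuous_on K f \<and> continuous_on K D \<and> (\<forall>x\<in>interior K. GDERIV f x :> D x)"

definition measure_div_eq ::
    "'a::euclidean_space set \<Rightarrow> ('a set \<Rightarrow> 'a) \<Rightarrow> 'a measure \<Rightarrow> 'a measure \<Rightarrow> bool" where
  "measure_div_eq K q \<mu>p \<mu>m \<longleftrightarrow>
     (\<forall>\<phi> D. C1_on K \<phi> D \<and> (LINT x:K|lebesgue. \<phi> x) = 0 \<longrightarrow>
        - vector_integral K q D = (LINT x:K|\<mu>p. \<phi> x) - (LINT x:K|\<mu>m. \<phi> x))"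

definition beckmann_solution ::
    "'a::euclidean_space set \<Rightarrow> ('a \<Rightarrow> real) \<Rightarrow> 'a measure \<Rightarrow> 'a measure \<Rightarrow> ('a set \<Rightarrow> 'a) \<Rightarrow> bool" where
  "beckmann_solution K w \<mu>p \<mu>m q \<longleftrightarrow>
     is_arg_min (\<lambda>q. LINT x:K|total_variation q. w x)
       (\<lambda>q. q \<in> vector_measures_on K \<and> measure_div_eq K q \<mu>p \<mu>m) q"


section \<open>The doubly regularized problem\<close>

definition Gstar :: "real \<Rightarrow> ('a::euclidean_space \<Rightarrow> real) \<Rightarrow> real \<Rightarrow> real \<Rightarrow> 'a \<Rightarrow> 'a \<Rightarrow> real" where
  "Gstar \<alpha> w \<epsilon> \<delta> x z =
     (if norm z \<le> \<delta> then (norm z)\<^sup>2 * (w x / (2 * \<delta>)) - \<delta> * w x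
      else \<epsilon> / \<alpha> * (norm z - \<delta>) powr \<alpha> - 3 / 2 * \<delta> * w x + norm z * w x)"

definition regularized_solution ::
    "'a::euclidean_space set \<Rightarrow> real \<Rightarrow> ('a \<Rightarrow> real) \<Rightarrow> 'a measure \<Rightarrow> 'a measure \<Rightarrow>
     real \<Rightarrow> real \<Rightarrow> ('a \<Rightarrow> 'a) \<Rightarrow> bool" where
  "regularized_solution K \<alpha> w \<mu>p \<mu>m \<epsilon> \<delta> q \<longleftrightarrow>
     is_arg_min (\<lambda>q. LINT x:K|lebesgue. Gstar \<alpha> w \<epsilon> \<delta> x (q x))
       (\<lambda>q. q \<in> Lp K \<alpha> \<and> div_eq (interior K) \<alpha> q (measure_functional K \<mu>p \<mu>m)) q"

end

theory Submission
  imports Defs "HOL-Probability.Helly_Selection"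
begin

text \<open>Near each boundary point of a Lipschitz domain there is a cone of directions pointing inwards.
Averaging a Sobolev function over truncated cones (\<open>avg\<close>) and correcting by an integral of its
gradient (\<open>cor\<close>) gives its continuous representative. Dually, averaging a vector measure over such
cones with a partition of unity, and adding the corrections that restore the divergence (\<open>flux\<close>),
turns every competitor of the Beckmann problem into a flux with integrable \<open>\<alpha>\<close>-th power that vanishes
outside \<open>\<Omega>\<close>, has the same divergence in the Sobolev sense and almost the same cost. These fluxes
are admissible in all regularized problems. The integrand lies between \<open>w |q| - 3/2 \<delta> w\<close> and
\<open>w |q| + \<epsilon>/\<alpha> |q|\<^sup>\<alpha>\<close>, so the costs of the minimizers are bounded by the Beckmann infimum up to
an error that tends to 0. Hence their masses are bounded and a subsequence converges weakly; the
constraint passes to the limit because the dilation factors tend to 1, and lower semicontinuity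
of the cost gives optimality.\<close>

text \<open>The obstacle is the boundary: a regularized competitor must be a genuine density without
  flux through the boundary, and its divergence must still be the measure \<open>mu\<close>, not a
  mollified one. Symmetric mollification fails on both counts. Averages over inward cones sample
  interior points only, so Sobolev functions need no extension, and the transposed formula never
  moves mass outside. The formula that recovers a function from its averages is the fundamental
  theorem of calculus in the dilation parameter; its kernel grows like \<open>|u|^(1-d)\<close>,
  which is locally integrable to the power \<open>alpha\<close> exactly when
  \<open>alpha (d-1) < d\<close>. This is where the bound on \<open>alpha\<close> enters. The
  divergence is restored exactly for every cone length, so the length can be chosen by the cost
  alone. The flux is fixed before \<open>n\<close> varies, hence its penalty is
  \<open>epsilon n\<close> times a constant. Weak compactness on compact sets is reduced by a
  space-filling curve to the selection theorem for measures on the line.\<close>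

notation scaleR (infixr "*R" 75)

abbreviation borelm :: "('a::topological_space => 'b::topological_space) set"
  where "borelm == borel_measurable borel"

lemmas bi_bound = Bochner_Integration.integrable_bound
  and bi_cong = Bochner_Integration.integral_cong
  and bi_sum = Bochner_Integration.integral_sum and bi_zero = Bochner_Integration.integral_zero
  and bi_diff = Bochner_Integration.integral_diff and bi_add = Bochner_Integration.integral_add
  and bi_addI = Bochner_Integration.integrable_add and bi_diffI = Bochner_Integration.integrable_diff
  and bi_sumI = Bochner_Integration.integrable_sum

section \<open>Vector measures\<close>

definition partition_seqs :: "'a::euclidean_space set => (nat => 'a set) set" where
 "partition_seqs A = {P. range P \<subseteq> sets borel \<and> disjoint_family P \<and> (\<Union>i. P i) = A}"

text \<open>The set function inside \<open>total_variation\<close>, named separately because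
  \<open>measure_of\<close> returns a useful measure only once countable additivity is
  known.\<close>

definition variation :: "('a::euclidean_space set => 'b::real_normed_vector) => 'a set => ennreal" where
 "variation q A = (SUP P\<in>partition_seqs A. \<Sum>i. ennreal (norm (q (P i))))"

lemma total_variation_alt: "total_variation q = measure_of UNIV (sets borel) (variation q)"
 unfolding total_variation_def variation_def partition_seqs_def by simp

lemma vector_measure_sums:
 assumes "vector_measure q" "!!i::nat. A i \<in> sets borel" "disjoint_family A"
 shows "(%i. q (A i)) sums q (\<Union>i. A i)"
 using assms unfolding vector_measure_def by blast

text \<open>The constant sequence of empty sets is disjoint, so \<open>q {}\<close> is the constant
  term of a convergent series. Finite additivity rests on this, since \<open>vector_measure\<close>
  speaks of sequences only.\<close>

lemma vector_measure_empty:
 assumes "vector_measure q" shows "q {} = 0"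
proof -
 have "(%i::nat. q {}) sums q (\<Union>i::nat. {})"
  by (rule vector_measure_sums[OF assms]) (auto simp: disjoint_family_on_def)
 then have "(%i::nat. q {}) \<longlonglongrightarrow> 0"
  using sums_summable summable_LIMSEQ_zero by blast
 then show ?thesis by (simp add: LIMSEQ_const_iff)
qed

lemma vector_measure_Un:
 assumes "vector_measure q" "A \<in> sets borel" "B \<in> sets borel" "A \<inter> B = {}"
 shows "q (A \<union> B) = q A + q B"
proof -
 have "(%i. q (binaryset A B i)) sums q (\<Union>i. binaryset A B i)"
  using assms by (intro vector_measure_sums) (auto simp: binaryset_def disjoint_family_on_def)
 moreover have "(%i. q (binaryset A B i)) sums (q A + q B)"
  by (rule binaryset_sums) (simp add: vector_measure_empty[OF assms(1)])
 ultimately show ?thesis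
  by (simp add: UN_binaryset_eq sums_unique2)
qed

lemma vector_measure_inner:
 assumes "vector_measure q" shows "vector_measure (%A. q A \<bullet> i)"
 using assms bounded_linear.sums[OF bounded_linear_inner_left]
 unfolding vector_measure_def by blast

lemma variation_ge:
 assumes "P \<in> partition_seqs A"
 shows "(\<Sum>i. ennreal (norm (q (P i)))) <= variation q A"
 unfolding variation_def using assms by (rule SUP_upper)

lemma norm_le_variation:
 assumes "vector_measure q" "A \<in> sets borel"
 shows "ennreal (norm (q A)) <= variation q A"
proof -
 have "binaryset A {} \<in> partition_seqs A"
  using assms by (auto simp: partition_seqs_def binaryset_def disjoint_family_on_def)
 then have "(\<Sum>i. ennreal (norm (q (binaryset A {} i)))) <= variation q A"
  by (rule variation_ge)
 also have "(\<Sum>i. ennreal (norm (q (binaryset A {} i)))) = ennreal (norm (q A)) + ennreal (norm (q {}))"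
  by (rule suminf_binaryset_eq[of "%A. ennreal (norm (q A))"]) (simp add: vector_measure_empty[OF assms(1)])
 finally show ?thesis by (simp add: vector_measure_empty[OF assms(1)])
qed

lemma partition_seqs_nonempty:
 assumes "A \<in> sets borel" shows "partition_seqs A ~= {}"
proof -
 have "binaryset A {} \<in> partition_seqs A"
  using assms by (auto simp: partition_seqs_def binaryset_def disjoint_family_on_def)
 then show ?thesis by auto
qed

lemma variation_empty:
 assumes "vector_measure q" shows "variation q {} = 0"
proof -
 have "(\<Sum>i. ennreal (norm (q (P i)))) = 0" if "P \<in> partition_seqs {}" for P
 proof -
  have "P i = {}" for i using that by (auto simp: partition_seqs_def)
  then show ?thesis by (simp add: vector_measure_empty[OF assms])
 qed
 then have "variation q {} <= 0" unfolding variation_def by (intro SUP_least) (simp only: order_refl)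
 then show ?thesis by simp
qed

text \<open>Partitions of \<open>A\<close> and \<open>B\<close> are laid out as rows 0 and 1 of an
  infinite matrix whose other rows are empty; enumerating the matrix by \<open>prod_decode\<close>
  gives a partition of the union whose sum is the sum of the two.\<close>

lemma variation_superadd:
 assumes "vector_measure q" "A \<in> sets borel" "B \<in> sets borel" "A \<inter> B = {}"
 shows "variation q A + variation q B <= variation q (A \<union> B)"
proof -
 have *: "(\<Sum>i. ennreal (norm (q (P i)))) + (\<Sum>i. ennreal (norm (q (R i)))) <= variation q (A \<union> B)"
  if P: "P \<in> partition_seqs A" and R: "R \<in> partition_seqs B" for P R
 proof -
  define F where "F j i = (if j = 0 then P i else if j = Suc 0 then R i else {})" for j i
  define S where "S n = F (fst (prod_decode n)) (snd (prod_decode n))" for n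
  have S: "S \<in> partition_seqs (A \<union> B)"
   unfolding partition_seqs_def
  proof (intro CollectI conjI)
   show "range S \<subseteq> sets borel"
    using P R by (auto simp: S_def F_def partition_seqs_def)
   have dP: "P i \<inter> P j = {}" "R i \<inter> R j = {}" if "i ~= j" for i j
    using P R that by (auto simp: partition_seqs_def disjoint_family_on_def)
   have dPR: "P i \<inter> R j = {}" "R i \<inter> P j = {}" for i j
    using P R assms(4) by (auto simp: partition_seqs_def)
   have dF: "F j i \<inter> F j' i' = {}" if "(j, i) ~= (j', i')" for i j i' j'
    using that dP dPR by (auto simp: F_def split: if_splits)
   show "disjoint_family S"
    unfolding disjoint_family_on_def S_def
   proof (intro ballI impI)
    fix m n :: nat assume "m ~= n"
    then have "prod_decode m ~= prod_decode n"
     by (metis prod_decode_inverse)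
    then show "F (fst (prod_decode m)) (snd (prod_decode m)) \<inter> F (fst (prod_decode n)) (snd (prod_decode n)) = {}"
     by (intro dF) (auto simp: prod_eq_iff)
   qed
   have "(\<Union>n. S n) = (\<Union>j. \<Union>i. F j i)"
   proof (intro equalityI subsetI)
    fix x assume "x \<in> (\<Union>j. \<Union>i. F j i)"
    then obtain j i where "x \<in> F j i" by blast
    then have "x \<in> S (prod_encode (j, i))" by (simp add: S_def)
    then show "x \<in> (\<Union>n. S n)" by blast
   qed (auto simp: S_def)
   also have "\<dots> = (\<Union>i. P i) \<union> (\<Union>i. R i)"
   proof (intro equalityI subsetI)
    fix x assume "x \<in> (\<Union>i. P i) \<union> (\<Union>i. R i)"
    then obtain i where "x \<in> F 0 i \<or> x \<in> F (Suc 0) i" by (auto simp: F_def)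
    then show "x \<in> (\<Union>j. \<Union>i. F j i)" by blast
   qed (auto simp: F_def split: if_splits)
   also have "\<dots> = A \<union> B" using P R by (auto simp: partition_seqs_def)
   finally show "(\<Union>n. S n) = A \<union> B" .
  qed
  have "(\<Sum>n. ennreal (norm (q (S n)))) = (\<Sum>n. (%(j, i). ennreal (norm (q (F j i)))) (prod_decode n))"
   by (simp only: S_def split_def)
  also have "\<dots> = (\<Sum>j. \<Sum>i. ennreal (norm (q (F j i))))"
   by (rule suminf_ennreal_2dimen) simp
  also have "\<dots> = (\<Sum>j<2. \<Sum>i. ennreal (norm (q (F j i))))"
   by (rule suminf_finite) (auto simp: F_def vector_measure_empty[OF assms(1)])
  also have "\<dots> = (\<Sum>i. ennreal (norm (q (P i)))) + (\<Sum>i. ennreal (norm (q (R i))))"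
   by (simp add: F_def numeral_2_eq_2)
  finally show ?thesis using variation_ge[OF S, of q] by simp
 qed
 have "variation q A + variation q B = (SUP P\<in>partition_seqs A. SUP R\<in>partition_seqs B.
   (\<Sum>i. ennreal (norm (q (P i)))) + (\<Sum>i. ennreal (norm (q (R i)))))"
  unfolding variation_def
  by (simp only: ennreal_SUP_add_left[OF partition_seqs_nonempty[OF assms(2)], symmetric]
     ennreal_SUP_add_right[OF partition_seqs_nonempty[OF assms(3)], symmetric])
 also have "\<dots> <= variation q (A \<union> B)"
  by (intro SUP_least *)
 finally show ?thesis .
qed

lemma variation_mono:
 assumes "vector_measure q" "A \<in> sets borel" "B \<in> sets borel" "A \<subseteq> B"
 shows "variation q A <= variation q B"
proof -
 have "variation q A + variation q (B - A) <= variation q (A \<union> (B - A))"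
  using assms by (intro variation_superadd) auto
 then have "variation q A + variation q (B - A) <= variation q B"
  using assms(4) by (simp add: Un_absorb1)
 then show ?thesis
  by (rule order_trans[OF add_increasing2[OF zero_le order_refl]])
qed

text \<open>One direction is finite superadditivity followed by monotonicity. For the other, each
  cell of a partition of the union is cut by the sets \<open>A n\<close>; the triangle inequality
  for the resulting series and an exchange of the two summations leave a partition of each
  \<open>A n\<close>.\<close>

lemma variation_countably_additive:
 assumes q: "vector_measure q" and A: "!!i::nat. A i \<in> sets borel" "disjoint_family A"
 shows "(\<Sum>n. variation q (A n)) = variation q (\<Union>n. A n)"
proof (rule antisym)
 have fin: "(\<Sum>n<N. variation q (A n)) <= variation q (\<Union>n<N. A n)" for N
 proof (induction N)
  case (Suc N)
  have "(\<Sum>n<Suc N. variation q (A n)) <= variation q (\<Union>n<N. A n) + variation q (A N)"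
   using Suc by (simp add: add_mono)
  also have "\<dots> <= variation q ((\<Union>n<N. A n) \<union> A N)"
   using A by (intro variation_superadd[OF q])
    (auto simp: disjoint_family_on_def, metis IntI empty_iff less_irrefl)
  also have "(\<Union>n<N. A n) \<union> A N = (\<Union>n<Suc N. A n)"
   by (auto simp: less_Suc_eq)
  finally show ?case .
 qed simp
 show "(\<Sum>n. variation q (A n)) <= variation q (\<Union>n. A n)"
 proof (rule suminf_le_const)
  fix N
  show "(\<Sum>n<N. variation q (A n)) <= variation q (\<Union>n. A n)"
   using fin[of N] A by (intro order_trans[OF fin] variation_mono[OF q]) auto
 qed simp
next
 show "variation q (\<Union>n. A n) <= (\<Sum>n. variation q (A n))"
  unfolding variation_def[of q "\<Union>n. A n"]
 proof (rule SUP_least)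
  fix P assume P: "P \<in> partition_seqs (\<Union>n. A n)"
  have Pb: "P i \<in> sets borel" for i using P by (auto simp: partition_seqs_def)
  have le: "ennreal (norm (q (P i))) <= (\<Sum>n. ennreal (norm (q (P i \<inter> A n))))" for i
  proof -
   have "(%n. q (P i \<inter> A n)) sums q (\<Union>n. P i \<inter> A n)"
    using A Pb by (intro vector_measure_sums[OF q]) (auto simp: disjoint_family_on_def)
   moreover have "(\<Union>n. P i \<inter> A n) = P i" using P by (auto simp: partition_seqs_def)
   ultimately have s: "(%n. q (P i \<inter> A n)) sums q (P i)" by simp
   then have "(%N. ennreal (norm (\<Sum>n<N. q (P i \<inter> A n)))) \<longlonglongrightarrow> ennreal (norm (q (P i)))"
    unfolding sums_def by (intro tendsto_ennrealI tendsto_norm)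
   moreover have "ennreal (norm (\<Sum>n<N. q (P i \<inter> A n))) <= (\<Sum>n. ennreal (norm (q (P i \<inter> A n))))" for N
   proof -
    have "ennreal (norm (\<Sum>n<N. q (P i \<inter> A n))) <= ennreal (\<Sum>n<N. norm (q (P i \<inter> A n)))"
     by (intro ennreal_leI norm_sum)
    also have "\<dots> = (\<Sum>n<N. ennreal (norm (q (P i \<inter> A n))))" by simp
    also have "\<dots> <= (\<Sum>n. ennreal (norm (q (P i \<inter> A n))))" by (rule sum_le_suminf) auto
    finally show ?thesis .
   qed
   ultimately show ?thesis using LIMSEQ_le_const2 by blast
  qed
  have PA: "(%i. P i \<inter> A n) \<in> partition_seqs (A n)" for n
  proof -
   have "disjoint_family (%i. P i \<inter> A n)"
    using P unfolding partition_seqs_def disjoint_family_on_def by blast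
   moreover have "(\<Union>i. P i \<inter> A n) = A n" using P unfolding partition_seqs_def by blast
   ultimately show ?thesis using A Pb by (auto simp: partition_seqs_def)
  qed
  have "(\<Sum>i. ennreal (norm (q (P i)))) <= (\<Sum>i. \<Sum>n. ennreal (norm (q (P i \<inter> A n))))"
   by (intro suminf_le le) auto
  \<comment> \<open>Tonelli for double series, in the form of a series of integrals over the
    counting measure.\<close>
  also have "\<dots> = (\<Sum>n. \<Sum>i. ennreal (norm (q (P i \<inter> A n))))"
   using nn_integral_suminf[of "%n i. ennreal (norm (q (P i \<inter> A n)))" "count_space UNIV"]
   by (simp only: nn_integral_count_space_nat borel_measurable_count_space)
  also have "\<dots> <= (\<Sum>n. variation q (A n))"
   by (intro suminf_le variation_ge[OF PA]) auto
  finally show "(\<Sum>i. ennreal (norm (q (P i)))) <= (\<Sum>n. variation q (A n))" .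
 qed
qed

lemma space_total_variation [simp]: "space (total_variation q) = UNIV"
 and sets_total_variation [simp, measurable_cong]: "sets (total_variation q) = sets borel"
 unfolding total_variation_alt
 using sets.sigma_sets_eq[of "borel :: 'a measure"] by simp_all

lemma emeasure_total_variation:
 assumes "vector_measure q" "A \<in> sets borel"
 shows "emeasure (total_variation q) A = variation q A"
 unfolding total_variation_alt
proof (rule emeasure_measure_of_sigma)
 show "sigma_algebra UNIV (sets (borel :: 'a measure))"
  using sets.sigma_algebra_axioms[of "borel :: 'a measure"] by simp
 show "positive (sets (borel :: 'a measure)) (variation q)"
  by (simp add: positive_def variation_empty[OF assms(1)])
 show "countably_additive (sets (borel :: 'a measure)) (variation q)"
  unfolding countably_additive_def
  by (auto intro!: variation_countably_additive[OF assms(1)])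
qed (use assms in auto)

text \<open>If a set had infinite variation, one could split off a piece of measure larger than 1 and keep
 a remainder of infinite variation, ad infinitum.\<close>

lemma real_variation_finite:
 fixes s :: "'a::euclidean_space set => real"
 assumes s: "vector_measure s"
 shows "variation s UNIV < \<infinity>"
proof (rule ccontr)
 assume inf: "\<not> variation s UNIV < \<infinity>"
 have split: "\<exists>B\<subseteq>E. B \<in> sets borel \<and> \<not> variation s B < \<infinity> \<and> 1 < \<bar>s (E - B)\<bar>"
  if E: "E \<in> sets borel" and Einf: "\<not> variation s E < \<infinity>" for E
 proof -
  \<comment> \<open>The factor 2 pays for the split by sign: the nonnegative or the negative cells
    alone carry more than half of \<open>T\<close>.\<close>
  define T where "T = 2 * (1 + \<bar>s E\<bar>)"
  have "ennreal T < variation s E" using Einf not_less_iff_gr_or_eq less_top by (metis ennreal_less_top infinity_ennreal_def)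
  then obtain P where P: "P \<in> partition_seqs E" and "ennreal T < (\<Sum>i. ennreal (norm (s (P i))))"
   unfolding variation_def less_SUP_iff by blast
  then have "\<exists>N. ennreal T < (\<Sum>i<N. ennreal (norm (s (P i))))"
   unfolding suminf_eq_SUP less_SUP_iff by simp
  then obtain N where "ennreal T < ennreal (\<Sum>i<N. \<bar>s (P i)\<bar>)"
   by auto
  then have N: "T < (\<Sum>i<N. \<bar>s (P i)\<bar>)"
   using ennreal_leI leD not_le by blast
  have Pb: "P i \<in> sets borel" for i using P by (auto simp: partition_seqs_def)
  have fin: "s (\<Union>i\<in>I. P i) = (\<Sum>i\<in>I. s (P i))" if "finite I" for I
   using that
  proof (induction I rule: finite_induct)
   case empty then show ?case by (simp add: vector_measure_empty[OF s])
  next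
   case (insert i I)
   have "s (P i \<union> (\<Union>i\<in>I. P i)) = s (P i) + s (\<Union>i\<in>I. P i)"
   proof (rule vector_measure_Un[OF s])
    have "P i \<inter> P j = {}" if "j \<in> I" for j
     using P that insert(2) unfolding partition_seqs_def disjoint_family_on_def by (metis (mono_tags, lifting) CollectD UNIV_I)
    then show "P i \<inter> (\<Union>i\<in>I. P i) = {}" by blast
   qed (use Pb insert(1) in auto)
   then show ?case using insert by simp
  qed
  define I where "I = {i. i < N \<and> 0 <= s (P i)}"
  define J where "J = {i. i < N \<and> s (P i) < 0}"
  have IJ: "finite I" "finite J" "{..<N} = I \<union> J" "I \<inter> J = {}" by (auto simp: I_def J_def)
  have "(\<Sum>i<N. \<bar>s (P i)\<bar>) = (\<Sum>i\<in>I. \<bar>s (P i)\<bar>) + (\<Sum>i\<in>J. \<bar>s (P i)\<bar>)"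
   unfolding IJ(3) by (rule sum.union_disjoint) (use IJ in auto)
  also have "(\<Sum>i\<in>I. \<bar>s (P i)\<bar>) = s (\<Union>i\<in>I. P i)"
   unfolding fin[OF IJ(1)] by (auto intro!: sum.cong simp: I_def)
  also have "(\<Sum>i\<in>J. \<bar>s (P i)\<bar>) = - s (\<Union>i\<in>J. P i)"
   unfolding fin[OF IJ(2)] sum_negf[symmetric] by (auto intro!: sum.cong simp: J_def)
  finally have TIJ: "T < s (\<Union>i\<in>I. P i) + - s (\<Union>i\<in>J. P i)" using N by simp
  then have "\<exists>A. A \<in> sets borel \<and> A \<subseteq> E \<and> 1 + \<bar>s E\<bar> < \<bar>s A\<bar>"
  proof (cases "1 + \<bar>s E\<bar> < \<bar>s (\<Union>i\<in>I. P i)\<bar>")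
   case True
   then show ?thesis using Pb P by (intro exI[of _ "\<Union>i\<in>I. P i"]) (auto simp: partition_seqs_def IJ)
  next
   case False
   then show ?thesis using Pb P TIJ
    by (intro exI[of _ "\<Union>i\<in>J. P i"]) (auto simp: partition_seqs_def IJ T_def)
  qed
  then obtain A where A: "A \<in> sets borel" "A \<subseteq> E" "1 + \<bar>s E\<bar> < \<bar>s A\<bar>" by blast
  have "s (A \<union> (E - A)) = s A + s (E - A)"
   using A E by (intro vector_measure_Un[OF s]) auto
  then have sE: "s E = s A + s (E - A)" using A(2) by (simp add: Un_absorb1)
  have "(\<Sum>n. variation s (binaryset A (E - A) n)) = variation s (\<Union>n. binaryset A (E - A) n)"
   using A E by (intro variation_countably_additive[OF s]) (auto simp: binaryset_def disjoint_family_on_def)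
  then have "variation s E = variation s A + variation s (E - A)"
   using A(2) suminf_binaryset_eq[of "variation s" A "E - A"] variation_empty[OF s]
   by (simp add: UN_binaryset_eq Un_absorb1)
  \<comment> \<open>From \<open>s E = s A + s (E - A)\<close> and \<open>|s A| > 1 + |s E|\<close>
    both pieces exceed 1 in modulus, so the one of infinite variation can be kept and the other one
    split off.\<close>
  then have "\<not> variation s A < \<infinity> \<or> \<not> variation s (E - A) < \<infinity>"
   using Einf by auto
  then show ?thesis
  proof
   assume "\<not> variation s A < \<infinity>"
   then show ?thesis using A E sE by (intro exI[of _ A]) auto
  next
   assume "\<not> variation s (E - A) < \<infinity>"
   moreover have "E - (E - A) = A" using A by auto
   ultimately show ?thesis using A E by (intro exI[of _ "E - A"]) auto
  qed
 qed
 define nxt where "nxt E = (SOME B. B \<subseteq> E \<and> B \<in> sets borel \<and> \<not> variation s B < \<infinity> \<and> 1 < \<bar>s (E - B)\<bar>)" for E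
 have nxt: "nxt E \<subseteq> E \<and> nxt E \<in> sets borel \<and> \<not> variation s (nxt E) < \<infinity> \<and> 1 < \<bar>s (E - nxt E)\<bar>"
  if "E \<in> sets borel" "\<not> variation s E < \<infinity>" for E
  unfolding nxt_def by (rule someI_ex) (use split[OF that] in blast)
 define E where "E n = (nxt ^^ n) UNIV" for n
 have E: "E n \<in> sets borel \<and> \<not> variation s (E n) < \<infinity>" for n
 proof (induction n)
  case 0 show ?case using inf by (simp add: E_def)
 next
  case (Suc n) then show ?case using nxt[of "E n"] unfolding E_def by simp
 qed
 have E_Suc: "E (Suc n) = nxt (E n)" for n by (simp add: E_def)
 have dec: "E n \<subseteq> E m" if "m <= n" for m n
  using that
 proof (induction rule: dec_induct)
  case (step n)
  then show ?case using nxt[of "E n"] E[of n] unfolding E_Suc by blast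
 qed simp
 define A where "A n = E n - E (Suc n)" for n
 have "disjoint_family A"
  unfolding disjoint_family_on_def
 proof (intro ballI impI)
  fix m n :: nat assume "m ~= n"
  then have "Suc m <= n \<or> Suc n <= m" by auto
  then show "A m \<inter> A n = {}" using dec unfolding A_def by blast
 qed
 then have "(%i. s (A i)) sums s (\<Union>i. A i)"
 proof (intro vector_measure_sums[OF s])
  show "A i \<in> sets borel" for i using E unfolding A_def by (intro sets.Diff) auto
 qed
 then have "(%i. s (A i)) \<longlonglongrightarrow> 0" using sums_summable summable_LIMSEQ_zero by blast
 then obtain n where "\<bar>s (A n)\<bar> < 1"
  using LIMSEQ_D[of "%i. s (A i)" 0 1] by auto
 moreover have "1 < \<bar>s (A n)\<bar>" using nxt[of "E n"] E[of n] unfolding A_def E_Suc by blast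
 ultimately show False by simp
qed

text \<open>The norm is at most the sum of the moduli of the coordinates, which reduces finiteness
  to the real case.\<close>

lemma variation_finite:
 fixes q :: "'a::euclidean_space set => 'b::euclidean_space"
 assumes q: "vector_measure q"
 shows "variation q UNIV < \<infinity>"
proof -
 have "variation q UNIV <= (\<Sum>i\<in>Basis. variation (%A. q A \<bullet> i) UNIV)"
  unfolding variation_def[of q]
 proof (rule SUP_least)
  fix P :: "nat => 'a set" assume P: "P \<in> partition_seqs UNIV"
  have "(\<Sum>n. ennreal (norm (q (P n)))) <= (\<Sum>n. \<Sum>i\<in>Basis. ennreal (norm (q (P n) \<bullet> i)))"
  proof (intro suminf_le)
   fix n
   have "ennreal (norm (q (P n))) <= ennreal (\<Sum>i\<in>Basis. norm (q (P n) \<bullet> i))"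
    by (intro ennreal_leI) (simp add: norm_le_l1)
   then show "ennreal (norm (q (P n))) <= (\<Sum>i\<in>Basis. ennreal (norm (q (P n) \<bullet> i)))"
    by simp
  qed auto
  also have "\<dots> = (\<Sum>i\<in>Basis. \<Sum>n. ennreal (norm (q (P n) \<bullet> i)))"
   by (rule suminf_sum) simp
  also have "\<dots> <= (\<Sum>i\<in>Basis. variation (%A. q A \<bullet> i) UNIV)"
   by (intro sum_mono variation_ge[OF P, where q="%A. q A \<bullet> _"])
  finally show "(\<Sum>n. ennreal (norm (q (P n)))) <= (\<Sum>i\<in>Basis. variation (%A. q A \<bullet> i) UNIV)" .
 qed
 also have "\<dots> < \<infinity>"
  using real_variation_finite[OF vector_measure_inner[OF q]] by (auto intro!: ennreal_sum_less_top)
 finally show ?thesis .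
qed

lemma finite_measure_total_variation:
 fixes q :: "'a::euclidean_space set => 'b::euclidean_space"
 assumes "vector_measure q"
 shows "finite_measure (total_variation q)"
 using variation_finite[OF assms] by (intro finite_measureI) (simp add: emeasure_total_variation[OF assms])

lemma norm_le_total_variation:
 fixes q :: "'a::euclidean_space set => 'b::euclidean_space"
 assumes "vector_measure q" "A \<in> sets borel"
 shows "norm (q A) <= measure (total_variation q) A"
proof -
 interpret finite_measure "total_variation q" by (rule finite_measure_total_variation[OF assms(1)])
 have "ennreal (norm (q A)) <= emeasure (total_variation q) A"
  using norm_le_variation assms emeasure_total_variation by metis
 then show ?thesis by (simp add: emeasure_eq_measure)
qed

section \<open>Integrals with respect to signed and vector measures\<close>

lemma bounded_integrable_finite:
 fixes F :: "'a => 'b::euclidean_space"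
 assumes "finite_measure M" "F \<in> borel_measurable M" "!!x. norm (F x) <= B"
 shows "integrable M F"
 using finite_measure.integrable_const_bound[OF assms(1), of F B] assms by simp

text \<open>Two decompositions of one signed measure satisfy \<open>m1 - m4 = m3 - m2\<close>;
  written with sums, the identity makes sense in the extended reals and survives the induction over
  nonnegative functions, monotone limits included.\<close>

lemma nn_integral_add_measure_eq:
 fixes F :: "'a::euclidean_space => ennreal"
 assumes F: "F \<in> borelm"
  and sets: "sets m1 = sets borel" "sets m2 = sets borel" "sets m3 = sets borel" "sets m4 = sets borel"
  and eq: "!!A. A \<in> sets borel ==> emeasure m1 A + emeasure m2 A = emeasure m3 A + emeasure m4 A"
 shows "integral\<^sup>N m1 F + integral\<^sup>N m2 F = integral\<^sup>N m3 F + integral\<^sup>N m4 F"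
proof -
 note [measurable_cong] = sets
 note sp = sets_eq_imp_space_eq[OF sets(1)] sets_eq_imp_space_eq[OF sets(2)]
  sets_eq_imp_space_eq[OF sets(3)] sets_eq_imp_space_eq[OF sets(4)]
 show ?thesis
  using F
 proof (induction F)
  case (cong f g)
  then have "f = g" by auto
  then show ?case using cong by simp
 next
  case (set A)
  then show ?case using eq[of A] by (simp add: sets)
 next
  case (mult u c)
  note [measurable] = mult(2)
  show ?case using mult(4)
   by (simp add: nn_integral_cmult distrib_left[symmetric])
 next
  case (add u v)
  have split: "integral\<^sup>N m (%x. v x + u x) = integral\<^sup>N m v + integral\<^sup>N m u" if "sets m = sets borel" for m
   using add.hyps(1,3) that by (intro nn_integral_add) (auto simp: measurable_cong_sets[OF that refl])
  have ac: "(a + b) + (c + d) = (a + c) + (b + d)" for a b c d :: ennreal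
   by (simp add: ac_simps)
  show ?case
   unfolding split[OF sets(1)] split[OF sets(2)] split[OF sets(3)] split[OF sets(4)]
   by (rule trans[OF ac trans[OF _ ac[symmetric]]]) (simp only: add.IH)
 next
  case (seq U)
  have lim: "integral\<^sup>N m (SUP i. U i) = (SUP i. integral\<^sup>N m (U i))" if "sets m = sets borel" for m
  proof -
   have "(SUP i. U i) = (%x. SUP i. U i x)" by (simp add: fun_eq_iff image_comp)
   then show ?thesis
    using nn_integral_monotone_convergence_SUP[OF seq.hyps(3), of m] seq.hyps(1)
    by (simp add: measurable_cong_sets[OF that refl])
  qed
  have inc: "incseq (%i. integral\<^sup>N m (U i))" for m :: "'a measure"
   using seq.hyps(3) by (auto simp: incseq_def le_fun_def intro!: nn_integral_mono)
  show ?case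
   using seq.IH by (simp only: lim[OF sets(1)] lim[OF sets(2)] lim[OF sets(3)] lim[OF sets(4)]
     ennreal_SUP_add[OF inc inc, symmetric])
 qed
qed

text \<open>Adding the bound \<open>B\<close> makes the integrand nonnegative; the total masses on
  both sides agree, so the added constants cancel.\<close>

lemma integral_add_measure_eq:
 fixes F :: "'a::euclidean_space => real"
 assumes F: "F \<in> borelm" "!!x. \<bar>F x\<bar> <= B"
  and sets: "sets m1 = sets borel" "sets m2 = sets borel" "sets m3 = sets borel" "sets m4 = sets borel"
  and fin: "finite_measure m1" "finite_measure m2" "finite_measure m3" "finite_measure m4"
  and eq: "!!A. A \<in> sets borel ==> measure m1 A + measure m2 A = measure m3 A + measure m4 A"
 shows "integral\<^sup>L m1 F + integral\<^sup>L m2 F = integral\<^sup>L m3 F + integral\<^sup>L m4 F"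
proof -
 note [measurable_cong] = sets
 have nn: "ennreal (integral\<^sup>L m F + B * measure m UNIV) = integral\<^sup>N m (%x. ennreal (F x + B))"
    and nn0: "0 <= integral\<^sup>L m F + B * measure m UNIV"
  if s: "sets m = sets borel" and "finite_measure m" for m
 proof -
  interpret finite_measure m by fact
  have Fm: "F \<in> borel_measurable m" using F by (simp add: measurable_cong_sets[OF s refl])
  have "integrable m F" using F by (intro bounded_integrable_finite[where B=B] that Fm) auto
  moreover have *: "0 <= F x + B" for x using F(2)[of x] by linarith
  ultimately have "integral\<^sup>N m (%x. ennreal (F x + B)) = ennreal (integral\<^sup>L m (%x. F x + B))"
   by (intro nn_integral_eq_integral) auto
  also have i: "integral\<^sup>L m (%x. F x + B) = integral\<^sup>L m F + B * measure m UNIV"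
   using \<open>integrable m F\<close> sets_eq_imp_space_eq[OF s] by simp
  finally show "ennreal (integral\<^sup>L m F + B * measure m UNIV) = integral\<^sup>N m (%x. ennreal (F x + B))" by simp
  show "0 <= integral\<^sup>L m F + B * measure m UNIV" unfolding i[symmetric] using * by simp
 qed
 have "integral\<^sup>N m1 (%x. ennreal (F x + B)) + integral\<^sup>N m2 (%x. ennreal (F x + B))
   = integral\<^sup>N m3 (%x. ennreal (F x + B)) + integral\<^sup>N m4 (%x. ennreal (F x + B))"
  using fin
  by (intro nn_integral_add_measure_eq sets)
   (use F eq in \<open>auto simp: finite_measure.emeasure_eq_measure simp flip: ennreal_plus\<close>)
 then have "integral\<^sup>L m1 F + B * measure m1 UNIV + (integral\<^sup>L m2 F + B * measure m2 UNIV)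
   = integral\<^sup>L m3 F + B * measure m3 UNIV + (integral\<^sup>L m4 F + B * measure m4 UNIV)"
  unfolding nn[OF sets(1) fin(1), symmetric] nn[OF sets(2) fin(2), symmetric]
   nn[OF sets(3) fin(3), symmetric] nn[OF sets(4) fin(4), symmetric]
  using nn0 sets fin by (simp flip: ennreal_plus)
 moreover have "B * measure m1 UNIV + B * measure m2 UNIV = B * measure m3 UNIV + B * measure m4 UNIV"
  using eq[of UNIV] by (simp flip: distrib_left)
 ultimately show ?thesis by linarith
qed

text \<open>\<open>|s A|\<close> never exceeds the total variation of \<open>A\<close>, so the value
  inside \<open>ennreal\<close> is not truncated; countable additivity then comes from that of
  \<open>total_variation s\<close> and of \<open>s\<close>.\<close>

lemma
 fixes s :: "'a::euclidean_space set => real"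
 assumes s: "vector_measure s"
 shows sets_positive_part [simp]: "sets (positive_part s) = sets borel"
  and finite_measure_positive_part: "finite_measure (positive_part s)"
  and measure_positive_part:
   "!!A. A \<in> sets borel ==> measure (positive_part s) A = (measure (total_variation s) A + s A) / 2"
proof -
 interpret V: finite_measure "total_variation s" by (rule finite_measure_total_variation[OF s])
 let ?m = "%A. (measure (total_variation s) A + s A) / 2"
 have nn: "0 <= ?m A" if "A \<in> sets borel" for A
  using norm_le_total_variation[OF s that] by simp
 have sig: "sigma_sets UNIV (sets (borel :: 'a measure)) = sets borel"
  using sets.sigma_sets_eq[of "borel :: 'a measure"] by simp
 show sets: "sets (positive_part s) = sets borel"
  unfolding positive_part_def by (simp add: sig)
 have em: "emeasure (positive_part s) A = ennreal (?m A)" if A: "A \<in> sets borel" for A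
  unfolding positive_part_def
 proof (rule emeasure_measure_of_sigma)
  show "sigma_algebra UNIV (sets (borel :: 'a measure))"
   using sets.sigma_algebra_axioms[of "borel :: 'a measure"] by simp
  show "positive (sets (borel :: 'a measure)) (%A. ennreal (?m A))"
   by (simp add: positive_def vector_measure_empty[OF s])
  show "countably_additive (sets (borel :: 'a measure)) (%A. ennreal (?m A))"
   unfolding countably_additive_def
  proof (intro allI impI)
   fix A :: "nat => 'a set" assume A: "range A \<subseteq> sets borel" "disjoint_family A"
   have "(%i. measure (total_variation s) (A i)) sums measure (total_variation s) (\<Union>i. A i)"
    using A by (intro V.finite_measure_UNION) auto
   moreover have "(%i. s (A i)) sums s (\<Union>i. A i)"
    using A by (intro vector_measure_sums[OF s]) auto
   ultimately have "(%i. ?m (A i)) sums ?m (\<Union>i. A i)"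
    by (intro sums_divide sums_add)
   then show "(\<Sum>i. ennreal (?m (A i))) = ennreal (?m (\<Union>i. A i))"
    using nn A by (intro sums_unique[symmetric]) (subst sums_ennreal, auto)
  qed
 qed fact
 show "finite_measure (positive_part s)"
  using em[of UNIV] by (intro finite_measureI) (simp add: sets_eq_imp_space_eq[OF sets])
 show "measure (positive_part s) A = ?m A" if "A \<in> sets borel" for A
  using em[OF that] nn[OF that] by (simp add: measure_def)
qed

lemma vector_measure_uminus:
 "vector_measure q ==> vector_measure (%A. - q A)"
 unfolding vector_measure_def by (simp add: sums_minus)

lemma total_variation_uminus: "total_variation (%A. - q A) = total_variation q"
 unfolding total_variation_def by simp

text \<open>Any decomposition \<open>s = m1 - m2\<close>, compared with the Jordan decomposition,
  yields an identity between sums of measures. Hence the integral can be computed from whatever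
  decomposition is at hand.\<close>

lemma signed_integral_eq:
 fixes s :: "'a::euclidean_space set => real"
 assumes s: "vector_measure s"
  and m: "sets m1 = sets borel" "finite_measure m1" "sets m2 = sets borel" "finite_measure m2"
  and eq: "!!A. A \<in> sets borel ==> s A = measure m1 A - measure m2 A"
  and K: "K \<in> sets borel" and F: "(%x. indicator K x *R f x) \<in> borelm"
  and B: "!!x. x \<in> K ==> \<bar>f x\<bar> <= B" "0 <= B"
 shows "signed_integral K s f = (LINT x:K|m1. f x) - (LINT x:K|m2. f x)"
proof -
 have "integral\<^sup>L (positive_part s) (%x. indicator K x *R f x) + integral\<^sup>L m2 (%x. indicator K x *R f x)
  = integral\<^sup>L m1 (%x. indicator K x *R f x) + integral\<^sup>L (positive_part (%A. - s A)) (%x. indicator K x *R f x)"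
 proof (rule integral_add_measure_eq[where B=B])
  fix A :: "'a set" assume "A \<in> sets borel"
  then show "measure (positive_part s) A + measure m2 A = measure m1 A + measure (positive_part (%A. - s A)) A"
   using eq[of A] vector_measure_uminus[OF s]
   by (simp add: measure_positive_part s total_variation_uminus field_simps)
 qed (use assms vector_measure_uminus[OF s] in \<open>auto simp: finite_measure_positive_part indicator_def\<close>)
 then show ?thesis
  unfolding signed_integral_def set_lebesgue_integral_def by simp
qed

text \<open>The image under \<open>T\<close> of the vector measure with density \<open>g\<close>.
  This form covers Lebesgue densities, superpositions of segments, and limits seen as measures on
  pairs of position and direction.\<close>

lemma vector_measure_integral:
 fixes g :: "'w => 'b::euclidean_space" and T :: "'w => 'a::euclidean_space"
 assumes T [measurable]: "T \<in> measurable M borel" and g: "integrable M g"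
 shows "vector_measure (%A. LINT omega|M. indicator A (T omega) *R g omega)"
 unfolding vector_measure_def sums_def
proof (intro allI impI)
 fix A :: "nat => 'a set" assume A: "range A \<subseteq> sets borel \<and> disjoint_family A"
 note [measurable] = borel_measurable_integrable[OF g]
 have Am [measurable]: "A i \<in> sets borel" for i using A by auto
 have int: "integrable M (%omega. indicator B (T omega) *R g omega)" if [measurable]: "B \<in> sets borel" for B
  by (rule bi_bound[OF g]) (auto simp: indicator_def)
 have sum: "(\<Sum>i<N. indicator (A i) x :: real) = indicator (\<Union>i<N. A i) x" for N x
  using A by (subst indicator_UN_disjoint) (auto simp: disjoint_family_on_def)
 have "(%N. LINT omega|M. indicator (\<Union>i<N. A i) (T omega) *R g omega) \<longlonglongrightarrow> (LINT omega|M. indicator (\<Union>i. A i) (T omega) *R g omega)"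
 proof (rule integral_dominated_convergence[where w="%omega. norm (g omega)"])
  show "AE omega in M. (%N. indicator (\<Union>i<N. A i) (T omega) *R g omega) \<longlonglongrightarrow> indicator (\<Union>i. A i) (T omega) *R g omega"
  proof (intro AE_I2 tendsto_scaleR tendsto_const)
   fix omega
   show "(%N. indicator (\<Union>i<N. A i) (T omega) :: real) \<longlonglongrightarrow> indicator (\<Union>i. A i) (T omega)"
    using LIMSEQ_indicator_UN[of A "T omega"] by simp
  qed
 qed (use g in \<open>auto simp: indicator_def\<close>)
 moreover have "(\<Sum>i<N. LINT omega|M. indicator (A i) (T omega) *R g omega) = (LINT omega|M. indicator (\<Union>i<N. A i) (T omega) *R g omega)" for N
  by (subst bi_sum[symmetric])
   (auto intro!: int bi_cong simp: sum scaleR_left.sum[symmetric])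
 ultimately show "(%N. \<Sum>i<N. LINT omega|M. indicator (A i) (T omega) *R g omega) \<longlonglongrightarrow> (LINT omega|M. indicator (\<Union> (range A)) (T omega) *R g omega)"
  by simp
qed

text \<open>Turns the coordinatewise Jordan integral of the definition into one Bochner integral.
  For each coordinate the images of the positive and the negative part of \<open>g\<close> form a
  decomposition, which need not be the Jordan one.\<close>

lemma vector_integral_integral:
 fixes g :: "'w => 'a::euclidean_space" and T :: "'w => 'a"
 assumes T [measurable]: "T \<in> measurable M borel" and g: "integrable M g"
  and q: "vector_measure q"
  and eq: "!!A. A \<in> sets borel ==> q A = (LINT omega|M. indicator A (T omega) *R g omega)"
  and K: "compact K" and f: "continuous_on K f"
 shows "vector_integral K q f = (LINT omega|M. indicator K (T omega) * (f (T omega) \<bullet> g omega))"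
proof -
 note [measurable] = borel_measurable_integrable[OF g]
 have Kb [measurable]: "K \<in> sets borel" using K by (simp add: compact_imp_closed)
 have F [measurable]: "(%x. indicator K x *R f x) \<in> borelm"
  by (rule borel_measurable_continuous_on_indicator[OF Kb f])
 obtain B where B: "!!x. x \<in> K ==> norm (f x) <= B" "0 <= B"
 proof -
  have "bounded (f ` K)" using compact_imp_bounded[OF compact_continuous_image[OF f K]] .
  then obtain B where "!!x. x \<in> K ==> norm (f x) <= B" by (auto simp: bounded_iff)
  then show ?thesis using that[of "max B 0"] by (meson max.cobounded2 max.coboundedI1)
 qed
 have comp: "signed_integral K (%A. q A \<bullet> i) (%x. f x \<bullet> i)
   = (LINT omega|M. indicator K (T omega) * ((f (T omega) \<bullet> i) * (g omega \<bullet> i)))"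
  and int: "integrable M (%omega. indicator K (T omega) * ((f (T omega) \<bullet> i) * (g omega \<bullet> i)))" if i: "i \<in> Basis" for i
 proof -
  let ?n = "%\<sigma>. distr (density M (%omega. ennreal (max 0 (\<sigma> * (g omega \<bullet> i))))) borel T"
  have ig: "integrable M (%omega. max 0 (\<sigma> * (g omega \<bullet> i)))" for \<sigma> :: real
   by (intro integrable_max integrable_mult_right integrable_inner_left g) auto
  have em: "emeasure (?n \<sigma>) A = ennreal (LINT omega|M. indicator A (T omega) *R max 0 (\<sigma> * (g omega \<bullet> i)))"
   if [measurable]: "A \<in> sets borel" for A \<sigma>
  proof -
   have "emeasure (?n \<sigma>) A = (\<integral>\<^sup>+ omega. ennreal (indicator A (T omega) *R max 0 (\<sigma> * (g omega \<bullet> i))) \<partial>M)"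
    by (subst emeasure_distr, simp, simp, subst emeasure_density, simp, simp)
      (auto intro!: nn_integral_cong simp: indicator_def)
   also have "\<dots> = ennreal (LINT omega|M. indicator A (T omega) *R max 0 (\<sigma> * (g omega \<bullet> i)))"
    by (intro nn_integral_eq_integral bi_bound[OF ig[of \<sigma>]]) (auto simp: indicator_def)
   finally show ?thesis .
  qed
  have fin: "finite_measure (?n \<sigma>)" for \<sigma>
   using em[of UNIV \<sigma>] by (intro finite_measureI) simp
  have me: "measure (?n \<sigma>) A = (LINT omega|M. indicator A (T omega) *R max 0 (\<sigma> * (g omega \<bullet> i)))"
   if "A \<in> sets borel" for A \<sigma>
   using em[OF that, of \<sigma>] unfolding measure_def by (simp add: integral_nonneg_AE)
  have intA: "integrable M (%omega. indicator A (T omega) *R max 0 (\<sigma> * (g omega \<bullet> i)))" if [measurable]: "A \<in> sets borel" for A \<sigma>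
   by (rule bi_bound[OF ig[of \<sigma>]]) (auto simp: indicator_def)
  have gA: "integrable M (%omega. indicator A (T omega) *R g omega)" if [measurable]: "A \<in> sets borel" for A
   by (rule bi_bound[OF g]) (auto simp: indicator_def)
  have si: "signed_integral K (%A. q A \<bullet> i) (%x. f x \<bullet> i) = (LINT x:K|?n 1. f x \<bullet> i) - (LINT x:K|?n (-1). f x \<bullet> i)"
  proof (rule signed_integral_eq[where B=B])
   fix A :: "'a set" assume A [measurable]: "A \<in> sets borel"
   have "q A \<bullet> i = (LINT omega|M. (indicator A (T omega) *R g omega) \<bullet> i)"
    unfolding eq[OF A] by (rule integral_inner_left[symmetric]) (rule gA[OF A])
   also have "\<dots> = (LINT omega|M. indicator A (T omega) *R max 0 (1 * (g omega \<bullet> i)) - indicator A (T omega) *R max 0 (-1 * (g omega \<bullet> i)))"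
    by (intro bi_cong) (auto simp: indicator_def max_def)
   also have "\<dots> = measure (?n 1) A - measure (?n (-1)) A"
    unfolding me[OF A] by (intro bi_diff intA A)
   finally show "q A \<bullet> i = measure (?n 1) A - measure (?n (-1)) A" .
  next
   show "(%x. indicator K x *R (f x \<bullet> i)) \<in> borelm"
    using borel_measurable_continuous_on_indicator[OF Kb, of "%x. f x \<bullet> i"] f
    by (simp add: continuous_on_inner)
   show "\<bar>f x \<bullet> i\<bar> <= B" if "x \<in> K" for x
    using B(1)[OF that] i Basis_le_norm[OF i, of "f x"] by linarith
  qed (use B fin vector_measure_inner[OF q] in \<open>simp_all only: sets_distr Kb\<close>)
  have Fi: "(%x. indicator K x *R (f x \<bullet> i)) \<in> borelm"
    using borel_measurable_continuous_on_indicator[OF Kb, of "%x. f x \<bullet> i"] f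
    by (simp add: continuous_on_inner)
  have FT [measurable]: "(%omega. indicator K (T omega) *R (f (T omega) \<bullet> i)) \<in> borel_measurable M"
   using measurable_compose[OF T Fi] .
  have nl: "(LINT x:K|?n \<sigma>. f x \<bullet> i) = (LINT omega|M. max 0 (\<sigma> * (g omega \<bullet> i)) *R (indicator K (T omega) *R (f (T omega) \<bullet> i)))" for \<sigma>
   unfolding set_lebesgue_integral_def
   by (subst integral_distr[OF _ Fi], simp, subst integral_density[OF FT]) simp_all
  have i2: "integrable M (%omega. max 0 (\<sigma> * (g omega \<bullet> i)) *R (indicator K (T omega) *R (f (T omega) \<bullet> i)))" for \<sigma>
  proof (rule bi_bound[OF integrable_mult_left[OF ig[of \<sigma>], of B]])
   show "AE x in M. norm (max 0 (\<sigma> * (g x \<bullet> i)) *R indicat_real K (T x) *R (f (T x) \<bullet> i)) <= norm (max 0 (\<sigma> * (g x \<bullet> i)) * B)"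
   proof (intro AE_I2)
    fix x
    have "\<bar>f (T x) \<bullet> i\<bar> <= B" if "T x \<in> K"
     using B(1)[OF that] Basis_le_norm[OF i, of "f (T x)"] by linarith
    then show "norm (max 0 (\<sigma> * (g x \<bullet> i)) *R indicat_real K (T x) *R (f (T x) \<bullet> i)) <= norm (max 0 (\<sigma> * (g x \<bullet> i)) * B)"
     using B(2) by (auto simp: indicator_def abs_mult intro!: mult_left_mono)
   qed
  qed measurable
  show "signed_integral K (%A. q A \<bullet> i) (%x. f x \<bullet> i)
   = (LINT omega|M. indicator K (T omega) * ((f (T omega) \<bullet> i) * (g omega \<bullet> i)))"
   by (simp only: si nl bi_diff[OF i2 i2, symmetric])
    (auto intro!: bi_cong simp: max_def)
  have "integrable M (%omega. max 0 (1 * (g omega \<bullet> i)) *R (indicator K (T omega) *R (f (T omega) \<bullet> i)) -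
    max 0 (-1 * (g omega \<bullet> i)) *R (indicator K (T omega) *R (f (T omega) \<bullet> i)))"
   by (intro bi_diffI i2)
  moreover have "(%omega. max 0 (1 * (g omega \<bullet> i)) *R (indicator K (T omega) *R (f (T omega) \<bullet> i)) -
    max 0 (-1 * (g omega \<bullet> i)) *R (indicator K (T omega) *R (f (T omega) \<bullet> i)))
   = (%omega. indicator K (T omega) * ((f (T omega) \<bullet> i) * (g omega \<bullet> i)))"
   by (auto simp: max_def)
  ultimately show "integrable M (%omega. indicator K (T omega) * ((f (T omega) \<bullet> i) * (g omega \<bullet> i)))"
   by simp
 qed
 have "vector_integral K q f = (LINT omega|M. (\<Sum>i\<in>Basis. indicator K (T omega) * ((f (T omega) \<bullet> i) * (g omega \<bullet> i))))"
  unfolding vector_integral_def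
  by (subst bi_sum) (auto simp: comp int)
 also have "\<dots> = (LINT omega|M. indicator K (T omega) * (f (T omega) \<bullet> g omega))"
  by (intro bi_cong) (simp_all add: sum_distrib_left[symmetric] euclidean_inner[symmetric])
 finally show ?thesis .
qed

lemma emeasure_total_variation_le:
 fixes g :: "'w => 'b::euclidean_space" and T :: "'w => 'a::euclidean_space"
 assumes T [measurable]: "T \<in> measurable M borel" and g: "integrable M g"
  and q: "vector_measure q"
  and eq: "!!A. A \<in> sets borel ==> q A = (LINT omega|M. indicator A (T omega) *R g omega)"
  and A: "A \<in> sets borel"
 shows "emeasure (total_variation q) A <= (\<integral>\<^sup>+omega. indicator A (T omega) * ennreal (norm (g omega)) \<partial>M)"
 unfolding emeasure_total_variation[OF q A] variation_def
proof (rule SUP_least)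
 note [measurable] = borel_measurable_integrable[OF g]
 fix P assume P: "P \<in> partition_seqs A"
 have Pb [measurable]: "P i \<in> sets borel" for i using P by (auto simp: partition_seqs_def)
 have "ennreal (norm (q (P i))) <= (\<integral>\<^sup>+omega. indicator (P i) (T omega) * ennreal (norm (g omega)) \<partial>M)" for i
 proof -
  have int: "integrable M (%omega. indicator (P i) (T omega) *R g omega)"
   by (rule bi_bound[OF g]) (auto simp: indicator_def)
  have "ennreal (norm (q (P i))) <= (\<integral>\<^sup>+omega. ennreal (norm (indicator (P i) (T omega) *R g omega)) \<partial>M)"
   unfolding eq[OF Pb] by (rule integral_norm_bound_ennreal[OF int])
  also have "\<dots> = (\<integral>\<^sup>+omega. indicator (P i) (T omega) * ennreal (norm (g omega)) \<partial>M)"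
   by (intro nn_integral_cong) (auto simp: indicator_def)
  finally show ?thesis .
 qed
 then have "(\<Sum>i. ennreal (norm (q (P i)))) <= (\<Sum>i. \<integral>\<^sup>+omega. indicator (P i) (T omega) * ennreal (norm (g omega)) \<partial>M)"
  by (intro suminf_le) auto
 also have "\<dots> = (\<integral>\<^sup>+omega. (\<Sum>i. indicator (P i) (T omega) * ennreal (norm (g omega))) \<partial>M)"
  by (rule nn_integral_suminf[symmetric]) measurable
 also have "\<dots> = (\<integral>\<^sup>+omega. indicator A (T omega) * ennreal (norm (g omega)) \<partial>M)"
 proof (intro nn_integral_cong)
  fix omega
  have "(\<Sum>i. indicator (P i) (T omega) :: ennreal) = indicator (\<Union>i. P i) (T omega)"
   using P by (intro suminf_indicator) (auto simp: partition_seqs_def)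
  then show "(\<Sum>i. indicator (P i) (T omega) * ennreal (norm (g omega))) = indicator A (T omega) * ennreal (norm (g omega))"
   using P by (simp add: ennreal_suminf_multc partition_seqs_def)
 qed
 finally show "(\<Sum>i. ennreal (norm (q (P i)))) <= (\<integral>\<^sup>+omega. indicator A (T omega) * ennreal (norm (g omega)) \<partial>M)" .
qed

text \<open>Only an inequality, because densities at different \<open>omega\<close> with the same
  image point may cancel. The setwise bound is first turned into an inequality of measures, which
  can then be integrated.\<close>

lemma nn_integral_total_variation_le:
 fixes g :: "'w => 'b::euclidean_space" and T :: "'w => 'a::euclidean_space"
 assumes T [measurable]: "T \<in> measurable M borel" and g: "integrable M g"
  and q: "vector_measure q"
  and eq: "!!A. A \<in> sets borel ==> q A = (LINT omega|M. indicator A (T omega) *R g omega)"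
  and u [measurable]: "u \<in> borelm"
 shows "integral\<^sup>N (total_variation q) u <= (\<integral>\<^sup>+omega. ennreal (norm (g omega)) * u (T omega) \<partial>M)"
proof -
 note [measurable] = borel_measurable_integrable[OF g]
 let ?N = "distr (density M (%omega. ennreal (norm (g omega)))) borel T"
 have "total_variation q <= ?N"
 proof (subst le_measure)
  show "\<forall>A\<in>sets (total_variation q). emeasure (total_variation q) A <= emeasure ?N A"
  proof
   fix A assume "A \<in> sets (total_variation q)"
   then have A [measurable]: "A \<in> sets borel" by simp
   have "emeasure ?N A = (\<integral>\<^sup>+omega. indicator A (T omega) * ennreal (norm (g omega)) \<partial>M)"
    by (subst emeasure_distr, simp, simp, subst emeasure_density, simp, simp)
      (auto intro!: nn_integral_cong simp: indicator_def)
   then show "emeasure (total_variation q) A <= emeasure ?N A"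
    using emeasure_total_variation_le[OF T g q eq A] by simp
  qed
 qed simp
 then have "integral\<^sup>N (total_variation q) u <= integral\<^sup>N ?N u"
  by (intro nn_integral_mono_measure) auto
 also have "\<dots> = (\<integral>\<^sup>+omega. ennreal (norm (g omega)) * u (T omega) \<partial>M)"
  by (subst nn_integral_distr, simp, simp, subst nn_integral_density) auto
 finally show ?thesis .
qed

section \<open>Polar decomposition of a vector measure\<close>

text \<open>The Jordan parts of every coordinate are absolutely continuous with respect to the total
  variation, so Radon-Nikodym supplies a density; that its norm is at most 1 is tested direction by
  direction.\<close>

lemma vector_measure_density:
 fixes q :: "'a::euclidean_space set => 'b::euclidean_space"
 assumes q: "vector_measure q"
 obtains g where "g \<in> borelm" "!!x. norm (g x) <= 1"
  "!!A. A \<in> sets borel ==> q A = (LINT x|total_variation q. indicator A x *R g x)"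
proof -
 define m where "m = total_variation q"
 interpret m: finite_measure m unfolding m_def by (rule finite_measure_total_variation[OF q])
 have sm [simp, measurable_cong]: "sets m = sets borel" by (simp add: m_def)
 have ex: "\<exists>D. D \<in> borelm \<and> integrable m D \<and> (\<forall>A\<in>sets borel. s A = (LINT x|m. indicator A x *R D x))"
  if s: "vector_measure s" and le: "!!A. A \<in> sets borel ==> variation s A <= variation q A" for s :: "'a set => real"
 proof -
  have pp: "\<exists>D. D \<in> borelm \<and> integrable m D \<and> (\<forall>A\<in>sets borel. measure (positive_part t) A = (LINT x|m. indicator A x *R D x))"
   if t: "vector_measure t" and le: "!!A. A \<in> sets borel ==> variation t A <= variation q A" for t :: "'a set => real"
  proof -
   interpret N: finite_measure "positive_part t" by (rule finite_measure_positive_part[OF t])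
   have ac: "absolutely_continuous m (positive_part t)"
    unfolding absolutely_continuous_def
   proof
    fix A assume "A \<in> null_sets m"
    then have A: "A \<in> sets borel" "variation q A = 0"
     by (auto simp: null_sets_def m_def emeasure_total_variation[OF q])
    then have "variation t A = 0" using le[of A] by simp
    then have "emeasure (total_variation t) A = 0" using A(1) by (simp add: emeasure_total_variation[OF t])
    then have "measure (total_variation t) A = 0" by (simp add: measure_def)
    moreover have "t A = 0" using norm_le_total_variation[OF t A(1)] calculation by simp
    ultimately have "measure (positive_part t) A = 0" using A(1) by (simp add: measure_positive_part[OF t])
    then show "A \<in> null_sets (positive_part t)"
     using A(1) t by (simp add: null_sets_def N.emeasure_eq_measure)
   qed
   have "\<exists>D. D \<in> borel_measurable m \<and> (AE x in m. RN_deriv m (positive_part t) x = ennreal (D x)) \<and> (\<forall>x. 0 <= D x)"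
    by (rule m.real_RN_deriv[OF N.finite_measure_axioms ac]) (simp add: t, blast)
   then obtain D where D: "D \<in> borel_measurable m" "AE x in m. RN_deriv m (positive_part t) x = ennreal (D x)" "!!x. 0 <= D x"
    by blast
   have em: "emeasure (positive_part t) A = (\<integral>\<^sup>+x. ennreal (indicator A x *R D x) \<partial>m)" if [measurable]: "A \<in> sets borel" for A
   proof -
    have "density m (RN_deriv m (positive_part t)) = positive_part t"
     using m.density_RN_deriv[OF ac] t by simp
    moreover have "emeasure (density m (RN_deriv m (positive_part t))) A = (\<integral>\<^sup>+x. RN_deriv m (positive_part t) x * indicator A x \<partial>m)"
     by (rule emeasure_density) auto
    ultimately have "emeasure (positive_part t) A = (\<integral>\<^sup>+x. RN_deriv m (positive_part t) x * indicator A x \<partial>m)"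
     by simp
    also have "\<dots> = (\<integral>\<^sup>+x. ennreal (indicator A x *R D x) \<partial>m)"
     using D(2) by (intro nn_integral_cong_AE) (auto simp: indicator_def)
    finally show ?thesis .
   qed
   have int: "integrable m D"
   proof (rule integrableI_nonneg)
    show "(\<integral>\<^sup>+x. ennreal (D x) \<partial>m) < \<infinity>"
     using em[of UNIV] N.emeasure_finite[of UNIV] by (simp add: less_top[symmetric])
   qed (use D in auto)
   have "measure (positive_part t) A = (LINT x|m. indicator A x *R D x)" if A [measurable]: "A \<in> sets borel" for A
    unfolding measure_def em[OF A] using D
    by (subst nn_integral_eq_integral)
     (auto intro!: bi_bound[OF int] simp: indicator_def integral_nonneg_AE)
   then show ?thesis using D(1) int by (intro exI[of _ D]) (auto simp: measurable_cong_sets[OF sm refl])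
  qed
  obtain D1 where D1: "D1 \<in> borelm" "integrable m D1" "!!A. A\<in>sets borel ==> measure (positive_part s) A = (LINT x|m. indicator A x *R D1 x)"
   using pp[OF s le] by blast
  have "!!A. A \<in> sets borel ==> variation (%A. - s A) A <= variation q A"
   using le by (simp add: variation_def)
  then obtain D2 where D2: "D2 \<in> borelm" "integrable m D2" "!!A. A\<in>sets borel ==> measure (positive_part (%A. - s A)) A = (LINT x|m. indicator A x *R D2 x)"
   using pp[OF vector_measure_uminus[OF s]] by blast
  have "s A = (LINT x|m. indicator A x *R (D1 x - D2 x))" if A [measurable]: "A \<in> sets borel" for A
  proof -
   have "s A = measure (positive_part s) A - measure (positive_part (%A. - s A)) A"
    using A by (simp add: measure_positive_part s vector_measure_uminus total_variation_uminus field_simps)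
   also have "\<dots> = (LINT x|m. indicator A x *R D1 x - indicator A x *R D2 x)"
    unfolding D1(3)[OF A] D2(3)[OF A]
    by (intro bi_diff[symmetric] bi_bound[OF D1(2)] bi_bound[OF D2(2)])
      (use D1(1) D2(1) in \<open>auto simp: indicator_def\<close>)
   finally show ?thesis by (simp add: right_diff_distrib)
  qed
  then show ?thesis
   using D1(1,2) D2(1,2) by (intro exI[of _ "%x. D1 x - D2 x"]) auto
 qed
 have "\<exists>D. D \<in> borelm \<and> integrable m D \<and> (\<forall>A\<in>sets borel. q A \<bullet> i = (LINT x|m. indicator A x *R D x))" if i: "i \<in> Basis" for i
 proof (rule ex[OF vector_measure_inner[OF q]])
  fix A :: "'a set" assume "A \<in> sets borel"
  show "variation (%A. q A \<bullet> i) A <= variation q A"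
   unfolding variation_def
   by (intro SUP_mono) (auto intro!: bexI suminf_le ennreal_leI simp: Basis_le_norm[OF i])
 qed
 then have "\<forall>i\<in>Basis. \<exists>D. D \<in> borelm \<and> integrable m D \<and> (\<forall>A\<in>sets borel. q A \<bullet> i = (LINT x|m. indicator A x *R D x))"
  by blast
 from bchoice[OF this] obtain D where D: "!!i. i \<in> Basis ==> D i \<in> borelm" "!!i. i \<in> Basis ==> integrable m (D i)"
   "!!i A. i \<in> Basis ==> A\<in>sets borel ==> q A \<bullet> i = (LINT x|m. indicator A x *R D i x)"
  by blast
 define G where "G x = (\<Sum>i\<in>Basis. D i x *R i)" for x
 have Gm [measurable]: "G \<in> borelm" unfolding G_def using D(1) by measurable
 have Gint: "integrable m G" unfolding G_def using D(2) by (intro bi_sumI integrable_scaleR_left) auto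
 have GA: "integrable m (%x. indicator A x *R G x)" if [measurable]: "A \<in> sets borel" for A
  by (rule bi_bound[OF Gint]) (auto simp: indicator_def)
 have qG: "q A = (LINT x|m. indicator A x *R G x)" if A: "A \<in> sets borel" for A
 proof (rule euclidean_eqI)
  fix i :: 'b assume i: "i \<in> Basis"
  have "(LINT x|m. indicator A x *R G x) \<bullet> i = (LINT x|m. (indicator A x *R G x) \<bullet> i)"
   by (rule integral_inner_left[symmetric]) (rule GA[OF A])
  also have "\<dots> = q A \<bullet> i"
   unfolding D(3)[OF i A]
   by (intro bi_cong) (use i in \<open>auto simp: G_def inner_sum_left inner_Basis if_distrib cong: if_cong\<close>)
  finally show "q A \<bullet> i = (LINT x|m. indicator A x *R G x) \<bullet> i" by simp
 qed
 \<comment> \<open>On the set where \<open>G x \<bullet> u\<close> exceeds \<open>norm u\<close>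
   their difference has the integral \<open>q A \<bullet> u - measure m A * norm u\<close>, which is
   at most 0; hence the set is null.\<close>
 have dir: "AE x in m. G x \<bullet> u <= norm u" for u
 proof -
  define A where "A = {x. norm u < G x \<bullet> u}"
  have A [measurable]: "A \<in> sets borel" unfolding A_def by measurable
  have i1: "integrable m (%x. indicator A x * (G x \<bullet> u))"
   using integrable_inner_left[OF GA[OF A], of u] by simp
  have i2: "integrable m (%x. indicator A x * norm u)"
   by (intro bounded_integrable_finite[where B="norm u"] m.finite_measure_axioms) (auto simp: indicator_def)
  have "(LINT x|m. indicator A x * (G x \<bullet> u) - indicator A x * norm u) = q A \<bullet> u - measure m A * norm u"
  proof -
   have "(LINT x|m. indicator A x * (G x \<bullet> u)) = q A \<bullet> u"
    unfolding qG[OF A] using integral_inner_left[where f="%x. indicator A x *R G x" and c=u and M=m] GA[OF A] by simp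
   moreover have "(LINT x|m. indicator A x * norm u) = measure m A * norm u"
    by simp
   ultimately show ?thesis using i1 i2 by simp
  qed
  also have "\<dots> <= 0"
  proof -
   have "q A \<bullet> u <= norm (q A) * norm u" by (rule norm_cauchy_schwarz)
   also have "\<dots> <= measure m A * norm u"
    unfolding m_def by (rule mult_right_mono[OF norm_le_total_variation[OF q A]]) simp
   finally show ?thesis by simp
  qed
  finally have le: "(LINT x|m. indicator A x * (G x \<bullet> u) - indicator A x * norm u) <= 0" .
  have nn: "0 <= indicator A x * (G x \<bullet> u) - indicator A x * norm u" for x
   by (auto simp: indicator_def A_def)
  have i12: "integrable m (%x. indicator A x * (G x \<bullet> u) - indicator A x * norm u)"
   by (rule bi_diffI[OF i1 i2])
  have "(LINT x|m. indicator A x * (G x \<bullet> u) - indicator A x * norm u) = 0"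
   by (rule antisym[OF le Bochner_Integration.integral_nonneg[OF nn]])
  then have "AE x in m. indicator A x * (G x \<bullet> u) - indicator A x * norm u = 0"
   using integral_nonneg_eq_0_iff_AE[OF i12 AE_I2[OF nn]] by simp
  then show ?thesis
   by (rule AE_mp) (auto intro!: AE_I2 simp: A_def indicator_def split: if_splits)
 qed
 \<comment> \<open>A countable dense set of directions leaves a single exceptional null set; a
   direction close to \<open>G x\<close> itself then detects \<open>norm (G x) > 1\<close>.\<close>
 obtain U :: "'b set" where U: "countable U" "!!X. open X ==> X ~= {} ==> \<exists>u\<in>U. u \<in> X"
  using countable_dense_setE by blast
 have "AE x in m. \<forall>u\<in>U. G x \<bullet> u <= norm u"
  using dir U(1) by (simp add: AE_ball_countable)
 then have nG: "AE x in m. norm (G x) <= 1"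
 proof (rule AE_mp, intro AE_I2 impI)
  fix x assume x: "\<forall>u\<in>U. G x \<bullet> u <= norm u"
  show "norm (G x) <= 1"
  proof (rule ccontr)
   assume "\<not> norm (G x) <= 1"
   then have "1 * norm (G x) < norm (G x) * norm (G x)"
    by (intro mult_strict_right_mono) auto
   then have "norm (G x) < G x \<bullet> G x"
    by (simp add: power2_norm_eq_inner[symmetric] power2_eq_square)
   moreover have "open {u. norm u < G x \<bullet> u}" by (intro open_Collect_less continuous_intros)
   ultimately obtain u where "u \<in> U" "norm u < G x \<bullet> u" using U(2)[of "{u. norm u < G x \<bullet> u}"] by blast
   then show False using x by force
  qed
 qed
 \<comment> \<open>Changed on a null set so that the bound holds everywhere, which spares
   almost-everywhere clauses later.\<close>
 define g where "g x = (if norm (G x) <= 1 then G x else 0)" for x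
 show thesis
 proof
  show "g \<in> borelm" unfolding g_def by measurable
  then have [measurable]: "g \<in> borelm" .
  show "norm (g x) <= 1" for x by (simp add: g_def)
  show "q A = (LINT x|total_variation q. indicator A x *R g x)" if A [measurable]: "A \<in> sets borel" for A
   unfolding qG[OF A] m_def[symmetric]
   by (rule integral_cong_AE) (use nG in \<open>auto simp: g_def\<close>)
 qed
qed

section \<open>Weak compactness of measures on compact sets\<close>

text \<open>Schoenberg's space-filling curve: every coordinate is a series of dilates of a continuous
 2-periodic function that equals 0 on \<open>[0, 1/3]\<close> and 1 on \<open>[2/3, 1]\<close>, so that it reads off the
 ternary digits of points of the Cantor set.\<close>

definition digit_fun :: "real => real" where
 "digit_fun s = max 0 (min 1 (1 / 2 - cos (pi * s)))"

lemma digit_fun_bounds: "0 <= digit_fun s" "digit_fun s <= 1"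
 by (auto simp: digit_fun_def)

lemma digit_fun_period: "digit_fun (2 * real N + s) = digit_fun s"
proof -
 have "cos (pi * (2 * real N + s)) = cos (pi * s + 2 * real N * pi)"
  by (simp add: algebra_simps)
 also have "\<dots> = cos (pi * s)"
  by (simp only: cos_add cos_2npi sin_2npi mult_1_right mult_zero_right diff_zero)
 finally show ?thesis by (simp add: digit_fun_def)
qed

lemma digit_fun_0: assumes "0 <= s" "s <= 1 / 3" shows "digit_fun s = 0"
proof -
 have "pi * s <= pi * (1 / 3)" using assms by (intro mult_left_mono) auto
 then have "cos (pi / 3) <= cos (pi * s)"
  using assms by (intro cos_monotone_0_pi_le) auto
 then show ?thesis by (simp add: digit_fun_def cos_60)
qed

lemma digit_fun_1: assumes "2 / 3 <= s" "s <= 1" shows "digit_fun s = 1"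
proof -
 have "pi * (2 / 3) <= pi * s" "pi * s <= pi * 1" using assms by (intro mult_left_mono; simp)+
 then have "cos (pi * s) <= cos (pi * (2 / 3))"
  using assms by (intro cos_monotone_0_pi_le) auto
 also have "cos (pi * (2 / 3)) = - 1 / 2"
  using cos_120 by (simp add: mult.commute)
 finally show ?thesis by (simp add: digit_fun_def)
qed

text \<open>Multiplication by \<open>3 ^ n\<close> shifts the digits. They are 0 or 2, so the
  integer split off is even and disappears by the period 2; the remaining tail lies in
  \<open>[0, 1/3]\<close> or in \<open>[2/3, 1]\<close> according to its leading digit.\<close>

lemma digit_fun_ternary:
 fixes a :: "nat => nat"
 assumes a: "!!n. a n <= 1"
 defines "t \<equiv> \<Sum>j. 2 * real (a j) / 3 ^ Suc j"
 shows "0 <= t" "t <= 1" "digit_fun (3 ^ n * t) = real (a n)"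
proof -
 define T where "T n = (\<Sum>j. 2 * real (a (n + j)) / 3 ^ Suc j)" for n
 have geo: "(%j. 2 * (1 / 3) ^ Suc j) sums (1 :: real)"
  using sums_mult[OF geometric_sums[of "1 / 3 :: real"], of "2 / 3"] by simp
 have ra: "0 <= real (a n)" "real (a n) <= 1" for n using a[of n] by auto
 have le: "2 * real (a m) / 3 ^ Suc j <= 2 * (1 / 3) ^ Suc j" for m j
  using ra(2)[of m] by (simp add: power_one_over field_simps)
 have summ: "summable (%j. 2 * real (a (n + j)) / 3 ^ Suc j)" for n
  by (rule summable_comparison_test'[OF sums_summable[OF geo], of 0]) (use le[of "n + _"] in auto)
 have T01: "0 <= T n" "T n <= 1" for n
 proof -
  show "0 <= T n" unfolding T_def by (rule suminf_nonneg[OF summ]) simp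
  have "T n <= (\<Sum>j. 2 * (1 / 3) ^ Suc j)"
   unfolding T_def by (rule suminf_le[OF le summ sums_summable[OF geo]])
  then show "T n <= 1" using sums_unique[OF geo] by simp
 qed
 have T_rec: "T n = 2 * real (a n) / 3 + T (Suc n) / 3" for n
 proof -
  have "T n = 2 * real (a (n + 0)) / 3 ^ Suc 0 + (\<Sum>j. 2 * real (a (n + Suc j)) / 3 ^ Suc (Suc j))"
   unfolding T_def using suminf_split_head[OF summ[of n]] by simp
  also have "(\<Sum>j. 2 * real (a (n + Suc j)) / 3 ^ Suc (Suc j)) = T (Suc n) / 3"
   unfolding T_def using suminf_divide[OF summ[of "Suc n"], of 3] by (simp add: field_simps)
  finally show ?thesis by simp
 qed
 have tT: "t = T 0" by (simp add: t_def T_def)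
 show "0 <= t" "t <= 1" using T01[of 0] by (auto simp: tT)
 have "\<exists>N::nat. 3 ^ n * t = 2 * real N + T n"
 proof (induction n)
  case 0 show ?case by (intro exI[of _ 0]) (simp add: tT)
 next
  case (Suc n)
  then obtain N where "3 ^ n * t = 2 * real N + T n" by blast
  then have "3 ^ Suc n * t = 2 * real (3 * N + a n) + T (Suc n)"
   using T_rec[of n] by simp
  then show ?case by blast
 qed
 then obtain N where N: "3 ^ n * t = 2 * real N + T n" by blast
 have "digit_fun (T n) = real (a n)"
 proof (cases "a n = 0")
  case True
  then have "T n <= 1 / 3" using T_rec[of n] T01[of "Suc n"] by simp
  then show ?thesis using True T01[of n] digit_fun_0 by simp
 next
  case False
  then have 1: "a n = 1" using a[of n] by simp
  then have "2 / 3 <= T n" using T_rec[of n] T01[of "Suc n"] by simp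
  then show ?thesis using 1 T01[of n] digit_fun_1 by simp
 qed
 then show "digit_fun (3 ^ n * t) = real (a n)" unfolding N digit_fun_period .
qed

lemma binary_expansion:
 fixes x :: real
 assumes "0 <= x" "x < 1"
 obtains b :: "nat => nat" where "!!k. b k <= 1" "(%k. real (b k) / 2 ^ Suc k) sums x"
proof
 define F where "F k = \<lfloor>2 ^ k * x\<rfloor>" for k :: nat
 define b where "b k = nat (F (Suc k) - 2 * F k)" for k
 have F: "2 * F k <= F (Suc k)" "F (Suc k) <= 2 * F k + 1" for k
 proof -
  have "2 * real_of_int (F k) <= 2 ^ Suc k * x" "2 ^ Suc k * x < 2 * real_of_int (F k) + 2"
  proof -
   have e: "2 ^ Suc k * x = 2 * (2 ^ k * x)" by simp
   show "2 * real_of_int (F k) <= 2 ^ Suc k * x" "2 ^ Suc k * x < 2 * real_of_int (F k) + 2"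
    unfolding F_def e using floor_correct[of "2 ^ k * x"] by linarith+
  qed
  then show "2 * F k <= F (Suc k)" "F (Suc k) <= 2 * F k + 1"
   unfolding F_def[of "Suc k"] by linarith+
 qed
 show "b k <= 1" for k using F[of k] by (simp add: b_def)
 have rb: "real (b k) = real_of_int (F (Suc k)) - 2 * real_of_int (F k)" for k
  using F[of k] by (simp add: b_def)
 have part: "(\<Sum>k<n. real (b k) / 2 ^ Suc k) = real_of_int (F n) / 2 ^ n" for n
 proof (induction n)
  case 0
  have "F 0 = 0" using assms by (simp add: F_def floor_eq_iff)
  then show ?case by simp
 next
  case (Suc n) then show ?case by (simp add: rb field_simps)
 qed
 have "(%n. real_of_int (F n) / 2 ^ n) \<longlonglongrightarrow> x"
 proof (rule LIMSEQ_I)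
  fix r :: real assume "0 < r"
  then obtain n0 where n0: "(1 / 2) ^ n0 < r" using real_arch_pow_inv[of r "1/2"] by auto
  show "\<exists>n0. \<forall>n\<ge>n0. norm (real_of_int (F n) / 2 ^ n - x) < r"
  proof (intro exI allI impI)
   fix n assume "n0 <= n"
   then have "(1 / 2 :: real) ^ n <= (1 / 2) ^ n0" by (intro power_decreasing) auto
   moreover have "real_of_int (F n) <= 2 ^ n * x" "2 ^ n * x < real_of_int (F n) + 1"
    unfolding F_def by linarith+
   then have "\<bar>real_of_int (F n) - 2 ^ n * x\<bar> / 2 ^ n <= 1 / 2 ^ n"
    by (intro divide_right_mono) (auto simp: abs_le_iff)
   moreover have "real_of_int (F n) / 2 ^ n - x = (real_of_int (F n) - 2 ^ n * x) / 2 ^ n"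
    by (simp add: field_simps)
   ultimately show "norm (real_of_int (F n) / 2 ^ n - x) < r" using n0 by (simp add: power_one_over)
  qed
 qed
 then show "(%k. real (b k) / 2 ^ Suc k) sums x" unfolding sums_def part .
qed

text \<open>The binary digits of all coordinates are interleaved into one ternary expansion: the
  coordinate numbered \<open>p i\<close> occupies the positions congruent to \<open>p i\<close>
  modulo the dimension. \<open>binary_expansion\<close> treats values below 1, hence the half open
  cube.\<close>

lemma unit_cube_curve:
 obtains c :: "real => 'b::euclidean_space" where "continuous_on UNIV c"
  "!!x. (!!i. i \<in> Basis ==> 0 <= x \<bullet> i \<and> x \<bullet> i < 1) ==> x \<in> c ` {0..1}"
proof -
 obtain p :: "'b => nat" where p: "bij_betw p Basis {..<DIM('b)}"
  using ex_bij_betw_finite_nat[OF finite_Basis] by (metis atLeast0LessThan)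
 define y where "y i t = (\<Sum>k. digit_fun (3 ^ (DIM('b) * k + p i) * t) / 2 ^ Suc k)" for i :: 'b and t
 define c where "c t = (\<Sum>i\<in>Basis. y i t *R i)" for t
 have "continuous_on UNIV (y i)" for i
 proof (rule uniform_limit_theorem)
  show "uniform_limit UNIV (%n t. \<Sum>k<n. digit_fun (3 ^ (DIM('b) * k + p i) * t) / 2 ^ Suc k) (y i) sequentially"
   unfolding y_def
  proof (rule Weierstrass_m_test)
   show "summable (%k. (1 / 2 :: real) ^ Suc k)"
    using summable_mult[OF summable_geometric[of "1 / 2 :: real"], of "1 / 2"] by simp
   show "norm (digit_fun (3 ^ (DIM('b) * k + p i) * t) / 2 ^ Suc k) <= (1 / 2) ^ Suc k" for k t
    using digit_fun_bounds[of "3 ^ (DIM('b) * k + p i) * t"] by (simp add: field_simps power_one_over)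
  qed
  show "\<forall>\<^sub>F n in sequentially. continuous_on UNIV (%t. \<Sum>k<n. digit_fun (3 ^ (DIM('b) * k + p i) * t) / 2 ^ Suc k)"
   unfolding digit_fun_def by (intro always_eventually allI continuous_intros) auto
 qed simp
 then have "continuous_on UNIV c" unfolding c_def by (intro continuous_intros) auto
 moreover have "x \<in> c ` {0..1}" if x: "!!i. i \<in> Basis ==> 0 <= x \<bullet> i \<and> x \<bullet> i < 1" for x
 proof -
  have "\<forall>i\<in>Basis. \<exists>b::nat=>nat. (\<forall>k. b k <= 1) \<and> (%k. real (b k) / 2 ^ Suc k) sums (x \<bullet> i)"
   using x binary_expansion by metis
  from bchoice[OF this] obtain b :: "'b => nat => nat" where
   b: "!!i k. i \<in> Basis ==> b i k <= 1" "!!i. i \<in> Basis ==> (%k. real (b i k) / 2 ^ Suc k) sums (x \<bullet> i)"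
   by blast
  define e where "e = inv_into Basis p"
  have e: "e m \<in> Basis" if "m < DIM('b)" for m
   unfolding e_def using p that by (intro inv_into_into) (auto simp: bij_betw_def)
  have ep: "e (p i) = i" if "i \<in> Basis" for i
   unfolding e_def using p that by (simp add: bij_betw_def inv_into_f_f)
  have pl: "p i < DIM('b)" if "i \<in> Basis" for i using p that by (auto simp: bij_betw_def)
  \<comment> \<open>Position \<open>DIM('b) * k + j\<close> stores binary digit \<open>k\<close> of
    the coordinate numbered \<open>j\<close>.\<close>
  define a where "a n = b (e (n mod DIM('b))) (n div DIM('b))" for n
  have a1: "a n <= 1" for n unfolding a_def by (intro b e) simp
  define t where "t = (\<Sum>j. 2 * real (a j) / 3 ^ Suc j)"
  have t: "0 <= t" "t <= 1" "!!n. digit_fun (3 ^ n * t) = real (a n)"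
   unfolding t_def by (rule digit_fun_ternary[of a, OF a1])+
  have "y i t = x \<bullet> i" if i: "i \<in> Basis" for i
  proof -
   have "a (DIM('b) * k + p i) = b i k" for k
    unfolding a_def using pl[OF i] by (simp add: ep[OF i] mod_mult_self4)
   then have "y i t = (\<Sum>k. real (b i k) / 2 ^ Suc k)" unfolding y_def t(3) by simp
   then show ?thesis using b(2)[OF i] by (simp add: sums_iff)
  qed
  then have "c t = x" unfolding c_def by (simp add: euclidean_representation)
  then show ?thesis using t by auto
 qed
 ultimately show ?thesis using that by blast
qed

lemma bounded_set_curve:
 fixes S :: "'b::euclidean_space set"
 assumes "bounded S"
 obtains c :: "real => 'b" where "continuous_on UNIV c" "S \<subseteq> c ` {0..1}"
proof -
 obtain R where R: "0 < R" "!!x. x \<in> S ==> norm x < R"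
  using assms bounded_pos_less by blast
 obtain c0 :: "real => 'b" where c0: "continuous_on UNIV c0"
  "!!x. (!!i. i \<in> Basis ==> 0 <= x \<bullet> i \<and> x \<bullet> i < 1) ==> x \<in> c0 ` {0..1}"
  using unit_cube_curve by blast
 define c where "c t = (2 * R) *R c0 t - R *R One" for t
 have "S \<subseteq> c ` {0..1}"
 proof
  fix x assume "x \<in> S"
  then have n: "norm x < R" by (rule R)
  have "(1 / (2 * R)) *R (x + R *R One) \<in> c0 ` {0..1}"
  proof (rule c0(2))
   fix i :: 'b assume i: "i \<in> Basis"
   then have "\<bar>x \<bullet> i\<bar> < R" using n Basis_le_norm[OF i, of x] by linarith
   then show "0 <= (1 / (2 * R)) *R (x + R *R One) \<bullet> i \<and> (1 / (2 * R)) *R (x + R *R One) \<bullet> i < 1"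
    using i R(1) by (auto simp: inner_add_left field_simps abs_less_iff)
  qed
  then obtain t where "t \<in> {0..1}" "c0 t = (1 / (2 * R)) *R (x + R *R One)" by auto
  then show "x \<in> c ` {0..1}" using R(1) by (intro image_eqI[of _ _ t]) (auto simp: c_def)
 qed
 moreover have "continuous_on UNIV c" unfolding c_def by (intro continuous_intros c0)
 ultimately show ?thesis using that by blast
qed

text \<open>The section is the first time at which the curve reaches the point. On the image of the
  curve its sublevel sets are images of intervals starting at 0, which are compact, so the section
  is Borel even where it jumps.\<close>

lemma curve_section:
 fixes c :: "real => 'b::euclidean_space"
 assumes c: "continuous_on UNIV c"
 obtains g where "g \<in> borelm" "!!x. g x \<in> {0..1}" "!!x. x \<in> c ` {0..1} ==> c (g x) = x"
proof -
 define Z where "Z = c ` {0..1}"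
 define g where "g x = (if x \<in> Z then Inf {t \<in> {0..1}. c t = x} else 0)" for x
 have cmp: "compact (c ` {0..s})" for s
  by (intro compact_continuous_image continuous_on_subset[OF c]) auto
 have inf: "Inf {t \<in> {0..1}. c t = x} \<in> {t \<in> {0..1}. c t = x}" if "x \<in> Z" for x
 proof (rule closed_contains_Inf)
  show "{t \<in> {0..1}. c t = x} ~= {}" using that by (auto simp: Z_def)
  show "bdd_below {t \<in> {0..1}. c t = x}" by (rule bdd_belowI[of _ 0]) auto
  show "closed {t \<in> {0..1}. c t = x}"
   using continuous_closed_preimage_constant[of "{0..1}" c x] continuous_on_subset[OF c] by simp
 qed
 have g: "g x \<in> {0..1}" "x \<in> Z ==> c (g x) = x" for x
  using inf[of x] by (auto simp: g_def)
 have "g \<in> borelm"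
  unfolding borel_measurable_iff_le
 proof
  fix s :: real
  have lev: "g x <= s \<longleftrightarrow> x \<in> c ` {0..min s 1}" if x: "x \<in> Z" for x
  proof
   assume "g x <= s"
   then show "x \<in> c ` {0..min s 1}" using g[of x] x by (intro image_eqI[of _ _ "g x"]) auto
  next
   assume "x \<in> c ` {0..min s 1}"
   then obtain t where t: "0 <= t" "t <= s" "t <= 1" "c t = x" by auto
   then have "Inf {t \<in> {0..1}. c t = x} <= t" by (intro cInf_lower) (auto intro!: bdd_belowI[of _ 0])
   then show "g x <= s" using t x by (simp add: g_def)
  qed
  have "{x. g x <= s} = (c ` {0..min s 1} \<inter> Z) \<union> (if 0 <= s then - Z else {})"
   using lev by (auto simp: g_def)
  moreover have "c ` {0..min s 1} \<in> sets borel" "Z \<in> sets borel"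
   using compact_imp_closed[OF cmp] unfolding Z_def by (auto intro: borel_closed)
  ultimately show "{x \<in> space borel. g x <= s} \<in> sets borel" by auto
 qed
 then show ?thesis using that[of g] g by (auto simp: Z_def)
qed

text \<open>The measures are normalised and pushed to \<open>{0..1}\<close> by the section of a
  space-filling curve, where tightness is automatic; the limit is pushed back by the curve. Test
  functions get composed with the curve, not with its discontinuous section, and so remain
  continuous.\<close>

theorem compact_weakly_convergent_subsequence:
 fixes m :: "nat => 'b::euclidean_space measure"
 assumes S: "compact S"
  and m: "!!n. sets (m n) = sets borel" "!!n. finite_measure (m n)" "!!n. AE x in m n. x \<in> S"
  and C: "!!n. measure (m n) UNIV <= C"
 obtains r M where "strict_mono (r :: nat => nat)" "sets M = sets borel" "finite_measure M" "AE x in M. x \<in> S"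
  "!!f :: 'b => real. continuous_on UNIV f ==> (%n. integral\<^sup>L (m (r n)) f) \<longlonglongrightarrow> integral\<^sup>L M f"
proof -
 have sp: "space (m n) = UNIV" for n using sets_eq_imp_space_eq[OF m(1)] by simp
 have Sb [measurable]: "S \<in> sets borel" using S by (simp add: compact_imp_closed borel_closed)
 have bddS: "\<exists>B\<ge>0. \<forall>x\<in>S. \<bar>f x\<bar> <= B" if f: "continuous_on UNIV f" for f :: "'b => real"
 proof -
  have "bounded (f ` S)"
   using compact_imp_bounded[OF compact_continuous_image[OF continuous_on_subset[OF f] S]] by simp
  then obtain B where "\<forall>x\<in>S. \<bar>f x\<bar> <= B" by (auto simp: bounded_iff)
  then show ?thesis by (intro exI[of _ "max B 0"]) (auto intro: max.coboundedI1)
 qed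
 have fm: "f \<in> borel_measurable (m n)" if "continuous_on UNIV f" for f :: "'b => real" and n
  using borel_measurable_continuous_onI[OF that] by (simp add: measurable_cong_sets[OF m(1) refl])
 define a where "a n = measure (m n) UNIV" for n
 have "bounded (range a)" unfolding bounded_iff a_def using C by (auto intro!: exI[of _ C])
 then obtain a0 r0 where r0: "strict_mono (r0 :: nat => nat)" "(a \<circ> r0) \<longlonglongrightarrow> a0"
  using bounded_imp_convergent_subsequence by blast
 have a0: "0 <= a0"
  by (rule LIMSEQ_le_const[OF r0(2)]) (simp add: a_def)
 show ?thesis
 proof (cases "a0 = 0")
  \<comment> \<open>Masses that tend to 0 cannot be normalised; the limit is the null
    measure.\<close>
  case True
  show ?thesis
  proof (rule that[of r0 "null_measure borel"])
   fix f :: "'b => real" assume f: "continuous_on UNIV f"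
   obtain B where B: "0 <= B" "!!x. x \<in> S ==> \<bar>f x\<bar> <= B" using bddS[OF f] by blast
   have "\<bar>integral\<^sup>L (m n) f\<bar> <= B * a n" for n
   proof -
    interpret finite_measure "m n" by (rule m)
    have "\<bar>integral\<^sup>L (m n) f\<bar> <= (\<integral>x. \<bar>f x\<bar> \<partial>m n)" by simp
    also have "\<dots> <= (\<integral>x. B \<partial>m n)"
     by (rule integral_mono_AE)
       (use m(3)[of n] B fm[OF f, of n] in \<open>auto intro!: integrable_const_bound[where B=B] elim: AE_mp\<close>)
    finally show ?thesis by (simp add: a_def sp mult.commute)
   qed
   then have "\<forall>\<^sub>F n in sequentially. norm (integral\<^sup>L (m (r0 n)) f) <= B * (a \<circ> r0) n" by simp
   moreover have "(%n. B * (a \<circ> r0) n) \<longlonglongrightarrow> 0"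
    using tendsto_mult[OF tendsto_const r0(2)[unfolded True], of B] by (simp only: mult_zero_right)
   ultimately have "(%n. integral\<^sup>L (m (r0 n)) f) \<longlonglongrightarrow> 0"
    by (rule Lim_null_comparison)
   then show "(%n. integral\<^sup>L (m (r0 n)) f) \<longlonglongrightarrow> integral\<^sup>L (null_measure borel) f"
    by simp
  qed (use r0 in \<open>auto intro!: finite_measureI AE_I[where N=UNIV]\<close>)
 next
  case False
  then have a0p: "0 < a0" using a0 by simp
  have "\<forall>\<^sub>F n in sequentially. 0 < (a \<circ> r0) n"
   using order_tendstoD(1)[OF r0(2) a0p] .
  then obtain N where N: "!!n. N <= n ==> 0 < a (r0 n)" by (auto simp: eventually_sequentially)
  define r1 where "r1 n = r0 (n + N)" for n
  have r1: "strict_mono r1" "(%n. a (r1 n)) \<longlonglongrightarrow> a0" "!!n. 0 < a (r1 n)"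
   using r0 N LIMSEQ_ignore_initial_segment[OF r0(2), of N] by (auto simp: r1_def strict_mono_def o_def)
  obtain c :: "real => 'b" where c: "continuous_on UNIV c" "S \<subseteq> c ` {0..1}"
   using bounded_set_curve[OF compact_imp_bounded[OF S]] by blast
  obtain g where g [measurable]: "g \<in> borelm" and g01: "!!x. g x \<in> {0..1}"
   and cg: "!!x. x \<in> c ` {0..1} ==> c (g x) = x"
   using curve_section[OF c(1)] by blast
  \<comment> \<open>Clamping the parameter keeps \<open>f (cl t)\<close> bounded on the whole line,
    as weak convergence of distributions demands.\<close>
  define cl :: "real => 'b" where "cl t = c (max 0 (min 1 t))" for t
  have cl: "continuous_on UNIV cl"
   unfolding cl_def by (intro continuous_on_compose2[OF c(1)] continuous_intros) auto
  then have clm [measurable]: "cl \<in> borelm" by (rule borel_measurable_continuous_onI)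
  have clg: "cl (g x) = x" if "x \<in> S" for x
   using that c(2) cg[of x] g01[of x] by (auto simp: cl_def)
  define P where "P n = distr (density (m (r1 n)) (%x. ennreal (1 / a (r1 n)))) borel g" for n
  have gm: "g \<in> borel_measurable (m n)" for n by (simp add: measurable_cong_sets[OF m(1) refl])
  have pP: "prob_space (density (m (r1 n)) (%x. ennreal (1 / a (r1 n))))" for n
  proof (rule prob_spaceI)
   interpret finite_measure "m (r1 n)" by (rule m)
   show "emeasure (density (m (r1 n)) (%x. ennreal (1 / a (r1 n)))) (space (density (m (r1 n)) (%x. ennreal (1 / a (r1 n))))) = 1"
    using r1(3)[of n] by (simp add: emeasure_density sp emeasure_eq_measure a_def nn_integral_cmult ennreal_mult[symmetric] m(1))
  qed
  have P: "real_distribution (P n)" for n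
   unfolding P_def by (rule prob_space.real_distribution_distr[OF pP]) (use gm in simp)
  have Pint: "integral\<^sup>L (P n) F = (\<integral>x. F (g x) \<partial>m (r1 n)) / a (r1 n)"
   if [measurable]: "F \<in> borelm" for F :: "real => real" and n
  proof -
   have Fg: "(%x. F (g x)) \<in> borel_measurable (m (r1 n))" using measurable_compose[OF gm that] .
   have "integral\<^sup>L (P n) F = (\<integral>x. F (g x) \<partial>density (m (r1 n)) (%x. ennreal (1 / a (r1 n))))"
    unfolding P_def by (rule integral_distr) (use gm in auto)
   also have "\<dots> = (\<integral>x. (1 / a (r1 n)) *R F (g x) \<partial>m (r1 n))"
    by (rule integral_density[OF Fg]) (use r1(3)[of n] in auto)
   finally show ?thesis by simp
  qed
  have "tight P"
   unfolding tight_def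
  proof (intro conjI allI impI P)
   fix e :: real assume "0 < e"
   have "measure (P n) {-1<..1} = 1" for n
   proof -
    interpret real_distribution "P n" by (rule P)
    have "AE x in P n. x \<in> {-1<..1}"
     unfolding P_def using g01 gm by (subst AE_distr_iff) (auto intro!: AE_I2 simp: less_le_trans[of _ 0])
    then show ?thesis by (subst (asm) AE_in_set_eq_1) auto
   qed
   then show "\<exists>a b. a < b \<and> (\<forall>n. 1 - e < measure (P n) {a<..b})"
    using \<open>0 < e\<close> by (intro exI[of _ "-1"] exI[of _ 1]) auto
  qed
  from tight_imp_convergent_subsubsequence[OF this strict_mono_id]
  obtain r2 P0 where r2: "strict_mono r2" "real_distribution P0" "weak_conv_m (%n. P (r2 n)) P0"
   by (auto simp: o_def)
  interpret P0: real_distribution P0 by fact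
  define M where "M = density (distr P0 borel cl) (%x. ennreal a0)"
  have Mint: "integral\<^sup>L M f = a0 * (\<integral>t. f (cl t) \<partial>P0)" if [measurable]: "f \<in> borelm" for f :: "'b => real"
  proof -
   have "integral\<^sup>L M f = (\<integral>x. a0 *R f x \<partial>distr P0 borel cl)"
    unfolding M_def by (rule integral_density) (use a0 in auto)
   also have "\<dots> = (\<integral>t. a0 *R f (cl t) \<partial>P0)" by (rule integral_distr) auto
   finally show ?thesis by simp
  qed
  have conv: "(%n. integral\<^sup>L (m (r1 (r2 n))) f) \<longlonglongrightarrow> integral\<^sup>L M f" if f: "continuous_on UNIV f" for f :: "'b => real"
  proof -
   have [measurable]: "f \<in> borelm" by (rule borel_measurable_continuous_onI[OF f])
   have fcl: "continuous_on UNIV (%t. f (cl t))" by (rule continuous_on_compose2[OF f cl]) auto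
   have "bounded ((%t. f (c t)) ` {0..1})"
    by (intro compact_imp_bounded compact_continuous_image continuous_on_subset[OF continuous_on_compose2[OF f c(1)]]) auto
   then obtain B where "\<forall>t\<in>{0..1}. \<bar>f (c t)\<bar> <= B" by (auto simp: bounded_iff)
   then have B: "\<bar>f (c t)\<bar> <= B" if "t \<in> {0..1}" for t using that by blast
   have "(%n. integral\<^sup>L (P (r2 n)) (%t. f (cl t))) \<longlonglongrightarrow> integral\<^sup>L P0 (%t. f (cl t))"
   proof (rule weak_conv_imp_integral_bdd_continuous_conv[OF P r2(2,3)])
    show "isCont (%t. f (cl t)) x" for x using fcl by (simp add: continuous_on_eq_continuous_at)
    show "norm (f (cl x)) <= B" for x using B[of "max 0 (min 1 x)"] by (simp add: cl_def)
   qed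
   then have "(%n. a (r1 (r2 n)) * integral\<^sup>L (P (r2 n)) (%t. f (cl t))) \<longlonglongrightarrow> a0 * integral\<^sup>L P0 (%t. f (cl t))"
    using LIMSEQ_subseq_LIMSEQ[OF r1(2) r2(1)] by (intro tendsto_mult) (auto simp: o_def)
   moreover have "a (r1 n) * integral\<^sup>L (P n) (%t. f (cl t)) = integral\<^sup>L (m (r1 n)) f" for n
   proof -
    have "a (r1 n) * integral\<^sup>L (P n) (%t. f (cl t)) = (\<integral>x. f (cl (g x)) \<partial>m (r1 n))"
     using r1(3)[of n] by (subst Pint) auto
    also have "\<dots> = integral\<^sup>L (m (r1 n)) f"
     by (rule integral_cong_AE)
      (use m(3)[of "r1 n"] clg in \<open>auto simp: measurable_cong_sets[OF m(1) refl] elim: AE_mp\<close>)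
    finally show ?thesis .
   qed
   ultimately show ?thesis by (simp add: Mint)
  qed
  have finM: "finite_measure M"
  proof (rule finite_measureI)
   have "prob_space (distr P0 borel cl)" by (rule P0.prob_space_distr) simp
   then interpret D: prob_space "distr P0 borel cl" .
   show "emeasure M (space M) ~= \<infinity>"
    unfolding M_def using D.emeasure_space_1 by (simp add: emeasure_density nn_integral_cmult)
  qed
  have "S ~= {}"
  proof
   assume "S = {}"
   then have "AE x in m (r1 0). False" using m(3)[of "r1 0"] by simp
   then have "{x \<in> space (m (r1 0)). \<not> False} \<in> null_sets (m (r1 0))"
    by (subst AE_iff_null[symmetric]) (auto simp: m(1) sp)
   then have "emeasure (m (r1 0)) UNIV = 0" by (simp add: sp null_sets_def)
   then show False using r1(3)[of 0] by (simp add: a_def measure_def)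
  qed
  \<comment> \<open>The truncated distance to \<open>S\<close> vanishes almost everywhere along the
    sequence, hence also for the limit. That \<open>S\<close> is nonempty matters because
    \<open>infdist\<close> to the empty set is 0.\<close>
  have "AE x in M. x \<in> S"
  proof -
   interpret M: finite_measure M by (rule finM)
   let ?f = "%x. min 1 (infdist x S)"
   have fc: "continuous_on UNIV ?f" by (intro continuous_intros)
   have [measurable]: "?f \<in> borelm" by (rule borel_measurable_continuous_onI[OF fc])
   have "integral\<^sup>L (m n) ?f = integral\<^sup>L (m n) (%x. 0)" for n
    by (rule integral_cong_AE) (use m(3)[of n] fm[OF fc] in \<open>auto elim: AE_mp\<close>)
   then have "integral\<^sup>L M ?f = 0"
    using LIMSEQ_unique[OF conv[OF fc]] by simp
   moreover have "integrable M ?f"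
    by (rule M.integrable_const_bound[where B=1]) (auto simp: M_def infdist_nonneg)
   ultimately have "AE x in M. ?f x = 0"
    by (subst (asm) integral_nonneg_eq_0_iff_AE) (auto simp: infdist_nonneg)
   then show ?thesis
   proof (rule AE_mp, intro AE_I2 impI)
    fix x assume "?f x = 0"
    then have "infdist x S = 0" by linarith
    then show "x \<in> S" using in_closed_iff_infdist_zero[OF compact_imp_closed[OF S] \<open>S ~= {}\<close>] by simp
   qed
  qed
  moreover have "strict_mono (r1 \<circ> r2)" by (rule strict_mono_o[OF r1(1) r2(1)])
  moreover have "sets M = sets borel" by (simp add: M_def)
  moreover have "(%n. integral\<^sup>L (m ((r1 \<circ> r2) n)) f) \<longlonglongrightarrow> integral\<^sup>L M f"
   if "continuous_on UNIV f" for f :: "'b => real" using conv[OF that] by simp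
  ultimately show ?thesis using finM by (intro that[of "r1 \<circ> r2" M])
 qed
qed

section \<open>Averages over truncated cones\<close>

text \<open>The constants \<open>1 / alpha\<close> and \<open>1 / conj_exp alpha\<close> are
  estimated by 1. What matters is the free weight: a small \<open>\<sigma>\<close> makes the second
  term small, after which the first one is controlled by the size of the kernel.\<close>

lemma Youngs_inequality_conj_exp:
 assumes "1 < alpha" "0 <= a" "0 <= b" "0 < \<sigma>"
 shows "a * b <= \<sigma> powr (- alpha) * a powr alpha + \<sigma> powr conj_exp alpha * b powr conj_exp alpha"
proof -
 define p where "p = conj_exp alpha"
 have p: "1 < p" "1 / alpha + 1 / p = 1" using assms(1) by (auto simp: p_def conj_exp_def field_simps)
 have "a * b = (a / \<sigma>) * (\<sigma> * b)" using assms by simp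
 also have "\<dots> <= (a / \<sigma>) powr alpha / alpha + (\<sigma> * b) powr p / p"
  using assms p by (intro Youngs_inequality) auto
 also have "\<dots> <= (a / \<sigma>) powr alpha + (\<sigma> * b) powr p"
 proof -
  have "x / c <= x" if "0 <= x" "1 < c" for x c :: real
   using that by (simp add: divide_le_eq mult_le_cancel_left1)
  then show ?thesis using assms p by (intro add_mono) auto
 qed
 also have "\<dots> = \<sigma> powr (- alpha) * a powr alpha + \<sigma> powr p * b powr p"
  using assms by (simp add: powr_divide powr_mult powr_minus divide_simps)
 finally show ?thesis by (simp add: p_def)
qed

text \<open>A nonintegrable \<open>f\<close> is covered as well: its Bochner integral is 0, and
  \<open>h\<close> is nonnegative.\<close>

lemma norm_integral_le:
 fixes f :: "'a => 'b::euclidean_space"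
 assumes "integrable M h" "!!x. norm (f x) <= h x"
 shows "norm (integral\<^sup>L M f) <= integral\<^sup>L M h"
proof (cases "integrable M f")
 case True
 have "norm (integral\<^sup>L M f) <= (\<integral>x. norm (f x) \<partial>M)" by (rule integral_norm_bound)
 also have "\<dots> <= integral\<^sup>L M h" using True assms by (intro integral_mono) auto
 finally show ?thesis .
next
 case False
 have "0 <= h x" for x using assms(2)[of x] norm_ge_zero[of "f x"] by linarith
 then show ?thesis using False by (simp add: not_integrable_integral_eq)
qed

lemma integral_lborel_affine:
 fixes f :: "'a::euclidean_space => 'b::euclidean_space"
 assumes [measurable]: "f \<in> borelm" and c: "c ~= 0"
 shows "(\<integral>x. f x \<partial>lborel) = \<bar>c\<bar> ^ DIM('a) *R (\<integral>x. f (t + c *R x) \<partial>lborel)"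
proof -
 have "(\<integral>x. f x \<partial>lborel) = (\<integral>x. f x \<partial>density (distr lborel borel (%x. t + c *R x)) (%_. ennreal (\<bar>c\<bar> ^ DIM('a))))"
  using lborel_affine[OF c, of t] by (simp add: ennreal_power)
 also have "\<dots> = (\<integral>x. \<bar>c\<bar> ^ DIM('a) *R f x \<partial>distr lborel borel (%x. t + c *R x))"
  by (rule integral_density) auto
 also have "\<dots> = (\<integral>x. \<bar>c\<bar> ^ DIM('a) *R f (t + c *R x) \<partial>lborel)"
  by (rule integral_distr) auto
 finally show ?thesis by simp
qed

lemma integrable_lborel_affine:
 fixes f :: "'a::euclidean_space => 'b::euclidean_space"
 assumes f: "integrable lborel f" and c: "c ~= 0"
 shows "integrable lborel (%x. f (t + c *R x))"
proof -
 have [measurable]: "f \<in> borelm" using f by auto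
 have "integrable (density (distr lborel borel (%x. t + c *R x)) (%_. ennreal (\<bar>c\<bar> ^ DIM('a)))) f"
  using f lborel_affine[OF c, of t] by (simp add: ennreal_power)
 then have "integrable (distr lborel borel (%x. t + c *R x)) (%x. \<bar>c\<bar> ^ DIM('a) *R f x)"
  by (subst (asm) integrable_density) auto
 then have "integrable lborel (%x. \<bar>c\<bar> ^ DIM('a) *R f (t + c *R x))"
  by (subst (asm) integrable_distr_eq) auto
 from integrable_scaleR_right[OF this, of "1 / \<bar>c\<bar> ^ DIM('a)"] show ?thesis
  using c by simp
qed

text \<open>A kernel bounded uniformly over a parameter set of finite measure is jointly integrable
  against an integrable \<open>F\<close>. With the inner product one statement serves scalar and
  vector valued kernels.\<close>

lemma lborel_strip_Fubini:
 fixes h :: "'t::euclidean_space => 'a::euclidean_space => 'b::euclidean_space" and F :: "'a => 'b"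
 assumes h [measurable]: "(%z. h (fst z) (snd z)) \<in> borelm"
  and I [measurable]: "I \<in> sets borel" "emeasure lborel I < \<infinity>"
  and C: "!!t y. t \<in> I ==> norm (h t y) <= C" and F: "integrable lborel F"
 shows "(LINT t:I|lborel. LINT y|lborel. h t y \<bullet> F y) = (LBINT y. (LINT t:I|lborel. h t y) \<bullet> F y)"
proof -
 have [measurable]: "F \<in> borelm" using F by auto
 have h2 [measurable]: "(%(t, y). h t y) \<in> borel_measurable (borel \<Otimes>\<^sub>M borel)"
  using h by (simp add: borel_prod split_beta')
 have ht: "h t \<in> borelm" for t
  using measurable_compose[of "%y. (t, y)" borel "borel \<Otimes>\<^sub>M borel", OF _ h2] by simp
 have hy [measurable]: "(%t. h t y) \<in> borelm" for y
  using measurable_compose[of "%t. (t, y)" borel "borel \<Otimes>\<^sub>M borel", OF _ h2] by simp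
 have C0: "norm (indicator I t *R (h t y \<bullet> F y)) <= \<bar>C\<bar> * (indicator I t * norm (F y))" for t y
 proof (cases "t \<in> I")
  case True
  have "\<bar>h t y \<bullet> F y\<bar> <= norm (h t y) * norm (F y)" by (rule Cauchy_Schwarz_ineq2)
  also have "\<dots> <= \<bar>C\<bar> * norm (F y)" using C[OF True, of y] by (intro mult_right_mono) auto
  finally show ?thesis using True by simp
 qed simp
 have inner_int: "integrable lborel (%y. indicator I t *R (h t y \<bullet> F y))" for t
 proof (rule bi_bound[where f="%y. \<bar>C\<bar> * (indicator I t * norm (F y))"])
  show "integrable lborel (%y. \<bar>C\<bar> * (indicator I t * norm (F y)))" using F by simp
  show "(%y. indicator I t *R (h t y \<bullet> F y)) \<in> borel_measurable lborel" using ht[of t] by simp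
 qed (use C0[of t] in \<open>auto intro: order_trans\<close>)
 have prod: "integrable (lborel \<Otimes>\<^sub>M lborel) (%(t, y). indicator I t *R (h t y \<bullet> F y))"
 proof (rule lborel_pair.Fubini_integrable)
  show "(%(t, y). indicator I t *R (h t y \<bullet> F y)) \<in> borel_measurable (lborel \<Otimes>\<^sub>M lborel)"
   by measurable
  show "AE t in lborel. integrable lborel (%y. case (t, y) of (t, y) => indicator I t *R (h t y \<bullet> F y))"
   using inner_int by simp
  show "integrable lborel (%t. LINT y|lborel. norm (case (t, y) of (t, y) => indicator I t *R (h t y \<bullet> F y)))"
  proof (rule bi_bound[where f="%t. \<bar>C\<bar> * indicator I t * (LBINT y. norm (F y))"])
   show "integrable lborel (%t. \<bar>C\<bar> * indicator I t * (LBINT y. norm (F y)))"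
    using I by (intro integrable_mult_left integrable_mult_right integrable_real_indicator) auto
   show "(%t. LINT y|lborel. norm (case (t, y) of (t, y) => indicator I t *R (h t y \<bullet> F y))) \<in> borel_measurable lborel"
    by measurable
   show "AE t in lborel. norm (LBINT y. norm (case (t, y) of (t, y) => indicator I t *R (h t y \<bullet> F y)))
    <= norm (\<bar>C\<bar> * indicator I t * (LBINT y. norm (F y)))"
   proof (intro AE_I2)
    fix t
    have "(LBINT y. norm (indicator I t *R (h t y \<bullet> F y))) <= (LBINT y. \<bar>C\<bar> * (indicator I t * norm (F y)))"
     using F inner_int[of t] C0[of t] by (intro integral_mono integrable_norm) auto
    then show "norm (LBINT y. norm (case (t, y) of (t, y) => indicator I t *R (h t y \<bullet> F y)))
     <= norm (\<bar>C\<bar> * indicator I t * (LBINT y. norm (F y)))"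
     by (simp add: abs_mult integral_nonneg_AE)
   qed
  qed
 qed
 have hI: "set_integrable lborel I (%t. h t y)" for y
  unfolding set_integrable_def
 proof (rule bi_bound[where f="%t. \<bar>C\<bar> * indicator I t"])
  show "integrable lborel (%t. \<bar>C\<bar> * indicator I t)" using I by (intro integrable_mult_right integrable_real_indicator) auto
  show "AE t in lborel. norm (indicator I t *R h t y) <= norm (\<bar>C\<bar> * indicator I t)"
   using C[of _ y] by (intro AE_I2) (auto simp: indicator_def intro: order_trans[OF C abs_ge_self])
 qed auto
 have "(LINT t:I|lborel. LINT y|lborel. h t y \<bullet> F y) = (LINT t|lborel. LINT y|lborel. indicator I t *R (h t y \<bullet> F y))"
  unfolding set_lebesgue_integral_def by simp
 also have "\<dots> = (LINT y|lborel. LINT t|lborel. indicator I t *R (h t y \<bullet> F y))"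
  using lborel_pair.Fubini_integral[OF prod] by simp
 also have "\<dots> = (LBINT y. (LINT t:I|lborel. h t y) \<bullet> F y)"
  unfolding set_lebesgue_integral_def
  using hI unfolding set_integrable_def
  by (intro bi_cong refl) (simp add: integral_inner_left[symmetric])
 finally show ?thesis .
qed

lemma box_Int_box:
 fixes a b u v :: "'a::euclidean_space"
 shows "box u v \<inter> box a b = box (\<Sum>i\<in>Basis. max (u \<bullet> i) (a \<bullet> i) *R i) (\<Sum>i\<in>Basis. min (v \<bullet> i) (b \<bullet> i) *R i)"
 by (auto simp: mem_box inner_sum_left inner_Basis if_distrib cong: if_cong)

text \<open>The positive and the negative part of \<open>h\<close>, restricted to a box inside
  \<open>V\<close>, are densities of finite measures that agree on the intersection-stable family of
  boxes, hence everywhere. Densities are unique almost everywhere, and countably many boxes exhaust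
  \<open>V\<close>.\<close>

lemma AE_eq_0_if_box_integrals:
 fixes h :: "'a::euclidean_space => real"
 assumes V: "open V" and [measurable]: "h \<in> borelm"
  and int: "!!a b. cbox a b \<subseteq> V ==> set_integrable lborel (cbox a b) h"
  and zero: "!!a b. cbox a b \<subseteq> V ==> (LINT x:box a b|lborel. h x) = 0"
 shows "AE x in lborel. x \<in> V --> h x = 0"
proof -
 have Q: "AE x in lborel. x \<in> cbox u v --> h x = 0" if uv: "cbox u v \<subseteq> V" for u v
 proof -
  define N where "N \<sigma> = density lborel (%x. ennreal (indicator (box u v) x * max 0 (\<sigma> * h x)))" for \<sigma> :: real
  have int_uv: "integrable lborel (%x. indicator (cbox u v) x * h x)"
   using int[OF uv] by (simp add: set_integrable_def)
  have intN: "integrable lborel (%x. indicator A x * (indicator (box u v) x * max 0 (\<sigma> * h x)))"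
   if "\<sigma> = 1 \<or> \<sigma> = -1" and [measurable]: "A \<in> sets borel" for \<sigma> A
   by (rule bi_bound[OF int_uv])
    (use that box_subset_cbox[of u v] in \<open>auto simp: indicator_def split: if_splits\<close>)
  have emN: "emeasure (N \<sigma>) A = ennreal (LBINT x. indicator A x * (indicator (box u v) x * max 0 (\<sigma> * h x)))"
   if \<sigma>: "\<sigma> = 1 \<or> \<sigma> = -1" and A [measurable]: "A \<in> sets borel" for \<sigma> A
  proof -
   have "emeasure (N \<sigma>) A = (\<integral>\<^sup>+x. ennreal (indicator A x * (indicator (box u v) x * max 0 (\<sigma> * h x))) \<partial>lborel)"
    unfolding N_def by (subst emeasure_density) (auto intro!: nn_integral_cong simp: indicator_def)
   also have "\<dots> = ennreal (LBINT x. indicator A x * (indicator (box u v) x * max 0 (\<sigma> * h x)))"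
    by (rule nn_integral_eq_integral[OF intN[OF \<sigma> A]]) (auto simp: indicator_def)
   finally show ?thesis .
  qed
  have eq_box: "emeasure (N 1) (box a b) = emeasure (N (-1)) (box a b)" for a b
  proof -
   define a' b' where "a' = (\<Sum>i\<in>Basis. max (u \<bullet> i) (a \<bullet> i) *R i)" and "b' = (\<Sum>i\<in>Basis. min (v \<bullet> i) (b \<bullet> i) *R i)"
   have "cbox a' b' \<subseteq> cbox u v"
    by (auto simp: a'_def b'_def mem_box inner_sum_left inner_Basis if_distrib cong: if_cong)
   then have "(LINT x:box a' b'|lborel. h x) = 0" using uv by (intro zero) auto
   moreover have "(LINT x:box a' b'|lborel. h x) =
     (LBINT x. indicator (box a b) x * (indicator (box u v) x * max 0 (1 * h x)) - indicator (box a b) x * (indicator (box u v) x * max 0 (-1 * h x)))"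
    unfolding set_lebesgue_integral_def a'_def b'_def box_Int_box[symmetric]
    by (intro bi_cong) (auto simp: indicator_def)
   ultimately have "(LBINT x. indicator (box a b) x * (indicator (box u v) x * max 0 (1 * h x)))
     = (LBINT x. indicator (box a b) x * (indicator (box u v) x * max 0 (-1 * h x)))"
    using intN[of 1 "box a b"] intN[of "-1" "box a b"] by simp
   then show ?thesis by (simp add: emN)
  qed
  have "N 1 = N (-1)"
  proof (rule measure_eqI_generator_eq[where E="range (%(a, b). box a b)" and \<Omega>=UNIV and A="%i::nat. box (- (real i *R One)) (real i *R One)"])
   show "Int_stable (range (%(a, b). box a b :: 'a set))"
    by (auto simp: Int_stable_def box_Int_box)
   show "emeasure (N 1) X = emeasure (N (-1)) X" if "X \<in> range (%(a, b). box a b)" for X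
    using that eq_box by auto
   have "sets borel = sigma_sets UNIV (range (%(a, b). box a b :: 'a set))"
    by (subst borel_eq_box) simp
   then show "sets (N 1) = sigma_sets UNIV (range (%(a, b). box a b))"
    "sets (N (-1)) = sigma_sets UNIV (range (%(a, b). box a b))"
    by (simp_all add: N_def)
   show "(\<Union>i. box (- (real i *R One)) (real i *R One)) = (UNIV :: 'a set)"
    by (rule UN_box_eq_UNIV)
   show "emeasure (N 1) (box (- (real i *R One)) (real i *R One)) ~= \<infinity>" for i
    by (simp add: emN)
  qed auto
  then have "AE x in lborel. ennreal (indicator (box u v) x * max 0 (1 * h x)) = ennreal (indicator (box u v) x * max 0 (-1 * h x))"
   unfolding N_def by (subst (asm) sigma_finite_measure.density_unique_iff[OF sigma_finite_lborel]) auto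
  moreover have "AE x in lborel. x \<notin> cbox u v - box u v"
  proof (rule AE_not_in)
   have eq: "emeasure lborel (cbox u v) = emeasure lborel (box u v)"
    by (simp add: emeasure_lborel_box_eq emeasure_lborel_cbox_eq)
   have fin: "emeasure lborel (box u v) ~= \<infinity>" by (simp add: emeasure_lborel_box_eq)
   have "emeasure lborel (cbox u v - box u v) = emeasure lborel (cbox u v) - emeasure lborel (box u v)"
    by (rule emeasure_Diff[OF fin]) (auto simp: box_subset_cbox)
   also have "\<dots> = 0" unfolding eq using fin by (intro ennreal_diff_self) simp
   finally show "cbox u v - box u v \<in> null_sets lborel" by (simp add: null_sets_def)
  qed
  ultimately show ?thesis
   by eventually_elim (auto simp: indicator_def max_def split: if_splits)
 qed
 obtain D where D: "countable D" "D \<subseteq> Pow V" "!!X. X \<in> D ==> \<exists>a b. X = cbox a b" "\<Union>D = V"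
  by (rule open_countable_Union_open_cbox[OF V], rule that)
 have "AE x in lborel. \<forall>X\<in>D. x \<in> X --> h x = 0"
 proof (subst AE_ball_countable[OF D(1)], intro ballI)
  fix X assume "X \<in> D"
  then obtain a b where "X = cbox a b" "cbox a b \<subseteq> V" using D(2,3) by blast
  then show "AE x in lborel. x \<in> X --> h x = 0" using Q by simp
 qed
 then show ?thesis by eventually_elim (use D(4) in blast)
qed

text \<open>Dyadic shells: where \<open>r / 2^(k+1) <= norm y < r / 2^k\<close> the power is at most
  its value at the inner radius, and the ball of the outer radius has volume proportional to
  \<open>(r / 2^k)^n\<close>. The resulting geometric series has ratio
  \<open>2 powr (a - n) < 1\<close>. At the origin \<open>powr\<close> yields 0.\<close>

lemma integrable_norm_powr:
 assumes "a < real DIM('a::euclidean_space)" "0 <= a"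
 shows "integrable lborel (%y::'a. indicator (ball 0 r) y * norm y powr (- a))"
proof (cases "r <= 0")
 case True
 then have "(%y::'a. indicator (ball 0 r) y * norm y powr (- a)) = (%_. 0)"
  by (auto simp: indicator_def fun_eq_iff) (meson norm_not_less_zero order_less_le_trans)
 then show ?thesis by simp
next
 case False
 then have r: "0 < r" by simp
 define n where "n = DIM('a)"
 have bound: "ennreal (indicator (ball 0 r) y * norm y powr (- a))
   <= (\<Sum>k. ennreal ((r / 2 ^ Suc k) powr (- a)) * indicator (ball 0 (r / 2 ^ k)) y)" for y :: 'a
 proof (cases "y \<in> ball 0 r \<and> y ~= 0")
  case True
  then have y: "0 < norm y" "norm y < r" by auto
  define P where "P k \<longleftrightarrow> r / 2 ^ k <= norm y" for k :: nat
  have "\<exists>k. P k"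
  proof -
   obtain k where "(1 / 2) ^ k < norm y / r" using real_arch_pow_inv[of "norm y / r" "1/2"] y r by auto
   then have "r / 2 ^ k <= norm y" using r by (simp add: field_simps power_one_over)
   then show ?thesis by (auto simp: P_def)
  qed
  then have "P (LEAST k. P k)" by (rule LeastI_ex)
  moreover have "\<not> P 0" using y by (simp add: P_def)
  ultimately obtain k where k: "(LEAST k. P k) = Suc k" "P (Suc k)" by (metis not0_implies_Suc)
  have "\<not> P k" using not_less_Least[of k P] k by simp
  then have "y \<in> ball 0 (r / 2 ^ k)" by (simp add: P_def)
  have "norm y powr (- a) <= (r / 2 ^ Suc k) powr (- a)"
   using k(2) r assms by (intro powr_mono2') (auto simp: P_def)
  then have "ennreal (indicator (ball 0 r) y * norm y powr (- a)) <= ennreal ((r / 2 ^ Suc k) powr (- a)) * indicator (ball 0 (r / 2 ^ k)) y"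
   using True \<open>y \<in> ball 0 (r / 2 ^ k)\<close> by (simp add: ennreal_leI)
  also have "\<dots> <= (\<Sum>k. ennreal ((r / 2 ^ Suc k) powr (- a)) * indicator (ball 0 (r / 2 ^ k)) y)"
  proof -
   let ?f = "%k. ennreal ((r / 2 ^ Suc k) powr (- a)) * indicator (ball 0 (r / 2 ^ k)) y"
   have "sum ?f {k} <= suminf ?f" by (rule sum_le_suminf) auto
   moreover have "sum ?f {k} = ?f k" by (rule trans[OF sum.insert[OF finite.emptyI]]) auto
   ultimately show ?thesis by (simp only:)
  qed
  finally show ?thesis .
 qed auto
 have "(\<integral>\<^sup>+y. ennreal (indicator (ball 0 r) y * norm y powr (- a)) \<partial>(lborel :: 'a measure))
   <= (\<integral>\<^sup>+y. (\<Sum>k. ennreal ((r / 2 ^ Suc k) powr (- a)) * indicator (ball 0 (r / 2 ^ k)) y) \<partial>(lborel :: 'a measure))"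
  by (rule nn_integral_mono) (rule bound)
 also have "\<dots> = (\<Sum>k. \<integral>\<^sup>+y. ennreal ((r / 2 ^ Suc k) powr (- a)) * indicator (ball 0 (r / 2 ^ k)) y \<partial>(lborel :: 'a measure))"
  by (rule nn_integral_suminf) (intro borel_measurable_times_ennreal borel_measurable_const borel_measurable_indicator, simp)
 also have "\<dots> = (\<Sum>k. ennreal ((r / 2 ^ Suc k) powr (- a)) * ennreal (unit_ball_vol n * (r / 2 ^ k) ^ n))"
 proof (rule suminf_cong)
  fix k
  have "emeasure lborel (ball (0::'a) (r / 2 ^ k)) = ennreal (unit_ball_vol n * (r / 2 ^ k) ^ n)"
   unfolding n_def by (rule emeasure_ball) (use r in simp)
  then show "(\<integral>\<^sup>+y. ennreal ((r / 2 ^ Suc k) powr (- a)) * indicator (ball 0 (r / 2 ^ k)) y \<partial>(lborel :: 'a measure))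
   = ennreal ((r / 2 ^ Suc k) powr (- a)) * ennreal (unit_ball_vol n * (r / 2 ^ k) ^ n)"
   by (subst nn_integral_cmult_indicator) simp_all
 qed
 also have "\<dots> = (\<Sum>k. ennreal (((r / 2) powr (- a) * unit_ball_vol n * r ^ n) * (2 powr (a - real n)) ^ k))"
 proof (intro suminf_cong)
  fix k
  have pw: "(2 powr b) ^ k = 2 powr (b * real k)" for b :: real
   by (simp add: powr_realpow[symmetric] powr_powr)
  have e1: "(r / 2 ^ Suc k) powr (- a) = (r / 2) powr (- a) * (2 powr a) ^ k"
  proof -
   have "(r / 2 ^ Suc k) = (r / 2) * 2 powr (- real k)"
    by (simp add: powr_minus powr_realpow divide_simps)
   then have "(r / 2 ^ Suc k) powr (- a) = (r / 2) powr (- a) * (2 powr (- real k)) powr (- a)"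
    using r by (simp only: powr_mult)
   then show ?thesis by (simp only: pw powr_powr) (simp add: mult.commute)
  qed
  have e2: "(r / 2 ^ k) ^ n = r ^ n * (2 powr (- real n)) ^ k"
   by (simp add: power_divide powr_minus powr_realpow divide_inverse power_inverse power_mult[symmetric] power_mult_distrib mult.commute[of n])
  have e3: "(2 powr a) ^ k * (2 powr (- real n)) ^ k = (2 powr (a - real n)) ^ k"
   by (simp add: power_mult_distrib[symmetric] powr_add[symmetric])
  have "(r / 2 ^ Suc k) powr (- a) * (unit_ball_vol n * (r / 2 ^ k) ^ n) = ((r / 2) powr (- a) * unit_ball_vol n * r ^ n) * ((2 powr a) ^ k * (2 powr (- real n)) ^ k)"
   unfolding e1 e2 by (simp only: ac_simps)
  then have e: "(r / 2 ^ Suc k) powr (- a) * (unit_ball_vol n * (r / 2 ^ k) ^ n) = ((r / 2) powr (- a) * unit_ball_vol n * r ^ n) * (2 powr (a - real n)) ^ k"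
   unfolding e3 .
  show "ennreal ((r / 2 ^ Suc k) powr (- a)) * ennreal (unit_ball_vol n * (r / 2 ^ k) ^ n) = ennreal (((r / 2) powr (- a) * unit_ball_vol n * r ^ n) * (2 powr (a - real n)) ^ k)"
   unfolding e[symmetric] by (rule ennreal_mult''[symmetric]) (use r in simp)
 qed
 also have "\<dots> < \<infinity>"
 proof -
  have "2 powr (a - real n) < 1" using assms by (simp add: n_def powr_less_one)
  then have "summable (%k. ((r / 2) powr (- a) * unit_ball_vol n * r ^ n) * (2 powr (a - real n)) ^ k)"
   by (intro summable_mult summable_geometric) simp
  then show ?thesis using r by (subst suminf_ennreal2) auto
 qed
 finally have fin: "(\<integral>\<^sup>+y. ennreal (indicator (ball 0 r) y * norm y powr (- a)) \<partial>(lborel :: 'a measure)) < \<infinity>" .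
 have [measurable]: "ball (0::'a) r \<in> sets borel" by simp
 have "(%y::'a. indicator (ball 0 r) y * norm y powr (- a)) \<in> borel_measurable lborel" by measurable
 then show ?thesis by (rule integrableI_nonneg) (use fin in simp_all)
qed

lemma tendsto_integral_norm_powr:
 assumes "a < real DIM('a::euclidean_space)" "0 <= a" and rho: "rho \<longlonglongrightarrow> 0"
 shows "(%n. LINT y|lborel. indicator (ball (0::'a) (rho n)) y * norm y powr (- a)) \<longlonglongrightarrow> 0"
proof -
 obtain R where R: "!!n. rho n < R"
 proof -
  have "Bseq rho" by (rule convergent_imp_Bseq[OF convergentI[OF rho]])
  then obtain K where "!!n. norm (rho n) <= K" by (auto simp: Bseq_def)
  then have "rho n < K + 1" for n by (smt (verit) real_norm_def)
  then show ?thesis by (rule that)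
 qed
 have [measurable]: "ball (0::'a) c \<in> sets borel" for c by simp
 have "(%n. LINT y|lborel. indicator (ball (0::'a) (rho n)) y * norm y powr (- a)) \<longlonglongrightarrow> (LINT y|(lborel :: 'a measure). 0)"
 proof (rule integral_dominated_convergence[where w="%y. indicator (ball 0 R) y * norm y powr (- a)"])
  show "integrable lborel (%y::'a. indicator (ball 0 R) y * norm y powr (- a))" by (rule integrable_norm_powr[OF assms(1,2)])
  show "AE y in (lborel :: 'a measure). (%n. indicator (ball 0 (rho n)) y * norm y powr (- a)) \<longlonglongrightarrow> (0::real)"
  proof (intro AE_I2)
   fix y :: 'a
   show "(%n. indicator (ball 0 (rho n)) y * norm y powr (- a)) \<longlonglongrightarrow> (0::real)"
   proof (cases "y = 0")
    case False
    then have "\<forall>\<^sub>F n in sequentially. rho n < norm y" using order_tendstoD(2)[OF rho, of "norm y"] by simp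
    then have "\<forall>\<^sub>F n in sequentially. indicator (ball 0 (rho n)) y * norm y powr (- a) = (0::real)"
     by eventually_elim simp
    then show ?thesis by (rule tendsto_eventually)
   qed simp
  qed
  show "AE y in (lborel :: 'a measure). norm (indicator (ball 0 (rho n)) y * norm y powr (- a)) <= indicator (ball 0 R) y * norm (y::'a) powr (- a)" for n
   using R[of n] by (intro AE_I2) (auto simp: indicator_def)
 qed auto
 then show ?thesis by simp
qed

section \<open>Calculus of test functions\<close>

lemma GDERIV_affine:
 assumes "GDERIV f (c *R (y - x)) :> D"
 shows "GDERIV (%y. f (c *R (y - x))) y :> c *R D"
proof -
 have "((%y. c *R (y - x)) has_derivative (%h. c *R h)) (at y)"
  by (auto intro!: derivative_eq_intros)
 from has_derivative_compose[OF this assms[unfolded gderiv_def]]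
 show ?thesis unfolding gderiv_def by simp
qed

lemma GDERIV_cmult: "GDERIV f x :> D ==> GDERIV (%x. c * f x) x :> c *R D"
 using GDERIV_mult[OF GDERIV_const, of f x D c] by simp

lemma GDERIV_continuous: "(!!x. GDERIV f x :> D x) ==> continuous_on UNIV f"
 unfolding gderiv_def continuous_on_eq_continuous_within
 by (auto intro: has_derivative_continuous)

lemma Ck_Suc_imp_Ck: "Ck (Suc k) f ==> Ck k f"
proof (induction k arbitrary: f)
 case 0
 then obtain D where "!!x. GDERIV f x :> D x" by auto
 then show ?case using GDERIV_continuous by auto
next
 case (Suc k)
 from Suc.prems obtain D where D: "!!x. GDERIV f x :> D x" "!!i. i \<in> Basis ==> Ck (Suc k) (%x. D x \<bullet> i)"
  unfolding Ck.simps(2)[of "Suc k"] by blast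
 have "Ck k (%x. D x \<bullet> i)" if "i \<in> Basis" for i by (rule Suc.IH[OF D(2)[OF that]])
 then show ?case using D(1) unfolding Ck.simps(2)[of k] by blast
qed

lemma Ck_SucI: "(!!x. GDERIV f x :> D x) ==> (!!i. i \<in> Basis ==> Ck k (%x. D x \<bullet> i)) ==> Ck (Suc k) f"
 by auto

lemma Ck_add: "Ck k f ==> Ck k g ==> Ck k (%x. f x + g x)"
proof (induction k arbitrary: f g)
 case (Suc k)
 from Suc.prems(1) obtain D where D: "!!x. GDERIV f x :> D x" "!!i. i \<in> Basis ==> Ck k (%x. D x \<bullet> i)"
  by auto
 from Suc.prems(2) obtain E where E: "!!x. GDERIV g x :> E x" "!!i. i \<in> Basis ==> Ck k (%x. E x \<bullet> i)"
  by auto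
 have "GDERIV (%x. f x + g x) x :> D x + E x" for x by (rule GDERIV_add[OF D(1) E(1)])
 moreover have "Ck k (%x. (D x + E x) \<bullet> i)" if "i \<in> Basis" for i
  using Suc.IH[OF D(2)[OF that] E(2)[OF that]] by (simp add: inner_add_left)
 ultimately show ?case by (rule Ck_SucI)
qed (auto intro: continuous_on_add)

lemma Ck_cmult: "Ck k f ==> Ck k (%x. c * f x)"
proof (induction k arbitrary: f)
 case (Suc k)
 then obtain D where D: "!!x. GDERIV f x :> D x" "!!i. i \<in> Basis ==> Ck k (%x. D x \<bullet> i)" by auto
 then have "GDERIV (%x. c * f x) x :> c *R D x" for x
  using GDERIV_mult[OF GDERIV_const D(1), of c x] by simp
 moreover have "Ck k (%x. (c *R D x) \<bullet> i)" if "i \<in> Basis" for i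
  using Suc.IH[OF D(2)[OF that]] by simp
 ultimately show ?case by (rule Ck_SucI)
qed (auto intro: continuous_on_mult_left)

lemma Ck_affine: "Ck k f ==> Ck k (%y. f (c *R (y - x)))"
proof (induction k arbitrary: f)
 case 0
 have "continuous_on UNIV (%y. f (c *R (y - x)))"
  by (rule continuous_on_compose2[of UNIV f]) (use 0 in \<open>auto intro!: continuous_intros\<close>)
 then show ?case by simp
next
 case (Suc k)
 then obtain D where D: "!!x. GDERIV f x :> D x" "!!i. i \<in> Basis ==> Ck k (%x. D x \<bullet> i)" by auto
 have "GDERIV (%y. f (c *R (y - x))) y :> c *R D (c *R (y - x))" for y by (rule GDERIV_affine[OF D(1)])
 moreover have "Ck k (%y. (c *R D (c *R (y - x))) \<bullet> i)" if "i \<in> Basis" for i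
  using Ck_cmult[OF Suc.IH[OF D(2)[OF that]], of c] by simp
 ultimately show ?case by (rule Ck_SucI)
qed

lemma GDERIV_coord: "GDERIV (%y. (y - x) \<bullet> i) y :> i"
proof -
 have "((%y. (y - x) \<bullet> i) has_derivative (%h. h \<bullet> i)) (at y)"
  by (auto intro!: derivative_eq_intros)
 then show ?thesis unfolding gderiv_def .
qed

text \<open>Products of a bump with the coordinates of \<open>y - x\<close> are the test functions
  that express the derivative of an average in the dilation parameter through the weak
  gradient.\<close>

lemma Ck_mult_coord: "Ck k f ==> Ck k (%y. f y * ((y - x) \<bullet> i))"
proof (induction k arbitrary: f)
 case (Suc k)
 then obtain D where D: "!!x. GDERIV f x :> D x" "!!i. i \<in> Basis ==> Ck k (%x. D x \<bullet> i)" by auto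
 have "GDERIV (%y. f y * ((y - x) \<bullet> i)) y :> f y *R i + ((y - x) \<bullet> i) *R D y" for y
  by (rule GDERIV_mult[OF D(1) GDERIV_coord])
 moreover have "Ck k (%y. (f y *R i + ((y - x) \<bullet> i) *R D y) \<bullet> j)" if j: "j \<in> Basis" for j
  using Ck_add[OF Ck_cmult[OF Ck_Suc_imp_Ck[OF Suc.prems], of "i \<bullet> j"] Suc.IH[OF D(2)[OF j]]]
  by (simp add: inner_add_left mult.commute)
 ultimately show ?case by (rule Ck_SucI)
qed (auto intro!: continuous_intros)

lemma Cc_infinityI:
 assumes "!!k. Ck k f" "compact S" "S \<subseteq> U" "!!y. y \<notin> S ==> f y = 0"
 shows "f \<in> Cc_infinity U"
proof -
 have "supp f \<subseteq> S"
  unfolding supp_def using assms(4) by (intro closure_minimal compact_imp_closed[OF assms(2)]) auto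
 moreover have "compact (supp f)"
  using compact_Int_closed[OF assms(2), of "supp f"] calculation by (simp add: supp_def Int_absorb1)
 ultimately show ?thesis using assms(1,3) by (auto simp: Cc_infinity_def)
qed

lemma Cc_infinity_dilation:
 assumes theta: "theta \<in> Cc_infinity V" and t: "0 < t" and U: "!!z. z \<in> supp theta ==> x + t *R z \<in> U"
 shows "(%y. c * theta ((1 / t) *R (y - x))) \<in> Cc_infinity U"
  and "(%y. (c * theta ((1 / t) *R (y - x))) * ((y - x) \<bullet> i)) \<in> Cc_infinity U"
proof -
 let ?S = "(%z. x + t *R z) ` supp theta"
 have S: "compact ?S" "?S \<subseteq> U"
  using theta U by (auto simp: Cc_infinity_def intro!: compact_continuous_image continuous_intros)
 have zero: "theta ((1 / t) *R (y - x)) = 0" if "y \<notin> ?S" for y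
 proof (rule ccontr)
  assume "theta ((1 / t) *R (y - x)) ~= 0"
  then have "(1 / t) *R (y - x) \<in> supp theta" unfolding supp_def using closure_subset by fastforce
  then have "x + t *R ((1 / t) *R (y - x)) \<in> ?S" by blast
  then show False using that t by simp
 qed
 have k: "Ck k (%y. c * theta ((1 / t) *R (y - x)))" for k
  using theta by (intro Ck_cmult Ck_affine) (auto simp: Cc_infinity_def)
 show "(%y. c * theta ((1 / t) *R (y - x))) \<in> Cc_infinity U"
  by (rule Cc_infinityI[OF k S]) (simp add: zero)
 show "(%y. (c * theta ((1 / t) *R (y - x))) * ((y - x) \<bullet> i)) \<in> Cc_infinity U"
  by (rule Cc_infinityI[OF Ck_mult_coord[OF k] S]) (simp add: zero)
qed

text \<open>The differentiation under the integral sign only uses the modulus of continuity of the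
 gradient of the kernel.\<close>

lemma GDERIV_convolution:
 fixes eta :: "'a::euclidean_space => real"
 assumes eta: "!!u. GDERIV eta u :> D u" and D: "uniformly_continuous_on UNIV D" "!!u. norm (D u) <= B"
  and b: "!!u. \<bar>eta u\<bar> <= B" and F: "integrable lborel F"
 shows "GDERIV (%x. LINT y|lborel. eta (y - x) * F y) x :> - (LBINT y. F y *R D (y - x))"
proof -
 have [measurable]: "F \<in> borelm" using F by auto
 have [measurable]: "eta \<in> borelm" "D \<in> borelm"
  using GDERIV_continuous[OF eta] uniformly_continuous_imp_continuous[OF D(1)]
  by (auto intro: borel_measurable_continuous_onI)
 have i1: "integrable lborel (%y. eta (y - x) * F y)" for x
 proof (rule bi_bound[where f="%y. B * F y"])
  show "AE y in lborel. norm (eta (y - x) * F y) <= norm (B * F y)"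
  proof (intro AE_I2)
   fix y
   have "\<bar>eta (y - x)\<bar> <= \<bar>B\<bar>" using b[of "y - x"] by linarith
   then show "norm (eta (y - x) * F y) <= norm (B * F y)" by (simp add: abs_mult mult_right_mono)
  qed
 qed (use F in auto)
 have i2: "integrable lborel (%y. F y *R D (y - x))" for x
 proof (rule bi_bound[where f="%y. B * F y"])
  show "AE y in lborel. norm (F y *R D (y - x)) <= norm (B * F y)"
  proof (intro AE_I2)
   fix y
   have "norm (D (y - x)) <= \<bar>B\<bar>" using D(2)[of "y - x"] by linarith
   then have "\<bar>F y\<bar> * norm (D (y - x)) <= \<bar>F y\<bar> * \<bar>B\<bar>" by (rule mult_left_mono) simp
   then show "norm (F y *R D (y - x)) <= norm (B * F y)" by (simp add: abs_mult mult.commute[of "\<bar>B\<bar>"])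
  qed
 qed (use F in auto)
 define N where "N = (LBINT y. \<bar>F y\<bar>)"
 have N: "0 <= N" unfolding N_def by simp
 show ?thesis
  unfolding gderiv_def has_derivative_at_alt
 proof (intro conjI allI impI)
  show "bounded_linear (%h. h \<bullet> - (LBINT y. F y *R D (y - x)))" by (rule bounded_linear_inner_left)
  fix e :: real assume e: "0 < e"
  then have "0 < e / (N + 1)" using N by simp
  then obtain d where d: "0 < d" "!!u v. norm (u - v) < d ==> norm (D u - D v) < e / (N + 1)"
   using D(1) unfolding uniformly_continuous_on_def dist_norm by blast
  have mv: "\<bar>eta (u - h) - eta u + h \<bullet> D u\<bar> <= e / (N + 1) * norm h" if h: "norm h < d" for u h
  proof -
   define f where "f s = eta (u - s *R h)" for s
   have "\<exists>s::real. 0 < s \<and> s < 1 \<and> f 1 - f 0 = (1 - 0) * (- (h \<bullet> D (u - s *R h)))"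
   proof (rule MVT2)
    fix s :: real
    have "((%s. u - s *R h) has_derivative (%k. - (k *R h))) (at s)"
     by (auto intro!: derivative_eq_intros)
    from has_derivative_compose[OF this eta[unfolded gderiv_def]]
    have "(f has_derivative (%k. - (k *R h) \<bullet> D (u - s *R h))) (at s)"
     unfolding f_def .
    then show "(f has_real_derivative - (h \<bullet> D (u - s *R h))) (at s)"
     unfolding has_field_derivative_def by (rule has_derivative_eq_rhs) (simp add: fun_eq_iff mult.commute)
   qed simp
   then obtain s where s: "0 < s" "s < 1" "f 1 - f 0 = - (h \<bullet> D (u - s *R h))" by auto
   then have "eta (u - h) - eta u + h \<bullet> D u = h \<bullet> (D u - D (u - s *R h))"
    by (simp add: f_def inner_diff_right)
   also have "\<bar>\<dots>\<bar> <= norm h * norm (D u - D (u - s *R h))" by (rule Cauchy_Schwarz_ineq2)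
   also have "\<dots> <= norm h * (e / (N + 1))"
   proof (rule mult_left_mono[OF less_imp_le[OF d(2)]])
    have "norm (u - (u - s *R h)) = s * norm h" using s by simp
    also have "\<dots> <= 1 * norm h" using s by (intro mult_right_mono) auto
    finally show "norm (u - (u - s *R h)) < d" using h by simp
   qed simp
   finally show ?thesis by (simp add: mult.commute)
  qed
  show "\<exists>d>0. \<forall>x'. norm (x' - x) < d -->
   norm ((LBINT y. eta (y - x') * F y) - (LBINT y. eta (y - x) * F y) - (x' - x) \<bullet> - (LBINT y. F y *R D (y - x)))
    <= e * norm (x' - x)"
  proof (intro exI[of _ d] conjI allI impI d(1))
   fix x' assume x': "norm (x' - x) < d"
   let ?h = "x' - x"
   have ii: "integrable lborel (%y. ?h \<bullet> (F y *R D (y - x)))"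
    by (rule integrable_inner_right) (rule i2)
   have "(LBINT y. eta (y - x') * F y) - (LBINT y. eta (y - x) * F y) - ?h \<bullet> - (LBINT y. F y *R D (y - x))
    = (LBINT y. eta (y - x') * F y - eta (y - x) * F y + ?h \<bullet> (F y *R D (y - x)))"
   proof -
    have "?h \<bullet> (LBINT y. F y *R D (y - x)) = (LBINT y. ?h \<bullet> (F y *R D (y - x)))"
     by (rule integral_inner_right[symmetric]) (rule i2)
    then show ?thesis using i1[of x] i1[of x'] ii by simp
   qed
   also have "norm \<dots> <= (LBINT y. e / (N + 1) * norm ?h * \<bar>F y\<bar>)"
   proof (rule norm_integral_le)
    show "integrable lborel (%y. e / (N + 1) * norm ?h * \<bar>F y\<bar>)" using F by simp
    fix y
    have "eta (y - x') * F y - eta (y - x) * F y + ?h \<bullet> (F y *R D (y - x))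
     = (eta ((y - x) - ?h) - eta (y - x) + ?h \<bullet> D (y - x)) * F y"
     by (simp add: algebra_simps)
    then show "norm (eta (y - x') * F y - eta (y - x) * F y + ?h \<bullet> (F y *R D (y - x))) <= e / (N + 1) * norm ?h * \<bar>F y\<bar>"
     using mv[OF x', of "y - x"] by (simp only: real_norm_def abs_mult) (rule mult_right_mono, auto)
   qed
   also have "\<dots> = e / (N + 1) * norm ?h * N" unfolding N_def using F by simp
   also have "\<dots> <= e * norm ?h"
   proof -
    have "e * N <= e * (N + 1)" using e by simp
    then have "e / (N + 1) * N <= e" using N by (simp add: field_simps)
    from mult_right_mono[OF this norm_ge_zero[of ?h]] show ?thesis by (simp add: ac_simps)
   qed
   finally show "norm ((LBINT y. eta (y - x') * F y) - (LBINT y. eta (y - x) * F y) - ?h \<bullet> - (LBINT y. F y *R D (y - x)))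
    <= e * norm ?h" .
  qed
 qed
qed

section \<open>Averages with a dilated bump\<close>

text \<open>Both functions are integrable on the whole space; \<open>U\<close> enters through the
  test functions only. Averages can then be written as integrals over the whole space.\<close>

definition weak_gradient_pair :: "'a::euclidean_space set => ('a => real) => ('a => 'a) => bool" where
 "weak_gradient_pair U phi g \<longleftrightarrow> integrable lborel phi \<and> integrable lborel g \<and>
   (\<forall>psi\<in>Cc_infinity U. \<forall>D. (\<forall>x. GDERIV psi x :> D x) -->
    (LBINT x. phi x *R D x) = - (LBINT x. psi x *R g x))"

text \<open>The support lies in a shell off the origin. Hence only \<open>t\<close> with
  \<open>norm u / R2 < t < norm u / R1\<close> contribute to an integral of
  \<open>theta (u / t)\<close> over the dilations, which is what bounds the kernel by a multiple of
  \<open>|u|^(1-d)\<close>. When the support lies in a small ball off the origin, its dilates sweep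
  out a truncated cone.\<close>

locale bump =
 fixes theta :: "'a::euclidean_space => real" and Dtheta :: "'a => 'a" and T R1 R2 :: real
 assumes test: "theta \<in> Cc_infinity UNIV"
  and gderiv: "!!z. GDERIV theta z :> Dtheta z" and uc: "uniformly_continuous_on UNIV Dtheta"
  and nonneg: "!!z. 0 <= theta z" and le: "!!z. theta z <= T" and Dle: "!!z. norm (Dtheta z) <= T"
  and supp: "!!z. z \<in> supp theta ==> R1 < norm z \<and> norm z < R2"
  and Dsupp: "!!z. z \<notin> supp theta ==> Dtheta z = 0"
  and R1: "0 < R1" and total: "(LBINT z. theta z) = 1"
begin

lemma T_nonneg: "0 <= T" using nonneg le order_trans by blast

lemma supp_nz: "theta z ~= 0 ==> z \<in> supp theta"
 unfolding supp_def using closure_subset by fastforce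

lemma nz: "theta z ~= 0 ==> R1 < norm z \<and> norm z < R2" using supp supp_nz by blast

lemma R2: "0 < R2"
proof -
 have "\<exists>z. theta z ~= 0"
 proof (rule ccontr)
  assume "\<not> (\<exists>z. theta z ~= 0)"
  then have "theta = (%_. 0)" by auto
  then show False using total by simp
 qed
 then show ?thesis using nz R1 by (meson less_trans)
qed

lemma theta_continuous: "continuous_on UNIV theta" by (rule GDERIV_continuous[OF gderiv])

lemma theta_measurable [measurable]: "theta \<in> borelm"
 by (rule borel_measurable_continuous_onI[OF theta_continuous])

lemma Dtheta_measurable [measurable]: "Dtheta \<in> borelm"
 by (rule borel_measurable_continuous_onI[OF uniformly_continuous_imp_continuous[OF uc]])

lemma theta_integrable: "integrable lborel theta"
 using total not_integrable_integral_eq by fastforce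

definition dil :: "real => 'a => real" where
 "dil t u = theta ((1 / t) *R u) / t ^ DIM('a)"

definition avg :: "real => ('a => 'b::euclidean_space) => 'a => 'b" where
 "avg t F x = (LBINT y. dil t (y - x) *R F y)"

definition kap :: "real => 'a => real" where
 "kap rho u = (LINT t:{0<..rho}|lborel. theta ((1 / t) *R u) / t ^ Suc DIM('a))"

text \<open>The vector field that spreads a unit mass at the origin into the density
  \<open>dil rho\<close>. The \<open>t\<close>-derivative of \<open>dil t u\<close> is minus the
  divergence in \<open>u\<close> of \<open>theta (u / t) u / t^(d+1)\<close>; integration over
  \<open>t\<close> gives formally \<open>div (ker rho) = delta_0 - dil rho\<close>. Integration by
  parts against a function with gradient \<open>g\<close> recovers that function as
  \<open>avg rho\<close> minus \<open>cor rho g\<close>.\<close>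

definition ker :: "real => 'a => 'a" where
 "ker rho u = kap rho u *R u"

definition cor :: "real => ('a => 'a) => 'a => real" where
 "cor rho g x = (LBINT y. ker rho (y - x) \<bullet> g y)"

lemma dil_measurable [measurable]: "dil t \<in> borelm"
 unfolding dil_def by measurable

lemma dil_bounds: assumes "0 < t" shows "0 <= dil t u" "dil t u <= T / t ^ DIM('a)"
 using assms nonneg le by (auto simp: dil_def intro!: divide_right_mono)

lemma dil_integral: assumes t: "0 < t"
 shows "(LBINT y. dil t (y - x)) = 1" "(LBINT x. dil t (y - x)) = 1"
proof -
 have "(LBINT y. dil t (y - x)) = \<bar>t\<bar> ^ DIM('a) *R (LBINT z. dil t ((x + t *R z) - x))"
  by (rule integral_lborel_affine) (use t in auto)
 also have "\<dots> = 1" using t total by (simp add: dil_def)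
 finally show "(LBINT y. dil t (y - x)) = 1" .
 have "(LBINT x. dil t (y - x)) = \<bar>- t\<bar> ^ DIM('a) *R (LBINT z. dil t (y - (y + (- t) *R z)))"
  by (rule integral_lborel_affine) (use t in auto)
 also have "\<dots> = 1" using t total by (simp add: dil_def)
 finally show "(LBINT x. dil t (y - x)) = 1" .
qed

lemma dil_zero: assumes "0 < t" "R2 * t <= norm u" shows "dil t u = 0"
proof (rule ccontr)
 assume "dil t u ~= 0"
 then have "theta ((1 / t) *R u) ~= 0" by (auto simp: dil_def)
 then have "norm u / t < R2" using nz assms by fastforce
 then show False using assms by (simp add: field_simps)
qed

lemma avg_integrable:
 fixes F :: "'a => 'b::euclidean_space"
 assumes "0 < t" "integrable lborel F"
 shows "integrable lborel (%y. dil t (y - x) *R F y)"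
proof (rule bi_bound[where f="%y. (T / t ^ DIM('a)) *R F y"])
 have [measurable]: "F \<in> borelm" using assms by auto
 show "(%y. dil t (y - x) *R F y) \<in> borel_measurable lborel" by measurable
 show "AE y in lborel. norm (dil t (y - x) *R F y) <= norm ((T / t ^ DIM('a)) *R F y)"
 proof (intro AE_I2)
  fix y
  have "\<bar>dil t (y - x)\<bar> <= \<bar>T / t ^ DIM('a)\<bar>" using dil_bounds[OF assms(1), of "y - x"] by linarith
  then show "norm (dil t (y - x) *R F y) <= norm ((T / t ^ DIM('a)) *R F y)"
   unfolding norm_scaleR by (rule mult_right_mono) simp
 qed
qed (use assms in simp)

lemma avg_bound:
 assumes "0 < t" "integrable lborel F"
 shows "norm (avg t F x) <= T / t ^ DIM('a) * (LBINT y. norm (F y))"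
proof -
 have "norm (avg t F x) <= (LBINT y. T / t ^ DIM('a) * norm (F y))"
  unfolding avg_def
 proof (rule norm_integral_le)
  show "norm (dil t (y - x) *R F y) <= T / t ^ DIM('a) * norm (F y)" for y
   using dil_bounds[OF assms(1), of "y - x"] unfolding norm_scaleR by (intro mult_right_mono) auto
 qed (use assms in simp)
 then show ?thesis using assms by simp
qed

lemma avg_continuous:
 assumes "0 < t" "integrable lborel F"
 shows "continuous_on UNIV (avg t F)"
 unfolding continuous_on_sequentially
proof (intro allI ballI impI)
 have [measurable]: "F \<in> borelm" using assms by auto
 fix X :: "nat => 'a" and x :: 'a assume "x \<in> UNIV" and X: "(\<forall>n::nat. X n \<in> UNIV) \<and> X \<longlonglongrightarrow> x"
 have dc: "continuous_on UNIV (dil t)"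
  unfolding dil_def by (intro continuous_intros continuous_on_compose2[OF theta_continuous]) (use assms in auto)
 show "(avg t F \<circ> X) \<longlonglongrightarrow> avg t F x"
  unfolding avg_def o_def
 proof (rule integral_dominated_convergence[where w="%y. T / t ^ DIM('a) * norm (F y)"])
  show "AE y in lborel. (%n. dil t (y - X n) *R F y) \<longlonglongrightarrow> dil t (y - x) *R F y"
  proof (intro AE_I2 tendsto_scaleR tendsto_const)
   fix y
   have "(%n. y - X n) \<longlonglongrightarrow> y - x" using X by (intro tendsto_diff tendsto_const) auto
   then show "(%n. dil t (y - X n)) \<longlonglongrightarrow> dil t (y - x)"
    using continuous_on_tendsto_compose[OF dc] by auto
  qed
  show "AE y in lborel. norm (dil t (y - X n) *R F y) <= T / t ^ DIM('a) * norm (F y)" for n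
   unfolding norm_scaleR using dil_bounds[OF assms(1), of "y - X n" for y]
   by (intro AE_I2 mult_right_mono) auto
 qed (use assms in auto)
qed

lemma avg_GDERIV:
 assumes t: "0 < t" and F: "integrable lborel F"
 shows "GDERIV (avg t F) x :> - (LBINT y. F y *R ((1 / t ^ Suc DIM('a)) *R Dtheta ((1 / t) *R (y - x))))"
proof -
 define B where "B = T / t ^ DIM('a) + T / t ^ Suc DIM('a)"
 have "GDERIV (%x. LINT y|lborel. dil t (y - x) * F y) x :> - (LBINT y. F y *R ((1 / t ^ Suc DIM('a)) *R Dtheta ((1 / t) *R (y - x))))"
 proof (rule GDERIV_convolution[where eta="dil t" and B=B, OF _ _ _ _ F])
  show "GDERIV (dil t) u :> (1 / t ^ Suc DIM('a)) *R Dtheta ((1 / t) *R u)" for u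
  proof -
   have "GDERIV (%u. (1 / t ^ DIM('a)) * theta ((1 / t) *R (u - 0))) u :> (1 / t ^ DIM('a)) *R (1 / t) *R Dtheta ((1 / t) *R (u - 0))"
    by (rule GDERIV_cmult[OF GDERIV_affine[OF gderiv]])
   then show ?thesis by (simp add: dil_def[abs_def] mult.commute)
  qed
  have "uniformly_continuous_on UNIV (%u::'a. (1 / t) *R u)"
   by (rule uniformly_continuous_on_cmul[OF uniformly_continuous_on_id])
  moreover have "uniformly_continuous_on (range (%u::'a. (1 / t) *R u)) Dtheta"
   using uc unfolding uniformly_continuous_on_def by blast
  ultimately have "uniformly_continuous_on UNIV (%u. Dtheta ((1 / t) *R u))"
   by (rule uniformly_continuous_on_compose)
  then show "uniformly_continuous_on UNIV (%u. (1 / t ^ Suc DIM('a)) *R Dtheta ((1 / t) *R u))"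
   by (rule uniformly_continuous_on_cmul)
  have T0: "0 <= T / t ^ DIM('a)" "0 <= T / t ^ Suc DIM('a)" using T_nonneg t by auto
  show "norm ((1 / t ^ Suc DIM('a)) *R Dtheta ((1 / t) *R u)) <= B" for u
  proof -
   have "norm ((1 / t ^ Suc DIM('a)) *R Dtheta ((1 / t) *R u)) = norm (Dtheta ((1 / t) *R u)) / t ^ Suc DIM('a)" using t by simp
   also have "\<dots> <= T / t ^ Suc DIM('a)" using t by (intro divide_right_mono Dle) simp
   finally show ?thesis using T0 by (simp add: B_def)
  qed
  show "\<bar>dil t u\<bar> <= B" for u using dil_bounds[OF t, of u] T0 by (simp add: B_def)
 qed
 then show ?thesis by (simp add: avg_def[abs_def])
qed

text \<open>As long as \<open>x + t supp theta\<close> stays in \<open>U\<close>, the shifted dilate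
  of \<open>theta\<close> is itself a test function on \<open>U\<close>, so its derivative can be
  moved to \<open>phi\<close> in the weak sense.\<close>

lemma avg_GDERIV_weak:
 assumes t: "0 < t" and w: "weak_gradient_pair U phi g" and U: "!!z. z \<in> supp theta ==> x + t *R z \<in> U"
 shows "GDERIV (avg t phi) x :> avg t g x"
proof -
 let ?psi = "%y. (1 / t ^ DIM('a)) * theta ((1 / t) *R (y - x))"
 have psi: "?psi \<in> Cc_infinity U" by (rule Cc_infinity_dilation(1)[OF test t U])
 have gd: "GDERIV ?psi y :> (1 / t ^ Suc DIM('a)) *R Dtheta ((1 / t) *R (y - x))" for y
 proof -
  have "(1 / t ^ Suc DIM('a)) *R Dtheta ((1 / t) *R (y - x)) = (1 / t ^ DIM('a)) *R (1 / t) *R Dtheta ((1 / t) *R (y - x))"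
   by (simp add: mult.commute)
  then show ?thesis
   by (simp only:) (rule GDERIV_cmult[OF GDERIV_affine[OF gderiv]])
 qed
 have "(LBINT y. phi y *R ((1 / t ^ Suc DIM('a)) *R Dtheta ((1 / t) *R (y - x)))) = - (LBINT y. ?psi y *R g y)"
  using w[unfolded weak_gradient_pair_def, THEN conjunct2, THEN conjunct2, rule_format, OF psi, OF gd] .
 moreover have "(LBINT y. ?psi y *R g y) = avg t g x" by (simp add: avg_def dil_def)
 ultimately show ?thesis
  using avg_GDERIV[OF t, of phi x] w unfolding weak_gradient_pair_def by simp
qed

text \<open>By Fubini the averaging passes to the indicator of the box. The averaged indicator lies
  between 0 and 1 and, at a point off the boundary of the box, equals the indicator as soon as
  \<open>R2 * tau k\<close> is below the distance to that boundary.\<close>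

lemma avg_box_tendsto:
 assumes F: "integrable lborel F" and tau: "tau \<longlonglongrightarrow> 0" "!!k. 0 < tau k"
 shows "(%k. LINT x:box a b|lborel. avg (tau k) F x) \<longlonglongrightarrow> (LINT x:box a b|lborel. (F x :: real))"
proof -
 have [measurable]: "F \<in> borelm" using F by auto
 let ?w = "%k y. LINT x:box a b|lborel. dil (tau k) (y - x)"
 have iB: "integrable lborel (%x. dil t (y - x))" if "0 < t" for t y
  using dil_integral(2)[OF that, of y] not_integrable_integral_eq by fastforce
 have w_meas [measurable]: "?w k \<in> borelm" for k
  unfolding set_lebesgue_integral_def by measurable
 have w01: "0 <= ?w k y" "?w k y <= 1" for k y
 proof -
  show "0 <= ?w k y" unfolding set_lebesgue_integral_def
   by (intro integral_nonneg_AE AE_I2) (simp add: dil_bounds[OF tau(2)])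
  have "?w k y <= (LBINT x. dil (tau k) (y - x))"
   unfolding set_lebesgue_integral_def
  proof (rule integral_mono)
   show "integrable lborel (%x. indicator (box a b) x *R dil (tau k) (y - x))"
    by (rule bi_bound[OF iB[OF tau(2)]]) (auto simp: indicator_def)
  qed (use iB[OF tau(2)] dil_bounds(1)[OF tau(2)] in \<open>auto simp: indicator_def\<close>)
  then show "?w k y <= 1" using dil_integral(2)[OF tau(2)] by simp
 qed
 have eq: "(LINT x:box a b|lborel. avg (tau k) F x) = (LBINT y. ?w k y * F y)" for k
 proof -
  have "(LINT x:box a b|lborel. LINT y|lborel. dil (tau k) (y - x) \<bullet> F y) = (LBINT y. ?w k y \<bullet> F y)"
  proof (rule lborel_strip_Fubini[where C="T / tau k ^ DIM('a)"])
   show "(%z. dil (tau k) (snd z - fst z)) \<in> borelm"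
    by (rule measurable_compose[OF _ dil_measurable]) (intro borel_measurable_continuous_onI continuous_intros)
   show "emeasure lborel (box a b) < \<infinity>" by (simp add: emeasure_lborel_box_eq)
  qed (use dil_bounds[OF tau(2)] F in auto)
  then show ?thesis by (simp add: avg_def)
 qed
 have "(%k. LINT y|lborel. ?w k y * F y) \<longlonglongrightarrow> (LBINT y. indicator (box a b) y * F y)"
 proof (rule integral_dominated_convergence[where w="%y. norm (F y)"])
  show "AE y in lborel. norm (?w k y * F y) <= norm (F y)" for k
   using w01[of k] by (intro AE_I2) (simp add: abs_mult mult_left_le_one_le)
  have "AE y in lborel. y \<notin> cbox a b - box a b"
  proof (rule AE_not_in)
   have e: "emeasure lborel (cbox a b) = emeasure lborel (box a b)"
    by (simp add: emeasure_lborel_box_eq emeasure_lborel_cbox_eq)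
   have fin: "emeasure lborel (box a b) ~= \<infinity>" by (simp add: emeasure_lborel_box_eq)
   have "emeasure lborel (cbox a b - box a b) = emeasure lborel (cbox a b) - emeasure lborel (box a b)"
    by (rule emeasure_Diff[OF fin]) (auto simp: box_subset_cbox)
   also have "\<dots> = 0" unfolding e using fin by (intro ennreal_diff_self) simp
   finally show "cbox a b - box a b \<in> null_sets lborel" by (simp add: null_sets_def)
  qed
  then show "AE y in lborel. (%k. ?w k y * F y) \<longlonglongrightarrow> indicator (box a b) y * F y"
  proof (rule AE_mp, intro AE_I2 impI)
   fix y assume y: "y \<notin> cbox a b - box a b"
   have near: "\<forall>\<^sub>F k in sequentially. R2 * tau k < d" if "0 < d" for d
    using order_tendstoD(2)[OF tendsto_mult[OF tendsto_const[of R2] tau(1)], of d] that by simp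
   have "\<forall>\<^sub>F k in sequentially. ?w k y = indicator (box a b) y"
   proof (cases "y \<in> box a b")
    case True
    obtain d where d: "0 < d" "ball y d \<subseteq> box a b" using open_box True open_contains_ball by blast
    from near[OF d(1)] show ?thesis
    proof eventually_elim
     case (elim k)
     have "indicator (box a b) x *R dil (tau k) (y - x) = dil (tau k) (y - x)" for x
     proof (cases "x \<in> box a b")
      case False
      then have "d <= norm (y - x)" using d(2) by (force simp: dist_norm)
      then show ?thesis using dil_zero[OF tau(2), of k "y - x"] elim by simp
     qed simp
     then have "?w k y = (LBINT x. dil (tau k) (y - x))"
      unfolding set_lebesgue_integral_def by (rule bi_cong[OF refl])
     then show ?case using True dil_integral(2)[OF tau(2)] by simp
    qed
   next
    case False
    then have "y \<in> - cbox a b" using y by blast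
    moreover have "open (- cbox a b)" by (intro open_Compl closed_cbox)
    ultimately obtain d where d: "0 < d" "ball y d \<subseteq> - cbox a b" using open_contains_ball by blast
    from near[OF d(1)] show ?thesis
    proof eventually_elim
     case (elim k)
     have "indicator (box a b) x *R dil (tau k) (y - x) = 0" for x
     proof (cases "x \<in> box a b")
      case True
      then have "x \<in> cbox a b" using box_subset_cbox by blast
      then have "d <= norm (y - x)" using d(2) by (force simp: dist_norm)
      then show ?thesis using dil_zero[OF tau(2), of k "y - x"] elim by simp
     qed simp
     then have "?w k y = (LINT x|(lborel :: 'a measure). 0)"
      unfolding set_lebesgue_integral_def by (rule bi_cong[OF refl])
     then show ?case using False by simp
    qed
   qed
   then have "\<forall>\<^sub>F k in sequentially. ?w k y * F y = indicator (box a b) y * F y"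
    by eventually_elim simp
   then show "(%k. ?w k y * F y) \<longlonglongrightarrow> indicator (box a b) y * F y" by (rule tendsto_eventually)
  qed
 qed (use F in auto)
 then show ?thesis unfolding eq by (simp add: set_lebesgue_integral_def)
qed

text \<open>Bounded pointwise limits of averages can be integrated over boxes, where
  \<open>avg_box_tendsto\<close> gives the integral of \<open>F\<close>; functions with equal box
  integrals agree almost everywhere.\<close>

lemma avg_limit_AE:
 assumes F: "integrable lborel F" and tau: "tau \<longlonglongrightarrow> 0" "!!k. 0 < tau k"
  and V: "open V" and c [measurable]: "c \<in> borelm"
  and lim: "!!x. x \<in> V ==> (%k. avg (tau k) F x) \<longlonglongrightarrow> c x"
  and B: "!!x k. x \<in> V ==> \<bar>avg (tau k) F x\<bar> <= B"
 shows "AE x in lborel. x \<in> V --> F x = (c x :: real)"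
proof -
 have [measurable]: "F \<in> borelm" using F by auto
 have [measurable]: "avg (tau k) F \<in> borelm" for k
  by (rule borel_measurable_continuous_onI[OF avg_continuous[OF tau(2) F]])
 have cB: "\<bar>c x\<bar> <= B" if "x \<in> V" for x
  by (rule LIMSEQ_le_const2[OF tendsto_rabs[OF lim[OF that]]]) (use B that in auto)
 have ic: "set_integrable lborel (cbox a b) c" if "cbox a b \<subseteq> V" for a b
  unfolding set_integrable_def
 proof (rule bi_bound[where f="%x. B * indicator (cbox a b) x"])
  show "integrable lborel (%x. B * indicator (cbox a b) x)"
   by (intro integrable_mult_right integrable_real_indicator) (auto simp: emeasure_lborel_cbox_eq)
  show "AE x in lborel. norm (indicator (cbox a b) x *R c x) <= norm (B * indicator (cbox a b) x)"
   using cB that by (intro AE_I2) (auto simp: indicator_def intro: order_trans[OF _ abs_ge_self])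
 qed measurable
 have iF: "set_integrable lborel A F" if "A \<in> sets borel" for A
  unfolding set_integrable_def using F that by (intro integrable_mult_indicator) auto
 have "AE x in lborel. x \<in> V --> F x - c x = 0"
 proof (rule AE_eq_0_if_box_integrals[OF V])
  show "set_integrable lborel (cbox a b) (%x. F x - c x)" if "cbox a b \<subseteq> V" for a b
   using ic[OF that] iF by (intro set_integral_diff) auto
  show "(LINT x:box a b|lborel. F x - c x) = 0" if ab: "cbox a b \<subseteq> V" for a b
  proof -
   have bV: "x \<in> V" if "x \<in> box a b" for x using that ab box_subset_cbox by blast
   have "(%k. LINT x:box a b|lborel. avg (tau k) F x) \<longlonglongrightarrow> (LINT x:box a b|lborel. c x)"
    unfolding set_lebesgue_integral_def
   proof (rule integral_dominated_convergence[where w="%x. B * indicator (box a b) x"])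
    show "integrable lborel (%x. B * indicator (box a b) x)"
     by (intro integrable_mult_right integrable_real_indicator) (auto simp: emeasure_lborel_box_eq)
    show "AE x in lborel. (%k. indicator (box a b) x *R avg (tau k) F x) \<longlonglongrightarrow> indicator (box a b) x *R c x"
     using lim bV by (intro AE_I2) (auto simp: indicator_def)
    show "AE x in lborel. norm (indicator (box a b) x *R avg (tau k) F x) <= B * indicator (box a b) x" for k
     using B bV by (intro AE_I2) (auto simp: indicator_def)
   qed measurable
   then have "(LINT x:box a b|lborel. F x) = (LINT x:box a b|lborel. c x)"
    using LIMSEQ_unique[OF avg_box_tendsto[OF F tau]] by blast
   moreover have "set_integrable lborel (box a b) c"
    by (rule set_integrable_subset[OF ic[OF ab]]) (auto simp: box_subset_cbox)
   ultimately show ?thesis using iF by (subst set_integral_diff(2)) auto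
  qed
 qed measurable
 then show ?thesis by eventually_elim simp
qed

end

section \<open>The correction kernel\<close>

context bump
begin

lemma kap_integrand:
 assumes "0 < t" "u ~= 0"
 shows "0 <= theta ((1 / t) *R u) / t ^ Suc DIM('a)"
  and "theta ((1 / t) *R u) / t ^ Suc DIM('a) <= T * (R2 / norm u) ^ Suc DIM('a) * indicator {0<..norm u / R1} t"
proof -
 show "0 <= theta ((1 / t) *R u) / t ^ Suc DIM('a)" using nonneg assms by simp
 show "theta ((1 / t) *R u) / t ^ Suc DIM('a) <= T * (R2 / norm u) ^ Suc DIM('a) * indicator {0<..norm u / R1} t"
 proof (cases "theta ((1 / t) *R u) = 0")
  case True
  then show ?thesis using T_nonneg R2 by simp
 next
  case False
  then have "R1 < norm u / t" "norm u / t < R2" using nz[of "(1 / t) *R u"] assms by auto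
  then have t: "t <= norm u / R1" "1 / t <= R2 / norm u"
   using assms R1 by (auto simp: field_simps)
  have "(1 / t) ^ Suc DIM('a) <= (R2 / norm u) ^ Suc DIM('a)"
   using t assms by (intro power_mono) auto
  then have "theta ((1 / t) *R u) * (1 / t) ^ Suc DIM('a) <= T * (R2 / norm u) ^ Suc DIM('a)"
   using le T_nonneg assms by (intro mult_mono) auto
  then show ?thesis using t assms by (simp add: divide_inverse power_inverse del: power_Suc)
 qed
qed

lemma kap_zero [simp]: "ker rho 0 = 0" by (simp add: ker_def)

lemma kap_integrable:
 assumes "u ~= 0"
 shows "set_integrable lborel {0<..rho} (%t. theta ((1 / t) *R u) / t ^ Suc DIM('a))"
 unfolding set_integrable_def
proof (rule bi_bound[where f="%t. T * (R2 / norm u) ^ Suc DIM('a) * indicator {0<..norm u / R1} t"])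
 show "integrable lborel (%t. T * (R2 / norm u) ^ Suc DIM('a) * indicator {0<..norm u / R1} t)"
  using R1 by (intro integrable_mult_right integrable_real_indicator) (simp, subst emeasure_lborel_Ioc, auto)
 show "AE t in lborel. norm (indicator {0<..rho} t *R (theta ((1 / t) *R u) / t ^ Suc DIM('a)))
   <= norm (T * (R2 / norm u) ^ Suc DIM('a) * indicator {0<..norm u / R1} t)"
 proof (intro AE_I2)
  fix t :: real
  show "norm (indicator {0<..rho} t *R (theta ((1 / t) *R u) / t ^ Suc DIM('a)))
   <= norm (T * (R2 / norm u) ^ Suc DIM('a) * indicator {0<..norm u / R1} t)"
  proof (cases "t \<in> {0<..rho}")
   case True
   then have "norm (indicator {0<..rho} t *R (theta ((1 / t) *R u) / t ^ Suc DIM('a))) = theta ((1 / t) *R u) / t ^ Suc DIM('a)"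
    using kap_integrand(1)[of t u] assms by (simp add: nonneg)
   also have "\<dots> <= T * (R2 / norm u) ^ Suc DIM('a) * indicator {0<..norm u / R1} t"
    by (rule kap_integrand(2)) (use True assms in auto)
   also have "\<dots> <= norm \<dots>" by (simp only: real_norm_def abs_ge_self)
   finally show ?thesis .
  qed simp
 qed
qed measurable

text \<open>The integrand is at most \<open>T (R2 / norm u)^(d+1)\<close> and lives on an interval
  of length \<open>norm u / R1\<close>.\<close>

lemma kap_bounds:
 assumes "u ~= 0"
 shows "0 <= kap rho u" "kap rho u <= T * R2 ^ Suc DIM('a) / R1 / norm u ^ DIM('a)"
proof -
 show "0 <= kap rho u"
  unfolding kap_def set_lebesgue_integral_def
  using kap_integrand(1)[OF _ assms] by (intro integral_nonneg_AE AE_I2) (auto simp: indicator_def)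
 have "kap rho u <= (LBINT t. T * (R2 / norm u) ^ Suc DIM('a) * indicator {0<..norm u / R1} t)"
  unfolding kap_def set_lebesgue_integral_def
 proof (rule integral_mono)
  show "integrable lborel (%t. indicator {0<..rho} t *R (theta ((1 / t) *R u) / t ^ Suc DIM('a)))"
   using kap_integrable[OF assms] by (simp add: set_integrable_def)
  show "integrable lborel (%t. T * (R2 / norm u) ^ Suc DIM('a) * indicator {0<..norm u / R1} t)"
   using R1 by (intro integrable_mult_right integrable_real_indicator) (simp, subst emeasure_lborel_Ioc, auto)
  fix t :: real
  show "indicator {0<..rho} t *R (theta ((1 / t) *R u) / t ^ Suc DIM('a)) <= T * (R2 / norm u) ^ Suc DIM('a) * indicator {0<..norm u / R1} t"
   using kap_integrand(2)[OF _ assms, of t] T_nonneg R2 by (cases "t \<in> {0<..rho}") auto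
 qed
 also have "\<dots> = T * (R2 / norm u) ^ Suc DIM('a) * (norm u / R1)"
  using R1 by simp
 also have "\<dots> = T * R2 ^ Suc DIM('a) / R1 / norm u ^ DIM('a)"
  using assms R1 by (simp add: power_divide field_simps)
 finally show "kap rho u <= T * R2 ^ Suc DIM('a) / R1 / norm u ^ DIM('a)" .
qed

lemma kap_outside:
 assumes "R2 * rho <= norm u"
 shows "kap rho u = 0"
proof -
 have "indicator {0<..rho} t *R (theta ((1 / t) *R u) / t ^ Suc DIM('a)) = 0" for t :: real
 proof (cases "t \<in> {0<..rho}")
  case True
  have "theta ((1 / t) *R u) = 0"
  proof (rule ccontr)
   assume "theta ((1 / t) *R u) ~= 0"
   then have "norm u < R2 * t" using nz[of "(1 / t) *R u"] True by (auto simp: field_simps)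
   also have "\<dots> <= R2 * rho" using True R2 by simp
   finally show False using assms by simp
  qed
  then show ?thesis by simp
 qed simp
 then show ?thesis unfolding kap_def set_lebesgue_integral_def by (simp only: bi_zero)
qed

definition C0 :: real where "C0 = T * R2 ^ Suc DIM('a) / R1"

lemma C0_nonneg: "0 <= C0" using T_nonneg R2 R1 by (simp add: C0_def)

text \<open>The factor \<open>u\<close> in \<open>ker\<close> regains one power of the singularity
  of \<open>kap\<close>, which brings the kernel below the critical exponent
  \<open>d\<close>.\<close>

lemma ker_bound:
 "norm (ker rho u) <= C0 * (indicator (ball 0 (R2 * rho)) u * norm u powr (- (real DIM('a) - 1)))"
proof (cases "u = 0 \<or> u \<notin> ball 0 (R2 * rho)")
 case True
 then have "ker rho u = 0" by (auto simp: ker_def kap_outside)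
 then show ?thesis using C0_nonneg by simp
next
 case False
 then have u: "u ~= 0" "u \<in> ball 0 (R2 * rho)" by auto
 have "norm (ker rho u) = kap rho u * norm u" using kap_bounds(1)[OF u(1)] by (simp add: ker_def)
 also have "\<dots> <= C0 / norm u ^ DIM('a) * norm u"
  unfolding C0_def by (intro mult_right_mono kap_bounds u) simp
 also have "\<dots> = C0 * norm u powr (- (real DIM('a) - 1))"
  using u by (simp add: powr_diff powr_realpow powr_minus divide_simps)
 finally show ?thesis using u by simp
qed

lemma kap_measurable [measurable]: "kap rho \<in> borelm"
 unfolding kap_def[abs_def] set_lebesgue_integral_def by measurable

lemma ker_measurable [measurable]: "ker rho \<in> borelm"
 unfolding ker_def[abs_def] by measurable

lemma ker_integrable: "integrable lborel (%u. norm (ker rho u))"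
proof (rule bi_bound)
 show "integrable lborel (%u::'a. C0 * (indicator (ball 0 (R2 * rho)) u * norm u powr (- (real DIM('a) - 1))))"
  by (intro integrable_mult_right integrable_norm_powr) (auto simp: DIM_positive Suc_leI)
 show "AE u in lborel. norm (norm (ker rho u)) <= norm (C0 * (indicator (ball 0 (R2 * rho)) u * norm u powr (- (real DIM('a) - 1))))"
  unfolding real_norm_def abs_norm_cancel by (intro AE_I2 order_trans[OF ker_bound abs_ge_self])
qed measurable

lemma ker_integral_tendsto_0:
 assumes "rho \<longlonglongrightarrow> 0"
 shows "(%k. LINT u|lborel. norm (ker (rho k) u)) \<longlonglongrightarrow> 0"
proof (rule Lim_null_comparison[OF always_eventually], rule allI)
 have "(%k. R2 * rho k) \<longlonglongrightarrow> R2 * 0" by (intro tendsto_mult tendsto_const assms)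
 then have "(%k. R2 * rho k) \<longlonglongrightarrow> 0" by simp
 then have "(%k. LINT u|lborel. indicator (ball (0::'a) (R2 * rho k)) u * norm u powr (- (real DIM('a) - 1))) \<longlonglongrightarrow> 0"
  by (intro tendsto_integral_norm_powr) (auto simp: DIM_positive Suc_leI)
 from tendsto_mult[OF tendsto_const[of C0] this]
 show "(%k. C0 * (LBINT u. indicator (ball (0::'a) (R2 * rho k)) u * norm u powr (- (real DIM('a) - 1)))) \<longlonglongrightarrow> 0"
  by simp
 show "norm (LBINT u. norm (ker (rho k) u)) <= C0 * (LBINT u. indicator (ball (0::'a) (R2 * rho k)) u * norm u powr (- (real DIM('a) - 1)))" for k
 proof -
  have i: "integrable lborel (%u::'a. indicator (ball 0 (R2 * rho k)) u * norm u powr (- (real DIM('a) - 1)))"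
   by (intro integrable_norm_powr) (auto simp: DIM_positive Suc_leI)
  have "(LBINT u. norm (ker (rho k) u)) <= (LBINT u. C0 * (indicator (ball (0::'a) (R2 * rho k)) u * norm u powr (- (real DIM('a) - 1))))"
   by (rule integral_mono[OF ker_integrable integrable_mult_right[OF i] ker_bound])
  then show ?thesis by simp
 qed
qed

text \<open>The \<open>t\<close>-derivative of \<open>dil t u\<close> and at the same time minus the
  divergence in \<open>u\<close> of \<open>theta (u / t) u / t^(d+1)\<close>; the second reading is
  what \<open>weak_identity\<close> exploits.\<close>

definition dilt :: "real => 'a => real" where
 "dilt t u = - (real DIM('a) * theta ((1 / t) *R u) / t ^ Suc DIM('a) + (Dtheta ((1 / t) *R u) \<bullet> u) / t ^ Suc (Suc DIM('a)))"

lemma dil_DERIV: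
 assumes t: "0 < t"
 shows "((%t. dil t u) has_real_derivative dilt t u) (at t)"
proof -
 have "((%s. (1 / s) *R u) has_derivative (%h. (- (h / t\<^sup>2)) *R u)) (at t)"
  using t by (auto intro!: derivative_eq_intros simp: power2_eq_square fun_eq_iff divide_simps)
 from has_derivative_compose[OF this gderiv[unfolded gderiv_def]]
 have "((%s. theta ((1 / s) *R u)) has_derivative (%h. ((- (h / t\<^sup>2)) *R u) \<bullet> Dtheta ((1 / t) *R u))) (at t)" .
 then have d: "((%s. theta ((1 / s) *R u)) has_real_derivative - (u \<bullet> Dtheta ((1 / t) *R u) / t\<^sup>2)) (at t)"
  unfolding has_field_derivative_def by (rule has_derivative_eq_rhs) (simp add: fun_eq_iff)
 have "((%s. theta ((1 / s) *R u) * (1 / s) ^ DIM('a)) has_real_derivative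
   - (u \<bullet> Dtheta ((1 / t) *R u) / t\<^sup>2) * (1 / t) ^ DIM('a) + (real DIM('a) * (1 / t) ^ (DIM('a) - 1) * (- 1 / t\<^sup>2)) * theta ((1 / t) *R u)) (at t)"
 proof (rule DERIV_mult[OF d])
  have "((%s::real. 1 / s) has_real_derivative - 1 / t\<^sup>2) (at t)"
   using t by (auto intro!: derivative_eq_intros simp: power2_eq_square)
  from DERIV_power[OF this, of "DIM('a)"]
  show "((%s::real. (1 / s) ^ DIM('a)) has_real_derivative real DIM('a) * (1 / t) ^ (DIM('a) - 1) * (- 1 / t\<^sup>2)) (at t)"
   by (simp add: ac_simps)
 qed
 moreover have "- (u \<bullet> Dtheta ((1 / t) *R u) / t\<^sup>2) * (1 / t) ^ DIM('a) + (real DIM('a) * (1 / t) ^ (DIM('a) - 1) * (- 1 / t\<^sup>2)) * theta ((1 / t) *R u) = dilt t u"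
 proof -
  obtain m where m: "DIM('a) = Suc m" using DIM_positive[where 'a='a] by (metis Suc_pred)
  show ?thesis using t unfolding dilt_def m
   by (simp add: power_one_over inner_commute power2_eq_square divide_simps)
 qed
 moreover have "(%s. theta ((1 / s) *R u) * (1 / s) ^ DIM('a)) = (%t. dil t u)"
  by (simp add: dil_def fun_eq_iff divide_inverse power_inverse)
 ultimately show ?thesis by simp
qed

lemma dilt_FTC:
 assumes "0 < tau" "tau <= rho"
 shows "(LINT t:{tau<..rho}|lborel. dilt t u) = dil rho u - dil tau u"
proof -
 have c: "continuous_on {tau..rho} (%t. dilt t u)"
  unfolding dilt_def
  by (intro continuous_intros continuous_on_compose2[OF theta_continuous]
    continuous_on_compose2[OF uniformly_continuous_imp_continuous[OF uc]]) (use assms in auto)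
 have "(LBINT t. indicator {tau..rho} t *R dilt t u) = dil rho u - dil tau u"
 proof (rule integral_FTC_Icc[OF assms(2) _ c])
  fix t assume "tau <= t" "t <= rho"
  then show "((%t. dil t u) has_vector_derivative dilt t u) (at t within {tau..rho})"
   using dil_DERIV[of t u] assms
   by (auto intro: has_vector_derivative_at_within simp: has_real_derivative_iff_has_vector_derivative)
 qed
 moreover have "(LINT t:{tau<..rho}|lborel. dilt t u) = (LBINT t. indicator {tau..rho} t *R dilt t u)"
 proof -
  have [measurable]: "(%t. dilt t u) \<in> borelm" unfolding dilt_def by measurable
  have "AE t in lborel. t ~= tau" by (rule AE_lborel_singleton)
  then show ?thesis unfolding set_lebesgue_integral_def
   by (intro integral_cong_AE) (auto simp: indicator_def)
 qed
 ultimately show ?thesis by simp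
qed

text \<open>The weak gradient is tested with each coordinate of the field
  \<open>theta ((y - x) / t) (y - x) / t^(d+1)\<close>; the diagonal derivatives add up to its
  divergence, which is \<open>- dilt t (y - x)\<close>.\<close>

lemma weak_identity:
 assumes t: "0 < t" and w: "weak_gradient_pair U phi g" and U: "!!z. z \<in> supp theta ==> x + t *R z \<in> U"
 shows "(LBINT y. dilt t (y - x) * phi y) = (LBINT y. ((theta ((1 / t) *R (y - x)) / t ^ Suc DIM('a)) *R (y - x)) \<bullet> g y)"
proof -
 let ?c = "1 / t ^ Suc DIM('a)"
 let ?psi = "%i y. (?c * theta ((1 / t) *R (y - x))) * ((y - x) \<bullet> i)"
 let ?D = "%i y. (?c * theta ((1 / t) *R (y - x))) *R i + ((y - x) \<bullet> i) *R (?c *R (1 / t) *R Dtheta ((1 / t) *R (y - x)))"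
 have phi: "integrable lborel phi" and g: "integrable lborel g" using w by (auto simp: weak_gradient_pair_def)
 have [measurable]: "phi \<in> borelm" "g \<in> borelm" using phi g by auto
 have cpos: "0 <= ?c" using t by simp
 have yx: "norm (y - x) <= R2 * t" if "(1 / t) *R (y - x) \<in> supp theta" for y
  using supp[OF that] t unfolding norm_scaleR by (auto simp: field_simps)
 have key: "(LBINT y. phi y * (?D i y \<bullet> i)) = - (LBINT y. ?psi i y * (g y \<bullet> i))"
  and i1: "integrable lborel (%y. phi y * (?D i y \<bullet> i))" and i2: "integrable lborel (%y. ?psi i y * (g y \<bullet> i))"
  if i: "i \<in> Basis" for i
 proof -
  have psi: "?psi i \<in> Cc_infinity U" by (rule Cc_infinity_dilation(2)[OF test t U])
  have gd: "GDERIV (?psi i) y :> ?D i y" for y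
   by (rule GDERIV_mult[OF GDERIV_cmult[OF GDERIV_affine[OF gderiv]] GDERIV_coord])
  have eq: "(LBINT y. phi y *R ?D i y) = - (LBINT y. ?psi i y *R g y)"
   using w[unfolded weak_gradient_pair_def, THEN conjunct2, THEN conjunct2, rule_format, OF psi, OF gd] .
  have inner_le: "\<bar>(y - x) \<bullet> i\<bar> <= norm (y - x)" for y by (rule Basis_le_norm[OF i])
  have Db: "norm (?D i y) <= ?c * T + R2 * t * (?c * ((1 / t) * T))" for y
  proof (cases "(1 / t) *R (y - x) \<in> supp theta")
   case True
   have "norm (?D i y) <= norm ((?c * theta ((1 / t) *R (y - x))) *R i) + norm (((y - x) \<bullet> i) *R (?c *R (1 / t) *R Dtheta ((1 / t) *R (y - x))))"
    by (rule norm_triangle_ineq)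
   moreover have "norm ((?c * theta ((1 / t) *R (y - x))) *R i) <= ?c * T"
    using i t nonneg le cpos by (simp add: divide_right_mono)
   moreover have "norm (((y - x) \<bullet> i) *R (?c *R (1 / t) *R Dtheta ((1 / t) *R (y - x)))) <= R2 * t * (?c * ((1 / t) * T))"
   proof -
    have "\<bar>(y - x) \<bullet> i\<bar> * (?c * ((1 / t) * norm (Dtheta ((1 / t) *R (y - x))))) <= R2 * t * (?c * ((1 / t) * T))"
     using order_trans[OF inner_le yx[OF True]] Dle R2 t cpos by (intro mult_mono) auto
    then show ?thesis using t by (simp del: power_Suc)
   qed
   ultimately show ?thesis by linarith
  next
   case False
   then have "theta ((1 / t) *R (y - x)) = 0" "Dtheta ((1 / t) *R (y - x)) = 0"
    using supp_nz Dsupp by blast+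
   then show ?thesis using T_nonneg R2 t by simp
  qed
  have psib: "\<bar>?psi i y\<bar> <= (?c * T) * (R2 * t)" for y
  proof (cases "(1 / t) *R (y - x) \<in> supp theta")
   case True
   have "\<bar>?c * theta ((1 / t) *R (y - x))\<bar> <= ?c * T" using t nonneg le by (simp add: divide_right_mono)
   moreover have "0 <= ?c * T" using t T_nonneg by simp
   ultimately show ?thesis
    unfolding abs_mult[of "?c * theta ((1 / t) *R (y - x))"] by (intro mult_mono order_trans[OF inner_le yx[OF True]]) auto
  next
   case False
   then have "theta ((1 / t) *R (y - x)) = 0" using supp_nz by blast
   then show ?thesis using T_nonneg R2 t by simp
  qed
  have Dm [measurable]: "?D i \<in> borelm" by measurable
  have psim [measurable]: "?psi i \<in> borelm" by measurable
  have iD: "integrable lborel (%y. phi y *R ?D i y)"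
  proof (rule bi_bound[where f="%y. phi y * (?c * T + R2 * t * (?c * ((1 / t) * T)))"])
   show "AE y in lborel. norm (phi y *R ?D i y) <= norm (phi y * (?c * T + R2 * t * (?c * ((1 / t) * T))))"
   proof (intro AE_I2)
    fix y
    show "norm (phi y *R ?D i y) <= norm (phi y * (?c * T + R2 * t * (?c * ((1 / t) * T))))"
     unfolding norm_scaleR real_norm_def abs_mult[of "phi y"]
     by (rule mult_left_mono[OF order_trans[OF Db abs_ge_self]]) simp
   qed
  qed (use phi in auto)
  have ipsi: "integrable lborel (%y. ?psi i y *R g y)"
  proof (rule bi_bound[where f="%y. ((?c * T) * (R2 * t)) *R g y"])
   show "AE y in lborel. norm (?psi i y *R g y) <= norm (((?c * T) * (R2 * t)) *R g y)"
   proof (intro AE_I2)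
    fix y
    show "norm (?psi i y *R g y) <= norm (((?c * T) * (R2 * t)) *R g y)"
     unfolding norm_scaleR by (rule mult_right_mono[OF order_trans[OF psib abs_ge_self]]) simp
   qed
  qed (use g in auto)
  show "integrable lborel (%y. phi y * (?D i y \<bullet> i))" using integrable_inner_left[OF iD, of i] by simp
  show "integrable lborel (%y. ?psi i y * (g y \<bullet> i))" using integrable_inner_left[OF ipsi, of i] by simp
  have "(LBINT y. (phi y *R ?D i y) \<bullet> i) = (LBINT y. phi y *R ?D i y) \<bullet> i"
   by (rule integral_inner_left) (rule iD)
  moreover have "(LBINT y. (?psi i y *R g y) \<bullet> i) = (LBINT y. ?psi i y *R g y) \<bullet> i"
   by (rule integral_inner_left) (rule ipsi)
  ultimately show "(LBINT y. phi y * (?D i y \<bullet> i)) = - (LBINT y. ?psi i y * (g y \<bullet> i))"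
   using eq by (simp only: inner_scaleR_left inner_minus_left)
 qed
 have "(LBINT y. (\<Sum>i\<in>Basis. phi y * (?D i y \<bullet> i))) = - (LBINT y. (\<Sum>i\<in>Basis. ?psi i y * (g y \<bullet> i)))"
  using i1 i2 key by (simp only: bi_sum sum_negf cong: sum.cong)
 moreover have "(\<Sum>i\<in>Basis. phi y * (?D i y \<bullet> i)) = - (dilt t (y - x) * phi y)" for y
 proof -
  have e: "?D i y \<bullet> i = ?c * theta ((1 / t) *R (y - x)) + (?c * (1 / t)) * (((y - x) \<bullet> i) * (Dtheta ((1 / t) *R (y - x)) \<bullet> i))" if "i \<in> Basis" for i
   using that by (simp add: inner_add_left)
  have "(\<Sum>i\<in>Basis. phi y * (?D i y \<bullet> i)) = phi y * (\<Sum>i\<in>Basis. ?D i y \<bullet> i)" by (rule sum_distrib_left[symmetric])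
  also have "(\<Sum>i\<in>Basis. ?D i y \<bullet> i) = (\<Sum>i\<in>Basis. ?c * theta ((1 / t) *R (y - x)) + (?c * (1 / t)) * (((y - x) \<bullet> i) * (Dtheta ((1 / t) *R (y - x)) \<bullet> i)))"
   by (rule sum.cong[OF refl e])
  also have "\<dots> = real DIM('a) * (?c * theta ((1 / t) *R (y - x))) + (?c * (1 / t)) * ((y - x) \<bullet> Dtheta ((1 / t) *R (y - x)))"
   unfolding sum.distrib sum_distrib_left[symmetric] euclidean_inner[symmetric] by simp
  also have "\<dots> = - dilt t (y - x)"
   by (simp add: dilt_def inner_commute mult.commute)
  finally show ?thesis by (simp add: mult.commute)
 qed
 moreover have "(\<Sum>i\<in>Basis. ?psi i y * (g y \<bullet> i)) = ((theta ((1 / t) *R (y - x)) / t ^ Suc DIM('a)) *R (y - x)) \<bullet> g y" for y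
 proof -
  have "(\<Sum>i\<in>Basis. ?psi i y * (g y \<bullet> i)) = (theta ((1 / t) *R (y - x)) / t ^ Suc DIM('a)) * (\<Sum>i\<in>Basis. ((y - x) \<bullet> i) * (g y \<bullet> i))"
   unfolding sum_distrib_left by (rule sum.cong) (simp_all del: power_Suc)
  then show ?thesis by (simp only: euclidean_inner[symmetric] inner_scaleR_left)
 qed
 ultimately show ?thesis by simp
qed

end

section \<open>Kernel bounds in the exponent and local representatives\<close>

lemma conj_exp_gt_1: "1 < alpha ==> 1 < conj_exp alpha"
 by (simp add: conj_exp_def field_simps)

text \<open>The second inequality is exactly the condition under which
  \<open>norm u powr (1 - d)\<close> is locally integrable to the power \<open>alpha\<close>;
  \<open>J rho\<close> measures the kernel in this sense.\<close>

locale bump_exp = bump +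
 fixes alpha :: real
 assumes alpha: "1 < alpha" "alpha * (real DIM('a) - 1) < real DIM('a)"
begin

definition J :: "real => real" where
 "J rho = (LBINT u. norm (ker rho u) powr alpha)"

lemma ker_powr_bound:
 "norm (ker rho u) powr alpha <= C0 powr alpha * (indicator (ball 0 (R2 * rho)) u * norm u powr (- (alpha * (real DIM('a) - 1))))"
proof -
 have "norm (ker rho u) powr alpha <= (C0 * (indicator (ball 0 (R2 * rho)) u * norm u powr (- (real DIM('a) - 1)))) powr alpha"
  using alpha by (intro powr_mono2 ker_bound) auto
 also have "\<dots> = C0 powr alpha * (indicator (ball 0 (R2 * rho)) u * norm u powr (- (alpha * (real DIM('a) - 1))))"
  using C0_nonneg by (cases "u \<in> ball 0 (R2 * rho)") (simp_all add: powr_mult powr_powr algebra_simps)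
 finally show ?thesis .
qed

lemma powr_kernel_integrable:
 "integrable lborel (%u::'a. indicator (ball 0 r) u * norm u powr (- (alpha * (real DIM('a) - 1))))"
 using alpha by (intro integrable_norm_powr) (auto simp: DIM_positive Suc_leI)

lemma ker_powr_integrable: "integrable lborel (%u. norm (ker rho u) powr alpha)"
proof (rule bi_bound)
 show "integrable lborel (%u::'a. C0 powr alpha * (indicator (ball 0 (R2 * rho)) u * norm u powr (- (alpha * (real DIM('a) - 1)))))"
  by (rule integrable_mult_right[OF powr_kernel_integrable])
 show "AE u in lborel. norm (norm (ker rho u) powr alpha) <= norm (C0 powr alpha * (indicator (ball 0 (R2 * rho)) u * norm u powr (- (alpha * (real DIM('a) - 1)))))"
  unfolding real_norm_def abs_of_nonneg[OF powr_ge_zero]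
  by (intro AE_I2 order_trans[OF ker_powr_bound abs_ge_self])
qed measurable

lemma J_nonneg: "0 <= J rho" unfolding J_def by simp

lemma J_tendsto_0:
 assumes "rho \<longlonglongrightarrow> 0"
 shows "(%k. J (rho k)) \<longlonglongrightarrow> 0"
proof (rule Lim_null_comparison[OF always_eventually], rule allI)
 have "(%k. R2 * rho k) \<longlonglongrightarrow> R2 * 0" by (intro tendsto_mult tendsto_const assms)
 then have "(%k. R2 * rho k) \<longlonglongrightarrow> 0" by simp
 then have "(%k. LINT u|lborel. indicator (ball (0::'a) (R2 * rho k)) u * norm u powr (- (alpha * (real DIM('a) - 1)))) \<longlonglongrightarrow> 0"
  using alpha by (intro tendsto_integral_norm_powr) (auto simp: DIM_positive Suc_leI)
 from tendsto_mult[OF tendsto_const[of "C0 powr alpha"] this]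
 show "(%k. C0 powr alpha * (LBINT u. indicator (ball (0::'a) (R2 * rho k)) u * norm u powr (- (alpha * (real DIM('a) - 1))))) \<longlonglongrightarrow> 0"
  by simp
 show "norm (J (rho k)) <= C0 powr alpha * (LBINT u. indicator (ball (0::'a) (R2 * rho k)) u * norm u powr (- (alpha * (real DIM('a) - 1))))" for k
 proof -
  have "J (rho k) <= (LBINT u. C0 powr alpha * (indicator (ball (0::'a) (R2 * rho k)) u * norm u powr (- (alpha * (real DIM('a) - 1)))))"
   unfolding J_def by (rule integral_mono[OF ker_powr_integrable integrable_mult_right[OF powr_kernel_integrable] ker_powr_bound])
  then show ?thesis using J_nonneg by simp
 qed
qed

lemma ker_shift_powr:
 "integrable lborel (%y. norm (ker rho (y - x)) powr alpha)"
 "(LBINT y. norm (ker rho (y - x)) powr alpha) = J rho"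
proof -
 show "integrable lborel (%y. norm (ker rho (y - x)) powr alpha)"
  using integrable_lborel_affine[OF ker_powr_integrable, of 1 rho "- x"] by simp
 have "(LBINT u. norm (ker rho u) powr alpha) = \<bar>1\<bar> ^ DIM('a) *R (LBINT y. norm (ker rho (- x + 1 *R y)) powr alpha)"
  by (rule integral_lborel_affine) auto
 then show "(LBINT y. norm (ker rho (y - x)) powr alpha) = J rho"
  by (simp add: J_def)
qed

text \<open>Young's inequality with a constant weight bounds the convolution independently of
  \<open>x\<close>, because the kernel integral \<open>J rho\<close> is translation
  invariant.\<close>

lemma
 assumes [measurable]: "g \<in> borelm" and g: "integrable lborel (%y. norm (g y) powr conj_exp alpha)"
 shows ker_inner_integrable: "integrable lborel (%y. ker rho (y - x) \<bullet> g y)"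
  and ker_norm_integrable: "integrable lborel (%y. norm (ker rho (y - x)) * norm (g y))"
  and ker_norm_integral_le: "0 < \<sigma> ==> (LBINT y. norm (ker rho (y - x)) * norm (g y))
     <= \<sigma> powr (- alpha) * J rho + \<sigma> powr conj_exp alpha * (LBINT y. norm (g y) powr conj_exp alpha)"
proof -
 have young: "norm (ker rho (y - x)) * norm (g y) <= \<sigma> powr (- alpha) * norm (ker rho (y - x)) powr alpha + \<sigma> powr conj_exp alpha * norm (g y) powr conj_exp alpha"
  if "0 < \<sigma>" for \<sigma> y
  using Youngs_inequality_conj_exp[OF alpha(1) _ _ that] by simp
 have ri: "integrable lborel (%y. \<sigma> powr (- alpha) * norm (ker rho (y - x)) powr alpha + \<sigma> powr conj_exp alpha * norm (g y) powr conj_exp alpha)" for \<sigma>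
  by (intro bi_addI integrable_mult_right ker_shift_powr g)
 show i: "integrable lborel (%y. norm (ker rho (y - x)) * norm (g y))"
 proof (rule bi_bound[OF ri[of 1]])
  show "AE y in lborel. norm (norm (ker rho (y - x)) * norm (g y)) <= norm (1 powr (- alpha) * norm (ker rho (y - x)) powr alpha + 1 powr conj_exp alpha * norm (g y) powr conj_exp alpha)"
  proof (intro AE_I2)
   fix y
   have "norm (norm (ker rho (y - x)) * norm (g y)) = norm (ker rho (y - x)) * norm (g y)" by simp
   also note young[of 1 y, OF zero_less_one]
   finally show "norm (norm (ker rho (y - x)) * norm (g y)) <= norm (1 powr (- alpha) * norm (ker rho (y - x)) powr alpha + 1 powr conj_exp alpha * norm (g y) powr conj_exp alpha)"
    by simp
  qed
 qed measurable
 show "integrable lborel (%y. ker rho (y - x) \<bullet> g y)"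
  by (rule bi_bound[OF i]) (auto simp: Cauchy_Schwarz_ineq2)
 assume \<sigma>: "0 < \<sigma>"
 have "(LBINT y. norm (ker rho (y - x)) * norm (g y)) <= (LBINT y. \<sigma> powr (- alpha) * norm (ker rho (y - x)) powr alpha + \<sigma> powr conj_exp alpha * norm (g y) powr conj_exp alpha)"
  by (rule integral_mono[OF i ri young[OF \<sigma>]])
 also have "\<dots> = \<sigma> powr (- alpha) * J rho + \<sigma> powr conj_exp alpha * (LBINT y. norm (g y) powr conj_exp alpha)"
  using ker_shift_powr[of rho x] g by simp
 finally show "(LBINT y. norm (ker rho (y - x)) * norm (g y))
     <= \<sigma> powr (- alpha) * J rho + \<sigma> powr conj_exp alpha * (LBINT y. norm (g y) powr conj_exp alpha)" .
qed

lemma cor_le: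
 assumes "g \<in> borelm" "integrable lborel (%y. norm (g y) powr conj_exp alpha)" "0 < \<sigma>"
 shows "\<bar>cor rho g x\<bar> <= \<sigma> powr (- alpha) * J rho + \<sigma> powr conj_exp alpha * (LBINT y. norm (g y) powr conj_exp alpha)"
proof -
 have "\<bar>cor rho g x\<bar> <= (LBINT y. norm (ker rho (y - x)) * norm (g y))"
  unfolding cor_def real_norm_def[symmetric]
  by (rule norm_integral_le[OF ker_norm_integrable[OF assms(1,2)]]) (simp add: Cauchy_Schwarz_ineq2)
 also note ker_norm_integral_le[OF assms]
 finally show ?thesis .
qed

text \<open>The weight \<open>\<sigma>\<close> is fixed before the cone length, so that the gradient
  term stays below \<open>e / 2\<close> throughout; then \<open>J (tau k)\<close> makes the kernel
  term small.\<close>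

lemma cor_small:
 assumes g: "g \<in> borelm" "integrable lborel (%y. norm (g y) powr conj_exp alpha)"
  and tau: "tau \<longlonglongrightarrow> 0" and e: "0 < e"
 shows "\<forall>\<^sub>F k in sequentially. \<forall>x. \<bar>cor (tau k) g x\<bar> < e"
proof -
 define G where "G = (LBINT y. norm (g y) powr conj_exp alpha)"
 have G: "0 <= G" unfolding G_def by simp
 have p: "1 < conj_exp alpha" by (rule conj_exp_gt_1[OF alpha(1)])
 \<comment> \<open>Solves \<open>\<sigma> powr conj_exp alpha * (G + 1) = e / 2\<close>; the added 1
   keeps the quotient meaningful when \<open>G = 0\<close>.\<close>
 define \<sigma> where "\<sigma> = (e / (2 * (G + 1))) powr (1 / conj_exp alpha)"
 have \<sigma>: "0 < \<sigma>" using e G by (simp add: \<sigma>_def)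
 have "\<sigma> powr conj_exp alpha = e / (2 * (G + 1))" using e G p by (simp add: \<sigma>_def powr_powr)
 then have "\<sigma> powr conj_exp alpha * (G + 1) = e / 2" using G by (simp add: field_simps)
 moreover have "0 < \<sigma> powr conj_exp alpha" using \<sigma> by simp
 ultimately have small: "\<sigma> powr conj_exp alpha * G < e / 2"
  unfolding distrib_left mult_1_right by linarith
 have "(%k. \<sigma> powr (- alpha) * J (tau k)) \<longlonglongrightarrow> \<sigma> powr (- alpha) * 0"
  by (intro tendsto_mult tendsto_const J_tendsto_0 tau)
 then have "\<forall>\<^sub>F k in sequentially. \<sigma> powr (- alpha) * J (tau k) < e / 2"
  using order_tendstoD(2)[of "%k. \<sigma> powr (- alpha) * J (tau k)" 0 sequentially "e / 2"] e by simp
 then show ?thesis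
 proof eventually_elim
  case (elim k)
  show ?case
  proof
   fix x
   show "\<bar>cor (tau k) g x\<bar> < e" using cor_le[OF g \<sigma>, of "tau k" x] elim small unfolding G_def by linarith
  qed
 qed
qed

lemma ker_diff:
 assumes "0 < tau" "tau <= rho"
 shows "ker rho u - ker tau u = (LINT t:{tau<..rho}|lborel. (theta ((1 / t) *R u) / t ^ Suc DIM('a)) *R u)"
proof (cases "u = 0")
 case False
 have un: "{0<..rho} = {0<..tau} \<union> {tau<..rho}" using assms by auto
 have i1: "set_integrable lborel {0<..tau} (%t. theta ((1 / t) *R u) / t ^ Suc DIM('a))" by (rule kap_integrable[OF False])
 have i2: "set_integrable lborel {tau<..rho} (%t. theta ((1 / t) *R u) / t ^ Suc DIM('a))"
  by (rule set_integrable_subset[OF kap_integrable[OF False, of rho]]) (use assms in auto)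
 have "kap rho u = kap tau u + (LINT t:{tau<..rho}|lborel. theta ((1 / t) *R u) / t ^ Suc DIM('a))"
  unfolding kap_def un by (rule set_integral_Un[OF _ i1 i2]) auto
 then have "ker rho u - ker tau u = (LINT t:{tau<..rho}|lborel. theta ((1 / t) *R u) / t ^ Suc DIM('a)) *R u"
  by (simp add: ker_def scaleR_left_distrib)
 also have "\<dots> = (LINT t:{tau<..rho}|lborel. (theta ((1 / t) *R u) / t ^ Suc DIM('a)) *R u)"
 proof -
  have "(LBINT t. (indicator {tau<..rho} t *R (theta ((1 / t) *R u) / t ^ Suc DIM('a))) *R u)
    = (LBINT t. indicator {tau<..rho} t *R (theta ((1 / t) *R u) / t ^ Suc DIM('a))) *R u"
   by (rule integral_scaleR_left) (use i2 in \<open>simp add: set_integrable_def\<close>)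
  then show ?thesis unfolding set_lebesgue_integral_def by simp
 qed
 finally show ?thesis .
qed (simp add: set_lebesgue_integral_def)

text \<open>The derivative of \<open>dil t\<close> is integrated over \<open>{tau<..rho}\<close>,
  and \<open>weak_identity\<close> is applied for each \<open>t\<close> between two exchanges of
  integrals. The lower end \<open>tau > 0\<close> keeps all kernels bounded, as the exchanges
  require.\<close>

lemma avg_diff_eq_cor_diff:
 assumes w: "weak_gradient_pair U phi g" and g: "integrable lborel (%y. norm (g y) powr conj_exp alpha)"
  and tau: "0 < tau" "tau <= rho" and U: "!!t z. 0 < t ==> t <= rho ==> z \<in> supp theta ==> x + t *R z \<in> U"
 shows "avg rho phi x - avg tau phi x = cor rho g x - cor tau g x"
proof -
 have phi: "integrable lborel phi" and gi: "integrable lborel g" using w by (auto simp: weak_gradient_pair_def)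
 have [measurable]: "phi \<in> borelm" "g \<in> borelm" using phi gi by auto
 have rho: "0 < rho" using tau by simp
 let ?I = "{tau<..rho}"
 let ?h = "%t y. (theta ((1 / t) *R (y - x)) / t ^ Suc DIM('a)) *R (y - x)"
 have I: "?I \<in> sets borel" "emeasure lborel ?I < \<infinity>" using tau by (auto simp: emeasure_lborel_Ioc)
 have pw: "1 / t ^ k <= 1 / tau ^ k" if "t \<in> ?I" for t k
  using that tau by (intro divide_left_mono power_mono) auto
 have sb: "norm u <= R2 * rho" if "t \<in> ?I" "(1 / t) *R u \<in> supp theta" for t u
 proof -
  have "norm u / t < R2" using supp[OF that(2)] that(1) tau by auto
  then have "norm u <= R2 * t" using that(1) tau by (auto simp: field_simps)
  also have "\<dots> <= R2 * rho" using that(1) R2 by auto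
  finally show ?thesis .
 qed
 have h_bound: "norm (?h t y) <= T * (1 / tau ^ Suc DIM('a)) * (R2 * rho)" if t: "t \<in> ?I" for t y
 proof (cases "(1 / t) *R (y - x) \<in> supp theta")
  case True
  have "norm (?h t y) = theta ((1 / t) *R (y - x)) * (1 / t ^ Suc DIM('a)) * norm (y - x)"
   using t tau nonneg by simp
  also have "\<dots> <= T * (1 / tau ^ Suc DIM('a)) * (R2 * rho)"
   using t tau nonneg le T_nonneg R2 by (intro mult_mono pw sb[OF t True]) (auto simp del: power_Suc)
  finally show ?thesis .
 next
  case False
  then have "theta ((1 / t) *R (y - x)) = 0" using supp_nz by blast
  then show ?thesis using T_nonneg R2 tau by simp
 qed
 have d_bound: "norm (dilt t (y - x)) <= real DIM('a) * T * (1 / tau ^ Suc DIM('a)) + T * (R2 * rho) * (1 / tau ^ Suc (Suc DIM('a)))" if t: "t \<in> ?I" for t y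
 proof (cases "(1 / t) *R (y - x) \<in> supp theta")
  case True
  have "norm (dilt t (y - x)) <= real DIM('a) * theta ((1 / t) *R (y - x)) * (1 / t ^ Suc DIM('a)) + \<bar>Dtheta ((1 / t) *R (y - x)) \<bullet> (y - x)\<bar> * (1 / t ^ Suc (Suc DIM('a)))"
   unfolding dilt_def real_norm_def abs_minus_cancel
   by (rule order_trans[OF abs_triangle_ineq]) (use t tau nonneg in \<open>simp add: abs_mult abs_divide\<close>)
  also have "\<bar>Dtheta ((1 / t) *R (y - x)) \<bullet> (y - x)\<bar> <= T * (R2 * rho)"
   by (rule order_trans[OF Cauchy_Schwarz_ineq2]) (intro mult_mono Dle sb[OF t True] T_nonneg norm_ge_zero)
  finally have a: "norm (dilt t (y - x)) <= real DIM('a) * theta ((1 / t) *R (y - x)) * (1 / t ^ Suc DIM('a)) + T * (R2 * rho) * (1 / t ^ Suc (Suc DIM('a)))"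
   using t tau by (simp add: divide_right_mono)
  have "real DIM('a) * theta ((1 / t) *R (y - x)) * (1 / t ^ Suc DIM('a)) <= real DIM('a) * T * (1 / tau ^ Suc DIM('a))"
   using t tau nonneg le T_nonneg by (intro mult_mono mult_left_mono pw) (auto simp del: power_Suc)
  moreover have "T * (R2 * rho) * (1 / t ^ Suc (Suc DIM('a))) <= T * (R2 * rho) * (1 / tau ^ Suc (Suc DIM('a)))"
   using T_nonneg R2 rho by (intro mult_left_mono pw[OF t]) auto
  ultimately show ?thesis using a by linarith
 next
  case False
  then have "theta ((1 / t) *R (y - x)) = 0" "Dtheta ((1 / t) *R (y - x)) = 0" using supp_nz Dsupp by blast+
  then show ?thesis using T_nonneg R2 tau by (simp add: dilt_def)
 qed
 have avgd: "avg rho phi x - avg tau phi x = (LBINT y. (LINT t:?I|lborel. dilt t (y - x)) \<bullet> phi y)"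
  unfolding avg_def dilt_FTC[OF tau] inner_real_def left_diff_distrib real_scaleR_def
  by (rule bi_diff[symmetric])
   (use avg_integrable[OF rho phi, of x] avg_integrable[OF tau(1) phi, of x] in simp_all)
 also have "\<dots> = (LINT t:?I|lborel. LINT y|lborel. dilt t (y - x) \<bullet> phi y)"
 proof (rule lborel_strip_Fubini[symmetric, OF _ I d_bound phi])
  show "(%z. dilt (fst z) (snd z - x)) \<in> borelm"
   unfolding dilt_def borel_prod[symmetric] by measurable
 qed
 also have "\<dots> = (LINT t:?I|lborel. LINT y|lborel. ?h t y \<bullet> g y)"
  unfolding set_lebesgue_integral_def
 proof (intro bi_cong refl)
  fix t :: real
  show "indicator ?I t *R (LBINT y. dilt t (y - x) \<bullet> phi y) = indicator ?I t *R (LBINT y. ?h t y \<bullet> g y)"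
  proof (cases "t \<in> ?I")
   case True
   then have "(LBINT y. dilt t (y - x) * phi y) = (LBINT y. ?h t y \<bullet> g y)"
    using tau by (intro weak_identity[OF _ w] U) auto
   then show ?thesis by (simp only: inner_real_def)
  qed simp
 qed
 also have "\<dots> = (LBINT y. (LINT t:?I|lborel. ?h t y) \<bullet> g y)"
 proof (rule lborel_strip_Fubini[OF _ I h_bound gi])
  show "(%z. ?h (fst z) (snd z)) \<in> borelm"
   unfolding borel_prod[symmetric] by measurable
 qed
 also have "\<dots> = (LBINT y. ker rho (y - x) \<bullet> g y - ker tau (y - x) \<bullet> g y)"
  unfolding ker_diff[OF tau, symmetric] inner_diff_left ..
 also have "\<dots> = cor rho g x - cor tau g x"
  unfolding cor_def by (rule bi_diff) (rule ker_inner_integrable, measurable, rule g)+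
 finally show ?thesis .
qed

text \<open>The local Sobolev embedding: on the points \<open>x\<close> whose truncated cone \<open>x + (0, rho] supp theta\<close> lies in
 \<open>U\<close>, the function \<open>avg rho phi - cor rho g\<close> is the continuous representative of \<open>phi\<close>.\<close>

lemma representative:
 assumes w: "weak_gradient_pair U phi g" and g: "integrable lborel (%y. norm (g y) powr conj_exp alpha)"
  and rho: "0 < rho" and U: "!!x t z. x \<in> A ==> 0 < t ==> t <= rho ==> z \<in> supp theta ==> x + t *R z \<in> U"
 shows representative_continuous: "continuous_on A (%x. avg rho phi x - cor rho g x)"
  and representative_AE: "open V ==> V \<subseteq> A ==> AE x in lborel. x \<in> V --> phi x = avg rho phi x - cor rho g x"
proof -
 have phi: "integrable lborel phi" and gi: "integrable lborel g" using w by (auto simp: weak_gradient_pair_def)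
 have gm [measurable]: "phi \<in> borelm" "g \<in> borelm" using phi gi by auto
 define tau where "tau k = rho / (real k + 1)" for k :: nat
 have taupos: "0 < tau k" "tau k <= rho" for k using rho by (auto simp: tau_def field_simps)
 have tau0: "tau \<longlonglongrightarrow> 0"
  unfolding tau_def using tendsto_mult[OF tendsto_const[of rho] LIMSEQ_inverse_real_of_nat]
  by (simp add: divide_inverse add.commute)
 have eq: "avg (tau k) phi x = avg rho phi x - cor rho g x + cor (tau k) g x" if "x \<in> A" for x k
  using avg_diff_eq_cor_diff[OF w g taupos, of x k] U[OF that] by simp
 \<comment> \<open>The average over the cone of length \<open>tau k\<close> differs from the
   proposed limit by \<open>cor (tau k) g\<close>, which is uniformly small.\<close>
 have unif: "uniform_limit A (%k. avg (tau k) phi) (%x. avg rho phi x - cor rho g x) sequentially"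
  unfolding uniform_limit_iff
 proof (intro allI impI)
  fix e :: real assume "0 < e"
  from cor_small[OF gm(2) g tau0 this]
  show "\<forall>\<^sub>F k in sequentially. \<forall>x\<in>A. dist (avg (tau k) phi x) (avg rho phi x - cor rho g x) < e"
   by eventually_elim (auto simp: dist_real_def eq)
 qed
 show "continuous_on A (%x. avg rho phi x - cor rho g x)"
  by (rule uniform_limit_theorem[OF always_eventually unif])
   (auto intro: continuous_on_subset[OF avg_continuous[OF taupos(1) phi]])
 assume V: "open V" "V \<subseteq> A"
 define c where "c x = avg rho phi x - cor rho g x" for x
 have [measurable]: "avg rho phi \<in> borelm"
  by (rule borel_measurable_continuous_onI[OF avg_continuous[OF rho phi]])
 have [measurable]: "c \<in> borelm" unfolding c_def[abs_def] cor_def by measurable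
 obtain B where B: "!!x k. x \<in> V ==> \<bar>avg (tau k) phi x\<bar> <= B"
 proof -
  define G where "G = (LBINT y. norm (g y) powr conj_exp alpha)"
  \<comment> \<open>The kernels increase with the cone length, so one constant bounds the
    corrections for all \<open>k\<close>.\<close>
  have Jtau: "J (tau k) <= J rho" for k
   unfolding J_def
  proof (rule integral_mono[OF ker_powr_integrable ker_powr_integrable])
   fix u
   have "norm (ker (tau k) u) <= norm (ker rho u)"
   proof (cases "u = 0")
    case False
    have "kap (tau k) u <= kap rho u"
     unfolding kap_def set_lebesgue_integral_def
    proof (rule integral_mono)
     fix t :: real
     show "indicator {0<..tau k} t *R (theta ((1 / t) *R u) / t ^ Suc DIM('a)) <= indicator {0<..rho} t *R (theta ((1 / t) *R u) / t ^ Suc DIM('a))"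
      using kap_integrand(1)[OF _ False, of t] taupos(2)[of k] by (auto simp: indicator_def)
    qed (use kap_integrable[OF False] in \<open>auto simp: set_integrable_def\<close>)
    then show ?thesis using kap_bounds(1)[OF False] by (simp add: ker_def mult_right_mono)
   qed simp
   then show "norm (ker (tau k) u) powr alpha <= norm (ker rho u) powr alpha" using alpha by (intro powr_mono2) auto
  qed
  have "\<bar>avg (tau k) phi x\<bar> <= T / rho ^ DIM('a) * (LBINT y. norm (phi y)) + (J rho + G) + (J rho + G)" if "x \<in> V" for x k
  proof -
   have "\<bar>avg rho phi x\<bar> <= T / rho ^ DIM('a) * (LBINT y. norm (phi y))"
    using avg_bound[OF rho phi, of x] by simp
   moreover have "\<bar>cor rho g x\<bar> <= J rho + G" using cor_le[OF gm(2) g zero_less_one, of rho x] by (simp add: G_def)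
   moreover have "\<bar>cor (tau k) g x\<bar> <= J rho + G"
    using cor_le[OF gm(2) g zero_less_one, of "tau k" x] Jtau[of k] by (simp add: G_def)
   ultimately show ?thesis using eq[of x k] that V by auto
  qed
  then show ?thesis by (rule that)
 qed
 have "AE x in lborel. x \<in> V --> phi x = c x"
 proof (rule avg_limit_AE[OF phi tau0 taupos(1) V(1) _ _ B])
  show "(%k. avg (tau k) phi x) \<longlonglongrightarrow> c x" if "x \<in> V" for x
   using tendsto_uniform_limitI[OF unif] that V(2) by (auto simp: c_def)
 qed measurable
 then show "AE x in lborel. x \<in> V --> phi x = avg rho phi x - cor rho g x" by (simp add: c_def)
qed

end

section \<open>Compactly supported functions and translated mollifiers\<close>

lemma GDERIV_unique: "GDERIV f x :> D ==> GDERIV f x :> E ==> D = E"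
 unfolding gderiv_def using has_derivative_unique by (metis vector_eq_rdot inner_commute)

lemma Cc_infinity_gradient:
 assumes "psi \<in> Cc_infinity U" and D: "!!x. GDERIV psi x :> D x"
 shows "continuous_on UNIV D" "!!x. x \<notin> supp psi ==> D x = 0"
proof -
 have "Ck (Suc 0) psi" using assms(1) unfolding Cc_infinity_def by blast
 then obtain E where E: "!!x. GDERIV psi x :> E x" "!!i. i \<in> Basis ==> continuous_on UNIV (%x. E x \<bullet> i)"
  by auto
 have "D = E" using GDERIV_unique[OF D E(1)] by auto
 then show "continuous_on UNIV D"
  using E(2) by (subst continuous_on_componentwise) auto
 show "D x = 0" if "x \<notin> supp psi" for x
 proof -
  have "open (- supp psi)" "x \<in> - supp psi" using that by (auto simp: supp_def)
  then obtain S where "open S" "x \<in> S" "S \<subseteq> - supp psi" by blast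
  have zero: "psi y = 0" if "y \<in> - supp psi" for y
   using that closure_subset[of "{x. psi x ~= 0}"] unfolding supp_def by blast
  have "((%_. 0) has_derivative (%h. h \<bullet> 0)) (at x)" by simp
  then have "(psi has_derivative (%h. h \<bullet> 0)) (at x)"
   by (rule has_derivative_transform_within_open[OF _ \<open>open (- supp psi)\<close> \<open>x \<in> - supp psi\<close>]) (simp add: zero)
  then show ?thesis using GDERIV_unique[OF D, of x 0] by (simp add: gderiv_def)
 qed
qed

lemma supp_zero: "x \<notin> supp psi ==> psi x = 0"
 unfolding supp_def using closure_subset[of "{x. psi x ~= 0}"] by blast

lemma bounded_of_compact_support:
 fixes f :: "'a::euclidean_space => 'b::euclidean_space"
 assumes "continuous_on UNIV f" "compact S" "!!x. x \<notin> S ==> f x = 0"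
 obtains B where "0 < B" "!!x. norm (f x) <= B"
proof -
 have "bounded (f ` S)" by (intro compact_imp_bounded compact_continuous_image continuous_on_subset[OF assms(1)] assms(2)) simp
 then obtain B where B: "0 < B" "\<forall>y\<in>f ` S. norm y <= B" using bounded_pos by blast
 have "norm (f x) <= B" for x using B assms(3)[of x] by (cases "x \<in> S") auto
 then show ?thesis using that B(1) by blast
qed

lemma uniformly_continuous_of_compact_support:
 fixes f :: "'a::euclidean_space => 'b::euclidean_space"
 assumes f: "continuous_on UNIV f" and S: "compact S" "!!x. x \<notin> S ==> f x = 0"
 shows "uniformly_continuous_on UNIV f"
proof -
 obtain R where R: "!!x. x \<in> S ==> norm x <= R"
  using compact_imp_bounded[OF S(1)] by (auto simp: bounded_iff)
 have uc: "uniformly_continuous_on (cball 0 (R + 2)) f"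
  by (intro compact_uniformly_continuous continuous_on_subset[OF f]) auto
 show ?thesis
  unfolding uniformly_continuous_on_def
 proof (intro allI impI)
  fix e :: real assume "0 < e"
  then obtain d where d: "0 < d" "!!x x'. x \<in> cball 0 (R + 2) ==> x' \<in> cball 0 (R + 2) ==> dist x' x < d ==> dist (f x') (f x) < e"
   using uc unfolding uniformly_continuous_on_def by metis
  show "\<exists>d>0. \<forall>x\<in>UNIV. \<forall>x'\<in>UNIV. dist x' x < d --> dist (f x') (f x) < e"
  proof (intro exI[of _ "min d 1"] conjI ballI impI)
   fix x x' :: 'a assume dd: "dist x' x < min d 1"
   show "dist (f x') (f x) < e"
   proof (cases "norm x <= R + 1")
    case True
    have "norm x' <= norm x + dist x' x" by (metis dist_norm norm_triangle_sub)
    then have "norm x' <= R + 2" using True dd by simp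
    then show ?thesis using d(2)[of x x'] True dd by auto
   next
    case False
    have "norm x <= norm x' + dist x' x" by (metis dist_norm norm_triangle_sub dist_commute)
    then have "\<not> norm x' <= R" using False dd by simp
    then have "x' \<notin> S" using R by blast
     moreover have "x \<notin> S" using R[of x] False by auto
     ultimately have "f x = 0" "f x' = 0" using S(2) by auto
    then show ?thesis using \<open>0 < e\<close> by simp
   qed
  qed (use d in simp)
 qed
qed

text \<open>A translation by a vector longer than the support radius moves the support into a ball
  off the origin, whose dilates sweep out a cone with axis \<open>a\<close>.\<close>

lemma bump_translate:
 fixes eta :: "'a::euclidean_space => real"
 assumes eta: "eta \<in> Cc_infinity UNIV" "!!x. 0 <= eta x" "(LINT x|lebesgue. eta x) = 1" "supp eta \<subseteq> ball 0 kappa"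
  and a: "kappa < norm a"
 obtains D T where "bump (%z. eta (z - a)) D T (norm a - kappa) (norm a + kappa)"
  "supp (%z. eta (z - a)) \<subseteq> ball a kappa"
proof -
 let ?theta = "%z. eta (z - a)"
 have cs: "compact (supp eta)" using eta(1) by (simp add: Cc_infinity_def)
 have "Ck (Suc 0) eta" using eta(1) unfolding Cc_infinity_def by blast
 then obtain E where E: "!!x. GDERIV eta x :> E x" by auto
 have Ec: "continuous_on UNIV E" "!!x. x \<notin> supp eta ==> E x = 0"
  using Cc_infinity_gradient[OF eta(1) E] by auto
 have etac: "continuous_on UNIV eta" by (rule GDERIV_continuous[OF E])
 obtain B1 where B1: "!!x. norm (E x) <= B1" using bounded_of_compact_support[OF Ec(1) cs Ec(2)] by blast
 obtain B2 where B2: "!!x. norm (eta x) <= B2" using bounded_of_compact_support[OF etac cs supp_zero[of _ eta]] by blast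
 have test: "?theta \<in> Cc_infinity UNIV"
 proof (rule Cc_infinityI[of _ "(%z. z + a) ` supp eta"])
  show "Ck k ?theta" for k using Ck_affine[of k eta 1 a] eta(1) by (auto simp: Cc_infinity_def)
  show "compact ((%z. z + a) ` supp eta)" by (intro compact_continuous_image cs continuous_intros)
  show "?theta y = 0" if "y \<notin> (%z. z + a) ` supp eta" for y
  proof (rule supp_zero[of "y - a" eta])
   show "y - a \<notin> supp eta" using that by (force intro: image_eqI[of _ _ "y - a"])
  qed
 qed simp
 have sub: "supp ?theta \<subseteq> (%z. z + a) ` supp eta"
 proof -
  have "{x. ?theta x ~= 0} \<subseteq> (%z. z + a) ` supp eta"
   using supp_zero[of _ eta] by (force intro: image_eqI[of _ _ "_ - a"])
  moreover have "closed ((%z. z + a) ` supp eta)"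
   by (intro compact_imp_closed compact_continuous_image cs continuous_intros)
  ultimately show ?thesis unfolding supp_def[of ?theta] by (rule closure_minimal)
 qed
 have sub': "supp ?theta \<subseteq> ball a kappa"
  using sub eta(4) by (auto simp: dist_norm subset_iff)
 have "bump ?theta (%z. E (z - a)) (max B1 B2) (norm a - kappa) (norm a + kappa)"
 proof
  show "?theta \<in> Cc_infinity UNIV" by (rule test)
  show gd: "GDERIV ?theta z :> E (z - a)" for z
   using GDERIV_affine[of eta 1 z a "E (z - a)"] E[of "z - a"] by simp
  show "E (z - a) = 0" if "z \<notin> supp ?theta" for z
   by (rule Cc_infinity_gradient(2)[OF test gd that])
  have "uniformly_continuous_on UNIV E" by (rule uniformly_continuous_of_compact_support[OF Ec(1) cs Ec(2)])
  then show "uniformly_continuous_on UNIV (%z. E (z - a))"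
   unfolding uniformly_continuous_on_def
  proof (intro allI impI)
   fix e :: real assume E: "\<forall>e>0. \<exists>d>0. \<forall>x\<in>UNIV. \<forall>x'\<in>UNIV. dist x' x < d --> dist (E x') (E x) < e" and "0 < e"
   then obtain d where d: "0 < d" "!!x x'. dist x' x < d ==> dist (E x') (E x) < e" by blast
   then show "\<exists>d>0. \<forall>x\<in>UNIV. \<forall>x'\<in>UNIV. dist x' x < d --> dist (E (x' - a)) (E (x - a)) < e"
    by (intro exI[of _ d]) (auto simp: dist_norm)
  qed
  show "0 <= ?theta z" for z by (rule eta(2))
  show "?theta z <= max B1 B2" for z using B2[of "z - a"] by simp
  show "norm (E (z - a)) <= max B1 B2" for z using B1[of "z - a"] by simp
  show "norm a - kappa < norm z \<and> norm z < norm a + kappa" if "z \<in> supp ?theta" for z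
  proof -
   have "norm (a - z) < kappa" using that sub' by (auto simp: dist_norm)
   then show ?thesis using norm_triangle_ineq2[of a z] norm_triangle_ineq2[of z a] by (simp add: norm_minus_commute)
  qed
  show "0 < norm a - kappa" using a by simp
  have [measurable]: "eta \<in> borelm" by (rule borel_measurable_continuous_onI[OF etac])
  have "(LBINT z. eta z) = \<bar>1\<bar> ^ DIM('a) *R (LBINT z. eta (- a + 1 *R z))"
   by (rule integral_lborel_affine) auto
  moreover have "(LBINT z. eta z) = 1" using eta(3) by (simp add: integral_completion)
  ultimately show "(LBINT z. ?theta z) = 1" by simp
 qed
 then show ?thesis using that sub' by blast
qed

text \<open>Translation invariance makes every difference quotient integrate to 0; the mean value
  theorem bounds the quotients and identifies their limit, so dominated convergence applies.\<close>

lemma integral_gradient_compact_support: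
 fixes F :: "'a::euclidean_space => real"
 assumes F: "!!x. GDERIV F x :> G x" and G: "continuous_on UNIV G"
  and S: "compact S" "!!x. x \<notin> S ==> F x = 0" "!!x. x \<notin> S ==> G x = 0"
 shows "(LBINT x. G x) = 0"
proof -
 have Fc: "continuous_on UNIV F" by (rule GDERIV_continuous[OF F])
 have [measurable]: "F \<in> borelm" "G \<in> borelm"
  using borel_measurable_continuous_onI Fc G by auto
 obtain B where B: "0 < B" "!!x. norm (G x) <= B" using bounded_of_compact_support[OF G S(1,3)] by blast
 obtain B' where B': "0 < B'" "!!x. norm (F x) <= B'" using bounded_of_compact_support[OF Fc S(1,2)] by blast
 obtain R where R: "!!x. x \<in> S ==> norm x <= R"
  using compact_imp_bounded[OF S(1)] by (auto simp: bounded_iff)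
 have ib: "integrable lborel f" if "f \<in> borelm" "!!x. norm (f x) <= C" "!!x. x \<notin> S ==> f x = 0" for f :: "'a => 'c::euclidean_space" and C
 proof (rule bi_bound[where f="%x. C * indicator (cball 0 R) x"])
  show "integrable lborel (%x::'a. C * indicator (cball 0 R) x)"
   by (intro integrable_mult_right integrable_real_indicator emeasure_bounded_finite) auto
  show "AE x in lborel. norm (f x) <= norm (C * indicator (cball 0 R) x)"
  proof (intro AE_I2)
   fix x
   show "norm (f x) <= norm (C * indicator (cball 0 R) x)"
   proof (cases "x \<in> S")
    case True
    then show ?thesis using R[OF True] that(2)[of x] by (simp add: indicator_def)
   qed (simp add: that(3))
  qed
 qed (use that in simp)
 have iF: "integrable lborel F" by (rule ib[OF _ B'(2) S(2)]) simp
 have iG: "integrable lborel G" by (rule ib[OF _ B(2) S(3)]) simp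
 have "(LBINT x. G x \<bullet> i) = 0" if i: "i \<in> Basis" for i
 proof -
  define h where "h n = 1 / (real n + 1)" for n :: nat
  have h: "0 < h n" "h n <= 1" for n by (auto simp: h_def)
  have h0: "h \<longlonglongrightarrow> 0" unfolding h_def using LIMSEQ_inverse_real_of_nat by (simp add: divide_inverse add.commute)
  have mv: "\<exists>s\<in>{0<..<h n}. F (x + h n *R i) - F x = h n * (G (x + s *R i) \<bullet> i)" for x n
  proof -
   have "\<exists>s. 0 < s \<and> s < h n \<and> F (x + h n *R i) - F (x + 0 *R i) = (h n - 0) * (G (x + s *R i) \<bullet> i)"
   proof (rule MVT2[OF h(1)])
    fix s :: real
    have "((%s. x + s *R i) has_derivative (%k. k *R i)) (at s)"
     by (auto intro!: derivative_eq_intros)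
    from has_derivative_compose[OF this F[unfolded gderiv_def]]
    have "((%s. F (x + s *R i)) has_derivative (%k. (k *R i) \<bullet> G (x + s *R i))) (at s)" .
    then show "((%s. F (x + s *R i)) has_real_derivative (G (x + s *R i) \<bullet> i)) (at s)"
     unfolding has_field_derivative_def by (rule has_derivative_eq_rhs) (simp add: fun_eq_iff inner_commute)
   qed
   then show ?thesis by auto
  qed
  define q where "q n x = (F (x + h n *R i) - F x) / h n" for n x
  have q0: "(LBINT x. q n x) = 0" for n
  proof -
   have "integrable lborel (%x. F (x + h n *R i))"
    using integrable_lborel_affine[OF iF, of 1 "h n *R i"] by (simp add: add.commute)
   moreover have "(LBINT x. F x) = \<bar>1\<bar> ^ DIM('a) *R (LBINT x. F (h n *R i + 1 *R x))"
    by (rule integral_lborel_affine) auto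
   ultimately show ?thesis unfolding q_def using iF by (simp add: add.commute)
  qed
  have "(%n. LINT x|lborel. q n x) \<longlonglongrightarrow> (LBINT x. G x \<bullet> i)"
  proof (rule integral_dominated_convergence[where w="%x. B * indicator (cball 0 (R + 1)) x"])
   show "integrable lborel (%x::'a. B * indicator (cball 0 (R + 1)) x)"
    by (intro integrable_mult_right integrable_real_indicator emeasure_bounded_finite) auto
   show "q n \<in> borel_measurable lborel" for n unfolding q_def by measurable
   show "AE x in lborel. (%n. q n x) \<longlonglongrightarrow> G x \<bullet> i"
   proof (intro AE_I2)
    fix x
    obtain s where s: "!!n. s n \<in> {0<..<h n}" "!!n. F (x + h n *R i) - F x = h n * (G (x + s n *R i) \<bullet> i)"
     using mv[of _ x] by metis
    have "s \<longlonglongrightarrow> 0"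
     by (rule tendsto_sandwich[OF _ _ tendsto_const h0]) (use s(1) in \<open>auto intro!: always_eventually less_imp_le\<close>)
    then have "(%n. x + s n *R i) \<longlonglongrightarrow> x + 0 *R i" by (intro tendsto_intros)
    then have "(%n. G (x + s n *R i)) \<longlonglongrightarrow> G x"
     using continuous_on_tendsto_compose[OF G, of "%n. x + s n *R i" x] by simp
    then have "(%n. G (x + s n *R i) \<bullet> i) \<longlonglongrightarrow> G x \<bullet> i" by (intro tendsto_intros)
    moreover have "q n x = G (x + s n *R i) \<bullet> i" for n using s(2)[of n] h(1)[of n] by (simp add: q_def)
    ultimately show "(%n. q n x) \<longlonglongrightarrow> G x \<bullet> i" by simp
   qed
   show "AE x in lborel. norm (q n x) <= B * indicator (cball 0 (R + 1)) x" for n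
   proof (intro AE_I2)
    fix x
    obtain s where s: "s \<in> {0<..<h n}" "F (x + h n *R i) - F x = h n * (G (x + s *R i) \<bullet> i)"
     using mv by blast
    have qn: "q n x = G (x + s *R i) \<bullet> i" using s(2) h(1)[of n] by (simp add: q_def)
    show "norm (q n x) <= B * indicator (cball 0 (R + 1)) x"
    proof (cases "x \<in> cball 0 (R + 1)")
     case True
     have "\<bar>G (x + s *R i) \<bullet> i\<bar> <= norm (G (x + s *R i))" by (rule Basis_le_norm[OF i])
     also have "\<dots> <= B" by (rule B)
     finally show ?thesis using True by (simp add: qn)
    next
     case False
     have "norm x <= norm (x + s *R i) + norm (s *R i)" using norm_triangle_ineq4[of "x + s *R i" "s *R i"] by simp
     moreover have "norm (s *R i) <= 1" using s(1) h(2)[of n] i by simp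
     ultimately have "x + s *R i \<notin> S" using R[of "x + s *R i"] False by auto
     then show ?thesis using B(1) by (simp add: qn S(3))
    qed
   qed
  qed simp
  then show ?thesis using q0 by (simp add: LIMSEQ_const_iff)
 qed
 then have "(LBINT x. G x) \<bullet> i = 0" if "i \<in> Basis" for i
  using integral_inner_left[of i lborel G] iG that by simp
 then show ?thesis using euclidean_eqI[of "LINT x|lborel. G x" 0] by simp
qed

section \<open>Borel versions of Lebesgue measurable functions\<close>

lemma lebesgue_integral_eq_lborel:
 fixes f g :: "'a::euclidean_space => 'b::euclidean_space"
 assumes f: "f \<in> borel_measurable lebesgue" and g: "g \<in> borelm" and ae: "AE x in lborel. f x = g x"
 shows "integral\<^sup>L lebesgue f = integral\<^sup>L lborel g" "integrable lebesgue f \<longleftrightarrow> integrable lborel g"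
proof -
 have ae': "AE x in lebesgue. f x = g x" using ae by (rule AE_completion)
 have gm: "g \<in> borel_measurable lebesgue" using g by (simp add: measurable_completion)
 show "integral\<^sup>L lebesgue f = integral\<^sup>L lborel g"
  using integral_cong_AE[OF f gm ae'] integral_completion[of g lborel] g by simp
 show "integrable lebesgue f \<longleftrightarrow> integrable lborel g"
  using integrable_cong_AE[OF f gm ae'] integrable_completion[of g lborel] g by simp
qed

lemma borel_representative:
 fixes f :: "'a::euclidean_space => 'b::euclidean_space"
 assumes "f \<in> borel_measurable lebesgue"
 obtains g where "g \<in> borelm" "AE x in lborel. f x = g x"
proof -
 have "\<forall>i\<in>Basis. \<exists>g\<in>borel_measurable lborel. AE x in lborel. f x \<bullet> i = (g x :: real)"
  using assms by (intro ballI completion_ex_borel_measurable_real borel_measurable_inner borel_measurable_const)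
 from bchoice[OF this[unfolded Bex_def]] obtain G where
  G: "!!i. i \<in> Basis ==> G i \<in> borel_measurable lborel" "!!i. i \<in> Basis ==> AE x in lborel. f x \<bullet> i = G i x"
  by blast
 have "(%x. \<Sum>i\<in>Basis. G i x *R i) \<in> borelm" using G(1) by simp
 moreover have "AE x in lborel. \<forall>i\<in>Basis. f x \<bullet> i = G i x"
  using G(2) by (intro AE_finite_allI) auto
 then have "AE x in lborel. f x = (\<Sum>i\<in>Basis. G i x *R i)"
  by eventually_elim (simp add: euclidean_eq_iff[where 'a='b])
 ultimately show ?thesis by (rule that)
qed

section \<open>Sobolev functions on Lipschitz domains\<close>

lemma Lp_borel_representative:
 fixes f :: "'a::euclidean_space => 'b::euclidean_space"
 assumes S: "S \<in> sets borel" "bounded S" and p: "1 <= p" and f: "f \<in> Lp S p"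
 obtains F where "F \<in> borelm" "!!x. x \<notin> S ==> F x = 0"
  "AE x in lborel. (if x \<in> S then f x else 0) = F x" "integrable lborel F" "integrable lborel (%x. norm (F x) powr p)"
  "(%x. if x \<in> S then f x else 0) \<in> borel_measurable lebesgue"
proof -
 have SL: "S \<in> sets lebesgue" using S(1) by simp
 define f' where "f' x = (if x \<in> S then f x else 0)" for x
 have f'm: "f' \<in> borel_measurable lebesgue"
  unfolding f'_def using f SL by (subst borel_measurable_if) (auto simp: Lp_def)
 obtain G where G: "G \<in> borelm" "AE x in lborel. f' x = G x" using borel_representative[OF f'm] by blast
 define F where "F x = indicator S x *R G x" for x
 have Fm [measurable]: "F \<in> borelm" unfolding F_def using G(1) S(1) by measurable
 have ae: "AE x in lborel. f' x = F x" using G(2) by eventually_elim (auto simp: F_def f'_def indicator_def)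
 have "integrable lebesgue (%x. indicator S x *R norm (f x) powr p)"
  using f SL by (subst integrable_restrict_space[symmetric]) (auto simp: Lp_def)
 moreover have "(%x. indicator S x *R norm (f x) powr p) = (%x. norm (f' x) powr p)"
  by (auto simp: f'_def indicator_def fun_eq_iff)
 ultimately have "integrable lebesgue (%x. norm (f' x) powr p)" by simp
 moreover have "(%x. norm (f' x) powr p) \<in> borel_measurable lebesgue" using calculation by (rule borel_measurable_integrable)
 moreover have "AE x in lborel. norm (f' x) powr p = norm (F x) powr p" using ae by eventually_elim simp
 ultimately have Fp: "integrable lborel (%x. norm (F x) powr p)"
  using lebesgue_integral_eq_lborel(2)[of "%x. norm (f' x) powr p" "%x. norm (F x) powr p"] by simp
 \<comment> \<open>On the bounded set \<open>S\<close> the norm is at most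
   \<open>1 + norm (F x) powr p\<close>.\<close>
 have "integrable lborel F"
 proof (rule bi_bound)
  show "integrable lborel (%x. indicator S x + norm (F x) powr p)"
   using S Fp by (intro bi_addI integrable_real_indicator emeasure_bounded_finite) auto
  show "AE x in lborel. norm (F x) <= norm (indicator S x + norm (F x) powr p)"
  proof (intro AE_I2)
   fix x
   show "norm (F x) <= norm (indicator S x + norm (F x) powr p)"
   proof (cases "norm (F x) <= 1")
    case True
    have "norm (F x) <= indicator S x" using True by (cases "x \<in> S") (simp_all add: F_def)
    moreover have "0 <= norm (F x) powr p" by (rule powr_ge_zero)
    ultimately show ?thesis unfolding real_norm_def by linarith
   next
    case False
    then have "norm (F x) powr 1 <= norm (F x) powr p" using p by (intro powr_mono) auto
    then show ?thesis using False by (simp add: indicator_def)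
   qed
  qed
 qed simp
 moreover have "F x = 0" if "x \<notin> S" for x using that by (simp add: F_def)
 moreover note ae[unfolded f'_def] f'm[unfolded f'_def]
 ultimately show ?thesis using that[OF Fm _ _ _ Fp] by blast
qed

text \<open>Passes from Lebesgue measurable functions on \<open>U\<close> to Borel functions on the
  whole space, for which the convolutions are computed.\<close>

lemma weak_pair_of_has_weak_gradient:
 fixes v :: "'a::euclidean_space => real"
 assumes U: "open U" "bounded U" and p: "1 <= p" and v: "v \<in> Lp U p" and g: "g \<in> Lp U p" and w: "has_weak_gradient U v g"
 obtains phi h where "weak_gradient_pair U phi h" "integrable lborel (%x. norm (h x) powr p)"
  "AE x in lborel. (if x \<in> U then v x else 0) = phi x" "AE x in lborel. (if x \<in> U then g x else 0) = h x"
  "!!x. x \<notin> U ==> h x = 0" "h \<in> borelm" "phi \<in> borelm"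
proof -
 have Ub: "U \<in> sets borel" using U by simp
 obtain phi where phi: "phi \<in> borelm" "AE x in lborel. (if x \<in> U then v x else 0) = phi x" "integrable lborel phi"
   "(%x. if x \<in> U then v x else 0) \<in> borel_measurable lebesgue"
  using Lp_borel_representative[OF Ub U(2) p v] by blast
 obtain h where h: "h \<in> borelm" "!!x. x \<notin> U ==> h x = 0" "AE x in lborel. (if x \<in> U then g x else 0) = h x" "integrable lborel h"
  "integrable lborel (%x. norm (h x) powr p)" "(%x. if x \<in> U then g x else 0) \<in> borel_measurable lebesgue"
  using Lp_borel_representative[OF Ub U(2) p g] by blast
 have "weak_gradient_pair U phi h"
  unfolding weak_gradient_pair_def
 proof (intro conjI ballI allI impI phi h)
  fix psi D assume psi: "psi \<in> Cc_infinity U" and D: "\<forall>x. GDERIV psi x :> D x"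
  have Dm [measurable]: "D \<in> borelm"
   using Cc_infinity_gradient(1)[OF psi] D by (intro borel_measurable_continuous_onI) auto
  have psim [measurable]: "psi \<in> borelm"
   using GDERIV_continuous D by (intro borel_measurable_continuous_onI) auto
  have DL: "D \<in> borel_measurable lebesgue" "psi \<in> borel_measurable lebesgue" using Dm psim by (auto simp: measurable_completion)
  have "(LBINT x. phi x *R D x) = (LINT x|lebesgue. (if x \<in> U then v x else 0) *R D x)"
  proof (rule lebesgue_integral_eq_lborel(1)[symmetric])
   show "(%x. (if x \<in> U then v x else 0) *R D x) \<in> borel_measurable lebesgue" by (intro borel_measurable_scaleR phi(4) DL)
   show "(%x. phi x *R D x) \<in> borelm" using phi(1) by measurable
   show "AE x in lborel. (if x \<in> U then v x else 0) *R D x = phi x *R D x" using phi(2) by eventually_elim simp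
  qed
  also have "\<dots> = (LINT x:U|lebesgue. v x *R D x)"
   unfolding set_lebesgue_integral_def by (intro bi_cong) auto
  also have "\<dots> = - (LINT x:U|lebesgue. psi x *R g x)"
   using w psi D unfolding has_weak_gradient_def by blast
  also have "(LINT x:U|lebesgue. psi x *R g x) = (LINT x|lebesgue. psi x *R (if x \<in> U then g x else 0))"
   unfolding set_lebesgue_integral_def by (intro bi_cong) auto
  also have "\<dots> = (LBINT x. psi x *R h x)"
  proof (rule lebesgue_integral_eq_lborel(1))
   show "(%x. psi x *R (if x \<in> U then g x else 0)) \<in> borel_measurable lebesgue" by (intro borel_measurable_scaleR h(6) DL)
   show "(%x. psi x *R h x) \<in> borelm" using h(1) by measurable
   show "AE x in lborel. psi x *R (if x \<in> U then g x else 0) = psi x *R h x" using h(3) by eventually_elim simp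
  qed
  finally show "(LBINT x. phi x *R D x) = - (LBINT x. psi x *R h x)" .
 qed
 then show ?thesis using that phi h by blast
qed

text \<open>\<open>div_eq\<close> quantifies over every weak gradient of a test function, so
  different ones have to be identified. Averages of their difference vanish because the averaging
  density is itself a test function; \<open>bump\<close> only supplies such densities.\<close>

lemma (in bump) weak_gradient_unique:
 fixes U :: "'a set"
 assumes U: "open U" "bounded U" and g1: "has_weak_gradient U v g1" and g2: "has_weak_gradient U v g2"
 shows "AE x in lborel. x \<in> U --> g1 x = g2 x"
proof -
 have ne: "- U ~= {}"
 proof
  assume "- U = {}"
  then have "U = UNIV" by auto
  then show False using U(2) not_bounded_UNIV by simp
 qed
 have cl: "closed (- U)" using U(1) by (rule closed_Compl)
 have V: "AE x in lborel. d < infdist x (- U) --> g1 x = g2 x" if d: "0 < d" for d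
 proof -
  \<comment> \<open>Weak gradients are known to be integrable on compact subsets. \<open>C\<close>
    keeps distance \<open>d / 2\<close> from the complement and contains every point sampled by
    short averages based in \<open>V\<close>.\<close>
  define C where "C = {x. d / 2 <= infdist x (- U)}"
  define V where "V = {x. d < infdist x (- U)}"
  have CU: "C \<subseteq> U"
  proof
   fix x assume "x \<in> C"
   then have "infdist x (- U) ~= 0" using d by (simp add: C_def)
   then show "x \<in> U" using infdist_zero[of x "- U"] by blast
  qed
  have closedC: "closed C" unfolding C_def by (intro closed_Collect_le continuous_intros)
  then have C: "compact C" using bounded_subset[OF U(2) CU] by (simp add: compact_eq_bounded_closed)
  have "open V" unfolding V_def by (intro open_Collect_less continuous_intros)
  have sC: "set_integrable lebesgue C g1" "set_integrable lebesgue C g2"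
   using g1 g2 C CU unfolding has_weak_gradient_def locally_integrable_def by auto
  define f where "f x = indicator C x *R g1 x - indicator C x *R g2 x" for x
  have fint: "integrable lebesgue f" unfolding f_def using sC unfolding set_integrable_def by (rule bi_diffI)
  then have fm: "f \<in> borel_measurable lebesgue" by (rule borel_measurable_integrable)
  obtain F where F: "F \<in> borelm" "AE x in lborel. f x = F x" using borel_representative[OF fm] by blast
  have Fint: "integrable lborel F" using lebesgue_integral_eq_lborel(2)[OF fm F] fint by simp
  have avg0: "avg t F x = 0" if x: "x \<in> V" and t: "0 < t" "R2 * t < d / 2" for x t
  proof -
   let ?psi = "%y. (1 / t ^ DIM('a)) * theta ((1 / t) *R (y - x))"
   have in_C: "y \<in> C" if "norm (y - x) < d / 2" for y
   proof -
    have "infdist x (- U) <= infdist y (- U) + dist x y" by (rule infdist_triangle)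
    then show ?thesis using x that by (simp add: C_def V_def dist_norm norm_minus_commute)
   qed
   have near: "norm (t *R z) < d / 2" if "z \<in> supp theta" for z
   proof -
    have "t * norm z <= t * R2" using supp[OF that] t by (intro mult_left_mono) auto
    moreover have "norm (t *R z) = t * norm z" using t(1) by simp
    ultimately show ?thesis using t(2) by (simp only: mult.commute[of t R2])
   qed
   have psi: "?psi \<in> Cc_infinity U"
    by (rule Cc_infinity_dilation(1)[OF test t(1)]) (use CU in_C near in fastforce)
   have gd: "GDERIV ?psi y :> (1 / t ^ DIM('a)) *R (1 / t) *R Dtheta ((1 / t) *R (y - x))" for y
    by (rule GDERIV_cmult[OF GDERIV_affine[OF gderiv]])
   have psi0: "?psi y = 0" if "y \<notin> C" for y
   proof (rule ccontr)
    assume "?psi y ~= 0"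
    then have "theta ((1 / t) *R (y - x)) ~= 0" by auto
    from near[OF supp_nz[OF this]] have "y \<in> C" using t by (intro in_C) simp
    then show False using that by simp
   qed
   have eq: "(LINT y:U|lebesgue. ?psi y *R g1 y) = (LINT y:U|lebesgue. ?psi y *R g2 y)"
    using g1[unfolded has_weak_gradient_def, THEN conjunct2, THEN conjunct2, rule_format, OF psi, OF gd]
     g2[unfolded has_weak_gradient_def, THEN conjunct2, THEN conjunct2, rule_format, OF psi, OF gd] by simp
   have conv: "(LINT y:U|lebesgue. ?psi y *R g y) = (LINT y|lebesgue. ?psi y *R (indicator C y *R g y))" for g :: "'a => 'a"
    unfolding set_lebesgue_integral_def
   proof (intro bi_cong refl)
    fix y
    show "indicator U y *R (?psi y *R g y) = ?psi y *R (indicator C y *R g y)"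
     using psi0[of y] CU by (cases "y \<in> C") (auto simp: indicator_def)
   qed
   have psim [measurable]: "?psi \<in> borelm" by measurable
   have psiL: "?psi \<in> borel_measurable lebesgue" using psim by (simp add: measurable_completion)
   have int: "integrable lebesgue (%y. ?psi y *R (indicator C y *R g y))" if "set_integrable lebesgue C g" for g :: "'a => 'a"
   proof (rule bi_bound[where f="%y. (T / t ^ DIM('a)) *R (indicator C y *R g y)"])
    show "integrable lebesgue (%y. (T / t ^ DIM('a)) *R (indicator C y *R g y))"
     using that unfolding set_integrable_def by (rule integrable_scaleR_right)
    show "(%y. ?psi y *R (indicator C y *R g y)) \<in> borel_measurable lebesgue"
     using that unfolding set_integrable_def by (intro borel_measurable_scaleR psiL borel_measurable_integrable)
    show "AE y in lebesgue. norm (?psi y *R (indicator C y *R g y)) <= norm ((T / t ^ DIM('a)) *R (indicator C y *R g y))"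
    proof (intro AE_I2)
     fix y
     have "\<bar>?psi y\<bar> <= \<bar>T / t ^ DIM('a)\<bar>" using nonneg le t T_nonneg by (simp add: divide_right_mono)
     then show "norm (?psi y *R (indicator C y *R g y)) <= norm ((T / t ^ DIM('a)) *R (indicator C y *R g y))"
      unfolding norm_scaleR by (rule mult_right_mono) simp
    qed
   qed
   have "(LINT y|lebesgue. ?psi y *R f y) = (LINT y|lebesgue. ?psi y *R (indicator C y *R g1 y) - ?psi y *R (indicator C y *R g2 y))"
    by (simp add: f_def scaleR_diff_right)
   also have "\<dots> = 0"
    using eq bi_diff[OF int[OF sC(1)] int[OF sC(2)]] unfolding conv by simp
   finally have "(LINT y|lebesgue. ?psi y *R f y) = 0" .
   moreover have "(LINT y|lebesgue. ?psi y *R f y) = (LBINT y. ?psi y *R F y)"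
   proof (rule lebesgue_integral_eq_lborel(1))
    show "(%y. ?psi y *R f y) \<in> borel_measurable lebesgue" by (intro borel_measurable_scaleR psiL fm)
    show "(%y. ?psi y *R F y) \<in> borelm" using F(1) by measurable
    show "AE y in lborel. ?psi y *R f y = ?psi y *R F y" using F(2) by eventually_elim simp
   qed
   ultimately show ?thesis by (simp add: avg_def dil_def)
  qed
  \<comment> \<open>The factor keeps averages based in \<open>V\<close> within distance
    \<open>d / 2\<close>, for every \<open>k\<close>.\<close>
  define tau where "tau k = (d / (4 * R2)) * inverse (real (Suc k))" for k :: nat
  have tau: "0 < tau k" "R2 * tau k < d / 2" for k
  proof -
   show "0 < tau k" using d R2 by (simp add: tau_def)
   have "R2 * tau k = d / 4 * inverse (real (Suc k))" unfolding tau_def using R2 by simp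
   also have "\<dots> <= d / 4 * 1" using d by (intro mult_left_mono) (simp_all add: inverse_le_1_iff)
   finally show "R2 * tau k < d / 2" using d by simp
  qed
  have tau0: "tau \<longlonglongrightarrow> 0"
   unfolding tau_def by (rule tendsto_mult_right_zero[OF LIMSEQ_inverse_real_of_nat])
  have comp: "AE x in lborel. x \<in> V --> F x \<bullet> i = 0" for i
  proof (rule avg_limit_AE[where c="%_. 0" and B=0, OF _ tau0 tau(1) \<open>open V\<close>])
   show "integrable lborel (%x. F x \<bullet> i)" by (rule integrable_inner_left) (rule Fint)
   have z: "avg (tau k) (%x. F x \<bullet> i) x = 0" if "x \<in> V" for x k
   proof -
    have "avg (tau k) (%x. F x \<bullet> i) x = (LBINT y. (dil (tau k) (y - x) *R F y) \<bullet> i)"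
     by (simp add: avg_def)
    also have "\<dots> = avg (tau k) F x \<bullet> i"
     unfolding avg_def by (rule integral_inner_left) (rule avg_integrable[OF tau(1) Fint])
    finally show ?thesis using avg0[OF that tau] by simp
   qed
   then show "(%k. avg (tau k) (%x. F x \<bullet> i) x) \<longlonglongrightarrow> 0" if "x \<in> V" for x using that by simp
   show "\<bar>avg (tau k) (%x. F x \<bullet> i) x\<bar> <= 0" if "x \<in> V" for x k using z[OF that] by simp
  qed simp
  have "AE x in lborel. \<forall>i\<in>(Basis :: 'a set). x \<in> V --> F x \<bullet> i = 0"
   by (subst AE_ball_countable[OF countable_finite[OF finite_Basis]]) (intro ballI comp)
  with F(2) have "AE x in lborel. f x = F x \<and> (\<forall>i\<in>(Basis :: 'a set). x \<in> V --> F x \<bullet> i = 0)"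
   by (rule AE_conjI)
  then show ?thesis
  proof (rule AE_mp, intro AE_I2 impI)
   fix x assume elim: "f x = F x \<and> (\<forall>i\<in>(Basis :: 'a set). x \<in> V --> F x \<bullet> i = 0)" and x: "d < infdist x (- U)"
   have "x \<in> V" using x by (simp add: V_def)
   then have "F x = 0" using elim by (subst euclidean_eq_iff) simp
   then have "f x = 0" using elim by simp
   moreover have "x \<in> C" using x d by (simp add: C_def)
   ultimately show "g1 x = g2 x" by (simp add: f_def)
  qed
 qed
 have "AE x in lborel. \<forall>n::nat. 1 / (real n + 1) < infdist x (- U) --> g1 x = g2 x"
  using V by (subst AE_all_countable) simp
 then show ?thesis
 proof eventually_elim
  case (elim x)
  show ?case
  proof
   assume "x \<in> U"
   then have "0 < infdist x (- U)"
    using in_closed_iff_infdist_zero[OF cl ne, of x] infdist_nonneg[of x "- U"] by auto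
   then obtain n where "1 / (real n + 1) < infdist x (- U)"
    using reals_Archimedean[of "infdist x (- U)"] by (auto simp: inverse_eq_divide add.commute)
   then show "g1 x = g2 x" using elim by blast
  qed
 qed
qed

section \<open>Continuous representatives and classical gradients\<close>

text \<open>A nonempty open set is not null, so the two functions agree on all of \<open>V\<close>;
  continuity then carries the equality to the boundary points in \<open>K\<close>.\<close>

lemma continuous_AE_eq_imp_eq:
 fixes f g :: "'a::euclidean_space => real"
 assumes f: "continuous_on K f" "continuous_on K g" and K: "K \<subseteq> closure V" "V \<subseteq> K" "open V"
  and ae: "AE x in lborel. x \<in> V --> f x = g x" and x: "x \<in> K"
 shows "f x = g x"
proof -
 have V: "f y = g y" if "y \<in> V" for y
 proof (rule ccontr)
  assume ne: "f y ~= g y"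
  have "continuous_on V (%x. f x - g x)" by (intro continuous_on_diff continuous_on_subset[OF f(1)] continuous_on_subset[OF f(2)] K)
  then have "open ((%x. f x - g x) -` (- {0}) \<inter> V)"
   using continuous_on_open_vimage[OF K(3)] by blast
  moreover have "y \<in> (%x. f x - g x) -` (- {0}) \<inter> V" using ne that by auto
  ultimately obtain e where e: "0 < e" "ball y e \<subseteq> (%x. f x - g x) -` (- {0}) \<inter> V" using open_contains_ball by blast
  have "AE x in lborel. x \<notin> ball y e" using ae by eventually_elim (use e(2) in auto)
  then have "{x \<in> space lborel. \<not> x \<notin> ball y e} \<in> null_sets lborel" by (subst (asm) AE_iff_null) auto
  then have "ball y e \<in> null_sets lborel" by (simp add: ball_def)
  then have "emeasure lborel (ball y e) = 0" by auto
  moreover have "emeasure lborel (ball y e) = ennreal (unit_ball_vol (real DIM('a)) * e ^ DIM('a))"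
   by (rule emeasure_ball) (use e(1) in simp)
  moreover have "0 < unit_ball_vol (real DIM('a)) * e ^ DIM('a)" using e(1) by simp
  ultimately show False by (simp add: ennreal_eq_0_iff)
 qed
 have "x \<in> closure V" using x K by blast
 then obtain s where s: "!!n. s n \<in> V" "s \<longlonglongrightarrow> x" unfolding closure_sequential by blast
 have "(%n. f (s n)) \<longlonglongrightarrow> f x" "(%n. g (s n)) \<longlonglongrightarrow> g x"
  using f s K(2) x by (auto intro!: continuous_on_tendsto_compose[OF _ s(2)] always_eventually)
 then show ?thesis using V s(1) LIMSEQ_unique by force
qed

lemma AE_lebesgue_on_iff:
 assumes "S \<in> sets borel"
 shows "(AE x in lebesgue_on S. P x) \<longleftrightarrow> (AE x in lborel. x \<in> S --> P x)"
 using assms by (simp add: AE_restrict_space_iff AE_completion_iff)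

text \<open>\<open>K\<close> lies in the closure of its interior, so every continuous representative
  coincides with the one picked by \<open>SOME\<close>. This makes the choice in
  \<open>cont_rep\<close> harmless.\<close>

lemma cont_rep_eq:
 fixes K :: "'a::euclidean_space set"
 assumes K: "K \<subseteq> closure (interior K)" and c: "continuous_on K c" "AE x in lborel. x \<in> interior K --> c x = phi x" and x: "x \<in> K"
 shows "cont_rep K phi x = c x"
proof -
 let ?P = "%c. continuous_on K c \<and> (AE x in lebesgue_on (interior K). c x = phi x)"
 have "?P c" using c by (simp add: AE_lebesgue_on_iff)
 then have "?P (cont_rep K phi)" unfolding cont_rep_def by (rule someI[of ?P])
 then have r: "continuous_on K (cont_rep K phi)" "AE x in lborel. x \<in> interior K --> cont_rep K phi x = phi x"
  by (auto simp: AE_lebesgue_on_iff)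
 have "AE x in lborel. x \<in> interior K --> cont_rep K phi x = c x"
  using r(2) c(2) by eventually_elim simp
 then show ?thesis
  by (rule continuous_AE_eq_imp_eq[OF r(1) c(1) K interior_subset open_interior _ x])
qed

text \<open>The product of a test function with \<open>f\<close>, extended by zero, is
  differentiable on the whole space with a continuous gradient of compact support, and such a
  gradient integrates to 0.\<close>

lemma has_weak_gradient_C1:
 fixes f :: "'a::euclidean_space => real"
 assumes f: "C1_on K f D"
 shows "has_weak_gradient (interior K) f D"
proof -
 let ?U = "interior K"
 have fc: "continuous_on ?U f" "continuous_on ?U D" and fD: "!!x. x \<in> ?U ==> GDERIV f x :> D x"
  using f interior_subset[of K] by (auto simp: C1_on_def intro: continuous_on_subset)
 have loc: "set_integrable lebesgue C u" if "compact C" "C \<subseteq> ?U" "continuous_on ?U u" for C and u :: "'a => 'b::euclidean_space"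
 proof -
  have "integrable lborel (%x. indicator C x *R u x)"
   by (rule borel_integrable_compact[OF that(1) continuous_on_subset[OF that(3,2)]])
  then show ?thesis unfolding set_integrable_def by (subst integrable_completion) auto
 qed
 show ?thesis
  unfolding has_weak_gradient_def locally_integrable_def
 proof (intro conjI allI impI ballI)
  show "set_integrable lebesgue C f" if "compact C \<and> C \<subseteq> ?U" for C using loc that fc by blast
  show "set_integrable lebesgue C D" if "compact C \<and> C \<subseteq> ?U" for C using loc that fc by blast
  fix psi E assume psi: "psi \<in> Cc_infinity ?U" and E: "\<forall>x. GDERIV psi x :> E x"
  let ?S = "supp psi"
  have S: "compact ?S" "?S \<subseteq> ?U" using psi by (auto simp: Cc_infinity_def)
  have E': "!!x. GDERIV psi x :> E x" using E by blast
  have Ec: "continuous_on UNIV E" "!!x. x \<notin> ?S ==> E x = 0" using Cc_infinity_gradient[OF psi E'] by auto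
  have psic: "continuous_on UNIV psi" by (rule GDERIV_continuous[OF E'])
  have psi0: "x \<notin> ?S ==> psi x = 0" for x by (rule supp_zero)
  define P where "P x = (if x \<in> ?U then psi x * f x else 0)" for x
  define G where "G x = (if x \<in> ?U then psi x *R D x + f x *R E x else 0)" for x
  have oS: "open (- ?S)" using S(1) by (simp add: compact_imp_closed open_Compl)
  have cov: "x \<in> ?U \<or> x \<in> - ?S" for x using S(2) by blast
  have "GDERIV P x :> G x" for x
  proof (cases "x \<in> ?U")
   case True
   have "GDERIV (%x. psi x * f x) x :> psi x *R D x + f x *R E x"
    by (rule GDERIV_mult[OF E' fD[OF True]])
   then have "(P has_derivative (%h. h \<bullet> (psi x *R D x + f x *R E x))) (at x)"
    unfolding gderiv_def
    by (rule has_derivative_transform_within_open[OF _ open_interior True]) (simp add: P_def)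
   then show ?thesis using True by (simp add: gderiv_def G_def)
  next
   case False
   then have x: "x \<in> - ?S" using cov by blast
   have "((%_. 0) has_derivative (%h. h \<bullet> 0)) (at x)" by simp
   then have "(P has_derivative (%h. h \<bullet> 0)) (at x)"
    by (rule has_derivative_transform_within_open[OF _ oS x]) (simp add: P_def psi0)
   then show ?thesis using False by (simp add: gderiv_def G_def)
  qed
  moreover have "continuous_on UNIV G"
  proof -
   have "continuous_on ?U G"
    by (subst continuous_on_cong[OF refl, of _ _ "%x. psi x *R D x + f x *R E x"])
     (auto simp: G_def intro!: continuous_intros fc continuous_on_subset[OF psic] continuous_on_subset[OF Ec(1)])
   moreover have "continuous_on (- ?S) G"
    by (subst continuous_on_cong[OF refl, of _ _ "%x. 0"]) (auto simp: G_def psi0 Ec(2))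
   ultimately have "continuous_on (?U \<union> - ?S) G" by (intro continuous_on_open_Un open_interior oS)
   moreover have "?U \<union> - ?S = UNIV" using cov by blast
   ultimately show ?thesis by simp
  qed
  ultimately have G0: "(LBINT x. G x) = 0"
   by (rule integral_gradient_compact_support[OF _ _ S(1)]) (auto simp: P_def G_def psi0 Ec(2))
  have c1: "continuous_on ?S (%x. psi x *R D x)" and c2: "continuous_on ?S (%x. f x *R E x)"
   by (auto intro!: continuous_intros continuous_on_subset[OF fc(1) S(2)] continuous_on_subset[OF fc(2) S(2)]
     continuous_on_subset[OF psic] continuous_on_subset[OF Ec(1)])
  have i1: "integrable lborel (%x. indicator ?S x *R (psi x *R D x))" by (rule borel_integrable_compact[OF S(1) c1])
  have i2: "integrable lborel (%x. indicator ?S x *R (f x *R E x))" by (rule borel_integrable_compact[OF S(1) c2])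
  have "(LBINT x. G x) = (LBINT x. indicator ?S x *R (psi x *R D x) + indicator ?S x *R (f x *R E x))"
  proof (intro bi_cong refl)
   fix x
   show "G x = indicator ?S x *R (psi x *R D x) + indicator ?S x *R (f x *R E x)"
    using S(2) by (cases "x \<in> ?S") (auto simp: G_def psi0 Ec(2))
  qed
  then have "(LBINT x. indicator ?S x *R (f x *R E x)) = - (LBINT x. indicator ?S x *R (psi x *R D x))"
   using G0 bi_add[OF i1 i2] by (simp add: add_eq_0_iff)
  moreover have "(LINT x:?U|lebesgue. f x *R E x) = (LBINT x. indicator ?S x *R (f x *R E x))"
  proof -
   have "(LINT x:?U|lebesgue. f x *R E x) = (LINT x|lebesgue. indicator ?S x *R (f x *R E x))"
    unfolding set_lebesgue_integral_def
   proof (intro bi_cong refl)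
    fix x show "indicator ?U x *R (f x *R E x) = indicator ?S x *R (f x *R E x)"
     using S(2) Ec(2)[of x] by (cases "x \<in> ?S") auto
   qed
   also have "\<dots> = (LBINT x. indicator ?S x *R (f x *R E x))"
    using i2 by (intro integral_completion) auto
   finally show ?thesis .
  qed
  moreover have "(LINT x:?U|lebesgue. psi x *R D x) = (LBINT x. indicator ?S x *R (psi x *R D x))"
  proof -
   have "(LINT x:?U|lebesgue. psi x *R D x) = (LINT x|lebesgue. indicator ?S x *R (psi x *R D x))"
    unfolding set_lebesgue_integral_def
   proof (intro bi_cong refl)
    fix x show "indicator ?U x *R (psi x *R D x) = indicator ?S x *R (psi x *R D x)"
     using S(2) psi0[of x] by (cases "x \<in> ?S") auto
   qed
   also have "\<dots> = (LBINT x. indicator ?S x *R (psi x *R D x))"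
    using i1 by (intro integral_completion) auto
   finally show ?thesis .
  qed
  ultimately show "(LINT x:?U|lebesgue. f x *R E x) = - (LINT x:?U|lebesgue. psi x *R D x)" by simp
 qed
qed

lemma continuous_in_Lp:
 fixes f :: "'a::euclidean_space => 'b::euclidean_space"
 assumes K: "compact K" and f: "continuous_on K f" and p: "0 < p"
 shows "f \<in> Lp (interior K) p"
proof -
 have Kb: "K \<in> sets borel" using K by (simp add: compact_imp_closed)
 have m: "(%x. indicator (interior K) x *R f x) \<in> borelm"
  by (rule borel_measurable_continuous_on_indicator) (auto intro: continuous_on_subset[OF f interior_subset])
 have "f \<in> borel_measurable (lebesgue_on (interior K))"
  by (subst borel_measurable_restrict_space_iff) (use m in \<open>auto simp: measurable_completion\<close>)
 moreover have "integrable lborel (%x. indicator K x *R norm (f x) powr p)"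
  by (rule borel_integrable_compact[OF K]) (rule continuous_on_powr'[OF continuous_on_norm[OF f] continuous_on_const], use p in auto)
 then have "integrable lborel (%x. indicator (interior K) x *R norm (f x) powr p)"
 proof (rule bi_bound)
  have "(%x. norm (indicator (interior K) x *R f x) powr p) \<in> borelm" using m by measurable
  moreover have "(%x. norm (indicator (interior K) x *R f x) powr p) = (%x. indicator (interior K) x *R norm (f x) powr p)"
   by (auto simp: indicator_def fun_eq_iff)
  ultimately show "(%x. indicator (interior K) x *R norm (f x) powr p) \<in> borel_measurable lborel" by simp
  show "AE x in lborel. norm (indicator (interior K) x *R norm (f x) powr p) <= norm (indicator K x *R norm (f x) powr p)"
   using interior_subset[of K] by (intro AE_I2) (auto simp: indicator_def)
 qed
 then have "integrable (lebesgue_on (interior K)) (%x. norm (f x) powr p)"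
  by (subst integrable_restrict_space) (auto simp: integrable_completion)
 ultimately show ?thesis by (simp add: Lp_def)
qed

section \<open>Inward cones and partitions of unity\<close>

text \<open>Near a boundary point the domain is the region above a Lipschitz graph. A step along
  \<open>e\<close> gains height, while a sideways deviation costs at most a multiple of its size; a
  narrow cone around \<open>e\<close> therefore points inwards, also from points on the
  graph.\<close>

lemma lipschitz_cone:
 fixes U :: "'a::euclidean_space set"
 assumes U: "lipschitz_domain U" and x0: "x0 \<in> closure U"
 obtains r a kappa where "0 < r" "0 < kappa" "kappa < norm a"
  "!!x t z. x \<in> closure U ==> x \<in> cball x0 r ==> 0 < t ==> t <= 1 ==> z \<in> ball a kappa ==> x + t *R z \<in> U"
proof (cases "x0 \<in> U")
 case True
 have "open U" using U by (simp add: lipschitz_domain_def)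
 then obtain r where r: "0 < r" "ball x0 r \<subseteq> U" using True open_contains_ball by blast
 obtain e :: 'a where e: "norm e = 1" using vector_choose_size[of 1] by auto
 \<comment> \<open>At an interior point every direction will do: the base point is within
   \<open>r / 4\<close> of \<open>x0\<close>, and the step is shorter than
   \<open>3 * r / 8\<close>.\<close>
 show ?thesis
 proof (rule that[of "r / 4" "r / 8" "(r / 4) *R e"])
  fix x z :: 'a and t :: real assume x: "x \<in> cball x0 (r / 4)" and t: "0 < t" "t <= 1" and z: "z \<in> ball ((r / 4) *R e) (r / 8)"
  have "norm z <= norm ((r / 4) *R e) + norm ((r / 4) *R e - z)" by (metis norm_triangle_sub norm_minus_commute)
  also have "\<dots> < r / 4 + r / 8" using z e r by (simp add: dist_norm)
  finally have "norm z < r / 4 + r / 8" .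
  moreover have norm_tz: "norm (t *R z) <= norm z" using t by (simp add: mult_left_le_one_le)
  ultimately have "norm (t *R z) < r / 4 + r / 8" using norm_tz by linarith
  moreover have "norm (x - x0) <= r / 4" using x by (simp add: dist_norm norm_minus_commute)
  moreover have "norm (x + t *R z - x0) <= norm (x - x0) + norm (t *R z)"
   using norm_triangle_ineq[of "x - x0" "t *R z"] by (simp add: algebra_simps)
  ultimately have "norm (x + t *R z - x0) < r" using r by linarith
  then show "x + t *R z \<in> U" using r(2) by (auto simp: dist_norm norm_minus_commute)
 qed (use r e in auto)
next
 case False
 have "open U" using U by (simp add: lipschitz_domain_def)
 then have "x0 \<in> frontier U" using x0 False by (simp add: frontier_def interior_open)
 then obtain e r L gamma where e: "norm e = 1" and r: "0 < r" and L: "L-lipschitz_on {z. z \<bullet> e = 0} gamma"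
  and Ug: "!!y. y \<in> ball x0 r ==> y \<in> U \<longleftrightarrow> gamma (y - (y \<bullet> e) *R e) < y \<bullet> e"
  using U unfolding lipschitz_domain_def by metis
 have L0: "0 <= L" using L by (rule lipschitz_on_nonneg)
 have ee: "e \<bullet> e = 1" using e by (simp add: norm_eq_1)
 define \<pi> where "\<pi> y = y - (y \<bullet> e) *R e" for y :: 'a
 have \<pi>0: "\<pi> y \<in> {z. z \<bullet> e = 0}" for y by (simp add: \<pi>_def inner_diff_left ee)
 have gammaL: "gamma (\<pi> y) <= gamma (\<pi> x) + L * norm (\<pi> (y - x))" for x y
 proof -
  have "dist (gamma (\<pi> y)) (gamma (\<pi> x)) <= L * dist (\<pi> y) (\<pi> x)" by (rule lipschitz_onD[OF L \<pi>0 \<pi>0])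
  moreover have "\<pi> y - \<pi> x = \<pi> (y - x)" by (simp add: \<pi>_def inner_diff_left algebra_simps)
  ultimately show ?thesis by (simp add: dist_norm dist_real_def)
 qed
 have \<pi>le: "norm (\<pi> y) <= 2 * norm y" for y
 proof -
  have "norm (\<pi> y) <= norm y + norm ((y \<bullet> e) *R e)" unfolding \<pi>_def by (rule norm_triangle_ineq4)
  moreover have "\<bar>y \<bullet> e\<bar> <= norm y" using Cauchy_Schwarz_ineq2[of y e] e by simp
  ultimately show ?thesis using e by simp
 qed
 \<comment> \<open>Points of the closure lie on or above the graph, by a limit in the strict
   inequality valid on \<open>U\<close>.\<close>
 have clos: "gamma (\<pi> x) <= x \<bullet> e" if x: "x \<in> closure U" "x \<in> ball x0 r" for x
 proof -
  obtain s where s: "!!n. s n \<in> U" "s \<longlonglongrightarrow> x" using x(1) unfolding closure_sequential by blast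
  have ev: "\<forall>\<^sub>F n in sequentially. s n \<in> ball x0 r" using topological_tendstoD[OF s(2) open_ball x(2)] .
  have "(%n. s n \<bullet> e + L * (2 * norm (x - s n))) \<longlonglongrightarrow> x \<bullet> e + L * (2 * norm (x - x))"
   by (intro tendsto_intros s(2))
  then have lim: "(%n. s n \<bullet> e + L * (2 * norm (x - s n))) \<longlonglongrightarrow> x \<bullet> e" by simp
  show ?thesis
  proof (rule tendsto_lowerbound[OF lim _ trivial_limit_sequentially])
   show "\<forall>\<^sub>F n in sequentially. gamma (\<pi> x) <= s n \<bullet> e + L * (2 * norm (x - s n))"
    using ev
   proof eventually_elim
    case (elim n)
    then have "gamma (\<pi> (s n)) < s n \<bullet> e" using Ug[OF elim] s(1) by (simp add: \<pi>_def)
    moreover have "L * norm (\<pi> (x - s n)) <= L * (2 * norm (x - s n))" using L0 \<pi>le by (intro mult_left_mono)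
    ultimately show ?case using gammaL[of x "s n"] by linarith
   qed
  qed
 qed
 \<comment> \<open>Chosen so that \<open>kappa * (2 * L + 2) = r / 8\<close>: a step
   \<open>(r / 8) e + d\<close> gains at least \<open>r / 8 - norm d\<close> in height, while the
   graph rises by at most \<open>2 * L * norm d\<close>.\<close>
 define kappa where "kappa = r / (8 * (2 * L + 2))"
 have kappa: "0 < kappa" using r L0 by (simp add: kappa_def)
 have kappaL: "kappa * (2 * L + 2) = r / 8"
 proof -
  have "2 * L + 2 ~= 0" using L0 by simp
  then show ?thesis unfolding kappa_def by (metis divide_divide_eq_left divide_divide_eq_left' nonzero_eq_divide_eq)
 qed
 have kappar: "kappa <= r / 16"
 proof -
  have "kappa * 2 <= kappa * (2 * L + 2)" using kappa L0 by (intro mult_left_mono) auto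
  then show ?thesis using kappaL by simp
 qed
 show ?thesis
 proof (rule that[of "r / 4" kappa "(r / 8) *R e"])
  fix x z :: 'a and t :: real assume xc: "x \<in> closure U" and x: "x \<in> cball x0 (r / 4)" and t: "0 < t" "t <= 1" and z: "z \<in> ball ((r / 8) *R e) kappa"
  define d where "d = z - (r / 8) *R e"
  have d: "norm d < kappa" using z by (simp add: d_def dist_norm norm_minus_commute)
  have zd: "z = (r / 8) *R e + d" by (simp add: d_def)
  have "norm z <= r / 8 + norm d" unfolding zd using norm_triangle_ineq[of "(r / 8) *R e" d] e r by simp
  then have nz: "norm z < r / 4" using d kappar r by linarith
  have norm_tz: "norm (t *R z) <= norm z" using t by (simp add: mult_left_le_one_le)
  then have "norm (t *R z) < r / 4" using nz norm_tz by linarith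
  moreover have "norm (x - x0) <= r / 4" using x by (simp add: dist_norm norm_minus_commute)
  moreover have "norm (x + t *R z - x0) <= norm (x - x0) + norm (t *R z)"
   using norm_triangle_ineq[of "x - x0" "t *R z"] by (simp add: algebra_simps)
  ultimately have "norm (x + t *R z - x0) < r" using r by linarith
  then have inb: "x + t *R z \<in> ball x0 r" by (simp add: dist_norm norm_minus_commute)
  have xb: "x \<in> ball x0 r" using x r by auto
  have \<pi>z: "\<pi> (t *R z) = t *R \<pi> d" by (simp add: zd \<pi>_def inner_add_left ee algebra_simps)
  have "gamma (\<pi> (x + t *R z)) <= gamma (\<pi> x) + L * norm (\<pi> (t *R z))" using gammaL[of "x + t *R z" x] by simp
  also have "L * norm (\<pi> (t *R z)) = t * (L * norm (\<pi> d))" using t by (simp add: \<pi>z)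
  also have "\<dots> <= t * (L * (2 * norm d))" using t L0 \<pi>le by (intro mult_left_mono) auto
  finally have g: "gamma (\<pi> (x + t *R z)) <= x \<bullet> e + t * (L * (2 * norm d))" using clos[OF xc xb] by linarith
  have "\<bar>d \<bullet> e\<bar> <= norm d" using Cauchy_Schwarz_ineq2[of d e] e by simp
  then have ze: "r / 8 - norm d <= z \<bullet> e" using r by (simp add: zd inner_add_left ee)
  have "norm d * (2 * L + 1) < kappa * (2 * L + 2)"
   using d L0 kappa by (intro mult_strict_mono) auto
  then have "L * (2 * norm d) < r / 8 - norm d" unfolding kappaL by (simp add: algebra_simps)
  then have "L * (2 * norm d) < z \<bullet> e" using ze by linarith
  then have "t * (L * (2 * norm d)) < t * (z \<bullet> e)" using t by (intro mult_strict_left_mono)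
  then have "gamma (\<pi> (x + t *R z)) < (x + t *R z) \<bullet> e" using g by (simp add: inner_add_left)
  then show "x + t *R z \<in> U" using Ug[OF inb] by (simp add: \<pi>_def)
 next
  show "kappa < norm ((r / 8) *R e)" using e r kappar by simp
 qed (use r kappa in auto)
qed

lemma GDERIV_max_square:
 assumes "GDERIV u x :> D"
 shows "GDERIV (%x. (max 0 (u x))\<^sup>2) x :> (2 * max 0 (u x)) *R D"
proof (rule GDERIV_DERIV_compose[OF assms])
 show "((%s::real. (max 0 s)\<^sup>2) has_real_derivative 2 * max 0 (u x)) (at (u x))"
 proof (cases "u x" "0::real" rule: linorder_cases)
  case less
  have "((%_. 0) has_real_derivative 2 * max 0 (u x)) (at (u x))" using less by simp
  then show ?thesis
   by (rule has_field_derivative_transform_within_open[where S="{..<0}"]) (use less in auto)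
 next
  case equal
  have "((%s::real. (max 0 s)\<^sup>2) has_real_derivative 0) (at 0)"
   unfolding DERIV_def
  proof (rule Lim_null_comparison[where g="%h. \<bar>h\<bar>"])
   show "\<forall>\<^sub>F h in at 0. norm (((max 0 (0 + h))\<^sup>2 - (max 0 0)\<^sup>2) / h) <= \<bar>h :: real\<bar>"
    by (intro always_eventually allI) (auto simp: max_def power2_eq_square)
   show "((%h::real. \<bar>h\<bar>) \<longlongrightarrow> 0) (at 0)" using tendsto_rabs_zero[OF tendsto_ident_at] by simp
  qed
  then show ?thesis using equal by simp
 next
  case greater
  have "((%s::real. s\<^sup>2) has_real_derivative 2 * max 0 (u x)) (at (u x))"
   using greater by (auto intro!: derivative_eq_intros)
  then show ?thesis
   by (rule has_field_derivative_transform_within_open[where S="{0<..}"]) (use greater in auto)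
 qed
qed

text \<open>A finite partition of unity of class \<open>C\<^sup>1\<close>, made of the functions \<open>(max 0 (r\<^sup>2 - |x - p|\<^sup>2))\<^sup>2\<close>.\<close>

lemma C1_partition_of_unity:
 fixes K :: "'a::euclidean_space set"
 assumes K: "compact K" and r: "!!p. p \<in> K ==> 0 < r p"
 obtains P xi E N where "finite P" "P \<subseteq> K" "open N" "K \<subseteq> N"
  "!!p x. x \<in> N ==> GDERIV (xi p) x :> E p x" "!!p. continuous_on N (E p)"
  "!!p x. x \<in> N ==> 0 <= xi p x" "!!p x. x \<in> N ==> r p <= dist p x ==> p \<in> P ==> xi p x = 0"
  "!!p x. x \<in> N ==> r p <= dist p x ==> p \<in> P ==> E p x = 0"
  "!!x. x \<in> N ==> (\<Sum>p\<in>P. xi p x) = 1" "!!x. x \<in> N ==> (\<Sum>p\<in>P. E p x) = 0"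
proof -
 have "\<exists>P\<subseteq>K. finite P \<and> K \<subseteq> (\<Union>p\<in>P. ball p (r p))"
  by (rule compactE_image[OF K, of K "%p. ball p (r p)"]) (use r in \<open>auto intro: exI\<close>)
 then obtain P where P: "P \<subseteq> K" "finite P" "K \<subseteq> (\<Union>p\<in>P. ball p (r p))" by blast
 define u where "u p x = (r p)\<^sup>2 - (x - p) \<bullet> (x - p)" for p x :: 'a
 define b where "b p x = (max 0 (u p x))\<^sup>2" for p x
 define B where "B p x = (2 * max 0 (u p x)) *R (- 2 *R (x - p))" for p x
 define s where "s x = (\<Sum>p\<in>P. b p x)" for x
 define S' where "S' x = (\<Sum>p\<in>P. B p x)" for x
 have ug: "GDERIV (u p) x :> - 2 *R (x - p)" for p x
  unfolding gderiv_def u_def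
  by (auto intro!: derivative_eq_intros simp: fun_eq_iff inner_commute inner_diff_left inner_diff_right algebra_simps)
 have bg: "GDERIV (b p) x :> B p x" for p x
  unfolding b_def B_def by (rule GDERIV_max_square[OF ug])
 have uc: "continuous_on A (u p)" for A p unfolding u_def by (intro continuous_intros)
 have bc: "continuous_on A (b p)" for A p unfolding b_def by (intro continuous_intros uc)
 have Bc: "continuous_on A (B p)" for A p unfolding B_def by (intro continuous_intros uc)
 have sc: "continuous_on A s" for A unfolding s_def by (intro continuous_intros bc)
 have sg: "GDERIV s x :> S' x" for x
 proof -
  have "((%x. \<Sum>p\<in>P. b p x) has_derivative (%h. \<Sum>p\<in>P. h \<bullet> B p x)) (at x)"
   using bg unfolding gderiv_def by (intro has_derivative_sum) auto
  then show ?thesis unfolding gderiv_def s_def S'_def by (simp add: inner_sum_right)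
 qed
 have S'c: "continuous_on A S'" for A unfolding S'_def by (intro continuous_intros Bc)
 \<comment> \<open>The sum of the bumps is positive on this open set, so the quotients are
   \<open>C1\<close> there.\<close>
 define N where "N = {x. 0 < s x}"
 have N: "open N" unfolding N_def by (intro open_Collect_less continuous_intros sc)
 have b0: "0 <= b p x" for p x by (simp add: b_def)
 have dn: "(dist p x)\<^sup>2 = (x - p) \<bullet> (x - p)" for p x :: 'a
  by (simp add: dist_norm norm_minus_commute[of p x] power2_norm_eq_inner)
 have u_pos: "0 < u p x" if "dist p x < r p" for p x
 proof -
  have "(dist p x)\<^sup>2 < (r p)\<^sup>2" using that by (intro power_strict_mono) auto
  then show ?thesis by (simp add: u_def dn)
 qed
 have u_neg: "u p x <= 0" if "r p <= dist p x" "p \<in> P" for p x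
 proof -
  have "(r p)\<^sup>2 <= (dist p x)\<^sup>2" using that r[of p] P(1) by (intro power_mono) auto
  then show ?thesis by (simp add: u_def dn)
 qed
 have KN: "K \<subseteq> N"
 proof
  fix x assume "x \<in> K"
  then obtain p where p: "p \<in> P" "dist p x < r p" using P(3) by auto
  have "0 < b p x" using u_pos[OF p(2)] by (simp add: b_def)
  then have "0 < s x" unfolding s_def by (rule sum_pos2[OF P(2) p(1)]) (simp add: b0)
  then show "x \<in> N" by (simp add: N_def)
 qed
 define xi where "xi p x = b p x * inverse (s x)" for p x
 define E where "E p x = b p x *R (- (inverse (s x))\<^sup>2 *R S' x) + inverse (s x) *R B p x" for p x
 show ?thesis
 proof (rule that[OF P(2,1) N KN, of xi E])
  fix p x assume x: "x \<in> N"
  then have s0: "s x ~= 0" by (simp add: N_def)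
  show "GDERIV (xi p) x :> E p x"
   unfolding xi_def E_def by (rule GDERIV_mult[OF bg GDERIV_inverse[OF sg s0]])
  show "0 <= xi p x" using x b0 by (simp add: xi_def N_def)
  assume "r p <= dist p x" "p \<in> P"
  then have "max 0 (u p x) = 0" using u_neg by simp
  then show "xi p x = 0" "E p x = 0" by (simp_all add: xi_def E_def b_def B_def)
 next
  show "continuous_on N (E p)" for p
   unfolding E_def by (intro continuous_intros bc sc Bc S'c) (auto simp: N_def)
 next
  fix x assume x: "x \<in> N"
  then have s0: "s x ~= 0" by (simp add: N_def)
  show "(\<Sum>p\<in>P. xi p x) = 1" using s0 by (simp add: xi_def sum_distrib_right[symmetric] s_def[symmetric])
  have "(\<Sum>p\<in>P. E p x) = s x *R (- (inverse (s x))\<^sup>2 *R S' x) + inverse (s x) *R S' x"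
   unfolding E_def sum.distrib scaleR_sum_left[symmetric] scaleR_sum_right[symmetric] s_def[symmetric] S'_def[symmetric] ..
  also have "\<dots> = 0" using s0 by (simp add: power2_eq_square)
  finally show "(\<Sum>p\<in>P. E p x) = 0" .
 qed
qed

section \<open>Smoothing of fluxes\<close>

lemma powr_add_le:
 fixes a b :: "'a::real_normed_vector"
 assumes "0 <= p"
 shows "norm (a + b) powr p <= 2 powr p * (norm a powr p + norm b powr p)"
proof -
 have "norm (a + b) <= 2 * max (norm a) (norm b)" using norm_triangle_ineq[of a b] by linarith
 then have "norm (a + b) powr p <= (2 * max (norm a) (norm b)) powr p" using assms by (intro powr_mono2) auto
 also have "\<dots> = 2 powr p * max (norm a) (norm b) powr p" by (rule powr_mult)
 also have "\<dots> <= 2 powr p * (norm a powr p + norm b powr p)"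
  by (intro mult_left_mono) (auto simp: max_def)
 finally show ?thesis .
qed

lemma integrable_powr_add:
 fixes f g :: "'w => 'b::euclidean_space"
 assumes "0 <= p" and [measurable]: "f \<in> borel_measurable M" "g \<in> borel_measurable M"
  and i: "integrable M (%x. norm (f x) powr p)" "integrable M (%x. norm (g x) powr p)"
 shows "integrable M (%x. norm (f x + g x) powr p)"
proof (rule bi_bound)
 show "integrable M (%x. 2 powr p * (norm (f x) powr p + norm (g x) powr p))" using i by simp
 show "AE x in M. norm (norm (f x + g x) powr p) <= norm (2 powr p * (norm (f x) powr p + norm (g x) powr p))"
  using powr_add_le[OF assms(1)] by (intro AE_I2) simp
qed measurable

lemma integrable_powr_sum:
 fixes f :: "'i => 'w => 'b::euclidean_space"
 assumes "0 <= p" "finite I" "!!i. i \<in> I ==> f i \<in> borel_measurable M"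
  and "!!i. i \<in> I ==> integrable M (%x. norm (f i x) powr p)"
 shows "integrable M (%x. norm (\<Sum>i\<in>I. f i x) powr p)"
 using assms(2,3,4)
proof (induction I rule: finite_induct)
 case (insert i I)
 have "integrable M (%x. norm (f i x + (\<Sum>i\<in>I. f i x)) powr p)"
  using insert by (intro integrable_powr_add[OF assms(1)] borel_measurable_sum) auto
 then show ?case using insert by simp
qed simp

section \<open>Convolutions of measures with averaging densities and kernels\<close>

lemma pair_sigma_finite_finite_lborel: "finite_measure n ==> pair_sigma_finite n lborel"
 by (rule pair_sigma_finite.intro[OF finite_measure.axioms(1) sigma_finite_lborel])

text \<open>Finiteness of \<open>n\<close> and a uniform bound on the slice integrals give joint
  integrability. Slices in the other direction are then integrable for almost every \<open>y\<close>
  only.\<close>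

lemma AE_pair_swap_integrable:
 fixes H :: "'a::euclidean_space => 'a => 'b::euclidean_space"
 assumes n: "finite_measure n" "sets n = sets borel" and H: "(%z. H (fst z) (snd z)) \<in> borelm"
  and i: "!!x. integrable lborel (%y. H x y)" and B: "!!x. (LBINT y. norm (H x y)) <= B"
 shows "integrable (n \<Otimes>\<^sub>M lborel) (%(x, y). H x y)"
  and "AE y in lborel. integrable n (%x. H x y)"
  and "integrable lborel (%y. LINT x|n. H x y)"
  and "(LINT x|n. LINT y|lborel. H x y) = (LINT y|lborel. LINT x|n. H x y)"
proof -
 interpret n: finite_measure n by fact
 interpret P: pair_sigma_finite n "lborel :: 'a measure" by (rule pair_sigma_finite_finite_lborel[OF n(1)])
 note [measurable_cong] = n(2)
 have Hm [measurable]: "(%(x, y). H x y) \<in> borel_measurable (borel \<Otimes>\<^sub>M borel)"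
  using H by (simp add: borel_prod split_beta')
 have Hm': "(%(x, y). H x y) \<in> borel_measurable (n \<Otimes>\<^sub>M lborel)" by measurable
 show I: "integrable (n \<Otimes>\<^sub>M lborel) (%(x, y). H x y)"
 proof (rule P.Fubini_integrable[OF Hm'])
  show "integrable n (%x. LINT y|lborel. norm (case (x, y) of (x, y) => H x y))"
  proof (rule n.integrable_const_bound[where B=B])
   show "AE x in n. norm (LBINT y. norm (case (x, y) of (x, y) => H x y)) <= B"
    using B by (intro AE_I2) (simp add: integral_nonneg_AE)
  qed measurable
  show "AE x in n. integrable lborel (%y. case (x, y) of (x, y) => H x y)" using i by simp
 qed
 show "AE y in lborel. integrable n (%x. H x y)" using P.AE_integrable_snd[OF I] by simp
 show "integrable lborel (%y. LINT x|n. H x y)" using P.integrable_snd[OF I] by simp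
 show "(LINT x|n. LINT y|lborel. H x y) = (LINT y|lborel. LINT x|n. H x y)"
  using P.Fubini_integral[OF I] by simp
qed

context bump
begin

lemma ker_nonzero: assumes "ker rho u ~= 0" obtains t z where "0 < t" "t <= rho" "z \<in> supp theta" "u = t *R z"
proof -
 have "\<exists>t\<in>{0<..rho}. theta ((1 / t) *R u) ~= 0"
 proof (rule ccontr)
  assume "\<not> ?thesis"
  then have "indicator {0<..rho} t *R (theta ((1 / t) *R u) / t ^ Suc DIM('a)) = 0" for t :: real
   by (cases "t \<in> {0<..rho}") auto
  then have "kap rho u = 0" unfolding kap_def set_lebesgue_integral_def by (simp only: bi_zero)
  then show False using assms by (simp add: ker_def)
 qed
 then obtain t where t: "t \<in> {0<..rho}" "theta ((1 / t) *R u) ~= 0" by blast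
 show ?thesis by (rule that[of t "(1 / t) *R u"]) (use t supp_nz in auto)
qed

lemma dil_nonzero: assumes "dil t u ~= 0" "0 < t" obtains z where "z \<in> supp theta" "u = t *R z"
proof -
 have "theta ((1 / t) *R u) ~= 0" using assms by (auto simp: dil_def)
 then show ?thesis using that[of "(1 / t) *R u"] supp_nz assms by simp
qed

text \<open>Transposes of averaging and correction: \<open>conv_dil\<close> moves \<open>avg\<close>
  from a test field to the vector measure with density \<open>b\<close> with respect to
  \<open>n\<close>, and \<open>conv_ker\<close> does the same for \<open>cor\<close> and a scalar
  density.\<close>

definition conv_dil :: "real => ('a => 'a) => 'a measure => 'a => 'a" where
 "conv_dil rho b n y = (LINT x|n. dil rho (y - x) *R b x)"

definition conv_ker :: "real => ('a => real) => 'a measure => 'a => 'a" where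
 "conv_ker rho a n y = (LINT x|n. a x *R ker rho (y - x))"

text \<open>The last claim is what keeps the cost from growing: averaging can be shifted from the
  density to the weight \<open>u\<close>, because \<open>dil\<close> is nonnegative.\<close>

lemma conv_dil:
 assumes n: "finite_measure n" "sets n = sets borel" and b [measurable]: "b \<in> borelm" "!!x. norm (b x) <= A"
  and rho: "0 < rho"
 shows conv_dil_measurable: "conv_dil rho b n \<in> borelm"
  and conv_dil_bound: "norm (conv_dil rho b n y) <= T / rho ^ DIM('a) * A * measure n UNIV"
  and conv_dil_inner: "integrable lborel g ==> (LBINT y. conv_dil rho b n y \<bullet> g y) = (LINT x|n. b x \<bullet> avg rho g x)"
  and conv_dil_norm: "u \<in> borelm ==> (!!y. 0 <= u y) ==> (!!y. u y <= B) ==>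
    integrable lborel (%y. u y * norm (conv_dil rho b n y)) \<and>
    (LBINT y. u y * norm (conv_dil rho b n y)) <= (LINT x|n. norm (b x) * (LBINT y. dil rho (y - x) * u y))"
proof -
 interpret n: finite_measure n by fact
 note [measurable_cong] = n(2)
 have sp: "space n = UNIV" using sets_eq_imp_space_eq[OF n(2)] by simp
 have A: "0 <= A" using b(2)[of 0] norm_ge_zero[of "b 0"] by linarith
 have dm [measurable]: "(%z. dil rho (snd z - fst z)) \<in> borel_measurable (borel \<Otimes>\<^sub>M borel)"
  by (rule measurable_compose[OF _ dil_measurable]) measurable
 show m [measurable]: "conv_dil rho b n \<in> borelm"
  unfolding conv_dil_def[abs_def] dil_def by measurable
 have nb: "norm (dil rho (y - x) *R b x) <= T / rho ^ DIM('a) * A" for x y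
  unfolding norm_scaleR using dil_bounds[OF rho, of "y - x"] b(2)[of x] by (intro mult_mono) auto
 have ix: "integrable n (%x. dil rho (y - x) *R b x)" for y
  by (rule n.integrable_const_bound[where B="T / rho ^ DIM('a) * A"]) (use nb in \<open>auto simp: dil_def\<close>)
 show "norm (conv_dil rho b n y) <= T / rho ^ DIM('a) * A * measure n UNIV"
 proof -
  have "norm (conv_dil rho b n y) <= (LINT x|n. T / rho ^ DIM('a) * A)"
   unfolding conv_dil_def by (rule norm_integral_le) (use nb in auto)
  also have "\<dots> = T / rho ^ DIM('a) * A * measure n UNIV" by (simp add: sp ac_simps)
  finally show ?thesis .
 qed
 show "(LBINT y. conv_dil rho b n y \<bullet> g y) = (LINT x|n. b x \<bullet> avg rho g x)" if g: "integrable lborel g"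
 proof -
  have [measurable]: "g \<in> borelm" using g by auto
  let ?H = "%x y. (dil rho (y - x) *R b x) \<bullet> g y"
  have bound: "norm (?H x y) <= T / rho ^ DIM('a) * A * norm (g y)" for x y
  proof -
   have "norm (?H x y) <= norm (dil rho (y - x) *R b x) * norm (g y)" by (simp only: real_norm_def Cauchy_Schwarz_ineq2)
   also have "\<dots> <= T / rho ^ DIM('a) * A * norm (g y)" by (rule mult_right_mono[OF nb]) simp
   finally show ?thesis .
  qed
  have ig: "integrable lborel (%y. T / rho ^ DIM('a) * A * norm (g y))" using g by simp
  have iH: "integrable lborel (%y. ?H x y)" for x
  proof (rule bi_bound[OF ig])
   show "(%y. ?H x y) \<in> borel_measurable lborel" by measurable
   show "AE y in lborel. norm (?H x y) <= norm (T / rho ^ DIM('a) * A * norm (g y))"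
    unfolding real_norm_def[of "T / rho ^ DIM('a) * A * norm (g _)"] by (rule AE_I2) (rule order_trans[OF bound abs_ge_self])
  qed
  have BH: "(LBINT y. norm (?H x y)) <= (LBINT y. T / rho ^ DIM('a) * A * norm (g y))" for x
   by (rule integral_mono[OF integrable_norm[OF iH] ig bound])
  have Hm: "(%z. ?H (fst z) (snd z)) \<in> borelm"
   unfolding borel_prod[symmetric] by measurable
  have "(LINT x|n. LINT y|lborel. ?H x y) = (LINT y|lborel. LINT x|n. ?H x y)"
   by (rule AE_pair_swap_integrable(4)[OF n Hm iH BH])
  moreover have "(LINT x|n. ?H x y) = conv_dil rho b n y \<bullet> g y" for y
   unfolding conv_dil_def by (rule integral_inner_left) (rule ix)
  moreover have "(LBINT y. ?H x y) = b x \<bullet> avg rho g x" for x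
  proof -
   have "(LBINT y. b x \<bullet> (dil rho (y - x) *R g y)) = b x \<bullet> avg rho g x"
    unfolding avg_def by (rule integral_inner_right) (rule avg_integrable[OF rho g])
   then show ?thesis by simp
  qed
  ultimately show ?thesis by simp
 qed
 assume u [measurable]: "u \<in> borelm" and u0: "!!y. 0 <= u y" and uB: "!!y. u y <= B"
 have id: "integrable lborel (%y. dil rho (y - x))" for x
  using dil_integral(1)[OF rho, of x] not_integrable_integral_eq by fastforce
 let ?H = "%x y. norm (b x) * (dil rho (y - x) * u y)"
 have iH: "integrable lborel (%y. ?H x y)" for x
 proof (rule bi_bound[where f="%y. norm (b x) * (dil rho (y - x) * B)"])
  show "integrable lborel (%y. norm (b x) * (dil rho (y - x) * B))" using id by simp
  show "AE y in lborel. norm (?H x y) <= norm (norm (b x) * (dil rho (y - x) * B))"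
   using u0 uB dil_bounds(1)[OF rho]
   by (intro AE_I2) (auto simp: abs_mult intro!: mult_left_mono order_trans[OF uB abs_ge_self])
 qed measurable
 have H0: "0 <= ?H x y" for x y using u0 dil_bounds(1)[OF rho] by simp
 have BH: "(LBINT y. norm (?H x y)) <= A * B" for x
 proof -
  have "(LBINT y. norm (?H x y)) <= (LBINT y. A * (dil rho (y - x) * B))"
  proof (rule integral_mono[OF integrable_norm[OF iH]])
   show "integrable lborel (%y. A * (dil rho (y - x) * B))" using id by simp
   show "norm (?H x y) <= A * (dil rho (y - x) * B)" for y
    using H0[of x y] u0 uB b(2) A dil_bounds(1)[OF rho] by (simp only: real_norm_def abs_of_nonneg) (intro mult_mono mult_left_mono; simp)
  qed
  then show ?thesis using dil_integral(1)[OF rho] by simp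
 qed
 have Hm: "(%z. ?H (fst z) (snd z)) \<in> borelm"
  unfolding borel_prod[symmetric] by measurable
 note F = AE_pair_swap_integrable[OF n Hm iH BH]
 have le: "u y * norm (conv_dil rho b n y) <= (LINT x|n. ?H x y)" for y
 proof -
  have "norm (conv_dil rho b n y) <= (LINT x|n. norm (dil rho (y - x) *R b x))"
   unfolding conv_dil_def by (rule integral_norm_bound)
  then have "u y * norm (conv_dil rho b n y) <= u y * (LINT x|n. norm (dil rho (y - x) *R b x))"
   using u0 by (rule mult_left_mono)
  also have "\<dots> = (LINT x|n. u y * norm (dil rho (y - x) *R b x))" by simp
  also have "\<dots> = (LINT x|n. ?H x y)"
   using dil_bounds(1)[OF rho] by (intro bi_cong) (auto simp: ac_simps)
  finally show ?thesis .
 qed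
 have i: "integrable lborel (%y. u y * norm (conv_dil rho b n y))"
 proof (rule bi_bound[OF F(3)])
  show "AE y in lborel. norm (u y * norm (conv_dil rho b n y)) <= norm (LINT x|n. ?H x y)"
   using le u0 by (intro AE_I2) (simp add: order_trans[OF le abs_ge_self])
 qed measurable
 have "(LBINT y. u y * norm (conv_dil rho b n y)) <= (LINT y|lborel. LINT x|n. ?H x y)"
  by (rule integral_mono[OF i F(3) le])
 also have "\<dots> = (LINT x|n. LINT y|lborel. ?H x y)" using F(4) by simp
 also have "\<dots> = (LINT x|n. norm (b x) * (LBINT y. dil rho (y - x) * u y))" by simp
 finally show "integrable lborel (%y. u y * norm (conv_dil rho b n y)) \<and>
    (LBINT y. u y * norm (conv_dil rho b n y)) <= (LINT x|n. norm (b x) * (LBINT y. dil rho (y - x) * u y))"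
  using i by simp
qed

text \<open>Translation invariance makes the \<open>L1\<close> norm of the shifted kernel
  independent of the base point, so Fubini bounds the whole convolution by it.\<close>

lemma conv_ker_norm:
 assumes n: "finite_measure n" "sets n = sets borel" and a [measurable]: "a \<in> borelm" "!!x. \<bar>a x\<bar> <= A"
 shows "conv_ker rho a n \<in> borelm"
  and "integrable lborel (%y. norm (conv_ker rho a n y))"
  and "(LBINT y. norm (conv_ker rho a n y)) <= A * measure n UNIV * (LBINT u. norm (ker rho u))"
proof -
 interpret n: finite_measure n by fact
 note [measurable_cong] = n(2)
 have sp: "space n = UNIV" using sets_eq_imp_space_eq[OF n(2)] by simp
 show m [measurable]: "conv_ker rho a n \<in> borelm"
  unfolding conv_ker_def[abs_def] by measurable
 have ish: "integrable lborel (%y. norm (ker rho (y - x)))" for x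
  using integrable_lborel_affine[OF ker_integrable, of 1 rho "- x"] by simp
 have Is: "(LBINT y. norm (ker rho (y - x))) = (LBINT u. norm (ker rho u))" for x
 proof -
  have "(LBINT u. norm (ker rho u)) = \<bar>1\<bar> ^ DIM('a) *R (LBINT y. norm (ker rho (- x + 1 *R y)))"
   by (rule integral_lborel_affine) auto
  then show ?thesis by simp
 qed
 let ?H = "%x y. \<bar>a x\<bar> * norm (ker rho (y - x))"
 have iH: "integrable lborel (%y. ?H x y)" for x using ish by simp
 have BH: "(LBINT y. norm (?H x y)) <= A * (LBINT u. norm (ker rho u))" for x
  using a(2)[of x] by (simp add: abs_mult Is mult_right_mono)
 have Hm: "(%z. ?H (fst z) (snd z)) \<in> borelm"
  unfolding borel_prod[symmetric] by measurable
 note F = AE_pair_swap_integrable[OF n Hm iH BH]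
 have le: "norm (conv_ker rho a n y) <= (LINT x|n. ?H x y)" for y
  unfolding conv_ker_def using integral_norm_bound[of n "%x. a x *R ker rho (y - x)"] by simp
 show i: "integrable lborel (%y. norm (conv_ker rho a n y))"
 proof (rule bi_bound[OF F(3)])
  show "AE y in lborel. norm (norm (conv_ker rho a n y)) <= norm (LINT x|n. ?H x y)"
   using le by (intro AE_I2) (simp add: order_trans[OF le abs_ge_self])
 qed measurable
 have "(LBINT y. norm (conv_ker rho a n y)) <= (LINT y|lborel. LINT x|n. ?H x y)"
  by (rule integral_mono[OF i F(3) le])
 also have "\<dots> = (LINT x|n. LINT y|lborel. ?H x y)" using F(4) by simp
 also have "\<dots> <= (LINT x|n. A * (LBINT u. norm (ker rho u)))"
 proof (rule integral_mono)
  have "(%x. LINT y|lborel. ?H x y) \<in> borel_measurable n" by measurable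
  then show "integrable n (%x. LINT y|lborel. ?H x y)"
   by (rule n.integrable_const_bound[where B="A * (LBINT u. norm (ker rho u))", rotated])
     (use BH in \<open>auto simp: integral_nonneg_AE\<close>)
  show "(LBINT y. ?H x y) <= A * (LBINT u. norm (ker rho u))" for x
   using BH[of x] by simp
 qed simp
 finally show "(LBINT y. norm (conv_ker rho a n y)) <= A * measure n UNIV * (LBINT u. norm (ker rho u))"
  by (simp add: sp ac_simps)
qed

end

lemma (in bump_exp) conv_ker_inner:
 assumes n: "finite_measure n" "sets n = sets borel" and a [measurable]: "a \<in> borelm" "!!x. \<bar>a x\<bar> <= A"
  and g [measurable]: "g \<in> borelm" and gp: "integrable lborel (%y. norm (g y) powr conj_exp alpha)"
 shows "(LBINT y. conv_ker rho a n y \<bullet> g y) = (LINT x|n. a x * cor rho g x)"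
  and "integrable lborel (%y. norm (conv_ker rho a n y) powr alpha)"
proof -
 interpret n: finite_measure n by fact
 note [measurable_cong] = n(2)
 have sp: "space n = UNIV" using sets_eq_imp_space_eq[OF n(2)] by simp
 have A: "0 <= A" using a(2)[of 0] by linarith
 define G where "G = (LBINT y. norm (g y) powr conj_exp alpha)"
 have m [measurable]: "conv_ker rho a n \<in> borelm" by (rule conv_ker_norm(1)[OF n a])
 text \<open>Integrability of the powers comes from Young's inequality with a \<open>y\<close>-dependent weight, in place
  of Jensen's inequality.\<close>
 let ?M = "%x y. norm (ker rho (y - x)) powr alpha"
 have Mm: "(%z. ?M (fst z) (snd z)) \<in> borelm"
  unfolding borel_prod[symmetric] by measurable
 have MB: "(LBINT y. norm (?M x y)) <= J rho" for x using ker_shift_powr(2)[of rho x] by simp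
 note FM = AE_pair_swap_integrable[OF n Mm ker_shift_powr(1) MB]
 \<comment> \<open>Young's inequality with second factor 1. The premise holds for almost every
   \<open>y\<close>.\<close>
 have ik: "integrable n (%x. ker rho (y - x))" if "integrable n (%x. ?M x y)" for y
 proof (rule bi_bound[where f="%x. 1 + ?M x y"])
  show "integrable n (%x. 1 + ?M x y)" using that by simp
  show "(%x. ker rho (y - x)) \<in> borel_measurable n" by measurable
  show "AE x in n. norm (ker rho (y - x)) <= norm (1 + ?M x y)"
  proof (intro AE_I2)
   fix x
   have "norm (ker rho (y - x)) * 1 <= 1 powr - alpha * ?M x y + 1 powr conj_exp alpha * 1 powr conj_exp alpha"
    by (rule Youngs_inequality_conj_exp[OF alpha(1)]) auto
   then show "norm (ker rho (y - x)) <= norm (1 + ?M x y)" by simp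
  qed
 qed
 have ia: "integrable n (%x. a x *R ker rho (y - x))" if "integrable n (%x. ?M x y)" for y
 proof (rule bi_bound[OF integrable_scaleR_right[OF ik[OF that], of A]])
  show "(%x. a x *R ker rho (y - x)) \<in> borel_measurable n" by measurable
  show "AE x in n. norm (a x *R ker rho (y - x)) <= norm (A *R ker rho (y - x))"
  proof (intro AE_I2)
   fix x
   show "norm (a x *R ker rho (y - x)) <= norm (A *R ker rho (y - x))"
    unfolding norm_scaleR by (rule mult_right_mono[OF order_trans[OF a(2) abs_ge_self]]) simp
  qed
 qed
 define N where "N = measure n UNIV"
 have N: "0 <= N" by (simp add: N_def)
 have pw: "norm (conv_ker rho a n y) powr alpha <= (A * (1 + N)) powr alpha * (LINT x|n. ?M x y)" if y: "integrable n (%x. ?M x y)" for y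
 proof -
  define M where "M = (LINT x|n. ?M x y)"
  have M: "0 <= M" by (simp add: M_def)
  define I where "I = (LINT x|n. norm (ker rho (y - x)))"
  have I0: "0 <= I" by (simp add: I_def)
  have "norm (conv_ker rho a n y) <= (LINT x|n. A * norm (ker rho (y - x)))"
   unfolding conv_ker_def
  proof (rule norm_integral_le)
   show "integrable n (%x. A * norm (ker rho (y - x)))" using ik[OF y] by simp
   show "norm (a x *R ker rho (y - x)) <= A * norm (ker rho (y - x))" for x
    unfolding norm_scaleR by (rule mult_right_mono[OF a(2)]) simp
  qed
  then have c: "norm (conv_ker rho a n y) <= A * I" by (simp add: I_def)
  \<comment> \<open>For \<open>M = 0\<close> the weight chosen below would vanish, but then the
    kernel is 0 almost everywhere.\<close>
  have I: "I <= (1 + N) * M powr (1 / alpha)"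
  proof (cases "M = 0")
   case True
   then have "AE x in n. ?M x y = 0"
    using integral_nonneg_eq_0_iff_AE[OF y] by (simp add: M_def)
   then have "AE x in n. norm (ker rho (y - x)) = 0" by eventually_elim simp
   then have "I = (LINT x|n. 0)" unfolding I_def by (intro integral_cong_AE) auto
   then show ?thesis using True by simp
  next
   case False
   then have Mp: "0 < M" using M by simp
   have p: "1 < conj_exp alpha" "1 / alpha + 1 / conj_exp alpha = 1"
    using alpha(1) by (auto simp: conj_exp_def field_simps)
   \<comment> \<open>Balances Young's inequality: \<open>\<sigma> powr (- alpha) * M\<close> and
     \<open>\<sigma> powr conj_exp alpha\<close> both become
     \<open>M powr (1 / alpha)\<close>.\<close>
   define \<sigma> where "\<sigma> = M powr (1 / (alpha * conj_exp alpha))"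
   have \<sigma>: "0 < \<sigma>" using Mp by (simp add: \<sigma>_def)
   have s1: "\<sigma> powr (- alpha) * M = M powr (1 / alpha)"
   proof -
    have "\<sigma> powr (- alpha) * M = M powr (- (1 / conj_exp alpha)) * M powr 1"
     using Mp alpha(1) by (simp add: \<sigma>_def powr_powr)
    also have "\<dots> = M powr (1 - 1 / conj_exp alpha)" by (simp only: powr_add[symmetric] add.commute diff_conv_add_uminus)
    also have "1 - 1 / conj_exp alpha = 1 / alpha" using p(2) by linarith
    finally show ?thesis .
   qed
   have s2: "\<sigma> powr conj_exp alpha = M powr (1 / alpha)" using Mp p(1) by (simp add: \<sigma>_def powr_powr)
   have "I <= (LINT x|n. \<sigma> powr (- alpha) * ?M x y + \<sigma> powr conj_exp alpha)"
    unfolding I_def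
   proof (rule integral_mono)
    show "integrable n (%x. norm (ker rho (y - x)))" using ik[OF y] by simp
    show "integrable n (%x. \<sigma> powr (- alpha) * ?M x y + \<sigma> powr conj_exp alpha)" using y by simp
    show "norm (ker rho (y - x)) <= \<sigma> powr (- alpha) * ?M x y + \<sigma> powr conj_exp alpha" for x
     using Youngs_inequality_conj_exp[OF alpha(1) norm_ge_zero zero_le_one \<sigma>, of "ker rho (y - x)"] by simp
   qed
   also have "\<dots> = \<sigma> powr (- alpha) * M + N * \<sigma> powr conj_exp alpha"
    using y by (simp add: M_def N_def sp)
   also have "\<dots> = (1 + N) * M powr (1 / alpha)" unfolding s1 s2 by (simp add: distrib_right)
   finally show ?thesis .
  qed
  have "norm (conv_ker rho a n y) <= A * (1 + N) * M powr (1 / alpha)"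
   using order_trans[OF c mult_left_mono[OF I A]] by (simp add: mult.assoc)
  then have "norm (conv_ker rho a n y) powr alpha <= (A * (1 + N) * M powr (1 / alpha)) powr alpha"
   using alpha(1) by (intro powr_mono2) auto
  also have "\<dots> = (A * (1 + N)) powr alpha * M"
   using alpha(1) M A N by (simp add: powr_mult powr_powr)
  finally show ?thesis by (simp add: M_def)
 qed
 show "integrable lborel (%y. norm (conv_ker rho a n y) powr alpha)"
 proof (rule bi_bound[OF integrable_mult_right[OF FM(3), of "(A * (1 + N)) powr alpha"]])
  show "AE y in lborel. norm (norm (conv_ker rho a n y) powr alpha) <= norm ((A * (1 + N)) powr alpha * (LINT x|n. ?M x y))"
   using FM(2) by eventually_elim (use pw in simp)
 qed measurable
 let ?H = "%x y. (a x *R ker rho (y - x)) \<bullet> g y"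
 have bound: "norm (?H x y) <= A * (norm (ker rho (y - x)) * norm (g y))" for x y
 proof -
  have "norm (?H x y) <= \<bar>a x\<bar> * (norm (ker rho (y - x)) * norm (g y))"
   using Cauchy_Schwarz_ineq2[of "a x *R ker rho (y - x)" "g y"] by (simp add: mult.assoc)
  also have "\<dots> <= A * (norm (ker rho (y - x)) * norm (g y))" by (rule mult_right_mono[OF a(2)]) simp
  finally show ?thesis .
 qed
 have iH: "integrable lborel (%y. ?H x y)" for x
  using ker_inner_integrable[OF g gp, of rho x] by simp
 have BH: "(LBINT y. norm (?H x y)) <= A * (J rho + G)" for x
 proof -
  have "(LBINT y. norm (?H x y)) <= (LBINT y. A * (norm (ker rho (y - x)) * norm (g y)))"
   by (rule integral_mono[OF integrable_norm[OF iH] integrable_mult_right[OF ker_norm_integrable[OF g gp]] bound])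
  also have "\<dots> = A * (LBINT y. norm (ker rho (y - x)) * norm (g y))" by simp
  also have "\<dots> <= A * (J rho + G)"
   using ker_norm_integral_le[OF g gp zero_less_one, of rho x] A by (intro mult_left_mono) (simp_all add: G_def)
  finally show ?thesis .
 qed
 have Hm: "(%z. ?H (fst z) (snd z)) \<in> borelm"
  unfolding borel_prod[symmetric] by measurable
 have "(LINT x|n. LINT y|lborel. ?H x y) = (LINT y|lborel. LINT x|n. ?H x y)"
  by (rule AE_pair_swap_integrable(4)[OF n Hm iH BH])
 moreover have "(LINT x|n. LINT y|lborel. ?H x y) = (LINT x|n. a x * cor rho g x)"
  by (simp add: cor_def)
 moreover have "(LINT y|lborel. LINT x|n. ?H x y) = (LBINT y. conv_ker rho a n y \<bullet> g y)"
 proof (rule integral_cong_AE)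
  show "AE y in lborel. (LINT x|n. ?H x y) = conv_ker rho a n y \<bullet> g y"
   using FM(2)
  proof eventually_elim
   case (elim y)
   show ?case unfolding conv_ker_def by (rule integral_inner_left) (rule ia[OF elim])
  qed
 qed measurable
 ultimately show "(LBINT y. conv_ker rho a n y \<bullet> g y) = (LINT x|n. a x * cor rho g x)" by simp
qed

section \<open>Gluing local averages by a partition of unity\<close>

lemma GDERIV_sum:
 "(!!i. i \<in> I ==> GDERIV (f i) x :> D i) ==> GDERIV (%x. \<Sum>i\<in>I. f i x) x :> (\<Sum>i\<in>I. D i)"
 unfolding gderiv_def inner_sum_right by (rule has_derivative_sum)

text \<open>The partition functions vanish beyond \<open>r p\<close>, whereas the cones are
  available up to \<open>2 * r p\<close>. In the overlap both facts hold, so products with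
  \<open>xi p\<close>, extended by zero, stay continuous and differentiable.\<close>

locale cone_cover =
 fixes K :: "'a::euclidean_space set" and alpha :: real and P N :: "'a set"
  and xi :: "'a => 'a => real" and E :: "'a => 'a => 'a" and r :: "'a => real"
  and theta :: "'a => 'a => real" and D :: "'a => 'a => 'a" and T R1 R2 :: "'a => real"
 assumes K: "compact K" "K \<subseteq> closure (interior K)"
  and P: "finite P" and N: "open N" "K \<subseteq> N" and r: "!!p. p \<in> P ==> 0 < r p"
  and xi_deriv: "!!p x. x \<in> N ==> GDERIV (xi p) x :> E p x" and E_cont: "!!p. continuous_on N (E p)"
  and xi_nonneg: "!!p x. x \<in> N ==> 0 <= xi p x"
  and xi_zero: "!!p x. x \<in> N ==> r p <= dist p x ==> p \<in> P ==> xi p x = 0"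
  and E_zero: "!!p x. x \<in> N ==> r p <= dist p x ==> p \<in> P ==> E p x = 0"
  and xi_sum: "!!x. x \<in> N ==> (\<Sum>p\<in>P. xi p x) = 1" and E_sum: "!!x. x \<in> N ==> (\<Sum>p\<in>P. E p x) = 0"
  and bumps: "!!p. p \<in> P ==> bump_exp (theta p) (D p) (T p) (R1 p) (R2 p) alpha"
  and cone: "!!p x t z. p \<in> P ==> x \<in> K ==> dist p x <= 2 * r p ==> 0 < t ==> t <= 1 ==>
    z \<in> supp (theta p) ==> x + t *R z \<in> interior K"
begin

lemma bump: "p \<in> P ==> bump (theta p) (D p) (T p) (R1 p) (R2 p)"
 by (rule bump_exp.axioms(1)[OF bumps])

lemma xi_continuous: "continuous_on K (xi p)"
proof -
 have "isCont (xi p) x" if "x \<in> K" for x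
  using xi_deriv[of x p] N(2) that unfolding gderiv_def by (blast intro: has_derivative_continuous)
 then show ?thesis by (simp add: continuous_at_imp_continuous_on)
qed

lemma E_continuous: "continuous_on K (E p)"
 by (rule continuous_on_subset[OF E_cont N(2)])

lemma sum_near:
 fixes F G :: "'a => 'b::real_vector"
 assumes x: "x \<in> K" and FG: "!!p. p \<in> P ==> dist p x < r p ==> F p = G p"
 shows "(\<Sum>p\<in>P. xi p x *R F p) = (\<Sum>p\<in>P. xi p x *R G p)"
 by (rule sum.cong) (use x FG xi_zero[of x] N(2) in \<open>force simp: not_less[symmetric]\<close>)+

lemma avg_cor_continuous:
 assumes w: "weak_gradient_pair (interior K) phi g" and g: "integrable lborel (%x. norm (g x) powr conj_exp alpha)"
  and p: "p \<in> P" and rho: "0 < rho" "rho <= 1"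
 shows "continuous_on {x\<in>K. dist p x <= 2 * r p} (%x. bump.avg (theta p) rho phi x - bump.cor (theta p) rho g x)"
 by (rule bump_exp.representative_continuous[OF bumps[OF p] w g rho(1)])
   (use cone[OF p] rho in auto)

lemma avg_cor_eq_AE:
 assumes w: "weak_gradient_pair (interior K) phi g" and g: "integrable lborel (%x. norm (g x) powr conj_exp alpha)"
  and p: "p \<in> P" and rho: "0 < rho" "rho <= 1"
 shows "AE x in lborel. x \<in> interior K \<inter> ball p (2 * r p) -->
      phi x = bump.avg (theta p) rho phi x - bump.cor (theta p) rho g x"
proof (rule bump_exp.representative_AE[OF bumps[OF p] w g rho(1), where A="{x\<in>K. dist p x <= 2 * r p}"])
 show "interior K \<inter> ball p (2 * r p) \<subseteq> {x\<in>K. dist p x <= 2 * r p}" using interior_subset by auto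
qed (use cone[OF p] rho in auto)

text \<open>Both sides are continuous up to the boundary of \<open>K\<close> near \<open>p\<close>
  and agree almost everywhere inside. The cone formula thus holds at boundary points too, which the
  measures may charge.\<close>

lemma representative_eq:
 assumes w: "weak_gradient_pair (interior K) phi g" and g: "integrable lborel (%x. norm (g x) powr conj_exp alpha)"
  and c: "continuous_on K c" "AE x in lborel. x \<in> interior K --> c x = phi x"
  and p: "p \<in> P" and rho: "0 < rho" "rho <= 1" and x: "x \<in> K" "dist p x < 2 * r p"
 shows "c x = bump.avg (theta p) rho phi x - bump.cor (theta p) rho g x"
proof (rule continuous_AE_eq_imp_eq[where K="K \<inter> ball p (2 * r p)" and V="interior K \<inter> ball p (2 * r p)"])
 show "continuous_on (K \<inter> ball p (2 * r p)) c" by (rule continuous_on_subset[OF c(1)]) auto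
 show "continuous_on (K \<inter> ball p (2 * r p)) (%x. bump.avg (theta p) rho phi x - bump.cor (theta p) rho g x)"
  by (rule continuous_on_subset[OF avg_cor_continuous[OF w g p rho]]) auto
 show "K \<inter> ball p (2 * r p) \<subseteq> closure (interior K \<inter> ball p (2 * r p))"
  using open_Int_closure_subset[OF open_ball, of p "2 * r p" "interior K"] K(2) by (auto simp: Int_commute)
 show "interior K \<inter> ball p (2 * r p) \<subseteq> K \<inter> ball p (2 * r p)" using interior_subset by auto
 show "AE x in lborel. x \<in> interior K \<inter> ball p (2 * r p) -->
   c x = bump.avg (theta p) rho phi x - bump.cor (theta p) rho g x"
  using avg_cor_eq_AE[OF w g p rho] c(2) by eventually_elim auto
qed (use x in auto)

text \<open>A local representative is continuous only within \<open>2 * r p\<close>; times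
  \<open>xi p\<close> it extends continuously by zero, since \<open>K\<close> is covered by two
  closed sets on each of which the product is continuous.\<close>

lemma Sobolev_representative:
 assumes w: "weak_gradient_pair (interior K) phi g" and g: "integrable lborel (%x. norm (g x) powr conj_exp alpha)"
 obtains c where "continuous_on K c" "AE x in lborel. x \<in> interior K --> c x = phi x"
proof -
 define k where "k p x = bump.avg (theta p) 1 phi x - bump.cor (theta p) 1 g x" for p x
 define c where "c x = (\<Sum>p\<in>P. xi p x *R k p x)" for x
 have "continuous_on K (%x. xi p x *R k p x)" if p: "p \<in> P" for p
 proof -
  have e: "K = {x\<in>K. dist p x <= 2 * r p} \<union> (K - ball p (r p))" using r[OF p] by auto
  have "{x\<in>K. dist p x <= 2 * r p} = K \<inter> cball p (2 * r p)" by auto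
  then have cl: "closed {x\<in>K. dist p x <= 2 * r p}" using K(1) by (simp add: compact_imp_closed closed_Int)
  have "continuous_on {x\<in>K. dist p x <= 2 * r p} (%x. xi p x *R k p x)"
   unfolding k_def by (intro continuous_on_scaleR avg_cor_continuous[OF w g p]
     continuous_on_subset[OF xi_continuous]) auto
  moreover have "continuous_on (K - ball p (r p)) (%x. xi p x *R k p x)"
  proof (subst continuous_on_cong[OF refl])
   show "xi p x *R k p x = 0" if "x \<in> K - ball p (r p)" for x
    using xi_zero[of x p] that p N(2) by auto
  qed simp
  ultimately show ?thesis
   by (subst e) (rule continuous_on_closed_Un[OF cl], use K(1) in \<open>auto simp: compact_imp_closed closed_Diff\<close>)
 qed
 then have "continuous_on K c" unfolding c_def by (intro continuous_on_sum) auto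
 moreover have "AE x in lborel. \<forall>p\<in>P. x \<in> interior K \<inter> ball p (2 * r p) --> phi x = k p x"
  using avg_cor_eq_AE[OF w g, of _ 1] by (simp add: AE_finite_all[OF P] k_def)
 then have "AE x in lborel. x \<in> interior K --> c x = phi x"
 proof eventually_elim
  case (elim x)
  show ?case
  proof
   assume x: "x \<in> interior K"
   then have xK: "x \<in> K" using interior_subset by blast
   have "c x = (\<Sum>p\<in>P. xi p x *R phi x)"
    unfolding c_def by (rule sum_near[OF xK]) (use elim x r in fastforce)
   also have "\<dots> = phi x" using xi_sum[of x] xK N(2) by (auto simp: scaleR_left.sum[symmetric] sum_distrib_right[symmetric])
   finally show "c x = phi x" .
  qed
 qed
 ultimately show ?thesis by (rule that)
qed

text \<open>Turns a Sobolev function into a test function for the measure constraint. The second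
  term of the gradient is the price of localisation: there the derivative falls on the
  partition.\<close>

lemma smooth_C1:
 assumes w: "weak_gradient_pair (interior K) phi g" and rho: "0 < rho" "rho <= 1"
 shows "C1_on K (%x. \<Sum>p\<in>P. xi p x * bump.avg (theta p) rho phi x)
      (%x. \<Sum>p\<in>P. xi p x *R bump.avg (theta p) rho g x + bump.avg (theta p) rho phi x *R E p x)"
proof -
 have i: "integrable lborel phi" "integrable lborel g" using w by (auto simp: weak_gradient_pair_def)
 have c: "continuous_on K (bump.avg (theta p) rho phi)" "continuous_on K (bump.avg (theta p) rho g)" if p: "p \<in> P" for p
  using bump.avg_continuous[OF bump[OF p] rho(1)] i by (blast intro: continuous_on_subset)+
 have "GDERIV (%x. xi p x * bump.avg (theta p) rho phi x) x :>
   xi p x *R bump.avg (theta p) rho g x + bump.avg (theta p) rho phi x *R E p x" if p: "p \<in> P" and x: "x \<in> interior K" for p x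
 proof -
  have xK: "x \<in> K" and xN: "x \<in> N" using x interior_subset N(2) by blast+
  show ?thesis
  proof (cases "dist p x <= 2 * r p")
   case True
   then show ?thesis
    using GDERIV_mult[OF xi_deriv[OF xN] bump.avg_GDERIV_weak[OF bump[OF p] rho(1) w], of p] cone[OF p xK _ rho] by blast
  next
   \<comment> \<open>The average is still differentiable here, perhaps with a gradient other than
     the average of \<open>g\<close>, but this gradient is multiplied by
     \<open>xi p x = 0\<close>.\<close>
   case False
   then have "r p <= dist p x" using r[OF p] by linarith
   then have z: "xi p x = 0" using xi_zero[OF xN _ p] by blast
   show ?thesis
    using GDERIV_mult[OF xi_deriv[OF xN] bump.avg_GDERIV[OF bump[OF p] rho(1) i(1)], of p] by (simp add: z)
  qed
 qed
 then show ?thesis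
  unfolding C1_on_def
  by (intro conjI ballI GDERIV_sum continuous_on_sum continuous_on_add continuous_on_mult continuous_on_scaleR
    c xi_continuous E_continuous) auto
qed

end

section \<open>Integrals of continuous functions over compact sets\<close>

lemma indicator_continuous_measurable:
 fixes f :: "'a::euclidean_space => 'b::euclidean_space"
 assumes "compact K" "continuous_on K f"
 shows "(%x. indicator K x *R f x) \<in> borelm"
 by (rule borel_measurable_continuous_on_indicator[OF _ assms(2)]) (simp add: assms(1) compact_imp_closed)

lemma compact_continuous_bound:
 fixes f :: "'a::euclidean_space => 'b::euclidean_space"
 assumes "compact K" "continuous_on K f"
 obtains B where "0 <= B" "!!x. x \<in> K ==> norm (f x) <= B"
proof -
 obtain B where "0 < B" "!!y. y \<in> f ` K ==> norm y <= B"
  using compact_imp_bounded[OF compact_continuous_image[OF assms(2,1)]] unfolding bounded_pos by blast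
 then show ?thesis using that[of B] by auto
qed

lemma set_integrable_continuous:
 fixes f :: "'a::euclidean_space => 'b::euclidean_space"
 assumes "finite_measure n" "sets n = sets borel" "compact K" "continuous_on K f"
 shows "set_integrable n K f"
proof -
 obtain B where "0 <= B" "!!x. x \<in> K ==> norm (f x) <= B" using compact_continuous_bound[OF assms(3,4)] by blast
 then show ?thesis
  unfolding set_integrable_def
  by (intro bounded_integrable_finite[where B=B] assms(1))
    (use indicator_continuous_measurable[OF assms(3,4)] in \<open>auto simp: indicator_def measurable_cong_sets[OF assms(2) refl]\<close>)
qed

lemma set_integral_lebesgue_eq_lborel:
 fixes f :: "'a::euclidean_space => real"
 assumes "compact K" "continuous_on K f"
 shows "(LINT x:K|lebesgue. f x) = (LINT x:K|lborel. f x)"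
 unfolding set_lebesgue_integral_def
 by (rule integral_completion) (use indicator_continuous_measurable[OF assms] in simp)

lemma set_integral_const_AE:
 assumes n: "prob_space n" "sets n = sets borel" "AE x in n. x \<in> K" and K: "K \<in> sets borel"
 shows "(LINT x:K|n. (c::real)) = c"
proof -
 have "AE x in n. indicator K x *R c = c" using n(3) by eventually_elim simp
 then have "(LINT x:K|n. c) = (LINT x|n. c)"
  unfolding set_lebesgue_integral_def
  by (intro integral_cong_AE) (use K in \<open>auto simp: measurable_cong_sets[OF n(2) refl]\<close>)
 then show ?thesis by (simp add: prob_space.prob_space[OF n(1)])
qed

text \<open>The constraint speaks of functions of mean zero. Subtracting the mean changes neither
  the gradient nor the difference of the integrals against two probability measures.\<close>

lemma measure_div_eq_C1:
 fixes K :: "'a::euclidean_space set"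
 assumes mp: "prob_space mup" "sets mup = sets borel" "AE x in mup. x \<in> K"
  and mm: "prob_space mum" "sets mum = sets borel" "AE x in mum. x \<in> K"
  and K: "compact K" and q: "measure_div_eq K q mup mum" and f: "C1_on K f D"
 shows "- vector_integral K q D = (LINT x:K|mup. f x) - (LINT x:K|mum. f x)"
proof -
 have Kb [measurable]: "K \<in> sets borel" using K by (simp add: compact_imp_closed)
 have fc: "continuous_on K f" using f by (simp add: C1_on_def)
 have Kf: "emeasure lborel K < \<infinity>" using emeasure_compact_finite[OF K] by simp
 define kappa where "kappa = (LINT x:K|lborel. f x) / measure lborel K"
 have si: "set_integrable lborel K f" "set_integrable lborel K (%x. kappa)"
  unfolding set_integrable_def using borel_integrable_compact[OF K fc] borel_integrable_compact[OF K continuous_on_const[of _ kappa]] by simp_all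
 have "(LINT x:K|lborel. f x - kappa) = (LINT x:K|lborel. f x) - kappa * measure lborel K"
  using set_integral_diff(2)[OF si] Kf by (simp add: set_lebesgue_integral_def)
 \<comment> \<open>For a null set \<open>K\<close> the mean is a division by 0, hence 0, and the
   integral vanishes as well.\<close>
 moreover have "(LINT x:K|lborel. f x) = 0" if "measure lborel K = 0"
 proof -
  have "emeasure lborel K = 0" using that Kf emeasure_eq_ennreal_measure[of lborel K] by auto
  then have "AE x in lborel. x \<notin> K" by (intro AE_not_in) (simp add: null_sets_def)
  then have "AE x in lborel. indicator K x *R f x = 0" by eventually_elim simp
  then have "(LBINT x. indicator K x *R f x) = (LINT x|(lborel::'a measure). 0)"
   by (intro integral_cong_AE) (use indicator_continuous_measurable[OF K fc] in auto)
  then show ?thesis by (simp add: set_lebesgue_integral_def)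
 qed
 ultimately have "(LINT x:K|lborel. f x - kappa) = 0" by (cases "measure lborel K = 0") (auto simp: kappa_def)
 then have z: "(LINT x:K|lebesgue. f x - kappa) = 0"
  using set_integral_lebesgue_eq_lborel[OF K continuous_on_diff[OF fc continuous_on_const]] by simp
 have "GDERIV (%x. f x - kappa) x :> D x" if "x \<in> interior K" for x
  using GDERIV_diff[OF _ GDERIV_const, of f x "D x" kappa] f that by (simp add: C1_on_def)
 then have "C1_on K (%x. f x - kappa) D"
  using f unfolding C1_on_def by (simp add: continuous_on_diff)
 then have *: "- vector_integral K q D = (LINT x:K|mup. f x - kappa) - (LINT x:K|mum. f x - kappa)"
  using q z unfolding measure_div_eq_def by blast
 have "(LINT x:K|n. f x - kappa) = (LINT x:K|n. f x) - kappa" if n: "prob_space n" "sets n = sets borel" "AE x in n. x \<in> K" for n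
 proof -
  have fn: "finite_measure n" by (rule prob_space.finite_measure[OF n(1)])
  show ?thesis
   using set_integral_diff(2)[OF set_integrable_continuous[OF fn n(2) K fc] set_integrable_continuous[OF fn n(2) K continuous_on_const], of kappa]
    set_integral_const_AE[OF n Kb, of kappa] by simp
 qed
 then show ?thesis using * mp mm by simp
qed

lemma Hoelder_integrable:
 fixes f g :: "'w => 'b::euclidean_space"
 assumes alpha: "1 < alpha" and [measurable]: "f \<in> borel_measurable M" "g \<in> borel_measurable M"
  and i: "integrable M (%x. norm (f x) powr alpha)" "integrable M (%x. norm (g x) powr conj_exp alpha)"
 shows "integrable M (%x. f x \<bullet> g x)"
proof (rule bi_bound[OF bi_addI[OF i]])
 show "AE x in M. norm (f x \<bullet> g x) <= norm (norm (f x) powr alpha + norm (g x) powr conj_exp alpha)"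
 proof (rule AE_I2)
  fix x
  have "norm (f x) * norm (g x) <= norm (f x) powr alpha + norm (g x) powr conj_exp alpha"
   using Youngs_inequality_conj_exp[OF alpha norm_ge_zero norm_ge_zero zero_less_one, of "f x" "g x"] by simp
  then show "norm (f x \<bullet> g x) <= norm (norm (f x) powr alpha + norm (g x) powr conj_exp alpha)"
   using Cauchy_Schwarz_ineq2[of "f x" "g x"] by (simp add: abs_of_nonneg)
 qed
qed measurable

lemma bounded_powr_integrable:
 fixes f :: "'a::euclidean_space => 'b::euclidean_space"
 assumes [measurable]: "f \<in> borelm" and U: "bounded U" "!!y. y \<notin> U ==> f y = 0"
  and B: "!!y. norm (f y) <= B" and alpha: "0 <= alpha"
 shows "integrable lborel (%y. norm (f y) powr alpha)"
proof -
 obtain R where R: "U \<subseteq> cball 0 R" using U(1) unfolding bounded_pos by (auto simp: subset_iff)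
 have i: "integrable lborel (%y::'a. indicator (cball 0 R) y *R (B powr alpha))"
  by (rule borel_integrable_compact) auto
 show ?thesis
 proof (rule bi_bound[OF i])
  show "AE y in lborel. norm (norm (f y) powr alpha) <= norm (indicator (cball 0 R) y *R (B powr alpha))"
  proof (rule AE_I2)
   fix y
   have "y \<notin> U" if "y \<notin> cball 0 R" using R that by blast
   then show "norm (norm (f y) powr alpha) <= norm (indicator (cball 0 R) y *R (B powr alpha))"
    using powr_mono2[OF alpha norm_ge_zero B[of y]] U(2)[of y] by (cases "y \<in> cball 0 R") auto
  qed
 qed measurable
qed

section \<open>The smoothed flux: support, integrability, divergence and cost\<close>

text \<open>In the application \<open>m\<close> is the total variation of a competitor,
  \<open>gamma\<close> its density of norm at most 1, and \<open>A p\<close> a bound on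
  \<open>K\<close> for the gradient of a partition function.\<close>

locale smoothed_flux = cone_cover K alpha P N xi E r theta D T R1 R2
 for K :: "'a::euclidean_space set" and alpha P N xi E r theta D T R1 R2 +
 fixes m mup mum :: "'a measure" and gamma :: "'a => 'a" and A :: "'a => real"
 assumes m: "finite_measure m" "sets m = sets borel" and mp: "finite_measure mup" "sets mup = sets borel"
  and mm: "finite_measure mum" "sets mum = sets borel"
  and gamma [measurable]: "gamma \<in> borelm" and gamma1: "!!x. norm (gamma x) <= 1" and alpha1: "1 < alpha"
  and A: "!!p x. x \<in> K ==> norm (E p x) <= A p" and A0: "!!p. 0 <= A p"
begin

definition X :: "'a => 'a => real" where "X p x = indicator K x *R xi p x"
definition a :: "'a => 'a => real" where "a p x = (indicator K x *R E p x) \<bullet> gamma x"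
definition cd :: "real => 'a => 'a => 'a" where "cd rho p = bump.conv_dil (theta p) rho (%x. X p x *R gamma x) m"
definition ck :: "real => 'a => 'a => 'a" where "ck rho p = bump.conv_ker (theta p) rho (a p) m"
definition cp :: "real => 'a measure => 'a => 'a => 'a" where "cp rho n p = bump.conv_ker (theta p) rho (X p) n"
text \<open>Read off by transposition, when localised averages of a test function are inserted into
  the constraint of the competitor: \<open>cd\<close> is the averaged competitor, \<open>ck\<close>
  comes from the gradients of the partition, and \<open>cp\<close> from the difference between the
  test function and its averages under the two given measures.\<close>

definition flux :: "real => 'a => 'a" where
 "flux rho y = (\<Sum>p\<in>P. cd rho p y + (ck rho p y + (cp rho mup p y - cp rho mum p y)))"

lemma X_measurable [measurable]: "X p \<in> borelm"
 unfolding X_def[abs_def] by (rule indicator_continuous_measurable[OF K(1) xi_continuous])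

lemma a_measurable [measurable]: "a p \<in> borelm"
proof -
 have [measurable]: "(%x. indicator K x *R E p x) \<in> borelm"
  by (rule indicator_continuous_measurable[OF K(1) E_continuous])
 show ?thesis unfolding a_def[abs_def] by measurable
qed

lemma X_bounds: assumes "p \<in> P" shows "0 <= X p x" "X p x <= 1"
proof -
 have "xi p x <= (\<Sum>p\<in>P. xi p x)" if "x \<in> K"
  using xi_nonneg[of x] that N(2) by (intro member_le_sum assms P) auto
 then show "0 <= X p x" "X p x <= 1" using xi_nonneg[of x p] xi_sum[of x] N(2) by (auto simp: X_def indicator_def)
qed

lemma X_sum: "(\<Sum>p\<in>P. X p x) = indicator K x"
 using xi_sum[of x] N(2) by (auto simp: X_def indicator_def)

lemma X_abs: "p \<in> P ==> \<bar>X p x\<bar> <= 1"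
 using X_bounds[of p x] by simp

lemma Xgamma_norm: "p \<in> P ==> norm (X p x *R gamma x) <= X p x"
 using X_bounds[of p x] gamma1[of x] by (simp add: mult_left_le)

lemma Xgamma_norm1: "p \<in> P ==> norm (X p x *R gamma x) <= 1"
 using Xgamma_norm[of p x] X_bounds[of p x] by simp

lemma a_abs: "\<bar>a p x\<bar> <= A p"
proof -
 have "\<bar>a p x\<bar> <= norm (indicator K x *R E p x) * norm (gamma x)" unfolding a_def by (rule Cauchy_Schwarz_ineq2)
 also have "\<dots> <= A p * 1" by (rule mult_mono) (use A A0 gamma1 in \<open>auto simp: indicator_def\<close>)
 finally show ?thesis by simp
qed

lemma X_nonzero: "X p x ~= 0 ==> p \<in> P ==> x \<in> K \<and> dist p x <= 2 * r p"
 using xi_zero[of x p] N(2) r[of p] by (force simp: X_def indicator_def)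

lemma a_nonzero: "a p x ~= 0 ==> p \<in> P ==> x \<in> K \<and> dist p x <= 2 * r p"
 using E_zero[of x p] N(2) r[of p] by (force simp: a_def indicator_def)

text \<open>The kernel carries mass along inward cones that start in \<open>K\<close>, so nothing
  arrives outside the interior.\<close>

lemma conv_ker_zero:
 assumes p: "p \<in> P" and rho: "rho <= 1" and h: "!!x. h x ~= 0 ==> x \<in> K \<and> dist p x <= 2 * r p"
  and y: "y \<notin> interior K"
 shows "bump.conv_ker (theta p) rho h n y = 0"
proof -
 have z: "h x *R bump.ker (theta p) rho (y - x) = 0" for x
 proof (rule ccontr)
  assume "\<not> ?thesis"
  then have hx: "h x ~= 0" and k: "bump.ker (theta p) rho (y - x) ~= 0" by auto
  obtain t z where tz: "0 < t" "t <= rho" "z \<in> supp (theta p)" "y - x = t *R z"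
   by (rule bump.ker_nonzero[OF bump[OF p] k])
  have "x + t *R z \<in> interior K" using cone[OF p, of x t z] h[OF hx] tz rho by auto
  then show False using y by (simp add: tz(4)[symmetric])
 qed
 show ?thesis unfolding bump.conv_ker_def[OF bump[OF p]] by (simp only: z bi_zero)
qed

lemma cd_zero:
 assumes p: "p \<in> P" and rho: "0 < rho" "rho <= 1" and y: "y \<notin> interior K"
 shows "cd rho p y = 0"
proof -
 have z: "bump.dil (theta p) rho (y - x) *R (X p x *R gamma x) = 0" for x
 proof (rule ccontr)
  assume "\<not> ?thesis"
  then have hx: "X p x ~= 0" and k: "bump.dil (theta p) rho (y - x) ~= 0" by auto
  obtain z where tz: "z \<in> supp (theta p)" "y - x = rho *R z"
   by (rule bump.dil_nonzero[OF bump[OF p] k rho(1)])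
  have "x + rho *R z \<in> interior K" using cone[OF p, of x rho z] X_nonzero[OF hx p] tz rho by auto
  then show False using y by (simp add: tz(2)[symmetric])
 qed
 show ?thesis unfolding cd_def bump.conv_dil_def[OF bump[OF p]] by (simp only: z bi_zero)
qed

lemma measurable_parts:
 assumes p: "p \<in> P" and rho: "0 < rho"
 shows "cd rho p \<in> borelm" "ck rho p \<in> borelm"
  "cp rho mup p \<in> borelm" "cp rho mum p \<in> borelm"
 unfolding cd_def ck_def cp_def
 by (rule bump.conv_dil_measurable[OF bump[OF p] m _ Xgamma_norm1[OF p] rho], measurable)
   (rule bump.conv_ker_norm(1)[OF bump[OF p] m _ a_abs] bump.conv_ker_norm(1)[OF bump[OF p] mp _ X_abs[OF p]]
    bump.conv_ker_norm(1)[OF bump[OF p] mm _ X_abs[OF p]], measurable)+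

lemma flux_measurable: "0 < rho ==> flux rho \<in> borelm"
 unfolding flux_def[abs_def]
 by (intro borel_measurable_sum borel_measurable_add borel_measurable_diff measurable_parts)

lemma flux_zero: "0 < rho ==> rho <= 1 ==> y \<notin> interior K ==> flux rho y = 0"
 unfolding flux_def ck_def cp_def
 using conv_ker_zero[OF _ _ a_nonzero] conv_ker_zero[OF _ _ X_nonzero] cd_zero by simp

lemma powr_parts:
 assumes p: "p \<in> P" and rho: "0 < rho" "rho <= 1"
 shows "integrable lborel (%y. norm (cd rho p y) powr alpha)" "integrable lborel (%y. norm (ck rho p y) powr alpha)"
  "integrable lborel (%y. norm (cp rho mup p y) powr alpha)" "integrable lborel (%y. norm (cp rho mum p y) powr alpha)"
proof -
 have bK: "bounded (interior K)" using K(1) compact_imp_bounded interior_subset bounded_subset by blast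
 have Xgamma: "(%x. X p x *R gamma x) \<in> borelm" by measurable
 show "integrable lborel (%y. norm (cd rho p y) powr alpha)"
  by (rule bounded_powr_integrable[OF measurable_parts(1)[OF p rho(1)] bK cd_zero[OF p rho]
     bump.conv_dil_bound[OF bump[OF p] m Xgamma Xgamma_norm1[OF p] rho(1), folded cd_def]])
    (use alpha1 in auto)
 \<comment> \<open>\<open>conv_ker_inner\<close> is wanted for its integrability claim; the zero
   field satisfies its hypotheses on \<open>g\<close>.\<close>
 have z: "integrable lborel (%y::'a. norm (0::'a) powr conj_exp alpha)" by simp
 show "integrable lborel (%y. norm (ck rho p y) powr alpha)"
  unfolding ck_def by (rule bump_exp.conv_ker_inner(2)[OF bumps[OF p] m a_measurable a_abs borel_measurable_const z])
 show "integrable lborel (%y. norm (cp rho mup p y) powr alpha)"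
  unfolding cp_def by (rule bump_exp.conv_ker_inner(2)[OF bumps[OF p] mp X_measurable X_abs[OF p] borel_measurable_const z])
 show "integrable lborel (%y. norm (cp rho mum p y) powr alpha)"
  unfolding cp_def by (rule bump_exp.conv_ker_inner(2)[OF bumps[OF p] mm X_measurable X_abs[OF p] borel_measurable_const z])
qed

lemma flux_powr:
 assumes rho: "0 < rho" "rho <= 1"
 shows "integrable lborel (%y. norm (flux rho y) powr alpha)"
proof -
 have alpha0: "0 <= alpha" using alpha1 by simp
 have mi: "integrable lborel (%y. norm (- cp rho mum p y) powr alpha)" if "p \<in> P" for p
  using powr_parts(4)[OF that rho] by simp
 have "integrable lborel (%y. norm (cd rho p y + (ck rho p y + (cp rho mup p y + - cp rho mum p y))) powr alpha)" if p: "p \<in> P" for p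
  using measurable_parts[OF p rho(1)]
  by (intro integrable_powr_add alpha0 powr_parts[OF p rho] mi[OF p] borel_measurable_add borel_measurable_uminus) simp_all
 then show ?thesis
  unfolding flux_def
  using measurable_parts[OF _ rho(1)]
  by (intro integrable_powr_sum[OF alpha0 P] borel_measurable_add borel_measurable_diff) simp_all
qed

lemma cor_measurable: "p \<in> P ==> g \<in> borelm ==> bump.cor (theta p) rho g \<in> borelm"
proof -
 assume p: "p \<in> P" and [measurable]: "g \<in> borelm"
 note [measurable] = bump.ker_measurable[OF bump[OF p]]
 show ?thesis unfolding bump.cor_def[OF bump[OF p], abs_def] by measurable
qed

text \<open>The hypothesis \<open>t\<close> is the constraint of the competitor for the localised
  averages. By the cone formula each average is \<open>c\<close> plus a correction, and
  \<open>ck\<close> and \<open>cp\<close> are the transposes of exactly these corrections; the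
  identity therefore holds without error.\<close>

lemma flux_inner:
 assumes rho: "0 < rho" "rho <= 1" and w: "weak_gradient_pair (interior K) phi g"
  and g: "g \<in> borelm" "integrable lborel (%x. norm (g x) powr conj_exp alpha)"
  and c: "continuous_on K c" "AE x in lborel. x \<in> interior K --> c x = phi x"
  and t: "- (LINT x|m. indicator K x * ((\<Sum>p\<in>P. xi p x *R bump.avg (theta p) rho g x + bump.avg (theta p) rho phi x *R E p x) \<bullet> (indicator K x *R gamma x)))
    = (LINT x:K|mup. \<Sum>p\<in>P. xi p x * bump.avg (theta p) rho phi x) - (LINT x:K|mum. \<Sum>p\<in>P. xi p x * bump.avg (theta p) rho phi x)"
 shows "- (LBINT y. flux rho y \<bullet> g y) = (LINT x:K|mup. c x) - (LINT x:K|mum. c x)"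
proof -
 have ig: "integrable lborel phi" "integrable lborel g" using w by (auto simp: weak_gradient_pair_def)
 let ?v = "%p. bump.avg (theta p) rho phi" and ?G = "%p. bump.avg (theta p) rho g" and ?k = "%p. bump.cor (theta p) rho g"
 have Gm: "?G p \<in> borelm" if "p \<in> P" for p
  by (rule borel_measurable_continuous_onI[OF bump.avg_continuous[OF bump[OF that] rho(1) ig(2)]])
 note km = cor_measurable[OF _ g(1)]
 have ki: "integrable n (%x. h x * ?k p x)" if p: "p \<in> P" and n: "finite_measure n" "sets n = sets borel"
  and h: "h \<in> borelm" "!!x. \<bar>h x\<bar> <= H" for p h H and n :: "'a measure"
 proof (rule bounded_integrable_finite[OF n(1)])
  have H: "0 <= H" using h(2)[of 0] by linarith
  show "(%x. h x * ?k p x) \<in> borel_measurable n"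
   using borel_measurable_times[OF h(1) km[OF p]] by (simp add: measurable_cong_sets[OF n(2) refl])
  show "norm (h x * ?k p x) <= H * (1 powr - alpha * bump_exp.J (theta p) alpha rho + 1 powr conj_exp alpha * (LBINT y. norm (g y) powr conj_exp alpha))" for x
   unfolding real_norm_def abs_mult
   by (rule mult_mono[OF h(2) bump_exp.cor_le[OF bumps[OF p] g zero_less_one] H]) simp
 qed
 have bi: "integrable m (%x. (X p x *R gamma x) \<bullet> ?G p x)" if p: "p \<in> P" for p
 proof (rule bounded_integrable_finite[OF m(1)])
  show "(%x. (X p x *R gamma x) \<bullet> ?G p x) \<in> borel_measurable m"
   unfolding measurable_cong_sets[OF m(2) refl]
   by (intro borel_measurable_inner borel_measurable_scaleR X_measurable gamma Gm p)
  show "norm ((X p x *R gamma x) \<bullet> ?G p x) <= 1 * (T p / rho ^ DIM('a) * (LBINT y. norm (g y)))" for x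
   unfolding real_norm_def
   by (rule order_trans[OF Cauchy_Schwarz_ineq2 mult_mono[OF Xgamma_norm1[OF p] bump.avg_bound[OF bump[OF p] rho(1) ig(2)]]]) auto
 qed
 define I1 where "I1 p = (LINT x|m. (X p x *R gamma x) \<bullet> ?G p x)" for p
 define I2 where "I2 p = (LINT x|m. a p x * ?k p x)" for p
 define I3 where "I3 n p = (LINT x|n. X p x * ?k p x)" for n p
 have Xgamma: "(%x. X p x *R gamma x) \<in> borelm" for p by measurable
 have hi: "integrable lborel (%y. f y \<bullet> g y)" if "f \<in> borelm" "integrable lborel (%y. norm (f y) powr alpha)" for f
  by (rule Hoelder_integrable[OF alpha1 _ _ that(2) g(2)]) (use that g in auto)
 have e: "(LBINT y. cd rho p y \<bullet> g y) = I1 p" "(LBINT y. ck rho p y \<bullet> g y) = I2 p"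
  "(LBINT y. cp rho mup p y \<bullet> g y) = I3 mup p" "(LBINT y. cp rho mum p y \<bullet> g y) = I3 mum p" if p: "p \<in> P" for p
  unfolding cd_def ck_def cp_def I1_def I2_def I3_def
  by (rule bump.conv_dil_inner[OF bump[OF p] m Xgamma Xgamma_norm1[OF p] rho(1) ig(2)])
   (rule bump_exp.conv_ker_inner(1)[OF bumps[OF p] m a_measurable a_abs g]
    bump_exp.conv_ker_inner(1)[OF bumps[OF p] mp X_measurable X_abs[OF p] g]
    bump_exp.conv_ker_inner(1)[OF bumps[OF p] mm X_measurable X_abs[OF p] g])+
 have ip: "integrable lborel (%y. cd rho p y \<bullet> g y)" "integrable lborel (%y. ck rho p y \<bullet> g y)"
   "integrable lborel (%y. cp rho mup p y \<bullet> g y)" "integrable lborel (%y. cp rho mum p y \<bullet> g y)" if p: "p \<in> P" for p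
  by (rule hi[OF measurable_parts(1)[OF p rho(1)] powr_parts(1)[OF p rho]] hi[OF measurable_parts(2)[OF p rho(1)] powr_parts(2)[OF p rho]]
   hi[OF measurable_parts(3)[OF p rho(1)] powr_parts(3)[OF p rho]] hi[OF measurable_parts(4)[OF p rho(1)] powr_parts(4)[OF p rho]])+
 have "(LBINT y. flux rho y \<bullet> g y) = (LBINT y. (\<Sum>p\<in>P. cd rho p y \<bullet> g y + (ck rho p y \<bullet> g y + (cp rho mup p y \<bullet> g y - cp rho mum p y \<bullet> g y))))"
  unfolding flux_def by (simp add: inner_sum_left inner_add_left inner_diff_left)
 also have "\<dots> = (\<Sum>p\<in>P. I1 p + (I2 p + (I3 mup p - I3 mum p)))"
  by (subst bi_sum) (simp_all add: ip e)
 finally have L: "(LBINT y. flux rho y \<bullet> g y) = (\<Sum>p\<in>P. I1 p) + (\<Sum>p\<in>P. I2 p) + ((\<Sum>p\<in>P. I3 mup p) - (\<Sum>p\<in>P. I3 mum p))"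
  by (simp add: sum.distrib sum_subtractf)
 have rep: "?v p x = c x + ?k p x" if "p \<in> P" "x \<in> K" "dist p x < r p" for p x
  using representative_eq[OF w g(2) c that(1) rho that(2)] that(3) r[OF that(1)] by linarith
 have "indicator K x * ((\<Sum>p\<in>P. xi p x *R ?G p x + ?v p x *R E p x) \<bullet> (indicator K x *R gamma x))
   = (\<Sum>p\<in>P. (X p x *R gamma x) \<bullet> ?G p x + a p x * ?k p x)" for x
 proof (cases "x \<in> K")
  case True
  \<comment> \<open>The part with \<open>c x\<close> cancels because the gradients of the partition
    sum to 0. What remains contains only corrections, which are small for short cones.\<close>
  have "(\<Sum>p\<in>P. ?v p x *R E p x) = (\<Sum>p\<in>P. c x *R E p x + ?k p x *R E p x)"
  proof (rule sum.cong[OF refl])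
   fix p assume p: "p \<in> P"
   show "?v p x *R E p x = c x *R E p x + ?k p x *R E p x"
   proof (cases "dist p x < r p")
    case True then show ?thesis by (simp add: rep[OF p \<open>x \<in> K\<close>] scaleR_add_left)
   next
    case False then show ?thesis using E_zero[of x p] p \<open>x \<in> K\<close> N(2) by auto
   qed
  qed
  also have "\<dots> = c x *R (\<Sum>p\<in>P. E p x) + (\<Sum>p\<in>P. ?k p x *R E p x)"
   by (simp add: sum.distrib scaleR_sum_right)
  also have "\<dots> = (\<Sum>p\<in>P. ?k p x *R E p x)" using E_sum[of x] True N(2) by auto
  finally have s: "(\<Sum>p\<in>P. ?v p x *R E p x) = (\<Sum>p\<in>P. ?k p x *R E p x)" .
  show ?thesis
   using True by (simp add: sum.distrib s inner_add_left inner_sum_left inner_add_right inner_sum_right X_def a_def inner_commute[of _ "gamma x"] mult.commute)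
 qed (simp add: X_def a_def)
 then have "(LINT x|m. indicator K x * ((\<Sum>p\<in>P. xi p x *R ?G p x + ?v p x *R E p x) \<bullet> (indicator K x *R gamma x)))
   = (LINT x|m. (\<Sum>p\<in>P. (X p x *R gamma x) \<bullet> ?G p x + a p x * ?k p x))" by (simp only:)
 also have "\<dots> = (\<Sum>p\<in>P. I1 p + I2 p)"
  by (subst bi_sum) (use bi ki[OF _ m a_measurable a_abs] in \<open>simp_all add: I1_def I2_def\<close>)
 finally have M1: "(LINT x|m. indicator K x * ((\<Sum>p\<in>P. xi p x *R ?G p x + ?v p x *R E p x) \<bullet> (indicator K x *R gamma x)))
   = (\<Sum>p\<in>P. I1 p) + (\<Sum>p\<in>P. I2 p)" by (simp add: sum.distrib)
 have M2: "(LINT x:K|n. \<Sum>p\<in>P. xi p x * ?v p x) = (LINT x:K|n. c x) + (\<Sum>p\<in>P. I3 n p)"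
  if n: "finite_measure n" "sets n = sets borel" for n
 proof -
  have "indicator K x *R (\<Sum>p\<in>P. xi p x * ?v p x) = indicator K x *R c x + (\<Sum>p\<in>P. X p x * ?k p x)" for x
  proof (cases "x \<in> K")
   case True
   have "(\<Sum>p\<in>P. xi p x *R ?v p x) = (\<Sum>p\<in>P. xi p x *R (c x + ?k p x))"
    by (rule sum_near[OF True]) (use rep True in auto)
   also have "\<dots> = (\<Sum>p\<in>P. xi p x) * c x + (\<Sum>p\<in>P. xi p x * ?k p x)"
    by (simp add: distrib_left sum.distrib sum_distrib_right)
   finally show ?thesis using True xi_sum[of x] N(2) by (auto simp: X_def)
  qed (simp add: X_def)
  then have "(LINT x:K|n. \<Sum>p\<in>P. xi p x * ?v p x) = (LINT x|n. indicator K x *R c x + (\<Sum>p\<in>P. X p x * ?k p x))"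
   by (simp add: set_lebesgue_integral_def)
  also have "\<dots> = (LINT x:K|n. c x) + (LINT x|n. (\<Sum>p\<in>P. X p x * ?k p x))"
   unfolding set_lebesgue_integral_def
   by (rule bi_add[OF set_integrable_continuous[OF n K(1) c(1), unfolded set_integrable_def]])
    (use ki[OF _ n X_measurable X_abs] in auto)
  also have "(LINT x|n. (\<Sum>p\<in>P. X p x * ?k p x)) = (\<Sum>p\<in>P. I3 n p)"
   by (subst bi_sum) (use ki[OF _ n X_measurable X_abs] in \<open>simp_all add: I3_def\<close>)
  finally show ?thesis .
 qed
 show ?thesis using t L M1 M2[OF mp] M2[OF mm] by linarith
qed

end

text \<open>Only \<open>x\<close> is confined to \<open>K\<close>; a ball containing
  \<open>K\<close>, enlarged by 1, and \<open>d <= 1\<close> keep \<open>y\<close> in a compact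
  set.\<close>

lemma uniform_continuity_near_compact:
 fixes W :: "'a::euclidean_space => 'b::real_normed_vector"
 assumes K: "compact K" and W: "continuous_on UNIV W" and e: "0 < e"
 obtains d where "0 < d" "!!x y. x \<in> K ==> dist x y < d ==> norm (W y - W x) < e"
proof -
 obtain R where R: "!!x. x \<in> K ==> norm x <= R" using compact_imp_bounded[OF K] unfolding bounded_pos by blast
 have "uniformly_continuous_on (cball 0 (R + 1)) W"
  by (rule compact_uniformly_continuous[OF continuous_on_subset[OF W]]) auto
 then obtain d where d: "0 < d" "!!x y. x \<in> cball 0 (R + 1) ==> y \<in> cball 0 (R + 1) ==> dist y x < d ==> dist (W y) (W x) < e"
  using e unfolding uniformly_continuous_on_def by blast
 show ?thesis
 proof (rule that[of "min d 1"])
  show "0 < min d 1" using d by simp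
  fix x y assume x: "x \<in> K" and xy: "dist x y < min d 1"
  have "norm y <= norm x + dist x y" using norm_triangle_ineq2[of y x] by (simp add: dist_norm norm_minus_commute)
  then have "y \<in> cball 0 (R + 1)" "x \<in> cball 0 (R + 1)" using R[OF x] xy by auto
  then show "norm (W y - W x) < e" using d(2)[of x y] xy by (simp add: dist_commute flip: dist_norm)
 qed
qed

context smoothed_flux
begin

text \<open>The averaged part costs at most the original cost up to \<open>e\<close>:
  \<open>dil\<close> is a probability density, \<open>W\<close> rises by at most \<open>e\<close>
  within its reach \<open>R2 p * rho\<close>, and the \<open>X p\<close> sum to the indicator of
  \<open>K\<close>. The other parts are bounded by \<open>L1\<close> norms of the kernels.\<close>

lemma flux_norm:
 assumes rho: "0 < rho" "rho <= 1" and W [measurable]: "W \<in> borelm" and W0: "!!y. 0 <= W y" and WB: "!!y. W y <= B"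
  and e: "0 <= e" "!!p x y. p \<in> P ==> x \<in> K ==> norm (y - x) < R2 p * rho ==> W y <= W x + e"
 shows "(LBINT y. W y * norm (flux rho y)) <= (LINT x:K|m. W x) + e * measure m UNIV +
      B * (\<Sum>p\<in>P. (A p * measure m UNIV + measure mup UNIV + measure mum UNIV) * (LBINT u. norm (bump.ker (theta p) rho u)))"
proof -
 interpret m: finite_measure m by (rule m(1))
 have sp: "space m = UNIV" using sets_eq_imp_space_eq[OF m(2)] by simp
 have B0: "0 <= B" using W0[of 0] WB[of 0] by linarith
 have Xgamma: "(%x. X p x *R gamma x) \<in> borelm" for p by measurable
 let ?kappa = "%p. LINT u|lborel. norm (bump.ker (theta p) rho u)"
 have cdn: "integrable lborel (%y. W y * norm (cd rho p y)) \<and> (LBINT y. W y * norm (cd rho p y))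
   <= (LINT x|m. norm (X p x *R gamma x) * (LBINT y. bump.dil (theta p) rho (y - x) * W y))" if p: "p \<in> P" for p
  unfolding cd_def by (rule bump.conv_dil_norm[OF bump[OF p] m Xgamma Xgamma_norm1[OF p] rho(1) W W0 WB])
 have k1: "integrable lborel (%y. norm (ck rho p y))" "(LBINT y. norm (ck rho p y)) <= A p * measure m UNIV * ?kappa p" if p: "p \<in> P" for p
  unfolding ck_def by (rule bump.conv_ker_norm(2,3)[OF bump[OF p] m a_measurable a_abs])+
 have k2: "integrable lborel (%y. norm (cp rho mup p y))" "(LBINT y. norm (cp rho mup p y)) <= 1 * measure mup UNIV * ?kappa p" if p: "p \<in> P" for p
  unfolding cp_def by (rule bump.conv_ker_norm(2,3)[OF bump[OF p] mp X_measurable X_abs[OF p]])+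
 have k3: "integrable lborel (%y. norm (cp rho mum p y))" "(LBINT y. norm (cp rho mum p y)) <= 1 * measure mum UNIV * ?kappa p" if p: "p \<in> P" for p
  unfolding cp_def by (rule bump.conv_ker_norm(2,3)[OF bump[OF p] mm X_measurable X_abs[OF p]])+
 have iW: "integrable m (%x. X p x * (W x + e))" if p: "p \<in> P" for p
 proof (rule bounded_integrable_finite[OF m(1)])
  show "(%x. X p x * (W x + e)) \<in> borel_measurable m" unfolding measurable_cong_sets[OF m(2) refl] by measurable
  show "norm (X p x * (W x + e)) <= 1 * (B + e)" for x
   unfolding real_norm_def abs_mult using X_bounds[OF p, of x] W0[of x] WB[of x] e(1) by (intro mult_mono) auto
 qed
 have cd: "(LBINT y. W y * norm (cd rho p y)) <= (LINT x|m. X p x * (W x + e))" if p: "p \<in> P" for p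
 proof -
  have "(LINT x|m. norm (X p x *R gamma x) * (LBINT y. bump.dil (theta p) rho (y - x) * W y)) <= (LINT x|m. X p x * (W x + e))"
  proof (rule integral_mono'[OF iW[OF p]])
   fix x
   show "0 <= X p x * (W x + e)" using X_bounds[OF p, of x] W0[of x] e(1) by simp
   show "norm (X p x *R gamma x) * (LBINT y. bump.dil (theta p) rho (y - x) * W y) <= X p x * (W x + e)"
   proof (cases "X p x = 0")
    case False
    then have x: "x \<in> K" using X_nonzero[OF _ p] by blast
    have d0: "0 <= bump.dil (theta p) rho u" for u by (rule bump.dil_bounds(1)[OF bump[OF p] rho(1)])
    have id: "integrable lborel (%y. bump.dil (theta p) rho (y - x))"
     using bump.dil_integral(1)[OF bump[OF p] rho(1), of x] not_integrable_integral_eq by fastforce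
    have "(LBINT y. bump.dil (theta p) rho (y - x) * W y) <= (LBINT y. bump.dil (theta p) rho (y - x) * (W x + e))"
    proof (rule integral_mono')
     show "integrable lborel (%y. bump.dil (theta p) rho (y - x) * (W x + e))" using id by simp
     fix y
     show "0 <= bump.dil (theta p) rho (y - x) * (W x + e)" using d0 W0[of x] e(1) by simp
     show "bump.dil (theta p) rho (y - x) * W y <= bump.dil (theta p) rho (y - x) * (W x + e)"
     proof (cases "R2 p * rho <= norm (y - x)")
      case True then show ?thesis using bump.dil_zero[OF bump[OF p] rho(1) True] by simp
     next
      case False then show ?thesis using e(2)[OF p x] d0 by (intro mult_left_mono) auto
     qed
    qed
    also have "\<dots> = W x + e" using bump.dil_integral(1)[OF bump[OF p] rho(1), of x] by simp
    finally have "(LBINT y. bump.dil (theta p) rho (y - x) * W y) <= W x + e" .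
    then show ?thesis
     using Xgamma_norm[OF p, of x] X_bounds[OF p, of x] d0 W0 by (intro mult_mono integral_nonneg_AE) auto
   qed simp
  qed
  then show ?thesis using cdn[OF p] by linarith
 qed
 have i: "integrable lborel (%y. W y * norm (cd rho p y))" if "p \<in> P" for p using cdn[OF that] by blast
 let ?R = "%y. \<Sum>p\<in>P. W y * norm (cd rho p y) + B * (norm (ck rho p y) + (norm (cp rho mup p y) + norm (cp rho mum p y)))"
 have iR: "integrable lborel ?R" using i k1(1) k2(1) k3(1)
  by (intro bi_sumI bi_addI integrable_mult_right) auto
 have "(LBINT y. W y * norm (flux rho y)) <= (LBINT y. ?R y)"
 proof (rule integral_mono'[OF iR])
  fix y
  show "0 <= ?R y" using W0 B0 by (intro sum_nonneg) auto
  have "norm (flux rho y) <= (\<Sum>p\<in>P. norm (cd rho p y) + (norm (ck rho p y) + (norm (cp rho mup p y) + norm (cp rho mum p y))))"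
   unfolding flux_def
  proof (rule order_trans[OF norm_sum sum_mono])
   fix p
   show "norm (cd rho p y + (ck rho p y + (cp rho mup p y - cp rho mum p y)))
     <= norm (cd rho p y) + (norm (ck rho p y) + (norm (cp rho mup p y) + norm (cp rho mum p y)))"
    using norm_triangle_ineq[of "cd rho p y" "ck rho p y + (cp rho mup p y - cp rho mum p y)"]
     norm_triangle_ineq[of "ck rho p y" "cp rho mup p y - cp rho mum p y"]
     norm_triangle_ineq4[of "cp rho mup p y" "cp rho mum p y"] by linarith
  qed
  from mult_left_mono[OF this W0[of y]] have "W y * norm (flux rho y) <= (\<Sum>p\<in>P. W y * norm (cd rho p y) + W y * (norm (ck rho p y) + (norm (cp rho mup p y) + norm (cp rho mum p y))))"
   by (simp only: sum_distrib_left distrib_left)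
  also have "\<dots> <= ?R y" using WB[of y] by (intro sum_mono add_left_mono mult_right_mono) auto
  finally show "W y * norm (flux rho y) <= ?R y" .
 qed
 also have "\<dots> = (\<Sum>p\<in>P. (LBINT y. W y * norm (cd rho p y)) + B * ((LBINT y. norm (ck rho p y)) + ((LBINT y. norm (cp rho mup p y)) + (LBINT y. norm (cp rho mum p y)))))"
  by (subst bi_sum) (use i k1(1) k2(1) k3(1) in simp_all)
 also have "\<dots> <= (\<Sum>p\<in>P. (LINT x|m. X p x * (W x + e)) + B * ((A p * measure m UNIV + measure mup UNIV + measure mum UNIV) * (LBINT u. norm (bump.ker (theta p) rho u))))"
 proof (intro sum_mono add_mono mult_left_mono B0 cd)
  fix p assume p: "p \<in> P"
  show "(LBINT y. norm (ck rho p y)) + ((LBINT y. norm (cp rho mup p y)) + (LBINT y. norm (cp rho mum p y)))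
    <= (A p * measure m UNIV + measure mup UNIV + measure mum UNIV) * (LBINT u. norm (bump.ker (theta p) rho u))"
   using k1(2)[OF p] k2(2)[OF p] k3(2)[OF p] by (simp add: distrib_right)
 qed
 also have "\<dots> = (\<Sum>p\<in>P. LINT x|m. X p x * (W x + e)) + B * (\<Sum>p\<in>P. (A p * measure m UNIV + measure mup UNIV + measure mum UNIV) * (LBINT u. norm (bump.ker (theta p) rho u)))"
  by (simp add: sum.distrib sum_distrib_left)
 also have "(\<Sum>p\<in>P. LINT x|m. X p x * (W x + e)) = (LINT x|m. (\<Sum>p\<in>P. X p x * (W x + e)))"
  by (rule bi_sum[symmetric]) (rule iW)
 also have "\<dots> = (LINT x|m. indicator K x *R W x + indicator K x *R e)"
 proof (rule bi_cong[OF refl])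
  fix x
  have "(\<Sum>p\<in>P. X p x * (W x + e)) = indicator K x * (W x + e)" by (simp only: sum_distrib_right[symmetric] X_sum)
  then show "(\<Sum>p\<in>P. X p x * (W x + e)) = indicator K x *R W x + indicator K x *R e"
   by (simp only: real_scaleR_def distrib_left)
 qed
 also have "\<dots> = (LINT x:K|m. W x) + e * measure m K"
 proof -
  have [measurable]: "K \<in> sets m" using K(1) m(2) by (simp add: compact_imp_closed)
  have [measurable]: "W \<in> borel_measurable m" using W by (simp add: measurable_cong_sets[OF m(2) refl])
  have "integrable m (%x. indicator K x *R W x)"
   by (rule bounded_integrable_finite[OF m(1), where B=B]) (use W0 WB B0 in \<open>auto simp: indicator_def\<close>)
  moreover have "integrable m (%x. indicator K x *R e)"
   by (rule bounded_integrable_finite[OF m(1), where B=e]) (use e(1) in \<open>auto simp: indicator_def\<close>)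
  ultimately show ?thesis by (subst bi_add) (auto simp: set_lebesgue_integral_def sp)
 qed
 also have "e * measure m K <= e * measure m UNIV"
  using m.bounded_measure[of K] e(1) by (intro mult_left_mono) (auto simp: sp)
 finally show ?thesis by simp
qed

text \<open>Short cones make the \<open>L1\<close> norms of the kernels small, and the cost sees
  nothing else of the corrections. The integral of the \<open>alpha\<close>-th power is not
  controlled as the cones shrink; for the chosen \<open>rho\<close> it is finite.\<close>

lemma flux_norm_small:
 assumes W: "continuous_on UNIV W" and W0: "!!y. 0 <= W y" and WB: "!!y. W y <= B" and eta: "0 < eta"
 obtains rho where "0 < rho" "rho <= 1" "(LBINT y. W y * norm (flux rho y)) <= (LINT x:K|m. W x) + eta"
proof -
 \<comment> \<open>Half of \<open>eta\<close> is reserved for the oscillation of \<open>W\<close>,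
   the other half for the kernels; the added 1 covers \<open>m = 0\<close>.\<close>
 define e where "e = eta / (2 * (measure m UNIV + 1))"
 have mp0: "0 < measure m UNIV + 1" by (simp add: add_nonneg_pos)
 have e0: "0 < e" using eta mp0 by (simp add: e_def)
 have em: "e * measure m UNIV <= eta / 2"
 proof -
  have "e * measure m UNIV <= e * (measure m UNIV + 1)" using e0 by (intro mult_left_mono) auto
  also have "\<dots> = eta / 2" using mp0 unfolding e_def by (simp only: times_divide_eq_left) (simp add: field_simps)
  finally show ?thesis .
 qed
 obtain d where d: "0 < d" "!!x y. x \<in> K ==> dist x y < d ==> \<bar>W y - W x\<bar> < e"
  using uniform_continuity_near_compact[OF K(1) W e0] unfolding real_norm_def by blast
 define rho where "rho k = inverse (real (Suc k))" for k
 have rho: "rho \<longlonglongrightarrow> 0" unfolding rho_def by (rule LIMSEQ_inverse_real_of_nat)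
 have rhok: "0 < rho k" "rho k <= 1" for k by (auto simp: rho_def field_simps)
 define S where "S k = B * (\<Sum>p\<in>P. (A p * measure m UNIV + measure mup UNIV + measure mum UNIV) * (LBINT u. norm (bump.ker (theta p) (rho k) u)))" for k
 have "S \<longlonglongrightarrow> B * (\<Sum>p\<in>P. (A p * measure m UNIV + measure mup UNIV + measure mum UNIV) * 0)"
  unfolding S_def[abs_def] by (intro tendsto_mult tendsto_sum tendsto_const bump.ker_integral_tendsto_0[OF bump rho])
 then have "S \<longlonglongrightarrow> 0" by simp
 then have 1: "\<forall>\<^sub>F k in sequentially. S k < eta / 2" by (rule order_tendstoD) (use eta in simp)
 have "\<forall>\<^sub>F k in sequentially. R2 p * rho k < d" for p
 proof -
  have "(%k. R2 p * rho k) \<longlonglongrightarrow> R2 p * 0" by (intro tendsto_mult tendsto_const rho)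
  then show ?thesis by (intro order_tendstoD(2)[of _ "0"]) (use d(1) in simp_all)
 qed
 then have 2: "\<forall>\<^sub>F k in sequentially. \<forall>p\<in>P. R2 p * rho k < d" by (intro eventually_ball_finite P) simp
 obtain k where k: "S k < eta / 2" "\<forall>p\<in>P. R2 p * rho k < d"
  using eventually_happens'[OF sequentially_bot eventually_conj[OF 1 2]] by blast
 have Wb: "W y <= W x + e" if "p \<in> P" "x \<in> K" "norm (y - x) < R2 p * rho k" for p x y
  using d(2)[of x y] that k(2) by (force simp: dist_norm norm_minus_commute)
 have "(LBINT y. W y * norm (flux (rho k) y)) <= (LINT x:K|m. W x) + e * measure m UNIV + S k"
  unfolding S_def by (rule flux_norm[OF rhok borel_measurable_continuous_onI[OF W] W0 WB less_imp_le[OF e0] Wb])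
 then show ?thesis by (intro that[OF rhok(1,2)[of k]]) (use k(1) em in linarith)
qed

end

section \<open>Cone covers and the smoothing of competitors\<close>

text \<open>An interior cone condition with a full ball of directions and step lengths up to 1,
  asked also at boundary points in \<open>K\<close>. In this form it passes from the Lipschitz
  domain to its dilates.\<close>

definition cone_property :: "'a::euclidean_space set => bool" where
 "cone_property K \<longleftrightarrow> (\<forall>p\<in>K. \<exists>r a kappa. 0 < r \<and> 0 < kappa \<and> kappa < norm a \<and>
   (\<forall>x t z. x \<in> K --> dist p x <= r --> 0 < t --> t <= 1 --> z \<in> ball a kappa --> x + t *R z \<in> interior K))"

lemma interior_scaleR_image: "c ~= 0 ==> interior ((%x. c *R x) ` S) = (%x. c *R x) ` interior (S :: 'a::euclidean_space set)"
 by (rule interior_injective_linear_image) (auto intro: linear_scaleR injI)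

text \<open>Dividing by \<open>c\<close> turns a step \<open>t\<close> into \<open>t / c\<close>,
  which is still at most 1 because \<open>c >= 1\<close>; directions stay the same.\<close>

lemma cone_property_scaleR:
 assumes K: "cone_property K" and c: "1 <= c"
 shows "cone_property ((%x. c *R x) ` K)"
 unfolding cone_property_def
proof
 have c0: "0 < c" using c by simp
 fix p assume "p \<in> (%x. c *R x) ` K"
 then obtain p' where p': "p' \<in> K" "p = c *R p'" by blast
 obtain r a kappa where *: "0 < r" "0 < kappa" "kappa < norm a"
  and cone: "!!x t z. x \<in> K ==> dist p' x <= r ==> 0 < t ==> t <= 1 ==> z \<in> ball a kappa ==> x + t *R z \<in> interior K"
  using K p'(1) unfolding cone_property_def by blast
 have "x + t *R z \<in> interior ((%x. c *R x) ` K)"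
  if x: "x \<in> (%x. c *R x) ` K" "dist p x <= c * r" and t: "0 < t" "t <= 1" and z: "z \<in> ball a kappa" for x t z
 proof -
  obtain x' where x': "x' \<in> K" "x = c *R x'" using x(1) by blast
  have "c * dist p' x' <= c * r" using x(2) c0 by (simp add: p'(2) x'(2) dist_norm scaleR_diff_right[symmetric])
  then have "x' + (t / c) *R z \<in> interior K"
   using c0 c t by (intro cone x'(1) z) (auto simp: field_simps)
  then have "c *R (x' + (t / c) *R z) \<in> interior ((%x. c *R x) ` K)"
   using c0 by (subst interior_scaleR_image) auto
  then show ?thesis using c0 by (simp add: x'(2) scaleR_add_right)
 qed
 then show "\<exists>r a kappa. 0 < r \<and> 0 < kappa \<and> kappa < norm a \<and> (\<forall>x t z. x \<in> (%x. c *R x) ` K --> dist p x <= r -->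
   0 < t --> t <= 1 --> z \<in> ball a kappa --> x + t *R z \<in> interior ((%x. c *R x) ` K))"
  using * c0 by (intro exI[of _ "c * r"] exI[of _ a] exI[of _ kappa]) auto
qed

text \<open>At each point a mollifier with support radius \<open>kappa\<close> is translated to the
  axis of the local cone. The radius is halved, so that the cones remain valid at twice the radius
  used for the partition of unity.\<close>

lemma cone_cover_exists:
 fixes K :: "'a::euclidean_space set"
 assumes K: "compact K" "K \<subseteq> closure (interior K)" "cone_property K"
  and moll: "!!kappa. 0 < kappa ==> \<exists>eta. eta \<in> Cc_infinity (UNIV :: 'a set) \<and> (\<forall>x. 0 <= eta x) \<and> (LINT x|lebesgue. eta x) = 1 \<and> supp eta \<subseteq> ball 0 kappa"
  and alpha: "1 < alpha" "alpha * (real DIM('a) - 1) < real DIM('a)"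
 shows "\<exists>P N xi E r theta D T R1 R2. cone_cover K alpha P N xi E r theta D T R1 R2"
proof -
 have "\<exists>r theta D T R1 R2. 0 < r \<and> bump_exp theta D T R1 R2 alpha \<and>
   (\<forall>x t z. x \<in> K --> dist p x <= 2 * r --> 0 < t --> t <= 1 --> z \<in> supp theta --> x + t *R z \<in> interior K)" if p: "p \<in> K" for p
 proof -
  obtain r a kappa where *: "0 < r" "0 < kappa" "kappa < norm a"
   and cone: "!!x t z. x \<in> K ==> dist p x <= r ==> 0 < t ==> t <= 1 ==> z \<in> ball a kappa ==> x + t *R z \<in> interior K"
   using K(3) p unfolding cone_property_def by blast
  obtain eta where eta: "eta \<in> Cc_infinity (UNIV :: 'a set)" "!!x. 0 <= eta x" "(LINT x|lebesgue. eta x) = 1" "supp eta \<subseteq> ball 0 kappa"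
   using moll[OF *(2)] by blast
  obtain D T where b: "bump (%z. eta (z - a)) D T (norm a - kappa) (norm a + kappa)" "supp (%z. eta (z - a)) \<subseteq> ball a kappa"
   by (rule bump_translate[OF eta *(3)])
  have "bump_exp (%z. eta (z - a)) D T (norm a - kappa) (norm a + kappa) alpha"
   using b(1) alpha by (simp add: bump_exp_def bump_exp_axioms_def)
  moreover have "\<forall>x t z. x \<in> K --> dist p x <= 2 * (r / 2) --> 0 < t --> t <= 1 --> z \<in> supp (%z. eta (z - a)) --> x + t *R z \<in> interior K"
   using cone b(2) by auto
  ultimately show ?thesis using *(1) half_gt_zero by blast
 qed
 then have "\<forall>p\<in>K. \<exists>r theta D T R1 R2. 0 < r \<and> bump_exp theta D T R1 R2 alpha \<and>
   (\<forall>x t z. x \<in> K --> dist p x <= 2 * r --> 0 < t --> t <= 1 --> z \<in> supp theta --> x + t *R z \<in> interior K)" by blast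
 then obtain r theta D T R1 R2 where c: "!!p. p \<in> K ==> 0 < r p" "!!p. p \<in> K ==> bump_exp (theta p) (D p) (T p) (R1 p) (R2 p) alpha"
  "!!p x t z. p \<in> K ==> x \<in> K ==> dist p x <= 2 * r p ==> 0 < t ==> t <= 1 ==> z \<in> supp (theta p) ==> x + t *R z \<in> interior K"
  unfolding bchoice_iff by blast
 have c': "!!p. p \<in> P ==> 0 < r p" "!!p. p \<in> P ==> bump_exp (theta p) (D p) (T p) (R1 p) (R2 p) alpha"
  "!!p x t z. p \<in> P ==> x \<in> K ==> dist p x <= 2 * r p ==> 0 < t ==> t <= 1 ==> z \<in> supp (theta p) ==> x + t *R z \<in> interior K"
  if "P \<subseteq> K" for P using c that by blast+
 show ?thesis
 proof (rule C1_partition_of_unity[OF K(1) c(1)])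
  fix P xi E N
  assume "finite P" "P \<subseteq> K" "open N" "K \<subseteq> N"
   "!!p x. x \<in> N ==> GDERIV (xi p) x :> E p x" "!!p. continuous_on N (E p)"
   "!!p x. x \<in> N ==> 0 <= xi p x" "!!p x. x \<in> N ==> r p <= dist p x ==> p \<in> P ==> xi p x = 0"
   "!!p x. x \<in> N ==> r p <= dist p x ==> p \<in> P ==> E p x = 0"
   "!!x. x \<in> N ==> (\<Sum>p\<in>P. xi p x) = 1" "!!x. x \<in> N ==> (\<Sum>p\<in>P. E p x) = 0"
  note * = this
  have "cone_cover K alpha P N xi E r theta D T R1 R2"
   by (rule cone_cover.intro) (fact * K c'[OF *(2)])+
  then show ?thesis by blast
 qed
qed

lemma vector_measures_on_density:
 fixes q :: "'a::euclidean_space set => 'a"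
 assumes q: "q \<in> vector_measures_on K" and K: "K \<in> sets borel"
 shows "\<exists>gamma. gamma \<in> borelm \<and> (\<forall>x. norm (gamma x) <= 1) \<and>
  (\<forall>A\<in>sets borel. q A = (LINT x|total_variation q. indicator A x *R (indicator K x *R gamma x)))"
proof -
 have vq: "vector_measure q" and qK: "!!A. A \<in> sets borel ==> q A = q (A \<inter> K)"
  using q by (auto simp: vector_measures_on_def)
 obtain gamma where gamma: "gamma \<in> borelm" "!!x. norm (gamma x) <= 1"
  "!!A. A \<in> sets borel ==> q A = (LINT x|total_variation q. indicator A x *R gamma x)"
  using vector_measure_density[OF vq] by blast
 have "q A = (LINT x|total_variation q. indicator A x *R (indicator K x *R gamma x))" if A: "A \<in> sets borel" for A
 proof -
  have "q A = q (A \<inter> K)" by (rule qK[OF A])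
  also have "\<dots> = (LINT x|total_variation q. indicator (A \<inter> K) x *R gamma x)" using A K by (intro gamma(3)) auto
  finally show ?thesis by (simp add: indicator_inter_arith)
 qed
 then show ?thesis using gamma(1,2) by (intro exI[of _ gamma]) simp
qed

text \<open>All properties of the smoothed flux except its cost hold for every cone length up to 1,
  so the length is chosen by the cost alone. The constraint on \<open>q\<close> speaks of
  \<open>C1\<close> functions, the conclusion of Sobolev functions of the conjugate
  exponent.\<close>

lemma smoothing:
 fixes K :: "'a::euclidean_space set"
 assumes K: "compact K" "K \<subseteq> closure (interior K)" "cone_property K"
  and moll: "!!kappa. 0 < kappa ==> \<exists>eta. eta \<in> Cc_infinity (UNIV :: 'a set) \<and> (\<forall>x. 0 <= eta x) \<and> (LINT x|lebesgue. eta x) = 1 \<and> supp eta \<subseteq> ball 0 kappa"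
  and alpha: "1 < alpha" "alpha * (real DIM('a) - 1) < real DIM('a)"
  and mp: "prob_space mup" "sets mup = sets borel" "AE x in mup. x \<in> K"
  and mm: "prob_space mum" "sets mum = sets borel" "AE x in mum. x \<in> K"
  and q: "q \<in> vector_measures_on K" "measure_div_eq K q mup mum"
  and W: "continuous_on UNIV W" "!!y. 0 <= W y" "!!y. W y <= B" and e: "0 < e"
 obtains f where "f \<in> borelm" "!!y. y \<notin> interior K ==> f y = 0"
  "integrable lborel (%y. norm (f y) powr alpha)"
  "(LBINT y. W y * norm (f y)) <= (LINT x:K|total_variation q. W x) + e"
  "!!phi g c. weak_gradient_pair (interior K) phi g ==> g \<in> borelm ==>
    integrable lborel (%x. norm (g x) powr conj_exp alpha) ==> continuous_on K c ==>
    AE x in lborel. x \<in> interior K --> c x = phi x ==>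
    - (LBINT y. f y \<bullet> g y) = (LINT x:K|mup. c x) - (LINT x:K|mum. c x)"
proof -
 obtain P N xi E r theta D T R1 R2 where cc: "cone_cover K alpha P N xi E r theta D T R1 R2"
  using cone_cover_exists[OF K moll alpha] by blast
 have Kb: "K \<in> sets borel" using K(1) by (simp add: compact_imp_closed)
 have vq: "vector_measure q" using q(1) by (simp add: vector_measures_on_def)
 obtain gamma where gamma0: "gamma \<in> borelm" "!!x. norm (gamma x) <= 1"
  "!!A. A \<in> sets borel ==> q A = (LINT x|total_variation q. indicator A x *R (indicator K x *R gamma x))"
  using vector_measures_on_density[OF q(1) Kb] by auto
 define m where "m = total_variation q"
 note gamma = gamma0[folded m_def]
 have m: "finite_measure m" "sets m = sets borel" unfolding m_def by (rule finite_measure_total_variation[OF vq]) simp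
 have "\<exists>A. 0 <= A \<and> (\<forall>x\<in>K. norm (E p x) <= A)" for p
 proof -
  obtain B where "0 <= B" "!!x. x \<in> K ==> norm (E p x) <= B"
   using compact_continuous_bound[OF K(1) cone_cover.E_continuous[OF cc, of p]] by blast
  then show ?thesis by blast
 qed
 then have "\<exists>A. \<forall>p. 0 <= A p \<and> (\<forall>x\<in>K. norm (E p x) <= A p)" by (intro choice allI)
 then obtain A where A: "!!p. 0 <= A p" "!!p x. x \<in> K ==> norm (E p x) <= A p" by blast
 interpret s: smoothed_flux K alpha P N xi E r theta D T R1 R2 m mup mum gamma A
  by (intro smoothed_flux.intro cc smoothed_flux_axioms.intro m prob_space.finite_measure[OF mp(1)] mp(2)
    prob_space.finite_measure[OF mm(1)] mm(2) gamma(1,2) alpha(1) A)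
 obtain rho where rho: "0 < rho" "rho <= 1" "(LBINT y. W y * norm (s.flux rho y)) <= (LINT x:K|m. W x) + e"
  using s.flux_norm_small[OF W e] by blast
 have vi: "vector_integral K q F = (LINT x|m. indicator K x * (F x \<bullet> (indicator K x *R gamma x)))" if F: "continuous_on K F" for F
 proof (rule vector_integral_integral[where T="%x. x", OF _ _ vq gamma(3) K(1) F])
  show "(%x. x) \<in> measurable m borel" by (simp add: measurable_ident_sets[OF m(2)])
  show "integrable m (%x. indicator K x *R gamma x)"
  proof (rule bounded_integrable_finite[OF m(1), where B=1])
   show "(%x. indicator K x *R gamma x) \<in> borel_measurable m"
    unfolding measurable_cong_sets[OF m(2) refl] using Kb gamma(1) by measurable
   show "norm (indicator K x *R gamma x) <= 1" for x using gamma(2)[of x] by (simp add: indicator_def)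
  qed
 qed
 show ?thesis
 proof (rule that)
  show "s.flux rho \<in> borelm" by (rule s.flux_measurable[OF rho(1)])
  show "s.flux rho y = 0" if "y \<notin> interior K" for y by (rule s.flux_zero[OF rho(1,2) that])
  show "integrable lborel (%y. norm (s.flux rho y) powr alpha)" by (rule s.flux_powr[OF rho(1,2)])
  show "(LBINT y. W y * norm (s.flux rho y)) <= (LINT x:K|total_variation q. W x) + e"
   using rho(3) by (simp add: m_def)
  fix phi g c
  assume w: "weak_gradient_pair (interior K) phi g" and g: "g \<in> borelm"
    "integrable lborel (%x. norm (g x) powr conj_exp alpha)"
   and c: "continuous_on K c" "AE x in lborel. x \<in> interior K --> c x = phi x"
  have C1: "C1_on K (%x. \<Sum>p\<in>P. xi p x * bump.avg (theta p) rho phi x)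
      (%x. \<Sum>p\<in>P. xi p x *R bump.avg (theta p) rho g x + bump.avg (theta p) rho phi x *R E p x)"
   by (rule s.smooth_C1[OF w rho(1,2)])
  have "continuous_on K (%x. \<Sum>p\<in>P. xi p x *R bump.avg (theta p) rho g x + bump.avg (theta p) rho phi x *R E p x)"
   using C1 by (simp add: C1_on_def)
  from measure_div_eq_C1[OF mp mm K(1) q(2) C1, unfolded vi[OF this]]
  show "- (LBINT y. s.flux rho y \<bullet> g y) = (LINT x:K|mup. c x) - (LINT x:K|mum. c x)"
   by (rule s.flux_inner[OF rho(1,2) w g c])
 qed
qed

section \<open>A competitor made of segments\<close>

text \<open>The path runs from \<open>x\<close> at \<open>u = -1\<close> through the origin to
  \<open>y\<close> at \<open>u = 1\<close>. Strict star shape keeps it in the interior except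
  possibly at the two ends, where continuity of \<open>f\<close> suffices; the kink at 0 is exempt
  from differentiability.\<close>

lemma segment_integral:
 fixes x y :: "'a::euclidean_space"
 assumes f: "C1_on K f D" and K: "compact K" "strictly_star_shaped K" and x: "x \<in> K" and y: "y \<in> K"
 defines "\<Gamma> \<equiv> %u. max (- u) 0 *R x + max u 0 *R y" and "\<Gamma>' \<equiv> %u::real. if u < 0 then - x else y"
 shows "!!u. \<bar>u\<bar> <= 1 ==> \<Gamma> u \<in> K"
  and "(LBINT u. indicator {-1..1} u * (indicator K (\<Gamma> u) * (D (\<Gamma> u) \<bullet> \<Gamma>' u))) = f y - f x"
proof -
 have star: "l *R z \<in> interior K" if "z \<in> K" "0 <= l" "l < 1" for z l
  using K(2) that by (auto simp: strictly_star_shaped_def)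
 have int: "\<Gamma> u \<in> interior K" if "\<bar>u\<bar> < 1" for u
  using star[OF x, of "- u"] star[OF y, of u] that by (cases "u <= 0") (auto simp: \<Gamma>_def max_def)
 show inK: "\<Gamma> u \<in> K" if "\<bar>u\<bar> <= 1" for u
 proof (cases "\<bar>u\<bar> < 1")
  case True then show ?thesis using int interior_subset by blast
 next
  case False
  then have "u = 1 \<or> u = -1" using that by linarith
  then show ?thesis using x y by (auto simp: \<Gamma>_def)
 qed
 have fc: "continuous_on K f" and Dc: "continuous_on K D" and fd: "!!z. z \<in> interior K ==> GDERIV f z :> D z"
  using f by (auto simp: C1_on_def)
 have \<Gamma>c: "continuous_on S \<Gamma>" for S unfolding \<Gamma>_def by (intro continuous_intros)
 have "((%u. D (\<Gamma> u) \<bullet> \<Gamma>' u) has_integral (f (\<Gamma> 1) - f (\<Gamma> (-1)))) {-1..1}"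
 proof (rule fundamental_theorem_of_calculus_interior_strong[where S="{0}" and f="%u. f (\<Gamma> u)"])
  show "continuous_on {-1..1} (%u. f (\<Gamma> u))"
   by (rule continuous_on_compose2[OF fc \<Gamma>c]) (use inK in auto)
  fix u :: real assume u: "u \<in> {-1<..<1} - {0}"
  have "(\<Gamma> has_vector_derivative \<Gamma>' u) (at u)"
  proof (cases "u < 0")
   case True
   have "((%u. (- u) *R x) has_vector_derivative \<Gamma>' u) (at u)"
    using True by (auto intro!: derivative_eq_intros simp: \<Gamma>'_def)
   then show ?thesis
    by (rule has_vector_derivative_transform_within_open[of _ _ _ "{..<0}"]) (use True in \<open>auto simp: \<Gamma>_def\<close>)
  next
   case False
   then have u0: "0 < u" using u by auto
   have "((%u. u *R y) has_vector_derivative \<Gamma>' u) (at u)"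
    using u0 by (auto intro!: derivative_eq_intros simp: \<Gamma>'_def)
   then show ?thesis
    by (rule has_vector_derivative_transform_within_open[of _ _ _ "{0<..}"]) (use u0 in \<open>auto simp: \<Gamma>_def\<close>)
  qed
  moreover have "(f has_derivative (%h. h \<bullet> D (\<Gamma> u))) (at (\<Gamma> u))"
   using fd[OF int[of u]] u by (auto simp: gderiv_def)
  ultimately show "((%u. f (\<Gamma> u)) has_vector_derivative D (\<Gamma> u) \<bullet> \<Gamma>' u) (at u)"
   unfolding has_vector_derivative_def
   using has_derivative_compose[of \<Gamma> "%h. h *R \<Gamma>' u" u UNIV f "%h. h \<bullet> D (\<Gamma> u)"]
   by (simp add: inner_commute)
 qed auto
 moreover have "f (\<Gamma> 1) - f (\<Gamma> (-1)) = f y - f x" by (simp add: \<Gamma>_def)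
 ultimately have "((%u. if u \<in> {-1..1} then D (\<Gamma> u) \<bullet> \<Gamma>' u else 0) has_integral (f y - f x)) UNIV"
  by (simp only: has_integral_restrict_UNIV)
 moreover have "(%u. if u \<in> {-1..1} then D (\<Gamma> u) \<bullet> \<Gamma>' u else 0) = (%u. indicator {-1..1} u * (D (\<Gamma> u) \<bullet> \<Gamma>' u))"
  by (auto simp: indicator_def)
 ultimately have "((%u. indicator {-1..1} u * (D (\<Gamma> u) \<bullet> \<Gamma>' u)) has_integral (f y - f x)) UNIV" by simp
 moreover have e: "indicator {-1..1} u * (D (\<Gamma> u) \<bullet> \<Gamma>' u) = indicator {-1..1} u * (indicator K (\<Gamma> u) * (D (\<Gamma> u) \<bullet> \<Gamma>' u))" for u
  using inK[of u] by (auto simp: indicator_def)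
 ultimately have hi: "((%u. indicator {-1..1} u * (indicator K (\<Gamma> u) * (D (\<Gamma> u) \<bullet> \<Gamma>' u))) has_integral (f y - f x)) UNIV" by simp
 obtain B where B: "0 <= B" "!!z. z \<in> K ==> norm (D z) <= B" using compact_continuous_bound[OF K(1) Dc] by blast
 have [measurable]: "(%z. indicator K z *R D z) \<in> borelm" by (rule indicator_continuous_measurable[OF K(1) Dc])
 have [measurable]: "\<Gamma> \<in> borelm" by (rule borel_measurable_continuous_onI[OF \<Gamma>c])
 have [measurable]: "\<Gamma>' \<in> borelm" unfolding \<Gamma>'_def by measurable
 have "(%u. indicator {-1..1} u * ((%z. indicator K z *R D z) (\<Gamma> u) \<bullet> \<Gamma>' u)) \<in> borelm" by measurable
 then have M: "(%u. indicator {-1..1} u * (indicator K (\<Gamma> u) * (D (\<Gamma> u) \<bullet> \<Gamma>' u))) \<in> borelm" by simp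
 have i: "integrable lborel (%u. indicator {-1..1} u * (indicator K (\<Gamma> u) * (D (\<Gamma> u) \<bullet> \<Gamma>' u)))"
 proof (rule bi_bound[where f="%u. indicator {-1..1} u *R (B * (norm x + norm y))"])
  show "integrable lborel (%u::real. indicator {-1..1} u *R (B * (norm x + norm y)))" by (rule borel_integrable_compact) auto
  show "AE u in lborel. norm (indicator {-1..1} u * (indicator K (\<Gamma> u) * (D (\<Gamma> u) \<bullet> \<Gamma>' u)))
    <= norm (indicator {-1..1} u *R (B * (norm x + norm y)) :: real)"
  proof (rule AE_I2)
   fix u
   have "\<bar>D (\<Gamma> u) \<bullet> \<Gamma>' u\<bar> <= B * (norm x + norm y)" if "\<Gamma> u \<in> K"
    by (rule order_trans[OF Cauchy_Schwarz_ineq2 mult_mono[OF B(2)[OF that]]]) (use B(1) in \<open>auto simp: \<Gamma>'_def\<close>)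
   then show "norm (indicator {-1..1} u * (indicator K (\<Gamma> u) * (D (\<Gamma> u) \<bullet> \<Gamma>' u)))
    <= norm (indicator {-1..1} u *R (B * (norm x + norm y)) :: real)"
    using B(1) by (auto simp: indicator_def abs_mult)
  qed
 qed (use M in simp)
 show "(LBINT u. indicator {-1..1} u * (indicator K (\<Gamma> u) * (D (\<Gamma> u) \<bullet> \<Gamma>' u))) = f y - f x"
  by (rule has_integral_unique[OF has_integral_integral_lborel[OF i] hi])
qed

text \<open>Mass is transported along the segments to the origin and back.\<close>

lemma flux_exists:
 fixes K :: "'a::euclidean_space set"
 assumes K: "compact K" "strictly_star_shaped K"
  and mp: "prob_space mup" "sets mup = sets borel" "AE x in mup. x \<in> K"
  and mm: "prob_space mum" "sets mum = sets borel" "AE x in mum. x \<in> K"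
 obtains q where "q \<in> vector_measures_on K" "measure_div_eq K q mup mum"
proof -
 interpret p: prob_space mup by (rule mp)
 interpret n: prob_space mum by (rule mm)
 note [measurable_cong] = mp(2) mm(2)
 have [measurable]: "K \<in> sets borel" using K(1) by (simp add: compact_imp_closed)
 define L where "L = density lborel (%u::real. ennreal (indicator {-1..1} u))"
 have [measurable_cong]: "sets L = sets borel" by (simp add: L_def)
 have L: "(LINT u|L. F u) = (LBINT u. indicator {-1..1} u * F u)" if "F \<in> borelm" for F :: "real => real"
  unfolding L_def by (subst integral_density) (use that in auto)
 have "emeasure L (space L) = emeasure lborel {-1..1::real}"
  unfolding L_def by (simp add: emeasure_density ennreal_indicator)
 then interpret L: finite_measure L by (intro finite_measureI) simp
 interpret nL: pair_sigma_finite mum L by (intro pair_sigma_finite.intro n.sigma_finite_measure_axioms L.sigma_finite_measure_axioms)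
 have fnL: "finite_measure (mum \<Otimes>\<^sub>M L)" by (rule finite_measure_pair_measure[OF L.finite_measure_axioms n.finite_measure_axioms])
 interpret nLf: finite_measure "mum \<Otimes>\<^sub>M L" by (rule fnL)
 interpret P: pair_sigma_finite mup "mum \<Otimes>\<^sub>M L"
  by (intro pair_sigma_finite.intro p.sigma_finite_measure_axioms finite_measure.axioms(1)[OF fnL])
 define M where "M = mup \<Otimes>\<^sub>M (mum \<Otimes>\<^sub>M L)"
 have fM: "finite_measure M" unfolding M_def by (rule finite_measure_pair_measure[OF fnL p.finite_measure_axioms])
 obtain R where R: "0 < R" "!!x. x \<in> K ==> norm x <= R" using compact_imp_bounded[OF K(1)] unfolding bounded_pos by blast
 \<comment> \<open>The two measures are coupled by their product: every \<open>x\<close> is joined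
   to every \<open>y\<close> by the path \<open>T\<close>, and \<open>g\<close> is its
   velocity.\<close>
 define T where "T = (%(x, y, u). max (- u) 0 *R x + max u 0 *R y :: 'a)"
 define H where "H x y = (indicator K x * indicator K y :: real)" for x y :: 'a
 define g where "g = (%(x, y, u::real). (H x y * indicator {-1..1} u) *R (if u < 0 then - x else y) :: 'a)"
 have [measurable]: "T \<in> borel_measurable M" unfolding T_def M_def by measurable
 have [measurable]: "g \<in> borel_measurable M" unfolding g_def H_def M_def by measurable
 have gi: "integrable M g"
 proof (rule bounded_integrable_finite[OF fM, where B=R])
  show "norm (g z) <= R" for z
   using R by (cases z) (auto simp: g_def H_def indicator_def)
 qed measurable
 have gK: "T z \<in> K" if "g z ~= 0" for z
 proof -
  obtain x y u where z: "z = (x, y, u)" by (cases z)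
  have "x \<in> K" "y \<in> K" "\<bar>u\<bar> <= 1" using that by (auto simp: z g_def H_def indicator_def split: if_splits)
  moreover have "C1_on K (%x. 0) (%x. 0)" by (simp add: C1_on_def GDERIV_const)
  ultimately show ?thesis using segment_integral(1)[OF _ K, of "%x. 0" "%x. 0" x y u] by (simp add: T_def z)
 qed
 define q where "q A = (LINT z|M. indicator A (T z) *R g z)" for A
 have vq: "vector_measure q" unfolding q_def by (rule vector_measure_integral[OF _ gi]) simp
 have "q A = q (A \<inter> K)" for A
  unfolding q_def by (rule bi_cong) (use gK in \<open>force simp: indicator_def\<close>)+
 then have "q \<in> vector_measures_on K" using vq by (auto simp: vector_measures_on_def)
 moreover have "- vector_integral K q D = (LINT x:K|mup. f x) - (LINT x:K|mum. f x)" if f: "C1_on K f D" for f D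
 proof -
  have fc: "continuous_on K f" and Dc: "continuous_on K D" using f by (auto simp: C1_on_def)
  have [measurable]: "(%z. indicator K z *R D z) \<in> borelm" by (rule indicator_continuous_measurable[OF K(1) Dc])
  have [measurable]: "(%z. indicator K z *R f z) \<in> borelm" by (rule indicator_continuous_measurable[OF K(1) fc])
  obtain B where B: "0 <= B" "!!z. z \<in> K ==> norm (D z) <= B" using compact_continuous_bound[OF K(1) Dc] by blast
  define F where "F z = indicator K (T z) * (D (T z) \<bullet> g z)" for z
  have "(%z. (%z. indicator K z *R D z) (T z) \<bullet> g z) \<in> borel_measurable M" by measurable
  then have Fm: "F \<in> borel_measurable M" by (simp add: F_def[abs_def])
  have Fi: "integrable M F"
  proof (rule bounded_integrable_finite[OF fM Fm, where B="B * R"])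
   show "norm (F z) <= B * R" for z
   proof (cases "T z \<in> K")
    case True
    have "norm (g z) <= R" using R by (cases z) (auto simp: g_def H_def indicator_def)
    then have "\<bar>D (T z) \<bullet> g z\<bar> <= B * R"
     by (intro order_trans[OF Cauchy_Schwarz_ineq2 mult_mono[OF B(2)[OF True]]]) (use B(1) in auto)
    then show ?thesis using True by (simp add: F_def)
   qed (use B R in \<open>simp add: F_def\<close>)
  qed
  have inner: "(LINT u|L. F (x, y, u)) = H x y * (f y - f x)" if xy: "(%u. F (x, y, u)) \<in> borelm" for x y
  proof (cases "x \<in> K \<and> y \<in> K")
   case True
   have "(LINT u|L. F (x, y, u)) = (LBINT u. indicator {-1..1} u * F (x, y, u))" by (rule L[OF xy])
   also have "\<dots> = (LBINT u. indicator {-1..1} u * (indicator K (max (- u) 0 *R x + max u 0 *R y) *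
     (D (max (- u) 0 *R x + max u 0 *R y) \<bullet> (if u < 0 then - x else y))))"
    by (rule bi_cong) (use True in \<open>auto simp: F_def T_def g_def H_def indicator_def\<close>)
   also have "\<dots> = f y - f x" by (rule segment_integral(2)[OF f K]) (use True in auto)
   finally show ?thesis using True by (simp add: H_def)
  qed (auto simp: F_def g_def H_def)
  have Fxy: "(%u. F (x, y, u)) \<in> borelm" for x y
  proof -
   have "F \<in> borel_measurable (borel \<Otimes>\<^sub>M (borel \<Otimes>\<^sub>M borel))"
    using Fm unfolding M_def by (simp cong: measurable_cong_sets sets_pair_measure_cong)
   then show ?thesis by measurable
  qed
  have "vector_integral K q D = (LINT z|M. F z)"
   unfolding F_def by (rule vector_integral_integral[OF _ gi vq _ K(1) Dc]) (simp_all add: q_def)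
  also have "\<dots> = (LINT x|mup. LINT w|(mum \<Otimes>\<^sub>M L). F (x, w))"
   using P.integral_fst'[of F] Fi unfolding M_def by simp
  also have "\<dots> = (LINT x|mup. LINT y|mum. LINT u|L. F (x, y, u))"
  proof (rule integral_cong_AE)
   have Fi': "integrable (mup \<Otimes>\<^sub>M (mum \<Otimes>\<^sub>M L)) F" using Fi by (simp add: M_def)
   show "(%x. LINT w|(mum \<Otimes>\<^sub>M L). F (x, w)) \<in> borel_measurable mup"
    using Fm unfolding M_def by measurable
   show "(%x. LINT y|mum. LINT u|L. F (x, y, u)) \<in> borel_measurable mup"
    using Fm unfolding M_def by measurable
   have "AE x in mup. integrable (mum \<Otimes>\<^sub>M L) (%w. F (x, w))"
    using P.AE_integrable_fst'[OF Fi'] .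
   then show "AE x in mup. (LINT w|(mum \<Otimes>\<^sub>M L). F (x, w)) = (LINT y|mum. LINT u|L. F (x, y, u))"
    by eventually_elim (rule nL.integral_fst'[symmetric])
  qed
  also have "\<dots> = (LINT x|mup. LINT y|mum. H x y * (f y - f x))" by (simp add: inner[OF Fxy])
  also have "\<dots> = (LINT x|mup. indicator K x * (LINT y:K|mum. f y) - indicator K x * f x)"
  proof (rule bi_cong[OF refl])
   fix x
   have "(LINT y|mum. H x y * (f y - f x)) = (LINT y|mum. indicator K x * (indicator K y *R (f y - f x)))"
    by (simp add: H_def ac_simps)
   also have "\<dots> = indicator K x * ((LINT y:K|mum. f y) - f x)"
    using set_integral_diff(2)[OF set_integrable_continuous[OF n.finite_measure_axioms mm(2) K(1) fc]
      set_integrable_continuous[OF n.finite_measure_axioms mm(2) K(1) continuous_on_const], of "f x"]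
      set_integral_const_AE[OF mm, of "f x"] by (simp add: set_lebesgue_integral_def)
   finally show "(LINT y|mum. H x y * (f y - f x)) = indicator K x * (LINT y:K|mum. f y) - indicator K x * f x"
    by (simp add: right_diff_distrib)
  qed
  also have "\<dots> = (LINT x:K|mup. (LINT y:K|mum. f y) - f x)"
   by (simp add: set_lebesgue_integral_def right_diff_distrib)
  also have "\<dots> = (LINT y:K|mum. f y) - (LINT x:K|mup. f x)"
   using set_integral_diff(2)[OF set_integrable_continuous[OF p.finite_measure_axioms mp(2) K(1) continuous_on_const]
      set_integrable_continuous[OF p.finite_measure_axioms mp(2) K(1) fc], of "LINT y:K|mum. f y"]
    set_integral_const_AE[OF mp, of "LINT y:K|mum. f y"] by simp
  finally show ?thesis by simp
 qed
 then have "measure_div_eq K q mup mum" by (simp add: measure_div_eq_def)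
 ultimately show ?thesis by (rule that)
qed

section \<open>Limits of regularized fluxes\<close>

lemma lebesgue_measurable_AE:
 fixes f g :: "'a::euclidean_space => 'b::euclidean_space"
 assumes g: "g \<in> borelm" and ae: "AE x in lborel. f x = g x"
 shows "f \<in> borel_measurable lebesgue"
proof (rule measurableI)
 fix A :: "'b set" assume A: "A \<in> sets borel"
 obtain N where N: "N \<in> null_sets lborel" "{x. f x ~= g x} \<subseteq> N"
  using ae unfolding eventually_ae_filter by auto
 have N': "N \<in> null_sets lebesgue" using N(1) by (rule null_sets_completionI)
 have 1: "f -` A \<inter> N \<in> null_sets lebesgue" by (rule null_sets_completion_subset[OF _ N']) auto
 have 2: "g -` A - N \<in> sets lebesgue"
  using measurable_sets[OF measurable_completion[of g lborel borel] A] g N' by auto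
 have "f -` A = (g -` A - N) \<union> (f -` A \<inter> N)" using N(2) by auto
 then have "f -` A \<in> sets lebesgue" using sets.Un[OF 2 null_setsD2[OF 1]] by simp
 then show "f -` A \<inter> space lebesgue \<in> sets lebesgue" by simp
qed simp

lemma integral_lebesgue_AE:
 fixes f g :: "'a::euclidean_space => 'b::euclidean_space"
 assumes "g \<in> borelm" "AE x in lborel. f x = g x"
 shows "(LINT x|lebesgue. f x) = (LBINT x. g x)"
 by (rule lebesgue_integral_eq_lborel(1)[OF lebesgue_measurable_AE[OF assms] assms])

lemma integrable_of_powr:
 fixes f :: "'a::euclidean_space => 'b::euclidean_space"
 assumes f: "f \<in> borelm" "integrable lborel (%x. norm (f x) powr p)" "!!x. x \<notin> K ==> f x = 0"
  and K: "compact K" and p: "1 <= p"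
 shows "integrable lborel f"
proof (rule bi_bound)
 show "integrable lborel (%x. indicator K x *R (1::real) + norm (f x) powr p)"
  by (intro bi_addI f(2) borel_integrable_compact K continuous_on_const)
 show "AE x in lborel. norm (f x) <= norm (indicator K x *R 1 + norm (f x) powr p)"
 proof (rule AE_I2)
  fix x
  have "norm (f x) <= 1 + norm (f x) powr p"
  proof (cases "norm (f x) <= 1")
   case False then show ?thesis using powr_mono[OF p, of "norm (f x)"] by simp
  qed (simp add: add_increasing2)
  then show "norm (f x) <= norm (indicator K x *R 1 + norm (f x) powr p)"
   using f(3)[of x] by (cases "x \<in> K") auto
 qed
qed (use f in simp)

lemma Lp_borel:
 fixes f :: "'a::euclidean_space => 'b::euclidean_space"
 assumes f: "f \<in> borelm" "integrable lborel (%x. norm (f x) powr p)" and S: "S \<in> sets borel"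
 shows "f \<in> Lp S p"
proof -
 have Sl: "S \<in> sets lebesgue" using S by simp
 have fm: "f \<in> borel_measurable lebesgue" using f(1) by (simp add: measurable_completion)
 have "integrable lebesgue (%x. norm (f x) powr p)"
  using integrable_completion[of "%x. norm (f x) powr p" lborel] f by simp
 from integrable_mult_indicator[OF Sl this]
 have "integrable (lebesgue_on S) (%x. norm (f x) powr p)"
  using Sl by (subst integrable_restrict_space) auto
 then show ?thesis using measurable_restrict_space1[OF fm] by (simp add: Lp_def)
qed

section \<open>Bounds for regularized minimizers and admissible fluxes\<close>

text \<open>For \<open>norm z <= delta\<close> the difference is the perfect square
  \<open>w x / (2 * delta) * (norm z - delta)^2\<close>; beyond \<open>delta\<close> it is the
  nonnegative penalty.\<close>

lemma Gstar_ge: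
 assumes "0 <= w x" "0 < delta" "0 < epsilon" "1 < alpha"
 shows "norm z * w x - 3 / 2 * delta * w x <= Gstar alpha w epsilon delta x z"
proof (cases "norm z <= delta")
 case True
 have "(norm z)\<^sup>2 * (w x / (2 * delta)) - delta * w x - (norm z * w x - 3 / 2 * delta * w x) = w x / (2 * delta) * (norm z - delta)\<^sup>2"
  using assms(2) by (simp add: field_simps power2_eq_square)
 moreover have "0 <= w x / (2 * delta) * (norm z - delta)\<^sup>2" using assms by simp
 ultimately show ?thesis using True by (simp add: Gstar_def)
next
 case False
 have "0 <= epsilon / alpha * (norm z - delta) powr alpha" using assms by simp
 then show ?thesis using False by (simp add: Gstar_def)
qed

lemma Gstar_le:
 assumes "0 <= w x" "0 < delta" "0 < epsilon" "1 < alpha"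
 shows "Gstar alpha w epsilon delta x z <= norm z * w x + epsilon / alpha * norm z powr alpha"
proof (cases "norm z <= delta")
 case True
 have "norm z * (norm z / (2 * delta)) <= norm z * 1"
  using True assms(2) by (intro mult_left_mono) (auto simp: field_simps)
 then have "(norm z)\<^sup>2 * (w x / (2 * delta)) <= norm z * w x"
  using mult_right_mono[OF _ assms(1)] by (fastforce simp: power2_eq_square)
 moreover have "0 <= delta * w x" "0 <= epsilon / alpha * norm z powr alpha" using assms by simp_all
 ultimately show ?thesis using True unfolding Gstar_def by (simp only: if_True)
next
 case False
 have "epsilon / alpha * (norm z - delta) powr alpha <= epsilon / alpha * norm z powr alpha"
  using False assms by (intro mult_left_mono powr_mono2) auto
 moreover have "0 <= 3 / 2 * delta * w x" using assms by simp
 ultimately show ?thesis using False unfolding Gstar_def by (simp only: if_False)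
qed

text \<open>Minimality is applied against a single admissible \<open>f\<close>. The bounds on the
  integrand also show that the objective is integrable, so that its Bochner value is not the default
  0. \<open>V\<close> replaces the weight by a bounded function on the whole space.\<close>

lemma regularized_bound:
 fixes K :: "'a::euclidean_space set"
 assumes K: "compact K" and alpha: "1 < alpha" and epsilon: "0 < epsilon" and delta: "0 < delta"
  and V: "continuous_on UNIV V" "!!x. 0 <= V x" "!!x. V x <= B" "!!x. x \<in> K ==> what x = V x"
  and sol: "regularized_solution K alpha what mup mum epsilon delta q"
  and F: "F \<in> borelm" "!!x. x \<notin> K ==> F x = 0" "AE x in lborel. (if x \<in> K then q x else 0) = F x"
   "integrable lborel (%x. norm (F x) powr alpha)"
  and f: "f \<in> borelm" "!!x. x \<notin> K ==> f x = 0" "integrable lborel (%x. norm (f x) powr alpha)"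
   "div_eq (interior K) alpha f (measure_functional K mup mum)"
 shows "(LBINT x. V x * norm (F x)) <= (LBINT x. V x * norm (f x)) + epsilon / alpha * (LBINT x. norm (f x) powr alpha)
      + delta * (3 / 2 * B * measure lborel K)"
proof -
 have Kb [measurable]: "K \<in> sets borel" using K by (simp add: compact_imp_closed)
 have [measurable]: "V \<in> borelm" by (rule borel_measurable_continuous_onI[OF V(1)])
 have B: "0 <= B" using V(2,3) order_trans by blast
 define Ob where "Ob P x = indicator K x * Gstar alpha V epsilon delta x (P x)" for P x
 have Om: "Ob P \<in> borelm" if [measurable]: "P \<in> borelm" for P
  unfolding Ob_def[abs_def] Gstar_def by measurable
 have obj: "(LINT x:K|lebesgue. Gstar alpha what epsilon delta x (p x)) = (LBINT x. Ob P x)"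
  if P: "P \<in> borelm" and ae: "AE x in lborel. (if x \<in> K then p x else 0) = P x" for p P
  unfolding set_lebesgue_integral_def
 proof (rule integral_lebesgue_AE[OF Om[OF P]])
  show "AE x in lborel. indicator K x *R Gstar alpha what epsilon delta x (p x) = Ob P x"
   using ae
  proof eventually_elim
   case (elim x)
   then show ?case using V(4)[of x] by (cases "x \<in> K") (auto simp: Ob_def Gstar_def)
  qed
 qed
 have VP: "integrable lborel (%x. V x * norm (P x))" if P: "integrable lborel P" for P :: "'a => 'a"
 proof (rule bi_bound)
  show "integrable lborel (%x. B * norm (P x))" using P by simp
  show "(%x. V x * norm (P x)) \<in> borel_measurable lborel" using P by measurable
  show "AE x in lborel. norm (V x * norm (P x)) <= norm (B * norm (P x))"
   using V(2,3) B by (intro AE_I2) (simp add: abs_mult mult_right_mono)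
 qed
 have iB: "integrable lborel (%x. indicator K x *R (3 / 2 * delta * B))" by (intro borel_integrable_compact K continuous_on_const)
 have IB: "(LBINT x. indicator K x *R (3 / 2 * delta * B)) = delta * (3 / 2 * B * measure lborel K)"
  using emeasure_compact_finite[OF K] by simp
 have bounds: "V x * norm (P x) - indicator K x *R (3 / 2 * delta * B) <= Ob P x"
   "Ob P x <= V x * norm (P x) + epsilon / alpha * norm (P x) powr alpha"
  if z: "!!x. x \<notin> K ==> P x = 0" for P :: "'a => 'a" and x
 proof -
  have B1: "3 / 2 * delta * V x <= 3 / 2 * delta * B" using V(3)[of x] delta by (intro mult_left_mono) auto
  note ge = Gstar_ge[where w=V and x=x and z="P x", OF V(2) delta epsilon alpha]
  note le = Gstar_le[where w=V and x=x and z="P x", OF V(2) delta epsilon alpha]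
  have c: "norm (P x) * V x = V x * norm (P x)" by (rule mult.commute)
  show "V x * norm (P x) - indicator K x *R (3 / 2 * delta * B) <= Ob P x"
  proof (cases "x \<in> K")
   case True
   then have "indicator K x *R (3 / 2 * delta * B) = 3 / 2 * delta * B" "Ob P x = Gstar alpha V epsilon delta x (P x)" by (simp_all add: Ob_def)
   then show ?thesis using ge B1 c by linarith
  next
   case False then show ?thesis using z[OF False] by (simp add: Ob_def)
  qed
  show "Ob P x <= V x * norm (P x) + epsilon / alpha * norm (P x) powr alpha"
  proof (cases "x \<in> K")
   case True
   then have "Ob P x = Gstar alpha V epsilon delta x (P x)" by (simp add: Ob_def)
   then show ?thesis using le c by linarith
  next
   case False then show ?thesis using z[OF False] by (simp add: Ob_def)
  qed
 qed
 have Oi: "integrable lborel (Ob P)" if P: "P \<in> borelm" "!!x. x \<notin> K ==> P x = 0"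
   "integrable lborel (%x. norm (P x) powr alpha)" for P
 proof (rule bi_bound)
  have Pi: "integrable lborel P" by (rule integrable_of_powr[OF P(1,3,2) K]) (use alpha in auto)
  show "integrable lborel (%x. (V x * norm (P x) + epsilon / alpha * norm (P x) powr alpha) + indicator K x *R (3 / 2 * delta * B))"
   by (intro bi_addI iB VP Pi integrable_mult_right P(3))
  show "AE x in lborel. norm (Ob P x) <= norm ((V x * norm (P x) + epsilon / alpha * norm (P x) powr alpha) + indicator K x *R (3 / 2 * delta * B))"
  proof (rule AE_I2)
   fix x
   have "0 <= V x * norm (P x)" "0 <= epsilon / alpha * norm (P x) powr alpha" "0 <= indicator K x *R (3 / 2 * delta * B)"
    using V(2)[of x] epsilon alpha delta B by simp_all
   then show "norm (Ob P x) <= norm ((V x * norm (P x) + epsilon / alpha * norm (P x) powr alpha) + indicator K x *R (3 / 2 * delta * B))"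
    using bounds(1)[where P=P and x=x, OF P(2)] bounds(2)[where P=P and x=x, OF P(2)]
    unfolding real_norm_def by (intro order_trans[OF _ abs_ge_self] abs_leI) linarith+
  qed
 qed (use Om[OF P(1)] in simp)
 have Fi: "integrable lborel F" by (rule integrable_of_powr[OF F(1,4,2) K]) (use alpha in auto)
 have fi: "integrable lborel f" by (rule integrable_of_powr[OF f(1,3,2) K]) (use alpha in auto)
 have "(LBINT x. V x * norm (F x)) - delta * (3 / 2 * B * measure lborel K)
   = (LBINT x. V x * norm (F x) - indicator K x *R (3 / 2 * delta * B))"
  using bi_diff[OF VP[OF Fi] iB] IB by simp
 also have "\<dots> <= (LBINT x. Ob F x)"
  by (rule integral_mono[OF bi_diffI[OF VP[OF Fi] iB] Oi[OF F(1,2,4)] bounds(1)[OF F(2)]])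
 also have "\<dots> = (LINT x:K|lebesgue. Gstar alpha what epsilon delta x (q x))" using obj[OF F(1,3)] by simp
 also have "\<dots> <= (LINT x:K|lebesgue. Gstar alpha what epsilon delta x (f x))"
 proof -
  have "f \<in> Lp K alpha" by (rule Lp_borel[OF f(1,3) Kb])
  then show ?thesis using sol f(4) unfolding regularized_solution_def is_arg_min_linorder by blast
 qed
 also have "\<dots> = (LBINT x. Ob f x)" by (rule obj[OF f(1)]) (use f(2) in auto)
 also have "\<dots> <= (LBINT x. V x * norm (f x) + epsilon / alpha * norm (f x) powr alpha)"
  by (rule integral_mono[OF Oi[OF f(1,2,3)] bi_addI[OF VP[OF fi] integrable_mult_right[OF f(3)]] bounds(2)[OF f(2)]])
 also have "\<dots> = (LBINT x. V x * norm (f x)) + epsilon / alpha * (LBINT x. norm (f x) powr alpha)"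
  using bi_add[OF VP[OF fi] integrable_mult_right[OF f(3)], of "epsilon / alpha"] by simp
 finally show ?thesis by linarith
qed

lemma set_integral_AE_subset:
 fixes h :: "'a::euclidean_space => real"
 assumes n: "sets n = sets borel" "AE x in n. x \<in> A" and AB: "A \<subseteq> B" "compact A" "compact B" and h: "continuous_on B h"
 shows "(LINT x:B|n. h x) = (LINT x:A|n. h x)"
 unfolding set_lebesgue_integral_def
proof (rule integral_cong_AE)
 show "(%x. indicator B x *R h x) \<in> borel_measurable n" "(%x. indicator A x *R h x) \<in> borel_measurable n"
  using indicator_continuous_measurable[OF AB(3) h] indicator_continuous_measurable[OF AB(2) continuous_on_subset[OF h AB(1)]]
  by (simp_all add: measurable_cong_sets[OF n(1) refl])
 show "AE x in n. indicator B x *R h x = indicator A x *R h x"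
  using n(2) by eventually_elim (use AB(1) in \<open>auto simp: indicator_def\<close>)
qed

text \<open>Test functions on the larger set restrict to the smaller one, and \<open>f\<close> and
  both measures see nothing else. One smoothed flux thereby becomes admissible on all enlarged
  domains.\<close>

lemma div_eq_enlarged:
 fixes K :: "'a::euclidean_space set"
 assumes K: "compact K" "K \<subseteq> closure (interior K)" "cone_property K"
  and moll: "!!kappa. 0 < kappa ==> \<exists>eta. eta \<in> Cc_infinity (UNIV :: 'a set) \<and> (\<forall>x. 0 <= eta x) \<and> (LINT x|lebesgue. eta x) = 1 \<and> supp eta \<subseteq> ball 0 kappa"
  and alpha: "1 < alpha" "alpha * (real DIM('a) - 1) < real DIM('a)"
  and S: "compact S" "S \<subseteq> K"
  and mp: "sets mup = sets borel" "AE x in mup. x \<in> S"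
  and mm: "sets mum = sets borel" "AE x in mum. x \<in> S"
  and f: "f \<in> borelm" "!!y. y \<notin> interior S ==> f y = 0"
  and eq: "!!phi g c. weak_gradient_pair (interior S) phi g ==> g \<in> borelm ==>
    integrable lborel (%x. norm (g x) powr conj_exp alpha) ==> continuous_on S c ==>
    AE x in lborel. x \<in> interior S --> c x = phi x ==>
    - (LBINT y. f y \<bullet> g y) = (LINT x:S|mup. c x) - (LINT x:S|mum. c x)"
 shows "div_eq (interior K) alpha f (measure_functional K mup mum)"
 unfolding div_eq_def
proof (intro ballI allI impI)
 fix phi g
 assume phi: "phi \<in> W1_mean0 (interior K) (conj_exp alpha)" and g: "has_weak_gradient (interior K) phi g"
 have bK: "bounded (interior K)" using K(1) compact_imp_bounded interior_subset bounded_subset by blast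
 have p: "1 <= conj_exp alpha" using conj_exp_gt_1[OF alpha(1)] by simp
 have SK: "interior S \<subseteq> interior K" by (rule interior_mono[OF S(2)])
 obtain g0 where g0: "phi \<in> Lp (interior K) (conj_exp alpha)" "g0 \<in> Lp (interior K) (conj_exp alpha)" "has_weak_gradient (interior K) phi g0"
  using phi unfolding W1_mean0_def W1_def by blast
 obtain phi' h where h: "weak_gradient_pair (interior K) phi' h" "integrable lborel (%x. norm (h x) powr conj_exp alpha)"
  "AE x in lborel. (if x \<in> interior K then phi x else 0) = phi' x" "AE x in lborel. (if x \<in> interior K then g0 x else 0) = h x"
  "!!x. x \<notin> interior K ==> h x = 0" "h \<in> borelm" "phi' \<in> borelm"
  by (rule weak_pair_of_has_weak_gradient[OF open_interior bK p g0]) blast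
 \<comment> \<open>Cones of the larger set provide a continuous representative on all of
   \<open>K\<close>, as \<open>cont_rep\<close> asks.\<close>
 obtain P N xi E r theta D T R1 R2 where cc: "cone_cover K alpha P N xi E r theta D T R1 R2"
  using cone_cover_exists[OF K moll alpha] by blast
 obtain c where c: "continuous_on K c" "AE x in lborel. x \<in> interior K --> c x = phi' x"
  by (rule cone_cover.Sobolev_representative[OF cc h(1,2)])
 have c': "AE x in lborel. x \<in> interior K --> c x = phi x" using c(2) h(3) by eventually_elim auto
 have cr: "cont_rep K phi x = c x" if "x \<in> K" for x by (rule cont_rep_eq[OF K(2) c(1) c' that])
 have mf: "(LINT x:K|n. cont_rep K phi x) = (LINT x:S|n. c x)" if n: "sets n = sets borel" "AE x in n. x \<in> S" for n
 proof -
  have "(LINT x:K|n. cont_rep K phi x) = (LINT x:K|n. c x)"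
   unfolding set_lebesgue_integral_def by (rule bi_cong) (use cr in \<open>auto simp: indicator_def\<close>)
  then show ?thesis using set_integral_AE_subset[OF n S(2,1) K(1) c(1)] by simp
 qed
 have wS: "weak_gradient_pair (interior S) phi' h"
  using h(1) SK unfolding weak_gradient_pair_def Cc_infinity_def by blast
 obtain eta where eta: "eta \<in> Cc_infinity (UNIV :: 'a set)" "!!x. 0 <= eta x" "(LINT x|lebesgue. eta x) = 1" "supp eta \<subseteq> ball 0 (1 / 2)"
  using moll[of "1 / 2"] by auto
 have n1: "1 / 2 < norm (SOME i. i \<in> Basis :: 'a)" by (simp add: SOME_Basis)
 \<comment> \<open>Any bump serves for the uniqueness of weak gradients; a basis vector is longer
   than the support radius \<open>1 / 2\<close>.\<close>
 obtain D' T' where bu: "bump (%z. eta (z - (SOME i. i \<in> Basis))) D' T' (norm (SOME i. i \<in> Basis :: 'a) - 1 / 2) (norm (SOME i. i \<in> Basis :: 'a) + 1 / 2)"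
  by (rule bump_translate[OF eta n1])
 have gu: "AE x in lborel. x \<in> interior K --> g x = g0 x"
  by (rule bump.weak_gradient_unique[OF bu open_interior bK g g0(3)])
 have "(LINT x:interior K|lebesgue. f x \<bullet> g x) = (LBINT x. f x \<bullet> h x)"
  unfolding set_lebesgue_integral_def
 proof (rule integral_lebesgue_AE)
  show "(%x. f x \<bullet> h x) \<in> borelm" using f(1) h(6) by measurable
  show "AE x in lborel. indicator (interior K) x *R (f x \<bullet> g x) = f x \<bullet> h x"
   using gu h(4) by eventually_elim (use h(5) in \<open>auto simp: indicator_def\<close>)
 qed
 moreover have "AE x in lborel. x \<in> interior S --> c x = phi' x" using c(2) by eventually_elim (use SK in blast)
 ultimately show "- (LINT x:interior K|lebesgue. f x \<bullet> g x) = measure_functional K mup mum phi"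
  using eq[OF wS h(6,2) continuous_on_subset[OF c(1) S(2)]] mf[OF mp] mf[OF mm] by (simp add: measure_functional_def)
qed

section \<open>The divergence constraint on dilated sets\<close>

lemma mean_zero_constant:
 fixes f :: "'a => real"
 assumes S: "S \<in> sets M" "emeasure M S < \<infinity>" and f: "set_integrable M S f"
 obtains k where "(LINT x:S|M. f x - k) = 0"
proof -
 have c: "set_integrable M S (%x. k)" for k :: real
  using S unfolding set_integrable_def by simp
 have d: "(LINT x:S|M. f x - k) = (LINT x:S|M. f x) - k * measure M S" for k
  using set_integral_diff(2)[OF f c] S by (simp add: set_lebesgue_integral_def)
 show ?thesis
 proof (cases "measure M S = 0")
  case True
  then have "S \<in> null_sets M" using S emeasure_eq_ennreal_measure[of M S] by (auto simp: null_sets_def)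
  then have "AE x in M. x \<notin> S" by (rule AE_not_in)
  then have "(LINT x:S|M. f x) = 0"
   unfolding set_lebesgue_integral_def by (intro integral_eq_zero_AE) (auto elim!: eventually_mono)
  then show ?thesis using that[of 0] by simp
 next
  case False
  then show ?thesis using that[of "(LINT x:S|M. f x) / measure M S"] d by simp
 qed
qed

lemma scaled_C1:
 fixes S :: "'a::euclidean_space set"
 assumes phi: "C1_on S phi D" and c: "0 < c"
 shows "C1_on ((%x. c *R x) ` S) (%y. phi ((1 / c) *R y)) (%y. (1 / c) *R D ((1 / c) *R y))"
proof -
 let ?K = "(%x. c *R x) ` S"
 have i: "continuous_on ?K (%y. (1 / c) *R y)" by (intro continuous_intros)
 have m: "(%y. (1 / c) *R y) ` ?K \<subseteq> S" using c by auto
 have "GDERIV (%y. phi ((1 / c) *R y)) y :> (1 / c) *R D ((1 / c) *R y)" if y: "y \<in> interior ?K" for y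
 proof -
  have "(1 / c) *R y \<in> interior S" using y c interior_scaleR_image[of c S] by auto
  then have "GDERIV phi ((1 / c) *R (y - 0)) :> D ((1 / c) *R y)" using phi by (simp add: C1_on_def)
  from GDERIV_affine[OF this] show ?thesis by simp
 qed
 then show ?thesis
  using phi continuous_on_compose2[OF _ i m, of phi] continuous_on_compose2[OF _ i m, of D]
  unfolding C1_on_def by (auto intro!: continuous_on_scaleR continuous_on_const)
qed

text \<open>A function that is \<open>C1\<close> up to the boundary is a Sobolev function. A
  constant is subtracted to reach mean zero and cancels, both measures having mass 1; the frontier
  is null, so integrals over \<open>K\<close> and over its interior agree.\<close>

lemma divergence_test:
 fixes S :: "'a::euclidean_space set"
 assumes S: "compact S" "S \<subseteq> K" and K: "compact K" "K \<subseteq> closure (interior K)" "negligible (frontier K)"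
  and alpha: "1 < alpha"
  and mp: "prob_space mup" "sets mup = sets borel" "AE x in mup. x \<in> S"
  and mm: "prob_space mum" "sets mum = sets borel" "AE x in mum. x \<in> S"
  and p: "div_eq (interior K) alpha p (measure_functional K mup mum)"
  and F: "F \<in> borelm" "!!x. x \<notin> K ==> F x = 0" "AE x in lborel. (if x \<in> K then p x else 0) = F x"
  and psi: "C1_on K psi G"
 shows "- (LBINT x. F x \<bullet> G x) = (LINT x:S|mup. psi x) - (LINT x:S|mum. psi x)"
proof -
 have psic: "continuous_on K psi" and Gc: "continuous_on K G" using psi by (auto simp: C1_on_def)
 have e: "0 < conj_exp alpha" using conj_exp_gt_1[OF alpha] by simp
 have Kb [measurable]: "K \<in> sets borel" using K(1) by (simp add: compact_imp_closed)
 have "set_integrable lebesgue K psi"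
  unfolding set_integrable_def
  by (rule integrable_completion[THEN iffD2, rotated, OF borel_integrable_compact[OF K(1) psic]])
    (use indicator_continuous_measurable[OF K(1) psic] in simp)
 then have "set_integrable lebesgue (interior K) psi"
  by (rule set_integrable_subset) (auto simp: interior_subset)
 moreover have "emeasure lebesgue (interior K) < \<infinity>"
  using emeasure_mono[of "interior K" K lborel] emeasure_compact_finite[OF K(1)] interior_subset[of K] by (simp add: order_le_less_trans)
 ultimately obtain k where k: "(LINT x:interior K|lebesgue. psi x - k) = 0"
  using mean_zero_constant[of "interior K" lebesgue psi] by auto
 have "GDERIV (%x. psi x - k) x :> G x" if "x \<in> interior K" for x
  using GDERIV_diff[OF _ GDERIV_const, of psi x "G x" k] psi that by (simp add: C1_on_def)
 then have C1: "C1_on K (%x. psi x - k) G" using psi by (simp add: C1_on_def continuous_on_diff)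
 have kc: "continuous_on K (%x. psi x - k)" using C1 by (simp add: C1_on_def)
 have "(%x. psi x - k) \<in> W1_mean0 (interior K) (conj_exp alpha)"
  using k continuous_in_Lp[OF K(1) kc e] continuous_in_Lp[OF K(1) Gc e] has_weak_gradient_C1[OF C1]
  unfolding W1_mean0_def W1_def by blast
 then have *: "- (LINT x:interior K|lebesgue. p x \<bullet> G x) = measure_functional K mup mum (%x. psi x - k)"
  using p has_weak_gradient_C1[OF C1] unfolding div_eq_def by blast
 have "(LINT x:interior K|lebesgue. p x \<bullet> G x) = (LBINT x. F x \<bullet> (indicator K x *R G x))"
  unfolding set_lebesgue_integral_def
 proof (rule integral_lebesgue_AE)
  show "(%x. F x \<bullet> (indicator K x *R G x)) \<in> borelm"
   using F(1) indicator_continuous_measurable[OF K(1) Gc] by (rule borel_measurable_inner)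
  have "frontier K \<in> null_sets lborel"
   using K(3) by (simp add: negligible_iff_null_sets null_sets_completion_iff)
  then have "AE x in lborel. x \<notin> frontier K" by (rule AE_not_in)
  then show "AE x in lborel. indicator (interior K) x *R (p x \<bullet> G x) = F x \<bullet> (indicator K x *R G x)"
   using F(3)
  proof eventually_elim
   case (elim x)
   show ?case
   proof (cases "x \<in> K")
    case True
    then have "x \<in> interior K" using elim(1) closure_subset[of K] by (auto simp: frontier_def)
    then show ?thesis using True elim(2) by simp
   next
    case False
    then show ?thesis using interior_subset[of K] by (auto simp: indicator_def)
   qed
  qed
 qed
 also have "\<dots> = (LBINT x. F x \<bullet> G x)"
  by (rule bi_cong) (use F(2) in \<open>auto simp: indicator_def\<close>)
 finally have L: "(LINT x:interior K|lebesgue. p x \<bullet> G x) = (LBINT x. F x \<bullet> G x)" .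
 have R: "(LINT x:K|n. cont_rep K (%x. psi x - k) x) = (LINT x:S|n. psi x) - k"
  if n: "prob_space n" "sets n = sets borel" "AE x in n. x \<in> S" for n
 proof -
  have fn: "finite_measure n" by (rule prob_space.finite_measure[OF n(1)])
  have Sb: "S \<in> sets borel" using S(1) by (simp add: compact_imp_closed)
  have psiS: "continuous_on S psi" by (rule continuous_on_subset[OF psic S(2)])
  have "cont_rep K (%x. psi x - k) x = psi x - k" if "x \<in> K" for x
   by (rule cont_rep_eq[OF K(2) kc _ that]) simp
  then have "(LINT x:K|n. cont_rep K (%x. psi x - k) x) = (LINT x:K|n. psi x - k)"
   unfolding set_lebesgue_integral_def by (intro bi_cong) (auto simp: indicator_def)
  also have "\<dots> = (LINT x:S|n. psi x - k)" by (rule set_integral_AE_subset[OF n(2,3) S(2,1) K(1) kc])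
  also have "\<dots> = (LINT x:S|n. psi x) - k"
   using set_integral_diff(2)[OF set_integrable_continuous[OF fn n(2) S(1) psiS] set_integrable_continuous[OF fn n(2) S(1) continuous_on_const], of k]
    set_integral_const_AE[OF n Sb, of k] by simp
  finally show ?thesis .
 qed
 show ?thesis using * L R[OF mp] R[OF mm] by (simp add: measure_functional_def)
qed

text \<open>The vector densities \<open>F n\<close> are replaced by the scalar measures \<open>norm (F n x) dx\<close> carried to the pairs
 of position and direction, so that weak limits control direction and total mass at the same time.\<close>

lemma vector_density_subsequence:
 fixes F :: "nat => 'a::euclidean_space => 'a"
 assumes S: "compact S" and F: "!!n. integrable lborel (F n)" "!!n x. x \<notin> S ==> F n x = 0"
  and C: "!!n. (LBINT x. norm (F n x)) <= C"
 shows "\<exists>r M. strict_mono (r :: nat => nat) \<and> sets M = sets (borel :: ('a \<times> 'a) measure) \<and> finite_measure M \<and>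
   (AE z in M. fst z \<in> S \<and> norm (snd z) <= 1) \<and>
   (\<forall>phi::'a => real. continuous_on UNIV phi -->
    (%n. LINT x|lborel. phi x * norm (F (r n) x)) \<longlonglongrightarrow> (LINT z|M. phi (fst z))) \<and>
   (\<forall>D::'a => 'a. continuous_on UNIV D -->
    (%n. LINT x|lborel. F (r n) x \<bullet> D x) \<longlonglongrightarrow> (LINT z|M. D (fst z) \<bullet> snd z))"
proof -
 have Fm [measurable]: "F n \<in> borelm" for n using F(1)[of n] by auto
 \<comment> \<open>The direction of \<open>F n x\<close>; division by 0 gives direction 0 where
   \<open>F n\<close> vanishes.\<close>
 define g where "g n x = (1 / norm (F n x)) *R F n x" for n x
 have [measurable]: "g n \<in> borelm" for n unfolding g_def by measurable
 have g1: "norm (g n x) <= 1" and gF: "norm (F n x) *R g n x = F n x" for n x by (auto simp: g_def)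
 define T where "T n x = (x, g n x)" for n x
 have Tm [measurable]: "T n \<in> borelm" for n unfolding T_def by measurable
 define d where "d n = density lborel (%x. ennreal (norm (F n x)))" for n
 have sd [measurable_cong]: "sets (d n) = sets borel" for n by (simp add: d_def)
 define m where "m n = distr (d n) borel (T n)" for n
 have int: "(LINT z|m n. phi z) = (LBINT x. norm (F n x) * phi (T n x))" if phi: "phi \<in> borelm"
  for n and phi :: "'a \<times> 'a => real"
 proof -
  have "(LINT z|m n. phi z) = (LINT x|d n. phi (T n x))" unfolding m_def by (rule integral_distr) (use phi in measurable)
  also have "\<dots> = (LBINT x. norm (F n x) *R phi (T n x))"
   unfolding d_def using measurable_compose[OF Tm phi] by (intro integral_density) auto
  finally show ?thesis by simp
 qed
 have em: "emeasure (m n) UNIV = ennreal (LBINT x. norm (F n x))" for n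
 proof -
  have "emeasure (m n) UNIV = emeasure (d n) UNIV" unfolding m_def by (subst emeasure_distr) (auto simp: d_def)
  also have "\<dots> = (\<integral>\<^sup>+x. ennreal (norm (F n x)) \<partial>lborel)" unfolding d_def by (subst emeasure_density) auto
  also have "\<dots> = ennreal (LBINT x. norm (F n x))" by (rule nn_integral_eq_integral) (use F(1) in auto)
  finally show ?thesis .
 qed
 have sm: "sets (m n) = sets borel" "space (m n) = UNIV" for n by (simp_all add: m_def)
 have fm: "finite_measure (m n)" for n by (rule finite_measureI) (simp add: sm em)
 have cS: "compact (S \<times> cball (0::'a) 1)" by (intro compact_Times S compact_cball)
 have Sb: "S \<in> sets borel" using S by (simp add: compact_imp_closed)
 have ae: "AE z in m n. z \<in> S \<times> cball 0 1" for n
  unfolding m_def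
 proof (subst AE_distr_iff)
  show "T n \<in> measurable (d n) borel" by measurable
  show "{x \<in> space borel. x \<in> S \<times> cball (0::'a) 1} \<in> sets borel"
   using borel_closed[OF compact_imp_closed[OF cS]] by simp
  show "AE x in d n. T n x \<in> S \<times> cball 0 1"
   unfolding d_def by (subst AE_density) (use F(2) g1 in \<open>auto simp: T_def\<close>)
 qed
 have mC: "measure (m n) UNIV <= C" for n using C[of n] by (simp add: measure_def em)
 show ?thesis
 proof (rule compact_weakly_convergent_subsequence[OF cS sm(1) fm ae mC])
 fix r M
 assume r: "strict_mono (r :: nat => nat)" and M: "sets M = sets borel" "finite_measure M" "AE z in M. z \<in> S \<times> cball 0 1"
  and lim: "!!phi :: 'a \<times> 'a => real. continuous_on UNIV phi ==> (%n. integral\<^sup>L (m (r n)) phi) \<longlonglongrightarrow> integral\<^sup>L M phi"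
 have "(%n. LINT x|lborel. phi x * norm (F (r n) x)) \<longlonglongrightarrow> (LINT z|M. phi (fst z))" if phi: "continuous_on UNIV phi" for phi :: "'a => real"
 proof -
  have c: "continuous_on UNIV (%z::'a \<times> 'a. phi (fst z))"
   by (rule continuous_on_compose2[OF phi]) (auto intro: continuous_intros)
  show ?thesis using lim[OF c] by (simp add: int[OF borel_measurable_continuous_onI[OF c]] T_def mult.commute)
 qed
 moreover have "(%n. LINT x|lborel. F (r n) x \<bullet> D x) \<longlonglongrightarrow> (LINT z|M. D (fst z) \<bullet> snd z)" if D: "continuous_on UNIV D" for D :: "'a => 'a"
 proof -
  have c: "continuous_on UNIV (%z::'a \<times> 'a. D (fst z) \<bullet> snd z)"
   by (intro continuous_on_inner continuous_on_compose2[OF D]) (auto intro: continuous_intros)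
  have "norm (F n x) * (D x \<bullet> g n x) = F n x \<bullet> D x" for n x
   by (subst (2) gF[symmetric]) (simp add: inner_commute)
  then show ?thesis using lim[OF c] by (simp add: int[OF borel_measurable_continuous_onI[OF c]] T_def)
 qed
 moreover have "AE z in M. fst z \<in> S \<and> norm (snd z) <= 1" using M(3) by eventually_elim auto
 ultimately show ?thesis using r M(1,2) by blast
 qed
qed

section \<open>Star shaped sets and their dilates\<close>

lemma strictly_star_shaped_closure_interior:
 fixes K :: "'a::euclidean_space set"
 assumes K: "strictly_star_shaped K"
 shows "K \<subseteq> closure (interior K)"
proof
 fix x assume x: "x \<in> K"
 have "(1 - inverse (real (Suc n))) *R x \<in> interior K" for n
  using K x unfolding strictly_star_shaped_def by (auto simp: field_simps)
 moreover have "(%n. (1 - inverse (real (Suc n))) *R x) \<longlonglongrightarrow> (1 - 0) *R x"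
  by (intro tendsto_scaleR tendsto_diff tendsto_const LIMSEQ_inverse_real_of_nat)
 ultimately show "x \<in> closure (interior K)" unfolding closure_sequential by fastforce
qed

text \<open>Every ray from the origin meets the frontier at most once, because scaling a frontier
  point by less than 1 leads into the interior.\<close>

lemma strictly_star_shaped_negligible_frontier:
 fixes K :: "'a::euclidean_space set"
 assumes K: "strictly_star_shaped K" "closed K"
 shows "negligible (frontier K)"
proof (rule starlike_negligible_strong[where a=0])
 fix c :: real and x :: 'a
 assume "0 <= c" "c < 1" "0 + x \<in> frontier K"
 then have "c *R x \<in> interior K"
  using K frontier_subset_closed[OF K(2)] unfolding strictly_star_shaped_def by auto
 then show "0 + c *R x \<notin> frontier K" by (simp add: frontier_def)
qed simp

lemma strictly_star_shaped_scaleR: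
 fixes K :: "'a::euclidean_space set"
 assumes K: "strictly_star_shaped K" and c: "0 < c"
 shows "strictly_star_shaped ((%x. c *R x) ` K)"
 unfolding strictly_star_shaped_def
proof (intro ballI allI impI)
 fix x l assume "x \<in> (%x. c *R x) ` K" and l: "0 <= l \<and> l < (1::real)"
 then obtain y where y: "y \<in> K" "x = c *R y" by blast
 have "l *R y \<in> interior K" using K y(1) l by (auto simp: strictly_star_shaped_def)
 then have "c *R (l *R y) \<in> (%x. c *R x) ` interior K" by blast
 then show "l *R x \<in> interior ((%x. c *R x) ` K)"
  using c by (subst interior_scaleR_image) (auto simp: y(2) mult.commute)
qed

lemma strictly_star_shaped_shrink:
 fixes K :: "'a::euclidean_space set"
 assumes K: "strictly_star_shaped K" and c: "1 <= c" and x: "x \<in> K"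
 shows "(1 / c) *R x \<in> K"
proof (cases "c = 1")
 case False
 then have "(1 / c) *R x \<in> interior K" using K x c by (auto simp: strictly_star_shaped_def)
 then show ?thesis using interior_subset by blast
qed (use x in simp)

lemma strictly_star_shaped_subset_scaleR:
 fixes K :: "'a::euclidean_space set"
 assumes K: "strictly_star_shaped K" and c: "1 <= c"
 shows "K \<subseteq> (%x. c *R x) ` K"
proof
 fix x assume "x \<in> K"
 then have "c *R ((1 / c) *R x) \<in> (%x. c *R x) ` K" using strictly_star_shaped_shrink[OF K c] by blast
 then show "x \<in> (%x. c *R x) ` K" using c by simp
qed

lemma lipschitz_cone_property:
 fixes K :: "'a::euclidean_space set"
 assumes "lipschitz_domain (interior K)" "K \<subseteq> closure (interior K)"
 shows "cone_property K"
 unfolding cone_property_def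
proof
 fix p assume p: "p \<in> K"
 then have p': "p \<in> closure (interior K)" using assms(2) by blast
 show "\<exists>r a kappa. 0 < r \<and> 0 < kappa \<and> kappa < norm a \<and> (\<forall>x t z. x \<in> K --> dist p x <= r --> 0 < t --> t <= 1 --> z \<in> ball a kappa --> x + t *R z \<in> interior K)"
 proof (rule lipschitz_cone[OF assms(1) p'])
  fix r a kappa
  assume *: "0 < r" "0 < kappa" "kappa < norm a"
   and c: "!!x t z. x \<in> closure (interior K) ==> x \<in> cball p r ==> 0 < t ==> t <= 1 ==> z \<in> ball a kappa ==> x + t *R z \<in> interior K"
  have "x + t *R z \<in> interior K" if "x \<in> K" "dist p x <= r" "0 < t" "t <= 1" "z \<in> ball a kappa" for x t z
   using that assms(2) by (intro c) auto
  then show ?thesis using * by (intro exI[of _ r] exI[of _ a] exI[of _ kappa]) simp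
 qed
qed

section \<open>Passage to the limit\<close>

text \<open>Lower semicontinuity of the cost: \<open>M\<close> retains the whole limit of the
  masses, while its average over directions, \<open>Q\<close>, can lose mass by
  cancellation.\<close>

lemma total_variation_integral_le:
 fixes M :: "('a::euclidean_space \<times> 'a) measure" and V :: "'a => real"
 assumes M: "sets M = sets borel" and s: "integrable M snd" "AE z in M. norm (snd z) <= 1"
  and Q: "vector_measure Q" "!!A. A \<in> sets borel ==> Q A = (LINT z|M. indicator A (fst z) *R snd z)"
  and K: "compact K" and V: "continuous_on UNIV V" "!!x. 0 <= V x" "integrable M (%z. V (fst z))"
 shows "(LINT x:K|total_variation Q. V x) <= (LINT z|M. V (fst z))"
proof -
 have [measurable]: "K \<in> sets borel" using K by (simp add: compact_imp_closed)
 have [measurable]: "V \<in> borelm" by (rule borel_measurable_continuous_onI[OF V(1)])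
 have fm: "fst \<in> measurable M borel"
  unfolding measurable_cong_sets[OF M refl] by (intro borel_measurable_continuous_onI continuous_intros)
 have "ennreal (LINT x:K|total_variation Q. V x) = (\<integral>\<^sup>+x. ennreal (indicator K x *R V x) \<partial>total_variation Q)"
  unfolding set_lebesgue_integral_def
  by (rule nn_integral_eq_integral[symmetric])
    (use set_integrable_continuous[OF finite_measure_total_variation[OF Q(1)] _ K continuous_on_subset[OF V(1)]] V(2) in
     \<open>auto simp: set_integrable_def\<close>)
 also have "\<dots> <= (\<integral>\<^sup>+z. ennreal (norm (snd z)) * ennreal (indicator K (fst z) *R V (fst z)) \<partial>M)"
  by (rule nn_integral_total_variation_le[OF fm s(1) Q]) simp_all
 also have "\<dots> <= (\<integral>\<^sup>+z. ennreal (V (fst z)) \<partial>M)"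
 proof (rule nn_integral_mono_AE)
  show "AE z in M. ennreal (norm (snd z)) * ennreal (indicator K (fst z) *R V (fst z)) <= ennreal (V (fst z))"
   using s(2)
  proof eventually_elim
   case (elim z)
   have "norm (snd z) * (indicator K (fst z) *R V (fst z)) <= 1 * V (fst z)"
    using elim V(2)[of "fst z"] by (intro mult_mono) (auto simp: indicator_def)
   then show ?case using V(2)[of "fst z"] by (simp add: ennreal_mult'[symmetric] ennreal_leI)
  qed
 qed
 also have "\<dots> = ennreal (LINT z|M. V (fst z))" by (rule nn_integral_eq_integral) (use V in auto)
 finally show ?thesis using V(2) by (simp add: ennreal_le_iff)
qed

lemma integrable_pointwise_bound:
 fixes f :: "'w => 'b::euclidean_space"
 assumes "integrable M h" "f \<in> borel_measurable M" "!!x. norm (f x) <= h x"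
 shows "integrable M f"
proof (rule bi_bound[OF assms(1,2)])
 show "AE x in M. norm (f x) <= norm (h x)"
  unfolding real_norm_def by (rule AE_I2) (rule order_trans[OF assms(3) abs_ge_self])
qed

text \<open>The dilated test fields converge uniformly on \<open>S\<close>, and the masses of
  \<open>F n\<close> are bounded by \<open>C\<close>.\<close>

lemma scaled_test_limit:
 fixes D :: "'a::euclidean_space => 'a" and F :: "nat => 'a => 'a"
 assumes S: "compact S" and F: "!!n. integrable lborel (F n)" "!!n x. x \<notin> S ==> F n x = 0"
  and C: "!!n. (LBINT x. norm (F n x)) <= C" and D: "continuous_on UNIV D"
  and c: "!!n. 1 <= c n" "c \<longlonglongrightarrow> 1"
 shows "(%n. (LBINT x. F n x \<bullet> ((1 / c n) *R D ((1 / c n) *R x))) - (LBINT x. F n x \<bullet> D x)) \<longlonglongrightarrow> 0"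
proof (rule LIMSEQ_I)
 fix e :: real assume e: "0 < e"
 have C0: "0 <= C" using C[of 0] by (rule order_trans[rotated]) simp
 \<comment> \<open>One \<open>e'\<close> pays for moving the argument of \<open>D\<close>, another
   one for the factor \<open>1 / c n\<close>; the added 1 covers \<open>C = 0\<close>.\<close>
 define e' where "e' = e / (2 * (C + 1))"
 have e': "0 < e'" using e C0 by (simp add: e'_def)
 have e'C: "2 * e' * C < e"
 proof -
  have "2 * e' * C = e * (C / (C + 1))" using C0 by (simp add: e'_def field_simps)
  also have "\<dots> < e * 1" using e C0 by (intro mult_strict_left_mono) auto
  finally show ?thesis by simp
 qed
 obtain d where d: "0 < d" "!!x y. x \<in> S ==> dist x y < d ==> norm (D y - D x) < e'"
  using uniform_continuity_near_compact[OF S D e'] by blast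
 obtain B where B: "0 <= B" "!!x. x \<in> S ==> norm (D x) <= B"
  using compact_continuous_bound[OF S continuous_on_subset[OF D]] by blast
 obtain R where R: "0 < R" "!!x. x \<in> S ==> norm x <= R" using compact_imp_bounded[OF S] unfolding bounded_pos by blast
 have l: "(%n. 1 - 1 / c n) \<longlonglongrightarrow> 1 - 1 / 1" by (intro tendsto_diff tendsto_divide tendsto_const c(2)) simp
 have "(%n. (1 - 1 / c n) * R) \<longlonglongrightarrow> 0" "(%n. (1 - 1 / c n) * B) \<longlonglongrightarrow> 0"
  using tendsto_mult[OF l tendsto_const] by force+
 then have "\<forall>\<^sub>F n in sequentially. (1 - 1 / c n) * R < d" "\<forall>\<^sub>F n in sequentially. (1 - 1 / c n) * B < e'"
  using d(1) e' by (auto intro: order_tendstoD)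
 then have "\<forall>\<^sub>F n in sequentially. (1 - 1 / c n) * R < d \<and> (1 - 1 / c n) * B < e'" by eventually_elim simp
 then obtain N where N: "!!n. N <= n ==> (1 - 1 / c n) * R < d" "!!n. N <= n ==> (1 - 1 / c n) * B < e'"
  unfolding eventually_sequentially by blast
 have "norm ((LBINT x. F n x \<bullet> ((1 / c n) *R D ((1 / c n) *R x))) - (LBINT x. F n x \<bullet> D x) - 0) < e" if n: "N <= n" for n
 proof -
  define k where "k = 1 / c n"
  have k: "0 <= k" "k <= 1" using c(1)[of n] by (auto simp: k_def field_simps)
  have [measurable]: "D \<in> borelm" by (rule borel_measurable_continuous_onI[OF D])
  have [measurable]: "F n \<in> borelm" using F(1)[of n] by auto
  have G: "norm (k *R D (k *R x) - D x) <= 2 * e'" if x: "x \<in> S" for x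
  proof -
   have "dist x (k *R x) = (1 - k) * norm x"
   proof -
    have "x - k *R x = (1 - k) *R x" by (simp add: scaleR_diff_left)
    then show ?thesis using k by (simp add: dist_norm)
   qed
   also have "\<dots> <= (1 - k) * R" using k R(2)[OF x] by (intro mult_left_mono) auto
   also have "\<dots> < d" using N(1)[OF n] by (simp add: k_def)
   finally have 1: "norm (D (k *R x) - D x) < e'" by (rule d(2)[OF x])
   have "k *R D (k *R x) - D x = k *R (D (k *R x) - D x) - (1 - k) *R D x" by (simp add: algebra_simps)
   also have "norm \<dots> <= norm (k *R (D (k *R x) - D x)) + norm ((1 - k) *R D x)" by (rule norm_triangle_ineq4)
   also have "norm (k *R (D (k *R x) - D x)) <= 1 * norm (D (k *R x) - D x)"
    unfolding norm_scaleR using k by (intro mult_right_mono) auto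
   also have "norm ((1 - k) *R D x) <= (1 - k) * B"
    unfolding norm_scaleR using k B(2)[OF x] by (simp add: mult_left_mono)
   also have "(1 - k) * B <= e'" using N(2)[OF n] by (simp add: k_def)
   finally show ?thesis using 1 by simp
  qed
  have b: "norm (F n x \<bullet> (k *R D (k *R x) - D x)) <= 2 * e' * norm (F n x)" for x
  proof (cases "x \<in> S")
   case True
   have "norm (F n x \<bullet> (k *R D (k *R x) - D x)) <= norm (F n x) * norm (k *R D (k *R x) - D x)"
    unfolding real_norm_def by (rule Cauchy_Schwarz_ineq2)
   also have "\<dots> <= norm (F n x) * (2 * e')" by (rule mult_left_mono[OF G[OF True]]) simp
   finally show ?thesis by (simp add: mult.commute)
  qed (simp add: F(2))
  have b2: "norm (F n x \<bullet> D x) <= B * norm (F n x)" for x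
  proof (cases "x \<in> S")
   case True
   have "norm (F n x \<bullet> D x) <= norm (F n x) * norm (D x)" unfolding real_norm_def by (rule Cauchy_Schwarz_ineq2)
   also have "\<dots> <= norm (F n x) * B" by (rule mult_left_mono[OF B(2)[OF True]]) simp
   finally show ?thesis by (simp add: mult.commute)
  qed (simp add: F(2))
  have i1: "integrable lborel (%x. F n x \<bullet> (k *R D (k *R x) - D x))"
   by (rule integrable_pointwise_bound[OF integrable_mult_right[OF integrable_norm[OF F(1)]] _ b]) measurable
  have i2: "integrable lborel (%x. F n x \<bullet> D x)"
   by (rule integrable_pointwise_bound[OF integrable_mult_right[OF integrable_norm[OF F(1)]] _ b2]) measurable
  have "(LBINT x. F n x \<bullet> (k *R D (k *R x))) = (LBINT x. F n x \<bullet> (k *R D (k *R x) - D x) + F n x \<bullet> D x)"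
   by (simp add: inner_diff_right)
  also have "\<dots> = (LBINT x. F n x \<bullet> (k *R D (k *R x) - D x)) + (LBINT x. F n x \<bullet> D x)"
   by (rule bi_add[OF i1 i2])
  finally have "norm ((LBINT x. F n x \<bullet> (k *R D (k *R x))) - (LBINT x. F n x \<bullet> D x))
    = norm (LBINT x. F n x \<bullet> (k *R D (k *R x) - D x))" by simp
  also have "\<dots> <= (LBINT x. 2 * e' * norm (F n x))"
   by (rule norm_integral_le[OF _ b]) (use F(1) in simp)
  also have "\<dots> <= 2 * e' * C" using C[of n] e' by simp
  finally show ?thesis using e'C by (simp add: k_def)
 qed
 then show "\<exists>N. \<forall>n\<ge>N. norm ((LBINT x. F n x \<bullet> ((1 / c n) *R D ((1 / c n) *R x))) - (LBINT x. F n x \<bullet> D x) - 0) < e" by blast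
qed

text \<open>Star shape keeps the shrunken points in \<open>K\<close>, where \<open>phi\<close> is
  bounded, so dominated convergence applies.\<close>

lemma scaled_integral_limit:
 fixes phi :: "'a::euclidean_space => real"
 assumes K: "compact K" "strictly_star_shaped K" and n: "finite_measure n" "sets n = sets borel"
  and phi: "continuous_on K phi" and c: "!!k. 1 <= c k" "c \<longlonglongrightarrow> 1"
 shows "(%k. LINT x:K|n. phi ((1 / c k) *R x)) \<longlonglongrightarrow> (LINT x:K|n. phi x)"
proof -
 obtain B where B: "0 <= B" "!!x. x \<in> K ==> norm (phi x) <= B" using compact_continuous_bound[OF K(1) phi] by blast
 have sh: "(1 / c k) *R x \<in> K" if "x \<in> K" for x k by (rule strictly_star_shaped_shrink[OF K(2) c(1) that])
 have phik: "continuous_on K (%x. phi ((1 / c k) *R x))" for k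
  by (rule continuous_on_compose2[OF phi]) (auto intro!: continuous_intros sh)
 have l: "(%k. 1 / c k) \<longlonglongrightarrow> 1 / 1" by (intro tendsto_divide tendsto_const c(2)) simp
 show ?thesis
  unfolding set_lebesgue_integral_def
 proof (rule integral_dominated_convergence[where w="%x. B"])
  show "(%x. indicator K x *R phi x) \<in> borel_measurable n"
   using indicator_continuous_measurable[OF K(1) phi] by (simp add: measurable_cong_sets[OF n(2) refl])
  show "(%x. indicator K x *R phi ((1 / c k) *R x)) \<in> borel_measurable n" for k
   using indicator_continuous_measurable[OF K(1) phik] by (simp add: measurable_cong_sets[OF n(2) refl])
  show "integrable n (%x. B)" by (rule bounded_integrable_finite[OF n(1), where B=B]) (use B(1) in auto)
  show "AE x in n. (%k. indicator K x *R phi ((1 / c k) *R x)) \<longlonglongrightarrow> indicator K x *R phi x"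
  proof (rule AE_I2)
   fix x
   show "(%k. indicator K x *R phi ((1 / c k) *R x)) \<longlonglongrightarrow> indicator K x *R phi x"
   proof (cases "x \<in> K")
    case True
    have "(%k. (1 / c k) *R x) \<longlonglongrightarrow> (1 / 1) *R x" by (intro tendsto_scaleR l tendsto_const)
    then have "(%k. (1 / c k) *R x) \<longlonglongrightarrow> x" by simp
    then have "(%k. phi ((1 / c k) *R x)) \<longlonglongrightarrow> phi x"
     by (rule continuous_on_tendsto_compose[OF phi _ True]) (simp add: sh[OF True])
    then show ?thesis using True by simp
   qed simp
  qed
  show "AE x in n. norm (indicator K x *R phi ((1 / c k) *R x)) <= B" for k
  proof (rule AE_I2)
   fix x
   show "norm (indicator K x *R phi ((1 / c k) *R x)) <= B"
    using B(2)[OF sh[of x k]] B(1) by (cases "x \<in> K") auto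
  qed
 qed
qed

lemma vector_measure_cong:
 fixes q q' :: "'a::euclidean_space set => 'b::real_normed_vector"
 assumes q: "vector_measure q" and eq: "!!A. A \<in> sets borel ==> q' A = q A"
 shows "vector_measure q'"
 unfolding vector_measure_def
proof (intro allI impI)
 fix A :: "nat => 'a set"
 assume A: "range A \<subseteq> sets borel \<and> disjoint_family A"
 then have "(%i. q (A i)) sums q (\<Union>i. A i)" using q unfolding vector_measure_def by blast
 moreover have "q' (A i) = q (A i)" for i using A by (intro eq) auto
 moreover have "q' (\<Union>i. A i) = q (\<Union>i. A i)" using A by (intro eq) auto
 ultimately show "(%i. q' (A i)) sums q' (\<Union>i. A i)" by simp
qed

text \<open>The Borel version \<open>F\<close> makes the density of a Lebesgue measurable function
  an image measure whose integrals are Bochner integrals.\<close>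

lemma density_on_facts:
 fixes F :: "'a::euclidean_space => 'a"
 assumes F: "integrable lborel F" "!!x. x \<notin> K ==> F x = 0" "AE x in lborel. (if x \<in> K then q x else 0) = F x"
  and K: "K \<subseteq> S" "compact S"
 shows "density_on K q \<in> vector_measures_on S"
  and "continuous_on UNIV f ==> (!!x. x \<in> S ==> f x = g x) ==> vector_integral S (density_on K q) g = (LBINT x. F x \<bullet> f x)"
proof -
 have [measurable]: "F \<in> borelm" using F(1) by auto
 have Sb: "S \<in> sets borel" using K(2) by (simp add: compact_imp_closed)
 have eq: "density_on K q A = (LBINT x. indicator A x *R F x)" if A: "A \<in> sets borel" for A
  unfolding density_on_def set_lebesgue_integral_def
 proof (rule integral_lebesgue_AE)
  show "(%x. indicator A x *R F x) \<in> borelm" using A by measurable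
  show "AE x in lborel. indicator A x *R (if x \<in> K then q x else 0) = indicator A x *R F x"
   using F(3) by eventually_elim simp
 qed
 have "vector_measure (%A. LINT x|lborel. indicator A x *R F x)" by (rule vector_measure_integral[OF _ F(1)]) simp
 then have vm: "vector_measure (density_on K q)" by (rule vector_measure_cong) (rule eq)
 have "density_on K q A = density_on K q (A \<inter> S)" if A: "A \<in> sets borel" for A
 proof -
  have "(LBINT x. indicator A x *R F x) = (LBINT x. indicator (A \<inter> S) x *R F x)"
  proof (rule bi_cong[OF refl])
   fix x
   show "indicator A x *R F x = indicator (A \<inter> S) x *R F x"
    using F(2)[of x] K(1) by (cases "x \<in> S") (auto simp: indicator_def)
  qed
  then show ?thesis using A Sb by (simp add: eq)
 qed
 then show "density_on K q \<in> vector_measures_on S" using vm by (simp add: vector_measures_on_def)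
 assume f: "continuous_on UNIV f" and g: "!!x. x \<in> S ==> f x = g x"
 have gc: "continuous_on S g" using continuous_on_subset[OF f, of S] g by (simp cong: continuous_on_cong)
 have "vector_integral S (density_on K q) g = (LBINT x. indicator S x * (g x \<bullet> F x))"
  by (rule vector_integral_integral[OF _ F(1) vm eq K(2) gc]) simp_all
 also have "\<dots> = (LBINT x. F x \<bullet> f x)"
 proof (rule bi_cong[OF refl])
  fix x
  show "indicator S x * (g x \<bullet> F x) = F x \<bullet> f x"
  proof (cases "x \<in> S")
   case True then show ?thesis using g[of x] by (simp add: inner_commute)
  next
   case False
   then have "F x = 0" using F(2)[of x] K(1) by blast
   then show ?thesis by simp
  qed
 qed
 finally show "vector_integral S (density_on K q) g = (LBINT x. F x \<bullet> f x)" .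
qed

text \<open>The enlarged domains enter as dilates by factors \<open>c n\<close> tending to 1 inside
  one compact \<open>S\<close>, the weight as a continuous function \<open>V\<close> on the whole
  space between positive bounds. Limits can then be taken with test functions on the whole
  space.\<close>

theorem regularized_fluxes_converge:
 fixes Omega S :: "'a::euclidean_space set" and w what V :: "'a => real" and mup mum :: "'a measure"
  and q :: "nat => 'a => 'a" and c epsilon delta :: "nat => real"
 assumes Omega: "compact Omega" "lipschitz_domain (interior Omega)" "strictly_star_shaped Omega"
  and moll: "!!kappa. 0 < kappa ==> \<exists>eta. eta \<in> Cc_infinity (UNIV :: 'a set) \<and> (\<forall>x. 0 <= eta x) \<and> (LINT x|lebesgue. eta x) = 1 \<and> supp eta \<subseteq> ball 0 kappa"
  and alpha: "1 < alpha" "alpha * (real DIM('a) - 1) < real DIM('a)"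
  and mp: "prob_space mup" "sets mup = sets borel" "AE x in mup. x \<in> Omega"
  and mm: "prob_space mum" "sets mum = sets borel" "AE x in mum. x \<in> Omega"
  and c: "!!n. 1 <= c n" "c \<longlonglongrightarrow> 1"
  and S: "compact S" "!!n. (%x. c n *R x) ` Omega \<subseteq> S"
  and V: "continuous_on UNIV V" "0 < wlow" "!!x. wlow <= V x" "!!x. V x <= B" "!!x. x \<in> S ==> what x = V x" "!!x. x \<in> Omega ==> w x = V x"
  and epsilon: "!!n. 0 < epsilon n" "epsilon \<longlonglongrightarrow> 0" and delta: "!!n. 0 < delta n" "delta \<longlonglongrightarrow> 0"
  and sol: "!!n. regularized_solution ((%x. c n *R x) ` Omega) alpha what mup mum (epsilon n) (delta n) (q n)"
 shows "\<exists>r Q. strict_mono r \<and>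
      weak_star_converges S (%n. density_on ((%x. c (r n) *R x) ` Omega) (q (r n))) Q \<and>
      beckmann_solution Omega w mup mum Q"
proof -
 define K where "K n = (%x. c n *R x) ` Omega" for n
 have c0: "0 < c n" for n using c(1)[of n] by linarith
 have Omegacl: "Omega \<subseteq> closure (interior Omega)" by (rule strictly_star_shaped_closure_interior[OF Omega(3)])
 have Omegacone: "cone_property Omega" by (rule lipschitz_cone_property[OF Omega(2) Omegacl])
 have Omegab [measurable]: "Omega \<in> sets borel" using Omega(1) by (simp add: compact_imp_closed)
 have Omegane: "Omega ~= {}" using Omega(2) interior_subset[of Omega] by (auto simp: lipschitz_domain_def)
 have Kst: "strictly_star_shaped (K n)" for n unfolding K_def by (rule strictly_star_shaped_scaleR[OF Omega(3) c0])
 have Kc: "compact (K n)" for n unfolding K_def by (rule compact_scaling[OF Omega(1)])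
 have Kcl: "K n \<subseteq> closure (interior (K n))" for n by (rule strictly_star_shaped_closure_interior[OF Kst])
 have Kneg: "negligible (frontier (K n))" for n
  by (rule strictly_star_shaped_negligible_frontier[OF Kst compact_imp_closed[OF Kc]])
 have Kcone: "cone_property (K n)" for n unfolding K_def by (rule cone_property_scaleR[OF Omegacone c(1)])
 have OmegaK: "Omega \<subseteq> K n" for n unfolding K_def by (rule strictly_star_shaped_subset_scaleR[OF Omega(3) c(1)])
 have KS: "K n \<subseteq> S" for n unfolding K_def by (rule S(2))
 have OmegaS: "Omega \<subseteq> S" using OmegaK KS by blast
 have Kb: "K n \<in> sets borel" "bounded (K n)" for n using Kc[of n] by (auto simp: compact_imp_closed compact_imp_bounded)
 have V0: "0 <= V x" for x using V(2) V(3)[of x] by linarith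
 have B: "0 <= B" using V0[of 0] V(4)[of 0] by linarith
 have sol': "regularized_solution (K n) alpha what mup mum (epsilon n) (delta n) (q n)" for n unfolding K_def by (rule sol)
 have qp: "q n \<in> Lp (K n) alpha" "div_eq (interior (K n)) alpha (q n) (measure_functional (K n) mup mum)" for n
  using sol'[of n] by (auto simp: regularized_solution_def is_arg_min_def)
 have "\<exists>F. F \<in> borelm \<and> (\<forall>x. x \<notin> K n --> F x = 0) \<and> (AE x in lborel. (if x \<in> K n then q n x else 0) = F x) \<and>
   integrable lborel F \<and> integrable lborel (%x. norm (F x) powr alpha)" for n
 proof (rule Lp_borel_representative[OF Kb[of n] _ qp(1)[of n]])
  show "1 <= alpha" using alpha(1) by simp
  fix F assume "F \<in> borelm" "!!x. x \<notin> K n ==> F x = 0"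
   "AE x in lborel. (if x \<in> K n then q n x else 0) = F x" "integrable lborel F" "integrable lborel (%x. norm (F x) powr alpha)"
  then show ?thesis by (intro exI[of _ F]) simp
 qed
 then have "\<forall>n. \<exists>F. F \<in> borelm \<and> (\<forall>x. x \<notin> K n --> F x = 0) \<and> (AE x in lborel. (if x \<in> K n then q n x else 0) = F x) \<and>
   integrable lborel F \<and> integrable lborel (%x. norm (F x) powr alpha)" by blast
 from choice[OF this] obtain F where F0: "\<forall>n. F n \<in> borelm \<and> (\<forall>x. x \<notin> K n --> F n x = 0) \<and>
   (AE x in lborel. (if x \<in> K n then q n x else 0) = F n x) \<and> integrable lborel (F n) \<and> integrable lborel (%x. norm (F n x) powr alpha)"
  by blast
 have F: "F n \<in> borelm" "!!x. x \<notin> K n ==> F n x = 0" "AE x in lborel. (if x \<in> K n then q n x else 0) = F n x"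
  "integrable lborel (F n)" "integrable lborel (%x. norm (F n x) powr alpha)" for n
  using F0 by blast+
 have FS: "F n x = 0" if "x \<notin> S" for n x using F(2) KS that by blast
 define C' where "C' = 3 / 2 * B * measure lborel S"
 \<comment> \<open>\<open>Cf\<close> depends on the competitor and on \<open>eta\<close> but not on
   \<open>n\<close>: the smoothed flux is chosen once and is admissible for all
   \<open>n\<close>.\<close>
 have ub: "\<exists>Cf. \<forall>n. (LBINT x. V x * norm (F n x)) <= (LINT x:Omega|total_variation q'. V x) + eta + epsilon n * Cf + delta n * C'"
  if q': "q' \<in> vector_measures_on Omega" "measure_div_eq Omega q' mup mum" and eta: "0 < eta" for q' eta
 proof (rule smoothing[OF Omega(1) Omegacl Omegacone moll alpha mp mm q' V(1) V0 V(4) eta])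
  fix f
  assume f: "f \<in> borelm" "!!y. y \<notin> interior Omega ==> f y = 0" "integrable lborel (%y. norm (f y) powr alpha)"
   "(LBINT y. V y * norm (f y)) <= (LINT x:Omega|total_variation q'. V x) + eta"
   and fd: "!!phi g c. weak_gradient_pair (interior Omega) phi g ==> g \<in> borelm ==>
    integrable lborel (%x. norm (g x) powr conj_exp alpha) ==> continuous_on Omega c ==>
    AE x in lborel. x \<in> interior Omega --> c x = phi x ==>
    - (LBINT y. f y \<bullet> g y) = (LINT x:Omega|mup. c x) - (LINT x:Omega|mum. c x)"
  have "(LBINT x. V x * norm (F n x)) <= (LINT x:Omega|total_variation q'. V x) + eta + epsilon n * ((LBINT x. norm (f x) powr alpha) / alpha) + delta n * C'" for n
  proof -
   have fK: "f y = 0" if "y \<notin> K n" for y using that f(2)[of y] OmegaK[of n] interior_subset[of Omega] by blast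
   have de: "div_eq (interior (K n)) alpha f (measure_functional (K n) mup mum)"
    by (rule div_eq_enlarged[OF Kc Kcl Kcone moll alpha Omega(1) OmegaK mp(2,3) mm(2,3) f(1,2) fd])
   have wV: "what x = V x" if "x \<in> K n" for x using V(5) KS that by blast
   have "(LBINT x. V x * norm (F n x)) <= (LBINT x. V x * norm (f x)) + epsilon n / alpha * (LBINT x. norm (f x) powr alpha)
      + delta n * (3 / 2 * B * measure lborel (K n))"
    by (rule regularized_bound[OF Kc alpha(1) epsilon(1) delta(1) V(1) V0 V(4) wV sol' F(1,2,3,5) f(1) fK f(3) de])
   moreover have "delta n * (3 / 2 * B * measure lborel (K n)) <= delta n * C'"
   proof -
    have "measure lborel (K n) <= measure lborel S"
     by (rule measure_mono_fmeasurable[OF KS]) (use Kb S(1) emeasure_compact_finite[OF S(1)] in \<open>auto simp: fmeasurable_def compact_imp_closed\<close>)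
    then show ?thesis using B delta(1)[of n] unfolding C'_def by (intro mult_left_mono) auto
   qed
   moreover have "epsilon n / alpha * (LBINT x. norm (f x) powr alpha) = epsilon n * ((LBINT x. norm (f x) powr alpha) / alpha)" by simp
   ultimately show ?thesis using f(4) by linarith
  qed
  then show ?thesis by blast
 qed
 \<comment> \<open>The segment competitor bounds the costs; the positive lower bound of the weight
   turns this into a bound on the masses.\<close>
 obtain C where C: "(LBINT x. norm (F n x)) <= C" for n
 proof (rule flux_exists[OF Omega(1,3) mp mm])
  fix q' assume "q' \<in> vector_measures_on Omega" "measure_div_eq Omega q' mup mum"
  from ub[OF this zero_less_one] obtain Cf where Cf:
   "!!n. (LBINT x. V x * norm (F n x)) <= (LINT x:Omega|total_variation q'. V x) + 1 + epsilon n * Cf + delta n * C'" by blast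
  have "(%n. (LINT x:Omega|total_variation q'. V x) + 1 + epsilon n * Cf + delta n * C') \<longlonglongrightarrow> (LINT x:Omega|total_variation q'. V x) + 1 + 0 * Cf + 0 * C'"
   by (intro tendsto_add tendsto_mult tendsto_const epsilon(2) delta(2))
  then have "Bseq (%n. (LINT x:Omega|total_variation q'. V x) + 1 + epsilon n * Cf + delta n * C')" by (rule convergentI[THEN convergent_imp_Bseq])
  then obtain H where H: "!!n. \<bar>(LINT x:Omega|total_variation q'. V x) + 1 + epsilon n * Cf + delta n * C'\<bar> <= H"
   unfolding Bseq_def by auto
  have "(LBINT x. norm (F n x)) <= H / wlow" for n
  proof -
   have Vm: "V \<in> borelm" by (rule borel_measurable_continuous_onI[OF V(1)])
   have "wlow * (LBINT x. norm (F n x)) = (LBINT x. wlow * norm (F n x))" by simp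
   also have "\<dots> <= (LBINT x. V x * norm (F n x))"
   proof (rule integral_mono)
    show "integrable lborel (%x. wlow * norm (F n x))" using F(4) by simp
    show "integrable lborel (%x. V x * norm (F n x))"
     by (rule integrable_pointwise_bound[OF integrable_mult_right[OF integrable_norm[OF F(4)], of B]])
       (use Vm F(1) V0 V(4) in \<open>auto intro!: mult_right_mono simp: abs_mult\<close>)
    show "wlow * norm (F n x) <= V x * norm (F n x)" for x by (rule mult_right_mono[OF V(3)]) simp
   qed
   also have "\<dots> <= H" using Cf[of n] H[of n] by linarith
   finally show ?thesis using V(2) by (simp add: field_simps)
  qed
  then show ?thesis by (rule that)
 qed
 have "\<exists>r M. strict_mono (r :: nat => nat) \<and> sets M = sets (borel :: ('a \<times> 'a) measure) \<and> finite_measure M \<and>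
   (AE z in M. fst z \<in> S \<and> norm (snd z) <= 1) \<and>
   (\<forall>phi::'a => real. continuous_on UNIV phi -->
    (%n. LINT x|lborel. phi x * norm (F (r n) x)) \<longlonglongrightarrow> (LINT z|M. phi (fst z))) \<and>
   (\<forall>D::'a => 'a. continuous_on UNIV D -->
    (%n. LINT x|lborel. F (r n) x \<bullet> D x) \<longlonglongrightarrow> (LINT z|M. D (fst z) \<bullet> snd z))"
  by (rule vector_density_subsequence[OF S(1) F(4) FS C])
 then obtain r M where r: "strict_mono (r :: nat => nat)" and M: "sets M = sets (borel :: ('a \<times> 'a) measure)" "finite_measure M"
   "AE z in M. fst z \<in> S \<and> norm (snd z) <= 1"
   and lim: "!!phi::'a => real. continuous_on UNIV phi ==> (%n. LINT x|lborel. phi x * norm (F (r n) x)) \<longlonglongrightarrow> (LINT z|M. phi (fst z))"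
   and limv: "!!D::'a => 'a. continuous_on UNIV D ==> (%n. LINT x|lborel. F (r n) x \<bullet> D x) \<longlonglongrightarrow> (LINT z|M. D (fst z) \<bullet> snd z)"
  by blast
 interpret M: finite_measure M by (rule M(2))
 have fm [measurable]: "fst \<in> borel_measurable M" and sm [measurable]: "snd \<in> borel_measurable M"
  unfolding measurable_cong_sets[OF M(1) refl] by (intro borel_measurable_continuous_onI continuous_intros)+
 have cr: "(%n. c (r n)) \<longlonglongrightarrow> 1" using LIMSEQ_subseq_LIMSEQ[OF c(2) r] by (simp add: o_def)
 have er: "(%n. epsilon (r n)) \<longlonglongrightarrow> 0" using LIMSEQ_subseq_LIMSEQ[OF epsilon(2) r] by (simp add: o_def)
 have dr: "(%n. delta (r n)) \<longlonglongrightarrow> 0" using LIMSEQ_subseq_LIMSEQ[OF delta(2) r] by (simp add: o_def)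
 have fi: "integrable M (%z. phi (fst z))" if phi: "continuous_on UNIV phi" for phi :: "'a => real"
 proof -
  obtain H where H: "!!x. x \<in> S ==> norm (phi x) <= H" using compact_continuous_bound[OF S(1) continuous_on_subset[OF phi]] by blast
  have [measurable]: "phi \<in> borelm" by (rule borel_measurable_continuous_onI[OF phi])
  show ?thesis
  proof (rule M.integrable_const_bound[where B=H])
   show "AE z in M. norm (phi (fst z)) <= H" using M(3) by eventually_elim (use H in blast)
  qed measurable
 qed
 \<comment> \<open>Points of the dilate by \<open>c n\<close> have distance at most
   \<open>(c n - 1) * R\<close> from \<open>Omega\<close>, so the integrated distance tends to 0
   along the sequence.\<close>
 have MOmega: "AE z in M. fst z \<in> Omega"
 proof -
  obtain R where R: "0 < R" "!!x. x \<in> Omega ==> norm x <= R" using compact_imp_bounded[OF Omega(1)] unfolding bounded_pos by blast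
  have ic: "continuous_on UNIV (%x. infdist x Omega)" by (intro continuous_intros)
  have "(LBINT x. infdist x Omega * norm (F (r n) x)) <= (c (r n) - 1) * R * C" for n
  proof -
   have "(LBINT x. infdist x Omega * norm (F (r n) x)) <= (LBINT x. (c (r n) - 1) * R * norm (F (r n) x))"
   proof (rule integral_mono')
    show "integrable lborel (%x. (c (r n) - 1) * R * norm (F (r n) x))" using F(4) by simp
    fix x
    show "0 <= (c (r n) - 1) * R * norm (F (r n) x)" using c(1)[of "r n"] R(1) by simp
    show "infdist x Omega * norm (F (r n) x) <= (c (r n) - 1) * R * norm (F (r n) x)"
    proof (cases "x \<in> K (r n)")
     case True
     then obtain y where y: "y \<in> Omega" "x = c (r n) *R y" by (auto simp: K_def)
     have "infdist x Omega <= dist x y" by (rule infdist_le[OF y(1)])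
     also have "\<dots> = (c (r n) - 1) * norm y"
     proof -
      have "x - y = (c (r n) - 1) *R y" by (simp add: y(2) scaleR_diff_left)
      then show ?thesis using c(1)[of "r n"] by (simp add: dist_norm)
     qed
     also have "\<dots> <= (c (r n) - 1) * R" using c(1)[of "r n"] R(2)[OF y(1)] by (intro mult_left_mono) auto
     finally show ?thesis by (rule mult_right_mono) simp
    qed (simp add: F(2))
   qed
   also have "\<dots> = (c (r n) - 1) * R * (LBINT x. norm (F (r n) x))" by simp
   also have "\<dots> <= (c (r n) - 1) * R * C" using C[of "r n"] c(1)[of "r n"] R(1) by (intro mult_left_mono) auto
   finally show ?thesis .
  qed
  moreover have "(%n. (c (r n) - 1) * R * C) \<longlonglongrightarrow> (1 - 1) * R * C" by (intro tendsto_mult tendsto_diff tendsto_const cr)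
  ultimately have "(LINT z|M. infdist (fst z) Omega) <= (1 - 1) * R * C"
   by (intro LIMSEQ_le[OF lim[OF ic]]) auto
  moreover have "0 <= (LINT z|M. infdist (fst z) Omega)" by (rule integral_nonneg_AE) (simp add: infdist_nonneg)
  ultimately have "(LINT z|M. infdist (fst z) Omega) = 0" by simp
  then have "AE z in M. infdist (fst z) Omega = 0"
   using integral_nonneg_eq_0_iff_AE[OF fi[OF ic]] by (simp add: infdist_nonneg)
  then show ?thesis
   by eventually_elim (use in_closed_iff_infdist_zero[OF compact_imp_closed[OF Omega(1)] Omegane] in blast)
 qed
 have s1: "AE z in M. norm (snd z) <= 1" using M(3) by eventually_elim simp
 have si: "integrable M snd" by (rule M.integrable_const_bound[OF s1]) measurable
 \<comment> \<open>The position marginal with averaged directions; this is the vector measure that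
   the densities converge to.\<close>
 define Q where "Q A = (LINT z|M. indicator A (fst z) *R snd z)" for A
 have vQ: "vector_measure Q" unfolding Q_def by (rule vector_measure_integral[OF fm si])
 have Qon: "Q \<in> vector_measures_on X" if X: "Omega \<subseteq> X" "compact X" for X
 proof -
  have Xb [measurable]: "X \<in> sets borel" using X(2) by (simp add: compact_imp_closed)
  have "Q A = Q (A \<inter> X)" if [measurable]: "A \<in> sets borel" for A
   unfolding Q_def
  proof (rule integral_cong_AE)
   show "AE z in M. indicator A (fst z) *R snd z = indicator (A \<inter> X) (fst z) *R snd z"
    using MOmega by eventually_elim (use X(1) in \<open>auto simp: indicator_def\<close>)
  qed measurable
  then show ?thesis using vQ unfolding vector_measures_on_def by blast
 qed
 have viQ: "vector_integral X Q g = (LINT z|M. f (fst z) \<bullet> snd z)"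
  if X: "Omega \<subseteq> X" "compact X" and f: "continuous_on UNIV f" and fg: "!!x. x \<in> X ==> f x = g x" for X f g
 proof -
  have [measurable]: "X \<in> sets borel" using X(2) by (simp add: compact_imp_closed)
  have [measurable]: "f \<in> borelm" by (rule borel_measurable_continuous_onI[OF f])
  have gc: "continuous_on X g" using continuous_on_subset[OF f, of X] fg by (simp cong: continuous_on_cong)
  have "vector_integral X Q g = (LINT z|M. indicator X (fst z) * (g (fst z) \<bullet> snd z))"
   by (rule vector_integral_integral[OF fm si vQ _ X(2) gc]) (simp add: Q_def)
  also have "\<dots> = (LINT z|M. indicator X (fst z) * (f (fst z) \<bullet> snd z))"
   by (rule bi_cong) (use fg in \<open>auto simp: indicator_def\<close>)
  also have "\<dots> = (LINT z|M. f (fst z) \<bullet> snd z)"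
  proof (rule integral_cong_AE)
   show "AE z in M. indicator X (fst z) * (f (fst z) \<bullet> snd z) = f (fst z) \<bullet> snd z"
    using MOmega by eventually_elim (use X(1) in auto)
  qed measurable
  finally show ?thesis .
 qed
 \<comment> \<open>Convergence is known for test fields on the whole space, whereas the definitions
   use fields on compact sets.\<close>
 have ext: "\<exists>f'. continuous_on UNIV f' \<and> (\<forall>x\<in>X. f' x = f x)" if X: "compact X" and f: "continuous_on X f" for X :: "'a set" and f :: "'a => 'a"
 proof (rule Tietze_unbounded[OF f, of UNIV])
  show "closedin (top_of_set UNIV) X" using compact_imp_closed[OF X] by simp
  fix g assume "continuous_on UNIV g" "!!x. x \<in> X ==> g x = f x"
  then show ?thesis by (intro exI[of _ g]) simp
 qed
 have ws: "weak_star_converges S (%n. density_on (K (r n)) (q (r n))) Q"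
  unfolding weak_star_converges_def
 proof (intro conjI allI impI)
  show "density_on (K (r n)) (q (r n)) \<in> vector_measures_on S" for n
   by (rule density_on_facts(1)[OF F(4,2,3) KS S(1)])
  show "Q \<in> vector_measures_on S" by (rule Qon[OF OmegaS S(1)])
  fix f :: "'a => 'a" assume "continuous_on S f"
  then obtain f' where f': "continuous_on UNIV f'" "!!x. x \<in> S ==> f' x = f x" using ext[OF S(1)] by blast
  show "(%n. vector_integral S (density_on (K (r n)) (q (r n))) f) \<longlonglongrightarrow> vector_integral S Q f"
   using limv[OF f'(1)] by (simp add: density_on_facts(2)[OF F(4,2,3) KS S(1) f'] viQ[OF OmegaS S(1) f'])
 qed
 have dQ: "measure_div_eq Omega Q mup mum"
  unfolding measure_div_eq_def
 proof (intro allI impI, elim conjE)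
  fix phi D assume phi: "C1_on Omega phi D"
  then have phic: "continuous_on Omega phi" and "continuous_on Omega D" by (auto simp: C1_on_def)
  then obtain D' where D': "continuous_on UNIV D'" "!!x. x \<in> Omega ==> D' x = D x" using ext[OF Omega(1)] by blast
  have C1: "C1_on Omega phi D'"
   using phi D' continuous_on_subset[OF D'(1), of Omega] interior_subset[of Omega] unfolding C1_on_def by (simp add: subset_iff)
  let ?L = "%n. LINT x|lborel. F n x \<bullet> ((1 / c n) *R D' ((1 / c n) *R x))"
  \<comment> \<open>The test function is dilated together with the domain and so is
    \<open>C1\<close> on the enlarged set. Beyond \<open>Omega\<close> only its gradient is
    extended, as a continuous field.\<close>
  have test: "- ?L n = (LINT x:Omega|mup. phi ((1 / c n) *R x)) - (LINT x:Omega|mum. phi ((1 / c n) *R x))" for n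
   by (rule divergence_test[OF Omega(1) OmegaK Kc Kcl Kneg alpha(1) mp mm qp(2) F(1,2,3) scaled_C1[OF C1 c0, folded K_def]])
  have "(%n. (?L (r n) - (LBINT x. F (r n) x \<bullet> D' x)) + (LBINT x. F (r n) x \<bullet> D' x)) \<longlonglongrightarrow> 0 + (LINT z|M. D' (fst z) \<bullet> snd z)"
   by (intro tendsto_add limv[OF D'(1)] scaled_test_limit[OF S(1) F(4) FS C D'(1) c(1) cr])
  then have "(%n. - ?L (r n)) \<longlonglongrightarrow> - (LINT z|M. D' (fst z) \<bullet> snd z)" by (intro tendsto_minus) simp
  moreover have "(%n. - ?L (r n)) \<longlonglongrightarrow> (LINT x:Omega|mup. phi x) - (LINT x:Omega|mum. phi x)"
   unfolding test
   by (intro tendsto_diff scaled_integral_limit[OF Omega(1,3) prob_space.finite_measure[OF mp(1)] mp(2) phic c(1) cr]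
     scaled_integral_limit[OF Omega(1,3) prob_space.finite_measure[OF mm(1)] mm(2) phic c(1) cr])
  ultimately have "- (LINT z|M. D' (fst z) \<bullet> snd z) = (LINT x:Omega|mup. phi x) - (LINT x:Omega|mum. phi x)" by (rule LIMSEQ_unique)
  then show "- vector_integral Omega Q D = (LINT x:Omega|mup. phi x) - (LINT x:Omega|mum. phi x)"
   by (simp add: viQ[OF order_refl Omega(1) D'])
 qed
 have wV: "(LINT x:Omega|n. w x) = (LINT x:Omega|n. V x)" for n
  unfolding set_lebesgue_integral_def by (rule bi_cong) (use V(6) in \<open>auto simp: indicator_def\<close>)
 \<comment> \<open>Competitor and \<open>eta\<close> stay fixed while \<open>n\<close> grows; the
   penalty and the \<open>delta\<close> term vanish, and the limit of the weighted masses dominates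
   the cost of \<open>Q\<close>.\<close>
 have opt: "(LINT x:Omega|total_variation Q. V x) <= (LINT x:Omega|total_variation q'. V x)"
  if q': "q' \<in> vector_measures_on Omega" "measure_div_eq Omega q' mup mum" for q'
 proof (rule field_le_epsilon)
  fix eta :: real assume eta: "0 < eta"
  obtain Cf where Cf: "!!n. (LBINT x. V x * norm (F n x)) <= (LINT x:Omega|total_variation q'. V x) + eta + epsilon n * Cf + delta n * C'"
   using ub[OF q' eta] by blast
  have "(%n. (LINT x:Omega|total_variation q'. V x) + eta + epsilon (r n) * Cf + delta (r n) * C') \<longlonglongrightarrow> (LINT x:Omega|total_variation q'. V x) + eta + 0 * Cf + 0 * C'"
   by (intro tendsto_add tendsto_mult tendsto_const er dr)
  then have "(LINT z|M. V (fst z)) <= (LINT x:Omega|total_variation q'. V x) + eta + 0 * Cf + 0 * C'"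
   by (rule LIMSEQ_le[OF lim[OF V(1)]]) (use Cf in blast)
  moreover have "(LINT x:Omega|total_variation Q. V x) <= (LINT z|M. V (fst z))"
   by (rule total_variation_integral_le[OF M(1) si s1 vQ _ Omega(1) V(1) V0 fi[OF V(1)]]) (simp add: Q_def)
  ultimately show "(LINT x:Omega|total_variation Q. V x) <= (LINT x:Omega|total_variation q'. V x) + eta" by simp
 qed
 have "beckmann_solution Omega w mup mum Q"
  unfolding beckmann_solution_def is_arg_min_def wV using Qon[OF order_refl Omega(1)] dQ opt by (auto simp: not_less)
 then show ?thesis using r ws unfolding K_def by blast
qed

section \<open>The parameters of the enlarged domains\<close>

text \<open>Makes the union of the enlarged domains one of them, namely that of the largest
  parameter, and hence compact.\<close>

lemma null_sequence_attains_Max: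
 fixes t :: "nat => real"
 assumes "!!k. 0 < t k" "t \<longlonglongrightarrow> 0"
 obtains m where "!!k. t k <= t m"
proof -
 have "\<forall>\<^sub>F k in sequentially. t k < t 0" using assms by (auto intro: order_tendstoD)
 then obtain N where N: "!!k. N <= k ==> t k < t 0" unfolding eventually_sequentially by blast
 have "Max (t ` {..N}) \<in> t ` {..N}" by (rule Max_in) auto
 then obtain m where m: "Max (t ` {..N}) = t m" by blast
 have le: "t k <= t m" if "k <= N" for k unfolding m[symmetric] using that by (intro Max_ge) auto
 have "t k <= t m" for k
  using le[of k] le[of 0] N[of k] by (cases "k <= N") auto
 then show ?thesis by (rule that)
qed

text \<open>A small \<open>epsilon n\<close> must be some \<open>t k\<close> with a large index,
  since the first finitely many \<open>t k\<close> stay above their positive minimum; for large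
  indices \<open>s (t k)\<close> is small.\<close>

lemma tendsto_compose_range:
 fixes t epsilon :: "nat => real" and s :: "real => real"
 assumes t: "!!k. 0 < t k" and s: "!!k. 0 < s (t k)" "(%k. s (t k)) \<longlonglongrightarrow> 0"
  and epsilon: "!!n. epsilon n \<in> range t" "epsilon \<longlonglongrightarrow> 0"
 shows "(%n. s (epsilon n)) \<longlonglongrightarrow> 0"
proof (rule order_tendstoI)
 fix a :: real
 { assume "a < 0"
  moreover have "0 < s (epsilon n)" for n using epsilon(1)[of n] s(1) by auto
  ultimately show "\<forall>\<^sub>F n in sequentially. a < s (epsilon n)" by (intro always_eventually allI) (meson less_trans) }
 assume a: "0 < a"
 have "\<forall>\<^sub>F k in sequentially. s (t k) < a" using s(2) a by (rule order_tendstoD)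
 then obtain N where N: "!!k. N <= k ==> s (t k) < a" unfolding eventually_sequentially by blast
 define m where "m = Min (t ` {..N})"
 have m: "0 < m" "!!k. k <= N ==> m <= t k" unfolding m_def using t by auto
 have "\<forall>\<^sub>F n in sequentially. epsilon n < m" using epsilon(2) m(1) by (rule order_tendstoD)
 then show "\<forall>\<^sub>F n in sequentially. s (epsilon n) < a"
 proof eventually_elim
  case (elim n)
  obtain k where k: "epsilon n = t k" using epsilon(1)[of n] by blast
  then have "\<not> k <= N" using elim m(2)[of k] by auto
  then show ?case using N[of k] k by simp
 qed
qed

theorem corollary4p11:
  fixes \<Omega> \<Omega>t :: "'a::euclidean_space set"
    and w what :: "'a \<Rightarrow> real"
    and \<alpha> wlow :: real
    and \<mu>p \<mu>m :: "'a measure"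
    and t :: "nat \<Rightarrow> real" and \<phi> :: "real \<Rightarrow> 'a \<Rightarrow> real" and s :: "real \<Rightarrow> real"
    and h :: "real \<Rightarrow> real"
    and \<epsilon> \<delta> :: "nat \<Rightarrow> real"
    and q :: "nat \<Rightarrow> 'a \<Rightarrow> 'a"
  assumes "compact \<Omega>" and "lipschitz_domain (interior \<Omega>)" and "strictly_star_shaped \<Omega>"
    and "continuous_on \<Omega> w" and "\<forall>x\<in>\<Omega>. 0 \<le> w x"
    (* alpha < d / (d - 1), read as no upper bound when d = 1 *)
    and "1 < \<alpha>" and "\<alpha> * (real DIM('a) - 1) < real DIM('a)"
    and "prob_space \<mu>p" and "sets \<mu>p = sets borel" and "AE x in \<mu>p. x \<in> \<Omega>"
    and "prob_space \<mu>m" and "sets \<mu>m = sets borel" and "AE x in \<mu>m. x \<in> \<Omega>"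
    and "neumann_well_posed (interior \<Omega>) (conj_exp \<alpha>)"
    (* the parameters tau are the members of the sequence t *)
    and "\<forall>k. 0 < t k" and "t \<longlonglongrightarrow> 0"
    and "\<forall>\<tau>\<in>range t. \<phi> \<tau> \<in> Cc_infinity UNIV \<and> (\<forall>x. 0 \<le> \<phi> \<tau> x) \<and>
           (LINT x|lebesgue. \<phi> \<tau> x) = 1"
    and "\<forall>r>0. \<forall>\<^sub>F k in sequentially. supp (\<phi> (t k)) \<subseteq> ball 0 r"
    and "\<forall>\<tau>\<in>range t. 0 < s \<tau>" and "(\<lambda>k. s (t k)) \<longlonglongrightarrow> 0"
    and "\<forall>\<tau>\<in>range t. {x + y |x y. x \<in> \<Omega> \<and> y \<in> supp (\<phi> \<tau>)} \<subseteq> enlarged \<Omega> s \<tau>"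
    and "\<forall>\<tau>\<in>range t. \<forall>\<theta>\<in>range t. \<theta> < \<tau> \<longrightarrow> enlarged \<Omega> s \<theta> \<subseteq> enlarged \<Omega> s \<tau>"
    and "\<Omega>t = (\<Union>\<tau>\<in>range t. enlarged \<Omega> s \<tau>)"
    and "continuous_on \<Omega>t what" and "\<forall>x\<in>\<Omega>. what x = w x"
    (* both infima are attained, since both sets are compact *)
    and "(INF x\<in>\<Omega>t. what x) = (INF x\<in>\<Omega>. w x)"
    and "\<forall>x>0. 0 \<le> h x" and "filterlim h at_top (at_right 0)"
    and "0 < wlow" and "\<forall>x\<in>\<Omega>. wlow \<le> w x"
    and "\<forall>n. 0 < \<epsilon> n" and "\<forall>n. \<epsilon> n \<in> range t" and "\<epsilon> \<longlonglongrightarrow> 0"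
    and "\<forall>n. 0 < \<delta> n" and "\<delta> \<longlonglongrightarrow> 0"
    and "(\<lambda>n. \<epsilon> n * h (\<delta> n) powr \<alpha>) \<longlonglongrightarrow> 0"
    and "\<forall>n. regularized_solution (enlarged \<Omega> s (\<epsilon> n)) \<alpha> what \<mu>p \<mu>m (\<epsilon> n) (\<delta> n) (q n)"
  shows "\<exists>r Q. strict_mono r \<and>
           weak_star_converges \<Omega>t (\<lambda>n. density_on (enlarged \<Omega> s (\<epsilon> (r n))) (q (r n))) Q \<and>
           beckmann_solution \<Omega> w \<mu>p \<mu>m Q"
proof -
  note \<Omega> = assms(1-3) and w = assms(4,5) and \<alpha> = assms(6,7) and mp = assms(8-10) and mm = assms(11-13)
  note t = assms(15,16) and \<phi> = assms(17,18) and s = assms(19,20) and nested = assms(22) and \<Omega>t = assms(23)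
  note what = assms(24-26) and wlow = assms(29,30) and \<epsilon> = assms(31-33) and \<delta> = assms(34,35) and sol = assms(37)
  \<comment> \<open>The mollifiers of the setting double as the bumps from which the cones are
    built.\<close>
  have moll: "\<exists>\<eta>. \<eta> \<in> Cc_infinity (UNIV :: 'a set) \<and> (\<forall>x. 0 \<le> \<eta> x) \<and> (LINT x|lebesgue. \<eta> x) = 1 \<and> supp \<eta> \<subseteq> ball 0 \<kappa>"
    if "0 < \<kappa>" for \<kappa>
  proof -
    have "\<forall>\<^sub>F k in sequentially. supp (\<phi> (t k)) \<subseteq> ball 0 \<kappa>" using \<phi>(2) that by blast
    then obtain k where "supp (\<phi> (t k)) \<subseteq> ball 0 \<kappa>" using eventually_happens'[OF sequentially_bot] by blast
    then show ?thesis using \<phi>(1) by blast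
  qed
  define c where "c n = 1 + s (\<epsilon> n)" for n
  have tp: "0 < t k" for k using t(1) by blast
  have sp: "0 < s (t k)" for k using s(1) by blast
  have c1: "1 \<le> c n" for n
  proof -
    obtain k where "\<epsilon> n = t k" using \<epsilon>(2) by blast
    then show ?thesis using sp[of k] by (simp add: c_def)
  qed
  have c: "c \<longlonglongrightarrow> 1"
    using tendsto_add[OF tendsto_const[of 1] tendsto_compose_range[OF tp sp s(2) _ \<epsilon>(3)]] \<epsilon>(2) by (simp add: c_def[abs_def])
  obtain m where m: "\<And>k. t k \<le> t m" using null_sequence_attains_Max[OF tp t(2)] by blast
  have sub: "enlarged \<Omega> s (t k) \<subseteq> enlarged \<Omega> s (t m)" for k
    using nested m[of k] by (cases "t k = t m") auto
  then have \<Omega>t_eq: "\<Omega>t = enlarged \<Omega> s (t m)" unfolding \<Omega>t by blast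
  have S: "compact \<Omega>t" unfolding \<Omega>t_eq enlarged_def by (rule compact_scaling[OF \<Omega>(1)])
  have \<Omega>S: "\<Omega> \<subseteq> \<Omega>t" unfolding \<Omega>t_eq enlarged_def
    using sp[of m] by (intro strictly_star_shaped_subset_scaleR[OF \<Omega>(3)]) simp
  have en: "enlarged \<Omega> s (\<epsilon> n) = (\<lambda>x. c n *\<^sub>R x) ` \<Omega>" for n by (simp add: enlarged_def c_def)
  have KS: "(\<lambda>x. c n *\<^sub>R x) ` \<Omega> \<subseteq> \<Omega>t" for n
    using \<epsilon>(2) unfolding en[symmetric] \<Omega>t by blast
  have \<Omega>ne: "\<Omega> \<noteq> {}" using \<Omega>(2) interior_subset[of \<Omega>] by (auto simp: lipschitz_domain_def)
  obtain B where B: "0 \<le> B" "\<And>x. x \<in> \<Omega>t \<Longrightarrow> norm (what x) \<le> B" using compact_continuous_bound[OF S what(1)] by blast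
  \<comment> \<open>The extended weight has the same infimum as \<open>w\<close>; this carries the
    positive lower bound to the enlarged domains.\<close>
  have what_ge: "wlow \<le> what x" if x: "x \<in> \<Omega>t" for x
  proof -
    have "wlow \<le> (INF x\<in>\<Omega>. w x)" by (rule cINF_greatest[OF \<Omega>ne]) (use wlow(2) in blast)
    also have "\<dots> = (INF x\<in>\<Omega>t. what x)" using what(3) by simp
    also have "\<dots> \<le> what x"
    proof (rule cINF_lower[OF _ x])
      have "- B \<le> what y" if "y \<in> \<Omega>t" for y using B(2)[OF that] by simp
      then show "bdd_below (what ` \<Omega>t)" by (intro bdd_belowI2)
    qed
    finally show ?thesis .
  qed
  have what_le: "what x \<le> B" if "x \<in> \<Omega>t" for x using B(2)[OF that] by simp
  obtain x0 where "x0 \<in> \<Omega>t" using \<Omega>ne \<Omega>S by blast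
  then have wB: "wlow \<le> B" using what_ge[of x0] what_le[of x0] by simp
  \<comment> \<open>Tietze extension within the bounds, so that \<open>V\<close> is positive and
    bounded on the whole space.\<close>
  have "\<exists>V. continuous_on UNIV V \<and> (\<forall>x\<in>\<Omega>t. V x = what x) \<and> (\<forall>x. wlow \<le> V x \<and> V x \<le> B)"
  proof (rule Tietze_closed_interval_1[OF what(1), of UNIV wlow B])
    show "closedin (top_of_set UNIV) \<Omega>t" using compact_imp_closed[OF S] by simp
    show "what x \<in> cbox wlow B" if "x \<in> \<Omega>t" for x using what_ge[OF that] what_le[OF that] by simp
    fix V assume "continuous_on UNIV V" "\<And>x. x \<in> \<Omega>t \<Longrightarrow> V x = what x" "\<And>x. x \<in> UNIV \<Longrightarrow> V x \<in> cbox wlow B"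
    then show ?thesis by (intro exI[of _ V]) simp
  qed (rule wB)
  then obtain V where V: "continuous_on UNIV V" "\<And>x. x \<in> \<Omega>t \<Longrightarrow> V x = what x" "\<And>x. wlow \<le> V x" "\<And>x. V x \<le> B" by blast
  have V5: "what x = V x" if "x \<in> \<Omega>t" for x using V(2)[OF that] by simp
  have V6: "w x = V x" if "x \<in> \<Omega>" for x using V(2)[of x] what(2) \<Omega>S that by auto
  have sol': "regularized_solution ((\<lambda>x. c n *\<^sub>R x) ` \<Omega>) \<alpha> what \<mu>p \<mu>m (\<epsilon> n) (\<delta> n) (q n)" for n
    using sol unfolding en[symmetric] by blast
  have \<epsilon>p: "0 < \<epsilon> n" and \<delta>p: "0 < \<delta> n" for n using \<epsilon>(1) \<delta>(1) by blast+
  show ?thesis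
    unfolding en
    by (rule regularized_fluxes_converge[OF \<Omega> moll \<alpha> mp mm c1 c S KS V(1) wlow(1) V(3,4) V5 V6 \<epsilon>p \<epsilon>(3) \<delta>p \<delta>(2) sol'])
qed

end
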